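(* Let $\Omega\subset\hat{\mathbb C}$ be a simply connected domain with compact piecewise $C^1$ boundary, $0,\infty\notin\partial\Omega$ and $\Omega=\mathrm{Int}(\overline\Omega)$, and let $\varphi$ be a Riemann map for $\Omega$ with inner–outer factorization $\varphi=\varphi_{\rm in}\varphi_{\rm out}$. Then $\Omega\in\mathrm{QD}_0$ if and only if there is a rational function $R$ with $\varphi_{\rm out}=e^{R}$ on $\mathbb D$ (if $\Omega$ is bounded) resp. on $\mathbb D^*$ (if $\Omega$ is unbounded).
   Context: $\hat{\mathbb C}$ is the Riemann sphere; a domain is a connected open subset of $\hat{\mathbb C}$. For $\Omega\subset\hat{\mathbb C}$, $\overline{\Omega}$ is its closure and $\Omega^*:=\hat{\mathbb C}\setminus\overline{\Omega}$. $\mathbb D=\{|z|<1\}$, $\mathbb D^*=\{|z|>1\}\cup\{\infty\}$. $dA=dx\,dy/\pi$ is normalized area measure; integrals over unbounded sets are principal values $\lim_{R\to\infty}\int_{\cdot\,\cap\{|w|<R\}}$. Contour integrals are normalized: $\oint_{\partial U}$ means $\frac{1}{2\pi i}\int_{\partial U}$ with $\partial U$ positively oriented with respect to $U$. $A(\Omega)$ denotes functions analytic in $\Omega$ and continuous on $\overline\Omega$ (in $\hat{\mathbb C}$); $\mathrm{Rat}(\Omega)$ denotes rational functions all of whose poles lie in $\Omega$, and $\mathrm{Rat}_0(\Omega)$ those vanishing at $\infty$. Let $\rho_0(w)=|w|^{-2}$ and $L^1_a(\Omega;\rho_0)=\{f\in A(\Omega):\int_\Omega|f|\rho_0\,dA<\infty\}$.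 A rectifiable domain $\Omega\subset\hat{\mathbb C}$ with $0,\infty\notin\partial\Omega$ and $\Omega=\mathrm{Int}(\overline\Omega)$ is a log-weighted quadrature domain (LQD) with quadrature function $h$, written $\Omega\in\mathrm{QD}_0(h)$, if $h\in\mathrm{Rat}_0(\Omega)$ when $\Omega$ is bounded, $h\in\mathrm{Rat}(\Omega)$ when $\Omega$ is unbounded, and $\int_\Omega f(w)|w|^{-2}dA(w)=\oint_{\partial\Omega}f(w)h(w)\,dw$ for all $f\in L^1_a(\Omega;\rho_0)$. $\Omega\in\mathrm{QD}_0$ means $\Omega\in\mathrm{QD}_0(h)$ for some $h$. Riemann maps: if $\Omega$ is bounded, a Riemann map is a conformal bijection $\varphi:\mathbb D\to\Omega$; if $\Omega$ is unbounded (so $\infty\in\Omega$), a Riemann map is a conformal bijection $\varphi:\mathbb D^*\to\Omega$ with $\varphi(\infty)=\infty$. These extend continuously to the closed (exterior) disk. Blaschke factors: for $\lambda\neq0$, $b_\lambda(z)=\frac{\bar\lambda}{|\lambda|}\frac{z-\lambda}{\bar\lambda z-1}$, and $b_0(z)=z$. Inner–outer factorization: if $g$ is bounded and analytic on $U\in\{\mathbb D,\mathbb D^*\}$, continuous on $\overline U$ and nonvanishing on $\partial\mathbb D$, then $g=g_{\rm in}g_{\rm out}$, where $g_{\rm in}$ is the finite Blaschke product (product of factors $b_\lambda$) over the zeros $\lambda$ of $g$ in $U$, counted with multiplicity, and $g_{\rm out}(z)=\exp\big(\frac12\oint_{\partial U}\frac{\xi+z}{\xi-z}\frac{\ln|g(\xi)|^2}{\xi}d\xi\big)$,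 $z\in U$. For bounded $\Omega$ with $0\notin\partial\Omega$, $\varphi_{\rm in},\varphi_{\rm out}$ are the factors of $g=\varphi$. For unbounded $\Omega$, let $g(z)=\varphi(z)/z$ on $\mathbb D^*$ and set $\varphi_{\rm out}:=g_{\rm out}$, $\varphi_{\rm in}(z):=z\,g_{\rm in}(z)$. *)

theory Defs
  imports "HOL-Complex_Analysis.Complex_Analysis" "HOL-Computational_Algebra.Polynomial"
begin

text \<open>Representation of a domain Omega of the Riemann sphere whose boundary is compact and
does not contain infinity: Omega is represented by its finite part S = Omega minus infinity,
an open subset of the complex plane; infinity belongs to Omega iff S is unbounded.\<close>

definition sphere_domain :: "complex set \<Rightarrow> bool" where
  "sphere_domain S \<longleftrightarrow> open S \<and> connected S \<and> S \<noteq> {} \<and> bounded (frontier S)"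

text \<open>Simple connectivity in the Riemann sphere. If infinity is in Omega, transport Omega
into the plane by a Moebius map z -> 1/(z-a) with a not in Omega (infinity goes to 0).\<close>
definition sphere_simply_connected :: "complex set \<Rightarrow> bool" where
  "sphere_simply_connected S \<longleftrightarrow>
     (if bounded S then simply_connected S
      else (\<exists>a. a \<notin> S \<and> simply_connected ((\<lambda>z. 1 / (z - a)) ` S \<union> {0})))"

definition pos_boundary_cycle :: "complex set \<Rightarrow> (real \<Rightarrow> complex) list \<Rightarrow> bool" where
  "pos_boundary_cycle S \<Gamma> \<longleftrightarrow>
     (\<forall>\<gamma>\<in>set \<Gamma>. valid_path \<gamma> \<and> pathfinish \<gamma> = pathstart \<gamma>) \<and>
     (\<Union>\<gamma>\<in>set \<Gamma>. path_image \<gamma>) = frontier S \<and>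
     (\<forall>z. z \<notin> frontier S \<longrightarrow>
        sum_list (map (\<lambda>\<gamma>. winding_number \<gamma> z) \<Gamma>) =
          (if bounded S then (if z \<in> S then 1 else 0) else (if z \<in> S then 0 else -1)))"

definition piecewise_C1_boundary :: "complex set \<Rightarrow> bool" where
  "piecewise_C1_boundary S \<longleftrightarrow> (\<exists>\<Gamma>. pos_boundary_cycle S \<Gamma>)"

definition bdry_int :: "(real \<Rightarrow> complex) list \<Rightarrow> (complex \<Rightarrow> complex) \<Rightarrow> complex" where
  "bdry_int \<Gamma> F = sum_list (map (\<lambda>\<gamma>. contour_integral \<gamma> F) \<Gamma>) / (2 * of_real pi * \<i>)"

text \<open>Principal value of the integral of F |w|^(-2) with respect to dA = dx dy / pi.\<close>
definition area_int0 :: "complex set \<Rightarrow> (complex \<Rightarrow> complex) \<Rightarrow> complex" where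
  "area_int0 S F = Lim at_top (\<lambda>R::real.
      integral (S \<inter> ball 0 R) (\<lambda>w. F w / of_real ((cmod w)\<^sup>2)) / of_real pi)"

definition analytic_at_infinity :: "(complex \<Rightarrow> complex) \<Rightarrow> bool" where
  "analytic_at_infinity f \<longleftrightarrow>
     (\<exists>c. (f \<longlongrightarrow> c) at_infinity \<and> (\<lambda>z. if z = 0 then c else f (1 / z)) analytic_on {0})"

definition A_space :: "complex set \<Rightarrow> (complex \<Rightarrow> complex) set" where
  "A_space S = {f. f holomorphic_on S \<and> continuous_on (closure S) f \<and>
                   (\<not> bounded S \<longrightarrow> analytic_at_infinity f)}"

definition L1a_rho0 :: "complex set \<Rightarrow> (complex \<Rightarrow> complex) set" where
  "L1a_rho0 S = {f. f \<in> A_space S \<and> (\<lambda>w. f w / of_real ((cmod w)\<^sup>2)) absolutely_integrable_on S}"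

text \<open>Rational function p/q (p, q coprime, q nonzero); its finite poles are the roots of q,
and it has a pole at infinity iff degree p > degree q.  h in Rat_0(Omega) for bounded Omega
(poles in Omega, vanishing at infinity), h in Rat(Omega) for unbounded Omega.\<close>
definition quad_fun_ok :: "complex set \<Rightarrow> complex poly \<Rightarrow> complex poly \<Rightarrow> bool" where
  "quad_fun_ok S p q \<longleftrightarrow> q \<noteq> 0 \<and> coprime p q \<and> (\<forall>z. poly q z = 0 \<longrightarrow> z \<in> S) \<and>
     (bounded S \<longrightarrow> (p = 0 \<or> degree p < degree q))"

definition QD0_with :: "complex set \<Rightarrow> complex poly \<Rightarrow> complex poly \<Rightarrow> bool" where
  "QD0_with S p q \<longleftrightarrow>
     sphere_domain S \<and> 0 \<notin> frontier S \<and> interior (closure S) = S \<and>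
     quad_fun_ok S p q \<and>
     (\<exists>\<Gamma>. pos_boundary_cycle S \<Gamma>) \<and>
     (\<forall>\<Gamma>. pos_boundary_cycle S \<Gamma> \<longrightarrow>
        (\<forall>f\<in>L1a_rho0 S. area_int0 S f = bdry_int \<Gamma> (\<lambda>w. f w * (poly p w / poly q w))))"

definition QD0 :: "complex set \<Rightarrow> bool" where
  "QD0 S \<longleftrightarrow> (\<exists>p q. QD0_with S p q)"

text \<open>Riemann map (taken as its continuous extension to the closed (exterior) disk).\<close>
definition riemann_map :: "complex set \<Rightarrow> (complex \<Rightarrow> complex) \<Rightarrow> bool" where
  "riemann_map S \<phi> \<longleftrightarrow>
     (if bounded S then
        \<phi> holomorphic_on ball 0 1 \<and> inj_on \<phi> (ball 0 1) \<and> \<phi> ` ball 0 1 = S \<and>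
        continuous_on (cball 0 1) \<phi>
      else
        \<phi> holomorphic_on (- cball 0 1) \<and> inj_on \<phi> (- cball 0 1) \<and> \<phi> ` (- cball 0 1) = S \<and>
        filterlim \<phi> at_infinity at_infinity \<and> continuous_on (- ball 0 1) \<phi>)"

text \<open>Outer factor g_out of g on U (U = D if the flag is True, U = D^* otherwise);
the contour is the unit circle positively oriented with respect to U.\<close>
definition outer_part :: "bool \<Rightarrow> (complex \<Rightarrow> complex) \<Rightarrow> complex \<Rightarrow> complex" where
  "outer_part in_disk g z =
     exp (1/2 * (contour_integral
        (if in_disk then circlepath 0 1 else reversepath (circlepath 0 1))
        (\<lambda>\<xi>. (\<xi> + z) / (\<xi> - z) * of_real (ln ((cmod (g \<xi>))\<^sup>2)) / \<xi>)
       / (2 * of_real pi * \<i>)))"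

definition phi_out :: "complex set \<Rightarrow> (complex \<Rightarrow> complex) \<Rightarrow> complex \<Rightarrow> complex" where
  "phi_out S \<phi> = (if bounded S then outer_part True \<phi> else outer_part False (\<lambda>z. \<phi> z / z))"

definition riemann_disk :: "complex set \<Rightarrow> complex set" where
  "riemann_disk S = (if bounded S then ball 0 1 else - cball 0 1)"

end

theory Submission
  imports Defs
begin

text \<open>Put \<open>u = ln |\<phi>|\<^sup>2\<close> on the unit circle. The outer factor is the exponential of the Schwarz
integral of \<open>u\<close>, so it is the exponential of a rational function iff \<open>u\<close> agrees on the circle with a
rational function.

If \<open>S\<close> is a quadrature domain, testing with \<open>w\<^sup>2 / ((w - a) (w - b)\<^sup>4)\<close> for \<open>a\<close>, \<open>b\<close> outside the closure
shows that the Cauchy transform of \<open>w / (cnj w (w - b)\<^sup>4)\<close> over \<open>S\<close> is rational outside \<open>S\<close>. As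
\<open>ln |w|\<^sup>2\<close> has d-bar derivative \<open>1 / cnj w\<close>, it follows that on the boundary \<open>ln |w|\<^sup>2\<close> is a quotient of
functions holomorphic in \<open>S\<close>; pulled back to the disk this is a real quotient of disk algebra
functions, hence rational.

Conversely, if \<open>u = A / B\<close>, the reflection \<open>|\<phi>|\<^sup>2 = exp (A / B)\<close> continues \<open>\<phi>\<close> across the circle, and the
boundary is an analytic curve whose double points are isolated. A contour integral along a possibly
non-rectifiable path in the boundary is therefore integration along this curve against a bounded
weight, so by Hartogs--Rosenthal the winding numbers determine it. By Green's formula the curve
integral of \<open>f ln |w|\<^sup>2 / w\<close> gives the area integral, and the principal parts of \<open>ln |w|\<^sup>2 / w\<close>, continued
into \<open>S\<close> as \<open>A / B\<close> composed with the inverse Riemann map, form the quadrature function.\<close>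


section \<open>The Cauchy transform\<close>

text \<open>The two implications meet different obstacles. \<open>riemann_map\<close> gives boundary
  values of \<phi> only as a continuous function, so the forward direction never differentiates
  \<phi> on the circle; it stays in the disk algebra. In the converse, \<open>QD0_with\<close>
  quantifies over every list of closed paths covering the frontier with the right winding numbers.
  Such paths may backtrack, and their derivative may be unbounded at exceptional points, so only
  increments of local primitives are accessible. The analytic curve supplies these primitives, even
  at its cusps.

  The factor w^2 of the test function leaves the bounded quotient w / cnj w after division by |w|^2,
  and the fourth power makes it integrable near infinity. In the converse, integrability of f /
  |w|^2 forces f to vanish at 0 and at infinity when they lie in the domain, which removes the
  residues there. Bounded and unbounded domains are both treated on the unit disk.\<close>

lemma lborel_complex_eq:
 "(lborel :: complex measure) = distr (lborel \<Otimes>\<^sub>M lborel) borel (\<lambda>(x, y). Complex x y)"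
proof (rule lborel_eqI)
 have meas: "(\<lambda>(x, y). Complex x y) \<in> borel_measurable (lborel \<Otimes>\<^sub>M lborel)"
  unfolding Complex_eq by measurable
 fix l u :: complex
 assume le: "\<And>b. b \<in> Basis \<Longrightarrow> l \<bullet> b \<le> u \<bullet> b"
 have le': "Re l \<le> Re u" "Im l \<le> Im u"
  using le[of 1] le[of \<i>] by (auto simp: Basis_complex_def)
 have "(\<lambda>(x, y). Complex x y) -` box l u \<inter> space (lborel \<Otimes>\<^sub>M lborel)
   = {Re l <..< Re u} \<times> {Im l <..< Im u}"
  by (auto simp: in_box_complex_iff space_pair_measure)
 then have "emeasure (distr (lborel \<Otimes>\<^sub>M lborel) borel (\<lambda>(x, y). Complex x y)) (box l u)
   = emeasure (lborel \<Otimes>\<^sub>M lborel) ({Re l <..< Re u} \<times> {Im l <..< Im u})"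
  using meas by (subst emeasure_distr) auto
 also have "\<dots> = ennreal (Re u - Re l) * ennreal (Im u - Im l)"
  using le' by (subst lborel.emeasure_pair_measure_Times) auto
 also have "\<dots> = ennreal (\<Prod>b\<in>Basis. (u - l) \<bullet> b)"
  using le' by (simp add: Basis_complex_def ennreal_mult' complex_eq_iff)
 finally show "emeasure (distr (lborel \<Otimes>\<^sub>M lborel) borel (\<lambda>(x, y). Complex x y)) (box l u)
   = ennreal (\<Prod>b\<in>Basis. (u - l) \<bullet> b)" .
qed auto

lemma borel_measurable_case_Complex [measurable]:
 "(\<lambda>(x, y). Complex x y) \<in> borel_measurable (lborel \<Otimes>\<^sub>M lborel)"
 unfolding Complex_eq by measurable

lemma nn_integral_complex:
 fixes f :: "complex \<Rightarrow> ennreal"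
 assumes [measurable]: "f \<in> borel_measurable borel"
 shows "(\<integral>\<^sup>+w. f w \<partial>lborel) = (\<integral>\<^sup>+x. \<integral>\<^sup>+y. f (Complex x y) \<partial>lborel \<partial>lborel)"
proof -
 have [measurable]: "(\<lambda>p. f (Complex (fst p) (snd p))) \<in> borel_measurable (lborel \<Otimes>\<^sub>M lborel)"
  using measurable_compose[OF borel_measurable_case_Complex assms] by (simp add: case_prod_unfold)
 have "(\<integral>\<^sup>+w. f w \<partial>lborel) = (\<integral>\<^sup>+p. f (Complex (fst p) (snd p)) \<partial>(lborel \<Otimes>\<^sub>M lborel))"
  by (subst lborel_complex_eq, subst nn_integral_distr) (auto simp: case_prod_unfold)
 also have "\<dots> = (\<integral>\<^sup>+x. \<integral>\<^sup>+y. f (Complex x y) \<partial>lborel \<partial>lborel)"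
  by (subst lborel.nn_integral_fst[symmetric]) auto
 finally show ?thesis .
qed

lemma nn_integral_inverse_sqrt:
 assumes "r > 0"
 shows "(\<integral>\<^sup>+x. ennreal (indicator {-r..r} x * \<bar>x\<bar> powr (-1/2)) \<partial>lborel) = ennreal (4 * sqrt r)"
proof -
 define G where "G \<equiv> \<lambda>x::real. indicator {0..r} x * x powr (-1/2)"
 have Gm [measurable]: "G \<in> borel_measurable borel" unfolding G_def by measurable
 have "((\<lambda>x. x powr (-1/2)) has_integral (r powr (-1/2 + 1) / (-1/2 + 1))) {0..r}"
  using assms by (intro has_integral_powr_from_0) auto
 then have "((\<lambda>x. x powr (-1/2)) has_integral 2 * sqrt r) {0..r}"
  using assms by (simp add: powr_half_sqrt mult.commute)
 then have "(G has_integral 2 * sqrt r) UNIV"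
  unfolding G_def by (subst (asm) has_integral_restrict_UNIV[symmetric])
   (simp add: indicator_def of_bool_def if_distrib[where f="\<lambda>x. x * _"] cong: if_cong)
 then have G1: "(\<integral>\<^sup>+x. ennreal (G x) \<partial>lborel) = ennreal (2 * sqrt r)"
  using assms by (intro nn_integral_has_integral_lborel) (auto simp: G_def)
 have G2: "(\<integral>\<^sup>+x. ennreal (G (- x)) \<partial>lborel) = ennreal (2 * sqrt r)"
  using nn_integral_real_affine[of "\<lambda>x. ennreal (G x)" "-1" 0] G1 by simp
 have "(\<integral>\<^sup>+x. ennreal (indicator {-r..r} x * \<bar>x\<bar> powr (-1/2)) \<partial>lborel)
   = (\<integral>\<^sup>+x. ennreal (G x) + ennreal (G (- x)) \<partial>lborel)"
  by (intro nn_integral_cong) (auto simp: G_def indicator_def)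
 also have "\<dots> = ennreal (2 * sqrt r) + ennreal (2 * sqrt r)"
  by (subst nn_integral_add) (auto simp: G1 G2)
 also have "\<dots> = ennreal (4 * sqrt r)"
  using assms by (simp add: ennreal_plus[symmetric] del: ennreal_plus)
 finally show ?thesis .
qed

text \<open>Polar coordinates are avoided: |x| |y| <= |w|^2 gives 1 / |w| <= |x|^(-1/2) |y|^(-1/2),
  and over the square of side 2 r the right side factors into (4 sqrt r)^2. This is the origin of
  the constant 16 in the bounds below.\<close>

lemma nn_integral_inverse_norm_0:
 assumes "r > 0"
 shows "(\<integral>\<^sup>+w. ennreal (indicator (ball 0 r) w / cmod w) \<partial>lborel) \<le> ennreal (16 * r)"
proof -
 have [measurable]: "ball (0::complex) r \<in> sets borel" by simp
 define G where "G \<equiv> \<lambda>x::real. indicator {-r..r} x * \<bar>x\<bar> powr (-1/2)"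
 have Gm [measurable]: "G \<in> borel_measurable borel" unfolding G_def by measurable
 have G0: "G x \<ge> 0" for x by (simp add: G_def)
 have bound: "indicator (ball 0 r) w / cmod w \<le> G (Re w) * G (Im w)" if ne: "Re w \<noteq> 0" "Im w \<noteq> 0" for w
 proof (cases "cmod w < r")
  case True
  have "\<bar>Re w\<bar> \<le> r" "\<bar>Im w\<bar> \<le> r"
   using abs_Re_le_cmod[of w] abs_Im_le_cmod[of w] True by auto
  then have G: "G (Re w) * G (Im w) = inverse (sqrt \<bar>Re w\<bar> * sqrt \<bar>Im w\<bar>)"
   using ne by (auto simp: G_def powr_minus powr_half_sqrt indicator_def abs_le_iff)
  have "\<bar>Re w\<bar> * \<bar>Im w\<bar> \<le> (Re w)\<^sup>2 + (Im w)\<^sup>2"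
   using sum_squares_bound[of "\<bar>Re w\<bar>" "\<bar>Im w\<bar>"] mult_nonneg_nonneg[of "\<bar>Re w\<bar>" "\<bar>Im w\<bar>"]
  unfolding power2_abs mult.assoc by linarith
  then have "sqrt \<bar>Re w\<bar> * sqrt \<bar>Im w\<bar> \<le> cmod w"
   unfolding cmod_def by (simp add: real_sqrt_mult[symmetric])
  then show ?thesis
   unfolding G using ne True le_imp_inverse_le[of "sqrt \<bar>Re w\<bar> * sqrt \<bar>Im w\<bar>" "cmod w"]
   by (simp add: divide_inverse indicator_def)
 qed (auto simp: G0)
 have "(\<integral>\<^sup>+w. ennreal (indicator (ball 0 r) w / cmod w) \<partial>lborel)
   = (\<integral>\<^sup>+x. \<integral>\<^sup>+y. ennreal (indicator (ball 0 r) (Complex x y) / cmod (Complex x y)) \<partial>lborel \<partial>lborel)"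
  by (subst nn_integral_complex) auto
 also have "\<dots> \<le> (\<integral>\<^sup>+x. \<integral>\<^sup>+y. ennreal (G x) * ennreal (G y) \<partial>lborel \<partial>lborel)"
 proof (rule nn_integral_mono_AE)
  have *: "AE x in lborel. x \<noteq> (0::real)" by (rule AE_lborel_singleton)
  then show "AE x in lborel. (\<integral>\<^sup>+y. ennreal (indicator (ball 0 r) (Complex x y) / cmod (Complex x y)) \<partial>lborel)
    \<le> (\<integral>\<^sup>+y. ennreal (G x) * ennreal (G y) \<partial>lborel)"
  proof eventually_elim
   case (elim x)
   show ?case
    using * by (intro nn_integral_mono_AE, eventually_elim)
     (use bound[of "Complex x _"] elim in \<open>auto simp: ennreal_mult'[symmetric] G0 intro!: ennreal_leI\<close>)
  qed
 qed
 also have "\<dots> = ennreal (4 * sqrt r) * ennreal (4 * sqrt r)"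
  using nn_integral_inverse_sqrt[OF assms]
  by (simp add: nn_integral_cmult nn_integral_multc G_def)
 also have "\<dots> = ennreal (16 * r)"
  using assms by (simp add: ennreal_mult'[symmetric])
 finally show ?thesis .
qed

lemma nn_integral_inverse_norm:
 assumes "r > 0"
 shows "(\<integral>\<^sup>+w. ennreal (indicator (ball a r) w / cmod (w - a)) \<partial>lborel) \<le> ennreal (16 * r)"
proof -
 have [measurable]: "ball a r \<in> sets borel" by simp
 have "(\<integral>\<^sup>+w. ennreal (indicator (ball a r) w / cmod (w - a)) \<partial>lborel)
  = (\<integral>\<^sup>+w. ennreal (indicator (ball a r) w / cmod (w - a)) \<partial>(distr lborel borel ((+) a)))"
  by (simp add: lborel_distr_plus)
 also have "\<dots> = (\<integral>\<^sup>+w. ennreal (indicator (ball a r) (a + w) / cmod w) \<partial>lborel)"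
  by (subst nn_integral_distr) auto
 also have "\<dots> = (\<integral>\<^sup>+w. ennreal (indicator (ball 0 r) w / cmod w) \<partial>lborel)"
  by (intro nn_integral_cong) (auto simp: indicator_def dist_norm)
 finally show ?thesis using nn_integral_inverse_norm_0[OF assms] by simp
qed

text \<open>The usual factor -1 / pi is left out: for a C1 density the d-bar derivative is -pi
  \<open>k\<close>, hence the division by pi wherever the transform corrects a non-holomorphic
  function. At \<open>w = a\<close> the integrand is 0 by the convention for division.\<close>

definition cauchy_transform :: "(complex \<Rightarrow> complex) \<Rightarrow> complex \<Rightarrow> complex" where
 "cauchy_transform k a = (LINT w|lborel. k w / (w - a))"

text \<open>The kernel is integrable at its singularity, so a density that is bounded on a small
  disk contributes only O(radius). With the trivial bound 1 / r off the disk this is the splitting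
  behind the estimates of the Cauchy transform.\<close>

lemma
 assumes [measurable]: "k \<in> borel_measurable borel" and r: "r > 0"
  and M: "\<And>w. w \<in> ball a r \<Longrightarrow> cmod (k w) \<le> M"
 shows cauchy_near_integrable: "integrable lborel (\<lambda>w. indicator (ball a r) w *\<^sub>R (k w / (w - a)))"
  and cauchy_near_norm_bound:
   "(LINT w|lborel. cmod (indicator (ball a r) w *\<^sub>R (k w / (w - a)))) \<le> 16 * M * r"
  and cauchy_near_bound: "cmod (LINT w|lborel. indicator (ball a r) w *\<^sub>R (k w / (w - a))) \<le> 16 * M * r"
proof -
 have [measurable]: "ball a r \<in> sets borel" by simp
 have M0: "M \<ge> 0" using M[of a] r by (auto intro: order_trans[OF norm_ge_zero])
 let ?f = "\<lambda>w. indicator (ball a r) w *\<^sub>R (k w / (w - a))"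
 have "(\<integral>\<^sup>+w. ennreal (cmod (?f w)) \<partial>lborel)
   \<le> (\<integral>\<^sup>+w. ennreal M * ennreal (indicator (ball a r) w / cmod (w - a)) \<partial>lborel)"
 proof (intro nn_integral_mono)
  fix w
  have "ennreal (cmod (?f w)) \<le> ennreal (M * (indicator (ball a r) w / cmod (w - a)))"
   using M[of w] M0 by (intro ennreal_leI) (auto simp: norm_divide indicator_def intro!: divide_right_mono)
  also have "\<dots> = ennreal M * ennreal (indicator (ball a r) w / cmod (w - a))"
   by (simp only: ennreal_mult'[OF M0])
  finally show "ennreal (cmod (?f w)) \<le> ennreal M * ennreal (indicator (ball a r) w / cmod (w - a))" .
 qed
 also have "\<dots> = ennreal M * (\<integral>\<^sup>+w. ennreal (indicator (ball a r) w / cmod (w - a)) \<partial>lborel)"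
  by (subst nn_integral_cmult) auto
 also have "\<dots> \<le> ennreal M * ennreal (16 * r)"
  using nn_integral_inverse_norm[OF r, of a] by (intro mult_left_mono) auto
 also have "\<dots> = ennreal (16 * M * r)"
  using M0 r by (simp add: ennreal_mult'[symmetric] mult_ac)
 finally have *: "(\<integral>\<^sup>+w. ennreal (cmod (?f w)) \<partial>lborel) \<le> ennreal (16 * M * r)" .
 show int: "integrable lborel ?f"
  using le_less_trans[OF * ennreal_less_top] by (intro integrableI_bounded) auto
 have "ennreal (LINT w|lborel. cmod (?f w)) = (\<integral>\<^sup>+w. ennreal (cmod (?f w)) \<partial>lborel)"
  by (rule nn_integral_eq_integral[OF integrable_norm[OF int], symmetric]) auto
 with * have "ennreal (LINT w|lborel. cmod (?f w)) \<le> ennreal (16 * M * r)"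
  by simp
 then show b: "(LINT w|lborel. cmod (?f w)) \<le> 16 * M * r"
  using M0 r by (subst (asm) ennreal_le_iff) auto
 show "cmod (LINT w|lborel. ?f w) \<le> 16 * M * r"
  by (rule order_trans[OF integral_norm_bound b])
qed

lemma
 assumes k: "integrable lborel k" and r: "r > 0"
 shows cauchy_far_integrable: "integrable lborel (\<lambda>w. indicator (- ball a r) w *\<^sub>R (k w / (w - a)))"
  and cauchy_far_norm_bound:
   "(LINT w|lborel. cmod (indicator (- ball a r) w *\<^sub>R (k w / (w - a)))) \<le> (LINT w|lborel. cmod (k w)) / r"
proof -
 have [measurable]: "k \<in> borel_measurable borel" "- ball a r \<in> sets borel" using k by auto
 have le: "cmod (indicator (- ball a r) w *\<^sub>R (k w / (w - a))) \<le> cmod (k w) / r" for w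
  using r by (auto simp: indicator_def dist_norm norm_minus_commute norm_divide intro!: divide_left_mono mult_pos_pos)
 show int: "integrable lborel (\<lambda>w. indicator (- ball a r) w *\<^sub>R (k w / (w - a)))"
  by (rule Bochner_Integration.integrable_bound[of _ "\<lambda>w. cmod (k w) / r"])
   (use k le r in \<open>auto intro: order_trans[OF le]\<close>)
 have "(LINT w|lborel. cmod (indicator (- ball a r) w *\<^sub>R (k w / (w - a)))) \<le> (LINT w|lborel. cmod (k w) / r)"
  by (intro integral_mono integrable_norm int le) (use k in auto)
 then show "(LINT w|lborel. cmod (indicator (- ball a r) w *\<^sub>R (k w / (w - a)))) \<le> (LINT w|lborel. cmod (k w)) / r"
  by simp
qed

lemma cauchy_kernel_split:
 fixes k :: "complex \<Rightarrow> complex"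
 shows   "k w / (w - a) = indicator (ball a r) w *\<^sub>R (k w / (w - a)) + indicator (- ball a r) w *\<^sub>R (k w / (w - a))"
 by (auto simp: indicator_def)

lemma
 assumes k: "integrable lborel k" and r: "r > 0"
  and M: "\<And>w. w \<in> ball a r \<Longrightarrow> cmod (k w) \<le> M"
 shows cauchy_transform_integrable: "integrable lborel (\<lambda>w. k w / (w - a))"
  and cauchy_transform_norm_bound:
   "(LINT w|lborel. cmod (k w / (w - a))) \<le> 16 * M * r + (LINT w|lborel. cmod (k w)) / r"
  and cauchy_transform_bound:
   "cmod (cauchy_transform k a) \<le> 16 * M * r + (LINT w|lborel. cmod (k w)) / r"
proof -
 have km: "k \<in> borel_measurable borel" using k by auto
 let ?n = "\<lambda>w. indicator (ball a r) w *\<^sub>R (k w / (w - a))"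
 let ?f = "\<lambda>w. indicator (- ball a r) w *\<^sub>R (k w / (w - a))"
 have near: "integrable lborel ?n" "(LINT w|lborel. cmod (?n w)) \<le> 16 * M * r"
  by (rule cauchy_near_integrable[OF km r] cauchy_near_norm_bound[OF km r], rule M, assumption)+
 note far = cauchy_far_integrable[OF k r, of a] cauchy_far_norm_bound[OF k r, of a]
 show int: "integrable lborel (\<lambda>w. k w / (w - a))"
  by (subst cauchy_kernel_split[where r=r]) (use near far in auto)
 have "(LINT w|lborel. cmod (k w / (w - a))) \<le> (LINT w|lborel. cmod (?n w) + cmod (?f w))"
 proof (intro integral_mono Bochner_Integration.integrable_add integrable_norm int near(1) far(1))
  show "cmod (k w / (w - a)) \<le> cmod (?n w) + cmod (?f w)" for w
   by (auto simp: indicator_def)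
 qed
 also have "\<dots> = (LINT w|lborel. cmod (?n w)) + (LINT w|lborel. cmod (?f w))"
  by (intro Bochner_Integration.integral_add integrable_norm near(1) far(1))
 also have "\<dots> \<le> 16 * M * r + (LINT w|lborel. cmod (k w)) / r"
  by (intro add_mono near(2) far(2))
 finally show b: "(LINT w|lborel. cmod (k w / (w - a))) \<le> 16 * M * r + (LINT w|lborel. cmod (k w)) / r" .
 show "cmod (cauchy_transform k a) \<le> 16 * M * r + (LINT w|lborel. cmod (k w)) / r"
  unfolding cauchy_transform_def by (rule order_trans[OF integral_norm_bound b])
qed

text \<open>The support of \<open>k\<close> keeps away from each point of \<open>U\<close>, so the
  derivative can be guessed as the integral of \<open>k w / (w - a1)^2\<close>, and the error of the
  difference quotient is an explicit integral of size O(a - a1).\<close>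

lemma cauchy_transform_holomorphic:
 assumes k: "integrable lborel k" and zero: "\<And>w. w \<in> U \<Longrightarrow> k w = 0" and U: "open U"
 shows "cauchy_transform k holomorphic_on U"
proof (subst holomorphic_on_open[OF U], intro ballI)
 fix a1 assume "a1 \<in> U"
 then obtain d where d: "d > 0" "ball a1 d \<subseteq> U"
  using U open_contains_ball by blast
 have km [measurable]: "k \<in> borel_measurable borel" using k by auto
 define D where "D = (LINT w|lborel. k w / (w - a1)^2)"
 have int1: "integrable lborel (\<lambda>w. k w / (w - a))" if "a \<in> ball a1 (d/2)" for a
 proof (rule cauchy_transform_integrable[OF k, of "d/2" _ 0])
  fix w assume "w \<in> ball a (d/2)"
  then have "dist a1 w < d" using that d dist_triangle_half_r[of a a1 d w] by (auto simp: dist_commute)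
  then show "cmod (k w) \<le> 0" using zero[of w] d by auto
 qed (use d in auto)
 have far: "d \<le> cmod (w - a1)" if "k w \<noteq> 0" for w
 proof -
  have "w \<notin> ball a1 d" using zero[of w] that d(2) by blast
  then show ?thesis by (simp add: dist_norm norm_minus_commute)
 qed
 have int2: "integrable lborel (\<lambda>w. k w / (w - a1)^2)"
 proof (rule Bochner_Integration.integrable_bound[of _ "\<lambda>w. cmod (k w) / d^2"])
  show "AE w in lborel. norm (k w / (w - a1)^2) \<le> norm (cmod (k w) / d^2)"
  proof (intro AE_I2)
   fix w show "norm (k w / (w - a1)^2) \<le> norm (cmod (k w) / d^2)"
    using far[of w] d
    by (cases "k w = 0") (auto simp: norm_divide norm_power intro!: divide_left_mono power_mono mult_pos_pos)
  qed
 qed (use k in \<open>auto intro!: integrable_divide integrable_norm\<close>)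
 \<comment> \<open>On the support of \<open>k\<close> one has |w - a1| >= d and |w - a| >= d / 2, so
   the kernel of the error is at most 1 / (d^3 / 2).\<close>
 have est: "cmod ((cauchy_transform k a - cauchy_transform k a1) / (a - a1) - D)
   \<le> cmod (a - a1) * ((LINT w|lborel. cmod (k w)) * (2 / d^3))" if a: "a \<in> ball a1 (d/2)" "a \<noteq> a1" for a
 proof -
  have e: "(k w / (w - a) - k w / (w - a1)) / (a - a1) - k w / (w - a1)^2
    = (a - a1) * k w / ((w - a) * (w - a1)^2)" for w
  proof (cases "k w = 0")
   case False
   then have "w \<noteq> a1" "w \<noteq> a" using far[of w] d a by (auto simp: dist_norm norm_minus_commute)
   define u v where uv: "u = w - a" "v = w - a1"
   have ne: "u \<noteq> 0" "v \<noteq> 0" "v \<noteq> u" using \<open>w \<noteq> a1\<close> \<open>w \<noteq> a\<close> a(2) by (auto simp: uv)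
   have "k w / u - k w / v = (v - u) * (k w / (u * v))"
    using ne by (simp add: field_simps)
   then have 1: "(k w / u - k w / v) / (v - u) = k w / (u * v)" using ne by simp
   have 2: "k w / (u * v) - k w / v\<^sup>2 = (v - u) * k w / (u * v\<^sup>2)"
    using ne by (simp add: field_simps power2_eq_square)
   have "a - a1 = v - u" by (simp add: uv)
   then show ?thesis unfolding uv[symmetric] using 1 2 by simp
  qed auto
  have i0: "integrable lborel (\<lambda>w. k w / (w - a1))" using int1[of a1] d by auto
  have "(cauchy_transform k a - cauchy_transform k a1) / (a - a1) - D
    = (LINT w|lborel. (k w / (w - a) - k w / (w - a1)) / (a - a1) - k w / (w - a1)^2)"
   unfolding cauchy_transform_def D_def
   using int1[OF a(1)] i0 int2 a(2) by simp
  also have "\<dots> = (LINT w|lborel. (a - a1) * k w / ((w - a) * (w - a1)^2))" by (simp only: e)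
  finally have eq: "(cauchy_transform k a - cauchy_transform k a1) / (a - a1) - D = \<dots>" .
  have int3: "integrable lborel (\<lambda>w. (a - a1) * k w / ((w - a) * (w - a1)^2))"
   using int1[OF a(1)] i0 int2 a(2) by (subst e[symmetric]) auto
  have "cmod (LINT w|lborel. (a - a1) * k w / ((w - a) * (w - a1)^2)) \<le> (LINT w|lborel. cmod (a - a1) * (cmod (k w) * (2 / d^3)))"
  proof (intro order_trans[OF integral_norm_bound] integral_mono)
   show "integrable lborel (\<lambda>w. cmod (a - a1) * (cmod (k w) * (2 / d^3)))" using k by auto
   fix w
   show "cmod ((a - a1) * k w / ((w - a) * (w - a1)^2)) \<le> cmod (a - a1) * (cmod (k w) * (2 / d^3))"
   proof (cases "k w = 0")
    case False
    note f = far[OF False]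
    have "cmod (w - a1) \<le> cmod (w - a) + cmod (a - a1)" using norm_triangle_ineq[of "w - a" "a - a1"] by simp
    then have f2: "d/2 \<le> cmod (w - a)" using f a(1) by (auto simp: dist_norm norm_minus_commute)
    have "d^3 / 2 = d / 2 * d^2" by (simp add: power2_eq_square power3_eq_cube)
    also have "\<dots> \<le> cmod (w - a) * cmod (w - a1)^2"
     using f f2 d by (intro mult_mono power_mono) auto
    finally have "inverse (cmod (w - a) * cmod (w - a1)^2) \<le> inverse (d^3/2)"
     using d by (intro le_imp_inverse_le) auto
    then have "cmod (a - a1) * cmod (k w) * inverse (cmod (w - a) * cmod (w - a1)^2)
     \<le> cmod (a - a1) * cmod (k w) * inverse (d^3/2)"
     by (intro mult_left_mono) auto
    moreover have "cmod ((a - a1) * k w / ((w - a) * (w - a1)^2))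
      = cmod (a - a1) * cmod (k w) * inverse (cmod (w - a) * cmod (w - a1)^2)"
     by (simp only: norm_mult norm_divide norm_power norm_inverse divide_inverse)
    moreover have "cmod (a - a1) * (cmod (k w) * (2 / d^3)) = cmod (a - a1) * cmod (k w) * inverse (d^3/2)"
     by (simp only: inverse_divide mult.assoc)
    ultimately show ?thesis by (simp only:)
   qed auto
  qed (use int3 in auto)
  then show ?thesis unfolding eq by (simp add: k)
 qed
 have "((\<lambda>a. (cauchy_transform k a - cauchy_transform k a1) / (a - a1) - D) \<longlongrightarrow> 0) (at a1)"
 proof (rule Lim_null_comparison)
  have "eventually (\<lambda>a. a \<in> ball a1 (d/2) - {a1}) (at a1)"
   using d by (intro eventually_at_in_open) auto
  then show "\<forall>\<^sub>F a in at a1. cmod ((cauchy_transform k a - cauchy_transform k a1) / (a - a1) - D)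
   \<le> cmod (a - a1) * ((LINT w|lborel. cmod (k w)) * (2 / d^3))"
   by eventually_elim (use est in auto)
  show "((\<lambda>a. cmod (a - a1) * ((LINT w|lborel. cmod (k w)) * (2 / d^3))) \<longlongrightarrow> 0) (at a1)"
   by (rule tendsto_eq_intros refl | simp)+
 qed
 then show "\<exists>f'. (cauchy_transform k has_field_derivative f') (at a1)"
  by (auto simp: has_field_derivative_iff dest: LIM_zero_cancel)
qed

text \<open>Remove from \<open>k\<close> its part in a disk of radius \<open>2 s\<close>: the rest
  has a holomorphic transform near \<open>a0\<close>, and the removed part contributes at most a
  constant times \<open>M s\<close>, uniformly in \<open>a\<close>.\<close>

lemma cauchy_transform_isCont:
 assumes k: "integrable lborel k" and r: "r > 0"
  and M: "\<And>w. w \<in> ball a0 r \<Longrightarrow> cmod (k w) \<le> M"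
 shows "isCont (cauchy_transform k) a0"
 unfolding continuous_at_eps_delta
proof (intro allI impI)
 fix e :: real assume e: "e > 0"
 have km [measurable]: "k \<in> borel_measurable borel" using k by auto
 have M0: "M \<ge> 0" using M[of a0] r by (auto intro: order_trans[OF norm_ge_zero])
 \<comment> \<open>Two contributions of 48 M s have to fit into e / 2, which 200 M s <= e grants;
   \<open>M + 1\<close> avoids a division by zero. The bound r / 4 keeps the disk of radius 3 s
   about any \<open>a\<close> in \<open>ball a0 s\<close> inside \<open>ball a0 r\<close>.\<close>
 define s where "s = min (r / 4) (e / (200 * (M + 1)))"
 have s: "s > 0" "4 * s \<le> r" "200 * (M * s) \<le> e"
 proof -
  show "s > 0" "4 * s \<le> r" using r e M0 by (auto simp: s_def)
  have "s \<le> e / (200 * (M + 1))" by (simp add: s_def)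
  then have "200 * (M + 1) * s \<le> e" using M0 by (simp add: field_simps)
  moreover have "200 * (M * s) \<le> 200 * (M + 1) * s" using \<open>s > 0\<close> by (simp add: algebra_simps)
  ultimately show "200 * (M * s) \<le> e" by linarith
 qed
 define k2 where "k2 = (\<lambda>w. indicator (- ball a0 (2 * s)) w *\<^sub>R k w)"
 have k2: "integrable lborel k2"
  unfolding k2_def by (rule integrable_mult_indicator) (use k in auto)
 have "cauchy_transform k2 holomorphic_on ball a0 (2 * s)"
  by (rule cauchy_transform_holomorphic[OF k2]) (auto simp: k2_def)
 then have "isCont (cauchy_transform k2) a0"
  using s holomorphic_on_imp_continuous_on[of "cauchy_transform k2" "ball a0 (2 * s)"]
  by (simp add: continuous_on_eq_continuous_at)
 then obtain d where d: "d > 0" "\<And>a. dist a a0 < d \<Longrightarrow> dist (cauchy_transform k2 a) (cauchy_transform k2 a0) < e/2"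
  unfolding continuous_at_eps_delta using e by (meson half_gt_zero)
 have diff: "cmod (cauchy_transform k a - cauchy_transform k2 a) \<le> 48 * (M * s)" if a: "a \<in> ball a0 s" for a
 proof -
  define k1 where "k1 = (\<lambda>w. indicator (ball a0 (2 * s)) w *\<^sub>R k w)"
  have [measurable]: "ball a0 (2 * s) \<in> sets borel" by simp
  have k1m [measurable]: "k1 \<in> borel_measurable borel" unfolding k1_def by measurable
  have sub: "ball a (3 * s) \<subseteq> ball a0 r" "ball a0 (2 * s) \<subseteq> ball a (3 * s)"
  proof -
   show "ball a (3 * s) \<subseteq> ball a0 r"
    using a s by (auto simp: ball_subset_ball_iff dist_commute)
   show "ball a0 (2 * s) \<subseteq> ball a (3 * s)"
    using a s by (auto simp: ball_subset_ball_iff dist_commute)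
  qed
  have i1: "integrable lborel (\<lambda>w. k w / (w - a))"
   by (rule cauchy_transform_integrable[OF k, of "3 * s" _ M]) (use M sub s in auto)
  have i2: "integrable lborel (\<lambda>w. k2 w / (w - a))"
   by (rule cauchy_transform_integrable[OF k2, of "3 * s" _ M]) (use M sub s M0 in \<open>auto simp: k2_def indicator_def\<close>)
  have "cauchy_transform k a - cauchy_transform k2 a = (LINT w|lborel. k w / (w - a) - k2 w / (w - a))"
   unfolding cauchy_transform_def using i1 i2 by simp
  also have "\<dots> = (LINT w|lborel. indicator (ball a (3 * s)) w *\<^sub>R (k1 w / (w - a)))"
   by (intro Bochner_Integration.integral_cong) (use sub in \<open>auto simp: k1_def k2_def indicator_def\<close>)
  also have "cmod \<dots> \<le> 16 * M * (3 * s)"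
   by (rule cauchy_near_bound) (use M sub s M0 in \<open>auto simp: k1_def indicator_def\<close>)
  finally show ?thesis by simp
 qed
 show "\<exists>d>0. \<forall>a. dist a a0 < d \<longrightarrow> dist (cauchy_transform k a) (cauchy_transform k a0) < e"
 proof (intro exI[of _ "min d s"] conjI allI impI)
  fix a assume a: "dist a a0 < min d s"
  have "cmod (cauchy_transform k a - cauchy_transform k a0)
   = cmod ((cauchy_transform k a - cauchy_transform k2 a) - (cauchy_transform k a0 - cauchy_transform k2 a0)
     + (cauchy_transform k2 a - cauchy_transform k2 a0))" by simp
  also have "\<dots> \<le> cmod (cauchy_transform k a - cauchy_transform k2 a) + cmod (cauchy_transform k a0 - cauchy_transform k2 a0)
     + cmod (cauchy_transform k2 a - cauchy_transform k2 a0)"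
   using norm_triangle_ineq4[of "cauchy_transform k a - cauchy_transform k2 a" "cauchy_transform k a0 - cauchy_transform k2 a0"]
   by (intro order_trans[OF norm_triangle_ineq] add_right_mono)
  also have "\<dots> < 48 * (M * s) + 48 * (M * s) + e / 2"
   using diff[of a] diff[of a0] d(2)[of a] a s by (auto simp: dist_norm norm_minus_commute)
  also have "\<dots> \<le> e" using s(3) M0 s(1) e by linarith
  finally show "dist (cauchy_transform k a) (cauchy_transform k a0) < e" by (simp add: dist_norm)
 qed (use d s in auto)
qed

text \<open>Split at the disk of radius |a| / 2 about \<open>a\<close>. On it |k| <= 2 C / |a|, so
  after multiplication by \<open>a\<close> its part is O(|a|); off it |a / (w - a)| <= 2 and
  dominated convergence applies. This later kills the residue at the origin when 0 lies in the
  domain.\<close>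

lemma cauchy_transform_at_0:
 assumes k: "integrable lborel k" and R: "R > 0"
  and C: "\<And>w. w \<in> ball 0 R - {0} \<Longrightarrow> cmod (k w) \<le> C / cmod w"
 shows "((\<lambda>a. a * cauchy_transform k a) \<longlongrightarrow> 0) (at 0)"
 unfolding tendsto_at_iff_sequentially comp_def
proof (intro allI impI)
 fix X :: "nat \<Rightarrow> complex" assume X: "\<forall>i. X i \<in> UNIV - {0}" "X \<longlonglongrightarrow> 0"
 have km [measurable]: "k \<in> borel_measurable borel" using k by auto
 let ?n = "\<lambda>i w. indicator (ball (X i) (cmod (X i) / 2)) w *\<^sub>R (k w / (w - X i))"
 let ?f = "\<lambda>i w. indicator (- ball (X i) (cmod (X i) / 2)) w *\<^sub>R (X i * k w / (w - X i))"
 have C0: "C \<ge> 0"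
 proof -
  have "cmod (k (of_real (R/2))) \<le> C / (R/2)" using C[of "of_real (R/2)"] R by auto
  then have "0 \<le> C / (R/2)" by (rule order_trans[OF norm_ge_zero])
  then show ?thesis using R by (simp add: zero_le_divide_iff)
 qed
 have far0: "(\<lambda>i. LINT w|lborel. ?f i w) \<longlonglongrightarrow> (LINT w::complex|lborel. (0::complex))"
 proof (rule integral_dominated_convergence[where w="\<lambda>w. 2 * cmod (k w)" and f="\<lambda>_. 0" and s="?f"])
  show "integrable lborel (\<lambda>w. 2 * cmod (k w))" using k by auto
  show "AE w in lborel. (\<lambda>i. ?f i w) \<longlonglongrightarrow> 0"
   using AE_lborel_singleton[of "0::complex"]
  proof eventually_elim
   case (elim w)
   have "(\<lambda>i. X i * k w / (w - X i)) \<longlonglongrightarrow> 0 * k w / (w - 0)"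
    using X elim by (intro tendsto_intros) auto
   then have *: "(\<lambda>i. cmod (X i * k w / (w - X i))) \<longlonglongrightarrow> 0" using tendsto_norm_zero by force
   show ?case
    by (rule Lim_null_comparison[OF _ *]) (auto simp: indicator_def)
  qed
  show "AE w in lborel. norm (?f i w) \<le> 2 * cmod (k w)" for i
  proof (intro AE_I2)
   fix w
   show "norm (?f i w) \<le> 2 * cmod (k w)"
   proof (cases "w \<in> ball (X i) (cmod (X i) / 2)")
    case False
    then have "cmod (X i) / cmod (w - X i) \<le> 2"
     using X(1) by (auto simp: dist_norm norm_minus_commute divide_simps)
    then have "cmod (X i) / cmod (w - X i) * cmod (k w) \<le> 2 * cmod (k w)"
     by (rule mult_right_mono) auto
    then show ?thesis using False by (simp add: norm_mult norm_divide)
   qed auto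
  qed
 qed auto
 have ev: "\<forall>\<^sub>F i in sequentially. cmod (X i) < R / 2"
  using order_tendstoD(2)[OF tendsto_norm_zero[OF X(2)], of "R/2"] R by simp
 have near: "\<forall>\<^sub>F i in sequentially. cmod (X i * cauchy_transform k (X i) - (LINT w|lborel. ?f i w)) \<le> 16 * C * cmod (X i)"
  using ev
 proof eventually_elim
  case (elim i)
  define a where "a = X i"
  have a: "a \<noteq> 0" "cmod a < R/2" using X(1) elim by (auto simp: a_def)
  have r: "cmod a / 2 > 0" using a by auto
  have b: "cmod (k w) \<le> 2 * C / cmod a" if "w \<in> ball a (cmod a / 2)" for w
  proof -
   have "cmod (a - w) < cmod a / 2" using that by (simp add: dist_norm)
   then have w: "cmod w \<ge> cmod a / 2" "cmod w < R" using a norm_triangle_ineq2[of a w] norm_triangle_ineq2[of w a]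
    by (auto simp: norm_minus_commute)
   then have "cmod (k w) \<le> C / cmod w" using C[of w] a by fastforce
   also have "\<dots> \<le> C / (cmod a / 2)" using w(1) r C0 less_le_trans[OF r w(1)] by (intro divide_left_mono mult_pos_pos) auto
   finally show ?thesis by (simp add: mult_ac)
  qed
  have fi: "integrable lborel (\<lambda>w. indicator (- ball a (cmod a / 2)) w *\<^sub>R (k w / (w - a)))"
   by (rule cauchy_far_integrable[OF k r])
  have ni: "integrable lborel (\<lambda>w. indicator (ball a (cmod a / 2)) w *\<^sub>R (k w / (w - a)))"
   by (rule cauchy_near_integrable[OF km r b])
  have "a * cauchy_transform k a = a * (LINT w|lborel. indicator (ball a (cmod a / 2)) w *\<^sub>R (k w / (w - a)) +
    indicator (- ball a (cmod a / 2)) w *\<^sub>R (k w / (w - a)))"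
   unfolding cauchy_transform_def cauchy_kernel_split[where a=a and r="cmod a / 2" and k=k, symmetric] ..
  also have "\<dots> = a * (LINT w|lborel. ?n i w) + a * (LINT w|lborel. indicator (- ball a (cmod a / 2)) w *\<^sub>R (k w / (w - a)))"
   using fi ni by (simp add: a_def algebra_simps)
  also have "a * (LINT w|lborel. indicator (- ball a (cmod a / 2)) w *\<^sub>R (k w / (w - a))) = (LINT w|lborel. ?f i w)"
   unfolding a_def[symmetric] integral_mult_right_zero[symmetric]
   by (intro Bochner_Integration.integral_cong) (auto simp: indicator_def)
  finally have "a * cauchy_transform k a - (LINT w|lborel. ?f i w) = a * (LINT w|lborel. ?n i w)" by simp
  also have "cmod \<dots> \<le> cmod a * (16 * (2 * C / cmod a) * (cmod a / 2))"
   unfolding norm_mult using cauchy_near_bound[OF km r b]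
   by (intro mult_left_mono) (auto simp: a_def)
  also have "\<dots> = 16 * C * cmod a" using a by simp
  finally show ?case by (simp add: a_def)
 qed
 have "(\<lambda>i. X i * cauchy_transform k (X i) - (LINT w|lborel. ?f i w)) \<longlonglongrightarrow> 0"
  by (rule Lim_null_comparison[OF near]) (use X(2) in \<open>auto intro!: tendsto_eq_intros\<close>)
 from tendsto_add[OF this far0] show "(\<lambda>i. X i * cauchy_transform k (X i)) \<longlonglongrightarrow> 0" by simp
qed


text \<open>Since a / (w - a) + 1 = w / (w - a), the difference from the limit is the transform of
  the density w k(w), handled by the same splitting; cubic decay of \<open>k\<close> makes the part
  near \<open>a\<close> O(1 / |a|). The limit is the coefficient of 1 / a that has to be compensated
  in an unbounded domain.\<close>

lemma cauchy_transform_at_infinity: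
 assumes k: "integrable lborel k" and R: "R > 0"
  and C: "\<And>w. cmod w \<ge> R \<Longrightarrow> cmod (k w) \<le> C / cmod w ^ 3"
 shows "((\<lambda>a. a * cauchy_transform k a) \<longlongrightarrow> - (LINT w|lborel. k w)) at_infinity"
 unfolding lim_at_infinity_0 tendsto_at_iff_sequentially comp_def
proof (intro allI impI)
 fix Z :: "nat \<Rightarrow> complex" assume Z: "\<forall>i. Z i \<in> UNIV - {0}" "Z \<longlonglongrightarrow> 0"
 define X where "X = (\<lambda>i. inverse (Z i))"
 have X0: "X i \<noteq> 0" for i using Z by (auto simp: X_def)
 have Zl: "filterlim Z (at 0) sequentially" using Z by (auto simp: filterlim_at)
 have Xinf: "filterlim X at_infinity sequentially"
  unfolding X_def using filterlim_compose[OF filterlim_inverse_at_infinity Zl] .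
 have invX: "(\<lambda>i. inverse (X i)) \<longlonglongrightarrow> 0" using Z(2) by (simp add: X_def)
 have km [measurable]: "k \<in> borel_measurable borel" using k by auto
 let ?f = "\<lambda>i w. indicator (- ball (X i) (cmod (X i) / 2)) w *\<^sub>R (w * k w / (w - X i))"
 have C0: "C \<ge> 0"
 proof -
  have "0 \<le> C / R ^ 3" using C[of "of_real R"] R order_trans[OF norm_ge_zero] by auto
  then show ?thesis using R by (simp add: zero_le_divide_iff)
 qed
 have far0: "(\<lambda>i. LINT w|lborel. ?f i w) \<longlonglongrightarrow> (LINT w::complex|lborel. (0::complex))"
 proof (rule integral_dominated_convergence[where w="\<lambda>w. 3 * cmod (k w)" and f="\<lambda>_. 0" and s="?f"])
  show "integrable lborel (\<lambda>w. 3 * cmod (k w))" using k by auto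
  show "AE w in lborel. (\<lambda>i. ?f i w) \<longlonglongrightarrow> 0"
  proof (intro AE_I2)
   fix w
   have "(\<lambda>i. w * k w * inverse (X i) / (w * inverse (X i) - 1)) \<longlonglongrightarrow> w * k w * 0 / (w * 0 - 1)"
    using invX by (intro tendsto_intros) auto
   moreover have "w * k w * inverse (X i) / (w * inverse (X i) - 1) = w * k w / (w - X i)" for i
    using X0[of i] by (simp add: field_simps)
   ultimately have *: "(\<lambda>i. cmod (w * k w / (w - X i))) \<longlonglongrightarrow> 0"
    using tendsto_norm_zero by force
   show "(\<lambda>i. ?f i w) \<longlonglongrightarrow> 0"
    by (rule Lim_null_comparison[OF _ *]) (auto simp: indicator_def)
  qed
  show "AE w in lborel. norm (?f i w) \<le> 3 * cmod (k w)" for i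
  proof (intro AE_I2)
   fix w
   show "norm (?f i w) \<le> 3 * cmod (k w)"
   proof (cases "w \<in> ball (X i) (cmod (X i) / 2)")
    case False
    then have "cmod w / cmod (w - X i) \<le> 3"
     using X0[of i] norm_triangle_ineq[of "w - X i" "X i"]
     by (auto simp: dist_norm norm_minus_commute divide_simps)
    then have "cmod w / cmod (w - X i) * cmod (k w) \<le> 3 * cmod (k w)"
     by (rule mult_right_mono) auto
    then show ?thesis using False by (simp add: norm_mult norm_divide)
   qed auto
  qed
 qed auto
 have "\<forall>\<^sub>F i in sequentially. cmod (X i) \<ge> 2 * R"
  using filterlim_at_infinity_imp_norm_at_top[OF Xinf] unfolding filterlim_at_top by auto
 then have near: "\<forall>\<^sub>F i in sequentially. cmod (X i * cauchy_transform k (X i) + (LINT w|lborel. k w) - (LINT w|lborel. ?f i w))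
   \<le> 32 * C * cmod (inverse (X i))"
 proof eventually_elim
  case (elim i)
  define a where "a = X i"
  have a: "a \<noteq> 0" "cmod a \<ge> 2 * R" using X0 elim by (auto simp: a_def)
  have r: "cmod a / 2 > 0" using a by auto
  have w: "cmod w \<ge> cmod a / 2" "cmod w \<ge> R" "w \<noteq> 0" if "w \<in> ball a (cmod a / 2)" for w
  proof -
   have "cmod (a - w) < cmod a / 2" using that by (simp add: dist_norm)
   then show "cmod w \<ge> cmod a / 2" "cmod w \<ge> R" using a norm_triangle_ineq2[of a w] R by auto
   then show "w \<noteq> 0" using R by auto
  qed
  have b0: "cmod (k w) \<le> C / R^3" if "w \<in> ball a (cmod a / 2)" for w
   using C[of w] w[OF that] R C0 by (auto intro!: order_trans[of "cmod (k w)" "C / cmod w ^ 3"] divide_left_mono power_mono)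
  have b: "cmod (w * k w) \<le> C * 4 / (cmod a)^2" if "w \<in> ball a (cmod a / 2)" for w
  proof -
   have "cmod (w * k w) \<le> cmod w * (C / cmod w ^ 3)"
    unfolding norm_mult using C[of w] w[OF that] by (intro mult_left_mono) auto
   also have "\<dots> = C / (cmod w)^2" using w[OF that] by (simp add: power2_eq_square power3_eq_cube)
   also have "\<dots> \<le> C / (cmod a / 2)^2"
    using w[OF that] a C0 by (intro divide_left_mono power_mono) auto
   finally show ?thesis by (simp add: power_divide mult_ac)
  qed
  have ki: "integrable lborel (\<lambda>w. k w / (w - a))"
   by (rule cauchy_transform_integrable[OF k r b0])
  have wkm: "(\<lambda>w. w * k w) \<in> borel_measurable borel" by measurable
  have ni: "integrable lborel (\<lambda>w. indicator (ball a (cmod a / 2)) w *\<^sub>R (w * k w / (w - a)))"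
   by (rule cauchy_near_integrable[OF wkm r b])
  have AEeq: "AE w in lborel. a * (k w / (w - a)) + k w = w * k w / (w - a)"
   using AE_lborel_singleton[of a] by eventually_elim (simp add: field_simps)
  have wki: "integrable lborel (\<lambda>w. w * k w / (w - a))"
   by (rule iffD1[OF integrable_cong_AE[OF _ _ AEeq] Bochner_Integration.integrable_add[OF integrable_mult_right[OF ki] k]]) auto
  have fi: "integrable lborel (\<lambda>w. ?f i w)"
  proof -
   have "integrable lborel (\<lambda>w. w * k w / (w - a) - indicator (ball a (cmod a / 2)) w *\<^sub>R (w * k w / (w - a)))"
    using wki ni by auto
   also have "(\<lambda>w. w * k w / (w - a) - indicator (ball a (cmod a / 2)) w *\<^sub>R (w * k w / (w - a))) = (\<lambda>w. ?f i w)"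
    by (auto simp: indicator_def a_def)
   finally show ?thesis .
  qed
  have "a * cauchy_transform k a + (LINT w|lborel. k w) = (LINT w|lborel. a * (k w / (w - a)) + k w)"
   unfolding cauchy_transform_def
   by (subst Bochner_Integration.integral_add[OF integrable_mult_right[OF ki] k], subst integral_mult_right_zero) simp
  also have "\<dots> = (LINT w|lborel. w * k w / (w - a))"
   using AEeq by (intro integral_cong_AE) auto
  also have "\<dots> = (LINT w|lborel. indicator (ball a (cmod a / 2)) w *\<^sub>R (w * k w / (w - a)) + ?f i w)"
   by (intro Bochner_Integration.integral_cong) (auto simp: indicator_def a_def)
  also have "\<dots> = (LINT w|lborel. indicator (ball a (cmod a / 2)) w *\<^sub>R (w * k w / (w - a))) + (LINT w|lborel. ?f i w)"
   by (rule Bochner_Integration.integral_add[OF ni fi])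
  finally have "cmod (a * cauchy_transform k a + (LINT w|lborel. k w) - (LINT w|lborel. ?f i w))
    = cmod (LINT w|lborel. indicator (ball a (cmod a / 2)) w *\<^sub>R (w * k w / (w - a)))" by simp
  also have "\<dots> \<le> 16 * (C * 4 / (cmod a)^2) * (cmod a / 2)"
   by (rule cauchy_near_bound[OF wkm r b])
  also have "\<dots> = 32 * C * cmod (inverse a)" using a by (simp only: norm_inverse) (simp add: field_simps power2_eq_square)
  finally show ?case by (simp add: a_def)
 qed
 have "(\<lambda>i. X i * cauchy_transform k (X i) + (LINT w|lborel. k w) - (LINT w|lborel. ?f i w)) \<longlonglongrightarrow> 0"
 proof (rule Lim_null_comparison[OF near])
  show "(\<lambda>i. 32 * C * cmod (inverse (X i))) \<longlonglongrightarrow> 0"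
   using tendsto_mult_left[OF tendsto_norm_zero[OF invX], of "32 * C"] by simp
 qed
 from tendsto_add[OF this far0]
 have "(\<lambda>i. X i * cauchy_transform k (X i) + (LINT w|lborel. k w)) \<longlonglongrightarrow> 0" by simp
 from tendsto_diff[OF this tendsto_const[of "LINT w|lborel. k w"]]
 show "(\<lambda>i. inverse (Z i) * cauchy_transform k (inverse (Z i))) \<longlonglongrightarrow> - (LINT w|lborel. k w)"
  by (simp add: X_def)
qed

section \<open>Pompeiu's formula on rectangles\<close>

lemma integral_complex_Fubini:
 fixes f :: "complex \<Rightarrow> complex"
 assumes f: "integrable lborel f"
 shows "(LINT w|lborel. f w) = (LINT x|lborel. LINT y|lborel. f (Complex x y))"
  and "(LINT w|lborel. f w) = (LINT y|lborel. LINT x|lborel. f (Complex x y))"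
proof -
 have fm: "f \<in> borel_measurable borel" using f by auto
 have "integrable (distr (lborel \<Otimes>\<^sub>M lborel) borel (\<lambda>(x, y). Complex x y)) f"
  using f by (subst lborel_complex_eq[symmetric])
 then have int: "integrable (lborel \<Otimes>\<^sub>M lborel) (\<lambda>(x, y). f (Complex x y))"
  by (subst (asm) integrable_distr_eq) (auto simp: fm case_prod_unfold)
 have eq: "(LINT w|lborel. f w) = integral\<^sup>L (lborel \<Otimes>\<^sub>M lborel) (\<lambda>(x, y). f (Complex x y))"
  by (subst lborel_complex_eq, subst integral_distr) (auto simp: fm case_prod_unfold)
 show "(LINT w|lborel. f w) = (LINT x|lborel. LINT y|lborel. f (Complex x y))"
  unfolding eq using lborel_pair.integral_fst'[OF int] by simp
 show "(LINT w|lborel. f w) = (LINT y|lborel. LINT x|lborel. f (Complex x y))"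
  unfolding eq using lborel_pair.integral_snd[OF int] by simp
qed

lemma contour_integral_rectpath_split:
 assumes "Re p < Re q" "Im p < Im q" and f: "continuous_on (path_image (rectpath p q)) f"
 shows "contour_integral (rectpath p q) f
  = contour_integral (linepath p (Complex (Re q) (Im p))) f
  + contour_integral (linepath (Complex (Re q) (Im p)) q) f
  + contour_integral (linepath q (Complex (Re p) (Im q))) f
  + contour_integral (linepath (Complex (Re p) (Im q)) p) f"
  and "f contour_integrable_on rectpath p q"
proof -
 have pi: "path_image (rectpath p q) = closed_segment p (Complex (Re q) (Im p)) \<union>
   closed_segment (Complex (Re q) (Im p)) q \<union> closed_segment q (Complex (Re p) (Im q)) \<union>
   closed_segment (Complex (Re p) (Im q)) p"
  by (auto simp: rectpath_def Let_def path_image_join)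
 have i: "f contour_integrable_on linepath p (Complex (Re q) (Im p))"
  "f contour_integrable_on linepath (Complex (Re q) (Im p)) q"
  "f contour_integrable_on linepath q (Complex (Re p) (Im q))"
  "f contour_integrable_on linepath (Complex (Re p) (Im q)) p"
  by (rule contour_integrable_continuous_linepath, rule continuous_on_subset[OF f], force simp: pi)+
 show "contour_integral (rectpath p q) f
  = contour_integral (linepath p (Complex (Re q) (Im p))) f
  + contour_integral (linepath (Complex (Re q) (Im p)) q) f
  + contour_integral (linepath q (Complex (Re p) (Im q))) f
  + contour_integral (linepath (Complex (Re p) (Im q)) p) f"
  unfolding rectpath_def Let_def using i
  by (simp add: contour_integrable_joinI valid_path_join)
 show "f contour_integrable_on rectpath p q"
  unfolding rectpath_def Let_def using i
  by (simp add: contour_integrable_joinI valid_path_join)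
qed

lemma cauchy_linepath_holomorphic:
 assumes F: "continuous_on (closed_segment a b) F"
 shows "(\<lambda>z. contour_integral (linepath a b) (\<lambda>w. F w / (w - z))) holomorphic_on - closed_segment a b"
proof (subst holomorphic_on_open)
 show "\<forall>z\<in>- closed_segment a b. \<exists>f'. ((\<lambda>z. contour_integral (linepath a b) (\<lambda>w. F w / (w - z))) has_field_derivative f') (at z)"
 proof
  fix z assume z: "z \<in> - closed_segment a b"
  show "\<exists>f'. ((\<lambda>z. contour_integral (linepath a b) (\<lambda>w. F w / (w - z))) has_field_derivative f') (at z)"
  proof (rule exI, rule Cauchy_next_derivative(2)[where B="norm (b - a)" and k=1 and S=UNIV and f'=F])
   fix w assume w: "w \<in> UNIV - path_image (linepath a b)"
   have "continuous_on (closed_segment a b) (\<lambda>u. F u / (u - w))"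
    using w by (intro continuous_intros F) auto
   then show "((\<lambda>u. F u / (u - w) ^ 1) has_contour_integral contour_integral (linepath a b) (\<lambda>u. F u / (u - w))) (linepath a b)"
    using has_contour_integral_integral contour_integrable_continuous_linepath by simp
  qed (use F z in auto)
 qed
qed auto

lemma has_contour_integral_linepath_horizontal_iff:
 assumes "Im z = c" "Im z' = c" "Re z = a" "Re z' = b" "a < b"
 shows "(f has_contour_integral I) (linepath z z') \<longleftrightarrow> ((\<lambda>x. f (Complex x c)) has_integral I) {a..b}"
proof -
 have z: "z = of_real a + \<i> * of_real c" "z' = of_real b + \<i> * of_real c"
  using assms by (auto simp: complex_eq_iff)
 have "linepath z z' t = linepath (of_real a) (of_real b) t + \<i> * of_real c" for t
  by (simp add: z linepath_def complex_eq_iff algebra_simps)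
 then have "(f has_contour_integral I) (linepath z z') \<longleftrightarrow>
   ((\<lambda>w. f (w + \<i> * of_real c)) has_contour_integral I) (linepath (of_real a) (of_real b))"
  by (simp add: has_contour_integral_linepath z)
 also have "\<dots> \<longleftrightarrow> ((\<lambda>x. f (of_real x + \<i> * of_real c)) has_integral I) {a..b}"
  using assms(5) by (subst has_contour_integral_linepath_Reals_iff) auto
 finally show ?thesis by (simp add: Complex_eq)
qed

text \<open>Fubini and the fundamental theorem of calculus are applied to the difference quotient
  \<open>K\<close> of \<open>g\<close> at \<open>a\<close>. It is bounded, so no disk about
  \<open>a\<close> has to be cut out: the two lines through \<open>a\<close> are negligible, and
  along every other horizontal or vertical line \<open>K\<close> is C1. The subtracted constant
  returns as \<open>g a\<close> times the winding number of the rectangle.\<close>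

lemma pompeiu_formula:
 fixes g :: "complex \<Rightarrow> complex" and D :: "complex \<Rightarrow> complex \<Rightarrow> complex"
 assumes sub: "cbox p q \<subseteq> U" and a: "a \<in> box p q"
  and D: "\<And>w. w \<in> U \<Longrightarrow> (g has_derivative D w) (at w)"
  and c1: "continuous_on U (\<lambda>w. D w 1)" and c2: "continuous_on U (\<lambda>w. D w \<i>)"
 shows "contour_integral (rectpath p q) (\<lambda>w. g w / (w - a)) - 2 * of_real pi * \<i> * g a
   = \<i> * (LINT w|lborel. indicator (cbox p q) w *\<^sub>R ((D w 1 + \<i> * D w \<i>) / (w - a)))"
proof -
 have lt: "Re p < Re a" "Re a < Re q" "Im p < Im a" "Im a < Im q"
  using a by (auto simp: in_box_complex_iff)
 have aU: "a \<in> cbox p q" using a box_subset_cbox by auto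
 have Dlin: "D w z = Re z *\<^sub>R D w 1 + Im z *\<^sub>R D w \<i>" if "w \<in> U" for w z
 proof -
  interpret bounded_linear "D w" using D[OF that] by (rule has_derivative_bounded_linear)
  have "D w z = D w (Re z *\<^sub>R 1 + Im z *\<^sub>R \<i>)"
   by (rule arg_cong[where f="D w"]) (simp add: complex_eq_iff)
  then show ?thesis by (simp only: add scaleR)
 qed
 have "compact ((\<lambda>w. D w 1) ` cbox p q)" "compact ((\<lambda>w. D w \<i>) ` cbox p q)"
  by (intro compact_continuous_image continuous_on_subset[OF _ sub] c1 c2 compact_cbox)+
 then obtain B1 B2 where B: "\<And>w. w \<in> cbox p q \<Longrightarrow> cmod (D w 1) \<le> B1" "\<And>w. w \<in> cbox p q \<Longrightarrow> cmod (D w \<i>) \<le> B2"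
  using compact_imp_bounded bounded_iff by (metis imageI)
 have B0: "0 \<le> B1" "0 \<le> B2" using B aU order_trans[OF norm_ge_zero] by blast+
 define L where "L = B1 + B2"
 have Lip: "cmod (g w - g a) \<le> L * cmod (w - a)" if "w \<in> cbox p q" for w
 proof (rule differentiable_bound[OF convex_box(1)[of p q] _ _ that aU])
  fix x assume x: "x \<in> cbox p q"
  show "(g has_derivative D x) (at x within cbox p q)"
   using D sub x by (blast intro: has_derivative_at_withinI)
  show "onorm (D x) \<le> L"
  proof (rule onorm_le)
   fix z
   have "cmod (D x z) \<le> \<bar>Re z\<bar> * cmod (D x 1) + \<bar>Im z\<bar> * cmod (D x \<i>)"
    using Dlin[of x z] x sub norm_triangle_ineq[of "Re z *\<^sub>R D x 1" "Im z *\<^sub>R D x \<i>"] by auto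
   also have "\<dots> \<le> cmod z * B1 + cmod z * B2"
    using B[OF x] abs_Re_le_cmod[of z] abs_Im_le_cmod[of z] by (intro add_mono mult_mono) auto
   finally show "cmod (D x z) \<le> L * cmod z" by (simp add: L_def algebra_simps)
  qed
 qed
 \<comment> \<open>\<open>K a = 0\<close> by the convention for division, so for measurability the
   point \<open>a\<close> can simply be taken out of the box.\<close>
 define K where "K = (\<lambda>w. (g w - g a) / (w - a))"
 define kx where "kx = (\<lambda>w. D w 1 - K w)"
 define ky where "ky = (\<lambda>w. D w \<i> - \<i> * K w)"
 have gc: "continuous_on (cbox p q) g"
  using D sub by (intro continuous_at_imp_continuous_on) (auto intro: has_derivative_continuous)
 have Kc: "continuous_on (cbox p q - {a}) K"
  unfolding K_def by (intro continuous_intros continuous_on_subset[OF gc]) auto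
 have KL: "cmod (K w) \<le> L" if "w \<in> cbox p q" for w
  using Lip[OF that] B0 by (cases "w = a") (auto simp: K_def norm_divide divide_simps L_def)
 have kint: "integrable lborel (\<lambda>w. indicator (cbox p q) w *\<^sub>R k w)"
  and kint2: "integrable lborel (\<lambda>w. indicator (cbox p q) w *\<^sub>R (k w / (w - a)))"
  if k: "k = (\<lambda>w. d w - c * K w)" and d: "continuous_on U d" for k d :: "complex \<Rightarrow> complex" and c
 proof -
  have "compact (d ` cbox p q)" by (intro compact_continuous_image continuous_on_subset[OF d sub] compact_cbox)
  then obtain B where B: "\<And>w. w \<in> cbox p q \<Longrightarrow> cmod (d w) \<le> B"
   using compact_imp_bounded bounded_iff by (metis imageI)
  have "(\<lambda>w. indicator (cbox p q) w *\<^sub>R d w - c * (indicator (cbox p q - {a}) w *\<^sub>R K w)) \<in> borel_measurable borel"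
   using borel_measurable_continuous_on_indicator[OF _ continuous_on_subset[OF d sub]]
    borel_measurable_continuous_on_indicator[OF _ Kc]
   by (intro borel_measurable_diff borel_measurable_times) auto
  also have "(\<lambda>w. indicator (cbox p q) w *\<^sub>R d w - c * (indicator (cbox p q - {a}) w *\<^sub>R K w))
    = (\<lambda>w. indicator (cbox p q) w *\<^sub>R k w)"
   by (auto simp: indicator_def k K_def fun_eq_iff)
  finally have m: "(\<lambda>w. indicator (cbox p q) w *\<^sub>R k w) \<in> borel_measurable borel" .
  have kb: "cmod (k w) \<le> B + cmod c * L" if "w \<in> cbox p q" for w
   unfolding k using B[OF that] KL[OF that]
   by (intro norm_triangle_le_diff) (auto simp: norm_mult intro!: add_mono mult_left_mono)
  then have kb0: "0 \<le> B + cmod c * L" using aU order_trans[OF norm_ge_zero] by blast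
  show i1: "integrable lborel (\<lambda>w. indicator (cbox p q) w *\<^sub>R k w)"
  proof (rule Bochner_Integration.integrable_bound)
   show "integrable lborel (\<lambda>w. indicator (cbox p q) w *\<^sub>R (B + cmod c * L))"
    by (rule integrable_real_mult_indicator[of _ lborel "\<lambda>_. B + cmod c * L", simplified] | 
      simp add: integrable_indicator_iff emeasure_lborel_cbox_eq)+
   show "AE w in lborel. norm (indicator (cbox p q) w *\<^sub>R k w) \<le> norm (indicator (cbox p q) w *\<^sub>R (B + cmod c * L))"
    using kb kb0 by (auto simp: indicator_def)
  qed (use m in auto)
  have "integrable lborel (\<lambda>w. (indicator (cbox p q) w *\<^sub>R k w) / (w - a))"
   by (rule cauchy_transform_integrable[OF i1 zero_less_one, of _ "B + cmod c * L"])
    (use kb kb0 in \<open>auto simp: indicator_def\<close>)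
  then show "integrable lborel (\<lambda>w. indicator (cbox p q) w *\<^sub>R (k w / (w - a)))"
   by (simp only: scaleR_conv_of_real times_divide_eq_right)
 qed
 have ix: "integrable lborel (\<lambda>w. indicator (cbox p q) w *\<^sub>R (kx w / (w - a)))"
  by (rule kint2[of kx "\<lambda>w. D w 1" 1]) (use c1 in \<open>auto simp: kx_def\<close>)
 have iy: "integrable lborel (\<lambda>w. indicator (cbox p q) w *\<^sub>R (ky w / (w - a)))"
  by (rule kint2[of ky "\<lambda>w. D w \<i>" \<i>]) (use c2 in \<open>auto simp: ky_def\<close>)
 have ind: "indicator (cbox p q) (Complex x y) = (indicator {Re p..Re q} x * indicator {Im p..Im q} y :: real)" for x y
  by (auto simp: indicator_def in_cbox_complex_iff)
 have swap: "(\<lambda>(y, x). Complex x y) \<in> borel_measurable (lborel \<Otimes>\<^sub>M lborel)"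
  unfolding Complex_eq by measurable
 have fr: "(d * u - G * c) / (u * u) = (d - c * (G / u)) / u" if "u \<noteq> 0" for u d G c :: complex
  using that by (simp add: field_simps)
 have vk: "((\<lambda>s. K (e s)) has_vector_derivative ((D (e s) t - t * K (e s)) / (e s - a))) (at s within X)"
  if e: "(e has_vector_derivative t) (at s within X)" and eU: "e s \<in> U" and ne: "e s \<noteq> a" for e t s X
 proof -
  have 2: "((\<lambda>s. g (e s)) has_vector_derivative D (e s) t) (at s within X)"
   using vector_derivative_diff_chain_within[OF e has_derivative_at_withinI[OF D[OF eU]]] by (simp add: comp_def)
  have "((\<lambda>s. K (e s)) has_vector_derivative
    ((D (e s) t - 0) * (e s - a) - (g (e s) - g a) * (t - 0)) / ((e s - a) * (e s - a))) (at s within X)"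
   unfolding K_def has_vector_derivative_def
  proof (rule has_derivative_eq_rhs[OF has_derivative_divide'])
   show "((\<lambda>s. g (e s) - g a) has_derivative (\<lambda>h. h *\<^sub>R D (e s) t)) (at s within X)"
    using 2 by (auto simp: has_vector_derivative_def intro!: derivative_eq_intros)
   show "((\<lambda>s. e s - a) has_derivative (\<lambda>h. h *\<^sub>R t)) (at s within X)"
    using e by (auto simp: has_vector_derivative_def intro!: derivative_eq_intros)
  qed (use ne in \<open>auto simp: fun_eq_iff scaleR_conv_of_real algebra_simps diff_divide_distrib\<close>)
  also have "((D (e s) t - 0) * (e s - a) - (g (e s) - g a) * (t - 0)) / ((e s - a) * (e s - a))
    = (D (e s) t - t * K (e s)) / (e s - a)"
   using fr[of "e s - a" _ _ t] ne by (simp add: K_def)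
  finally show ?thesis .
 qed
 have vx: "((\<lambda>x. K (Complex x y)) has_vector_derivative (kx (Complex x y) / (Complex x y - a))) (at x within X)"
  if "Complex x y \<in> U" "y \<noteq> Im a" for x y X
 proof -
  have 1: "((\<lambda>x. Complex x y) has_vector_derivative 1) (at x within X)"
   unfolding Complex_eq has_vector_derivative_def by (auto intro!: derivative_eq_intros simp: scaleR_conv_of_real)
  have 2: "Complex x y \<noteq> a" using that(2) by auto
  show ?thesis using vk[where e="\<lambda>x. Complex x y", OF 1 that(1) 2] by (simp add: kx_def)
 qed
 have vy: "((\<lambda>y. K (Complex x y)) has_vector_derivative (ky (Complex x y) / (Complex x y - a))) (at y within X)"
  if "Complex x y \<in> U" "x \<noteq> Re a" for x y X
 proof -
  have 1: "((\<lambda>y. Complex x y) has_vector_derivative \<i>) (at y within X)"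
   unfolding Complex_eq has_vector_derivative_def by (auto intro!: derivative_eq_intros simp: scaleR_conv_of_real mult.commute)
  have 2: "Complex x y \<noteq> a" using that(2) by auto
  show ?thesis using vk[where e="\<lambda>y. Complex x y", OF 1 that(1) 2] by (simp add: ky_def)
 qed
 have kxc: "continuous_on (cbox p q - {a}) (\<lambda>w. kx w / (w - a))"
  unfolding kx_def by (intro continuous_intros Kc continuous_on_subset[OF c1]) (use sub in auto)
 have kyc: "continuous_on (cbox p q - {a}) (\<lambda>w. ky w / (w - a))"
  unfolding ky_def by (intro continuous_intros Kc continuous_on_subset[OF c2]) (use sub in auto)
 have Cx: "continuous_on X (\<lambda>x. Complex x y)" and Cy: "continuous_on Y (\<lambda>y. Complex x y)" for X Y x y
  unfolding Complex_eq by (intro continuous_intros)+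
 have "(LINT w|lborel. indicator (cbox p q) w *\<^sub>R (kx w / (w - a)))
   = (LINT y|lborel. LINT x|lborel. indicator (cbox p q) (Complex x y) *\<^sub>R (kx (Complex x y) / (Complex x y - a)))"
  by (rule integral_complex_Fubini(2)[OF ix])
 also have "\<dots> = (LINT y|lborel. indicator {Im p..Im q} y *\<^sub>R (K (Complex (Re q) y) - K (Complex (Re p) y)))"
 proof (rule integral_cong_AE)
  have *: "(LINT x|lborel. indicator (cbox p q) (Complex x y) *\<^sub>R (kx (Complex x y) / (Complex x y - a)))
    = indicator {Im p..Im q} y *\<^sub>R (K (Complex (Re q) y) - K (Complex (Re p) y))" if "y \<noteq> Im a" for y
  proof (cases "y \<in> {Im p..Im q}")
   case True
   have "(LINT x|lborel. indicator {Re p..Re q} x *\<^sub>R (kx (Complex x y) / (Complex x y - a)))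
    = K (Complex (Re q) y) - K (Complex (Re p) y)"
   proof (rule integral_FTC_Icc)
    show "continuous_on {Re p..Re q} (\<lambda>x. kx (Complex x y) / (Complex x y - a))"
     by (rule continuous_on_compose2[OF kxc Cx]) (use True that in \<open>auto simp: in_cbox_complex_iff\<close>)
       show "((\<lambda>x. K (Complex x y)) has_vector_derivative kx (Complex x y) / (Complex x y - a)) (at x within {Re p..Re q})"
     if "Re p \<le> x" "x \<le> Re q" for x
     by (rule vx) (use True that \<open>y \<noteq> Im a\<close> sub in \<open>auto simp: in_cbox_complex_iff\<close>)
   qed (use lt in auto)
   then show ?thesis using True by (simp add: ind)
  qed (simp add: ind)
  show "AE y in lborel. (LINT x|lborel. indicator (cbox p q) (Complex x y) *\<^sub>R (kx (Complex x y) / (Complex x y - a)))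
    = indicator {Im p..Im q} y *\<^sub>R (K (Complex (Re q) y) - K (Complex (Re p) y))"
   using AE_lborel_singleton[of "Im a"] by eventually_elim (use * in auto)
  have "(\<lambda>w. indicator (cbox p q) w *\<^sub>R (kx w / (w - a))) \<in> borel_measurable borel" using ix by auto
  then have "(\<lambda>(y, x). indicator (cbox p q) (Complex x y) *\<^sub>R (kx (Complex x y) / (Complex x y - a))) \<in> borel_measurable (lborel \<Otimes>\<^sub>M lborel)"
   using measurable_compose[OF swap] by (simp add: case_prod_unfold)
  then show "(\<lambda>y. LINT x|lborel. indicator (cbox p q) (Complex x y) *\<^sub>R (kx (Complex x y) / (Complex x y - a))) \<in> borel_measurable lborel"
   by (intro lborel.borel_measurable_lebesgue_integral)
  show "(\<lambda>y. indicator {Im p..Im q} y *\<^sub>R (K (Complex (Re q) y) - K (Complex (Re p) y))) \<in> borel_measurable lborel"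
   using lt by (simp, intro borel_measurable_continuous_on_indicator continuous_intros continuous_on_compose2[OF Kc Cy])
    (auto simp: in_cbox_complex_iff complex_eq_iff)
 qed
 also have "\<dots> = integral {Im p..Im q} (\<lambda>y. K (Complex (Re q) y)) - integral {Im p..Im q} (\<lambda>y. K (Complex (Re p) y))"
 proof -
  have c: "continuous_on {Im p..Im q} (\<lambda>y. K (Complex (Re q) y))" "continuous_on {Im p..Im q} (\<lambda>y. K (Complex (Re p) y))"
   by (rule continuous_on_compose2[OF Kc Cy]; use lt in \<open>auto simp: in_cbox_complex_iff complex_eq_iff\<close>)+
  then show ?thesis
   using set_borel_integral_eq_integral(2)[OF borel_integrable_atLeastAtMost'[OF continuous_on_diff[OF c]]]
   by (simp add: set_lebesgue_integral_def integral_diff integrable_continuous_interval)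
 qed
 finally have X: "(LINT w|lborel. indicator (cbox p q) w *\<^sub>R (kx w / (w - a)))
   = integral {Im p..Im q} (\<lambda>y. K (Complex (Re q) y)) - integral {Im p..Im q} (\<lambda>y. K (Complex (Re p) y))" .
 have "(LINT w|lborel. indicator (cbox p q) w *\<^sub>R (ky w / (w - a)))
   = (LINT x|lborel. LINT y|lborel. indicator (cbox p q) (Complex x y) *\<^sub>R (ky (Complex x y) / (Complex x y - a)))"
  by (rule integral_complex_Fubini(1)[OF iy])
 also have "\<dots> = (LINT x|lborel. indicator {Re p..Re q} x *\<^sub>R (K (Complex x (Im q)) - K (Complex x (Im p))))"
 proof (rule integral_cong_AE)
  have *: "(LINT y|lborel. indicator (cbox p q) (Complex x y) *\<^sub>R (ky (Complex x y) / (Complex x y - a)))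
    = indicator {Re p..Re q} x *\<^sub>R (K (Complex x (Im q)) - K (Complex x (Im p)))" if "x \<noteq> Re a" for x
  proof (cases "x \<in> {Re p..Re q}")
   case True
   have "(LINT y|lborel. indicator {Im p..Im q} y *\<^sub>R (ky (Complex x y) / (Complex x y - a)))
    = K (Complex x (Im q)) - K (Complex x (Im p))"
   proof (rule integral_FTC_Icc)
    show "continuous_on {Im p..Im q} (\<lambda>y. ky (Complex x y) / (Complex x y - a))"
     by (rule continuous_on_compose2[OF kyc Cy]) (use True that in \<open>auto simp: in_cbox_complex_iff\<close>)
       show "((\<lambda>y. K (Complex x y)) has_vector_derivative ky (Complex x y) / (Complex x y - a)) (at y within {Im p..Im q})"
     if "Im p \<le> y" "y \<le> Im q" for y
     by (rule vy) (use True that \<open>x \<noteq> Re a\<close> sub in \<open>auto simp: in_cbox_complex_iff\<close>)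
   qed (use lt in auto)
   then show ?thesis using True by (simp add: ind)
  qed (simp add: ind)
  show "AE x in lborel. (LINT y|lborel. indicator (cbox p q) (Complex x y) *\<^sub>R (ky (Complex x y) / (Complex x y - a)))
    = indicator {Re p..Re q} x *\<^sub>R (K (Complex x (Im q)) - K (Complex x (Im p)))"
   using AE_lborel_singleton[of "Re a"] by eventually_elim (use * in auto)
  have "(\<lambda>w. indicator (cbox p q) w *\<^sub>R (ky w / (w - a))) \<in> borel_measurable borel" using iy by auto
  from measurable_compose[OF borel_measurable_case_Complex this]
  have "(\<lambda>(x, y). indicator (cbox p q) (Complex x y) *\<^sub>R (ky (Complex x y) / (Complex x y - a))) \<in> borel_measurable (lborel \<Otimes>\<^sub>M lborel)"
   by (simp add: case_prod_unfold)
  then show "(\<lambda>x. LINT y|lborel. indicator (cbox p q) (Complex x y) *\<^sub>R (ky (Complex x y) / (Complex x y - a))) \<in> borel_measurable lborel"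
   by (intro lborel.borel_measurable_lebesgue_integral)
  show "(\<lambda>x. indicator {Re p..Re q} x *\<^sub>R (K (Complex x (Im q)) - K (Complex x (Im p)))) \<in> borel_measurable lborel"
   using lt by (simp, intro borel_measurable_continuous_on_indicator continuous_intros continuous_on_compose2[OF Kc Cx])
    (auto simp: in_cbox_complex_iff complex_eq_iff)
 qed
 also have "\<dots> = integral {Re p..Re q} (\<lambda>x. K (Complex x (Im q))) - integral {Re p..Re q} (\<lambda>x. K (Complex x (Im p)))"
 proof -
  have c: "continuous_on {Re p..Re q} (\<lambda>x. K (Complex x (Im q)))" "continuous_on {Re p..Re q} (\<lambda>x. K (Complex x (Im p)))"
   by (rule continuous_on_compose2[OF Kc Cx]; use lt in \<open>auto simp: in_cbox_complex_iff complex_eq_iff\<close>)+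
  then show ?thesis
   using set_borel_integral_eq_integral(2)[OF borel_integrable_atLeastAtMost'[OF continuous_on_diff[OF c]]]
   by (simp add: set_lebesgue_integral_def integral_diff integrable_continuous_interval)
 qed
 finally have Y: "(LINT w|lborel. indicator (cbox p q) w *\<^sub>R (ky w / (w - a)))
   = integral {Re p..Re q} (\<lambda>x. K (Complex x (Im q))) - integral {Re p..Re q} (\<lambda>x. K (Complex x (Im p)))" .
 have pim: "path_image (rectpath p q) = cbox p q - box p q"
  using lt by (intro path_image_rectpath_cbox_minus_box) auto
 have Kcr: "continuous_on (path_image (rectpath p q)) K"
  by (rule continuous_on_subset[OF Kc]) (use a in \<open>auto simp: pim\<close>)
 have seg: "closed_segment p (Complex (Re q) (Im p)) \<subseteq> path_image (rectpath p q)"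
   "closed_segment (Complex (Re q) (Im p)) q \<subseteq> path_image (rectpath p q)"
   "closed_segment (Complex (Re p) (Im q)) q \<subseteq> path_image (rectpath p q)"
   "closed_segment p (Complex (Re p) (Im q)) \<subseteq> path_image (rectpath p q)"
  by (auto simp: rectpath_def Let_def path_image_join closed_segment_commute)
 have Kline: "(K has_contour_integral contour_integral (linepath u v) K) (linepath u v)"
  if "closed_segment u v \<subseteq> path_image (rectpath p q)" for u v
  using continuous_on_subset[OF Kcr that] by (intro has_contour_integral_integral contour_integrable_continuous_linepath)
 have H: "contour_integral (linepath p (Complex (Re q) (Im p))) K = integral {Re p..Re q} (\<lambda>x. K (Complex x (Im p)))"
   "contour_integral (linepath (Complex (Re p) (Im q)) q) K = integral {Re p..Re q} (\<lambda>x. K (Complex x (Im q)))"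
  using has_contour_integral_linepath_horizontal_iff[of p "Im p" "Complex (Re q) (Im p)" "Re p" "Re q" K] Kline[OF seg(1)]
   has_contour_integral_linepath_horizontal_iff[of "Complex (Re p) (Im q)" "Im q" q "Re p" "Re q" K] Kline[OF seg(3)] lt
  by (auto simp: integral_unique[symmetric])
 have V: "contour_integral (linepath (Complex (Re q) (Im p)) q) K = \<i> * integral {Im p..Im q} (\<lambda>y. K (Complex (Re q) y))"
   "contour_integral (linepath p (Complex (Re p) (Im q))) K = \<i> * integral {Im p..Im q} (\<lambda>y. K (Complex (Re p) y))"
  using has_contour_integral_linepath_same_Re_iff[of "Complex (Re q) (Im p)" "Re q" q "Im p" "Im q" K] Kline[OF seg(2)]
   has_contour_integral_linepath_same_Re_iff[of p "Re p" "Complex (Re p) (Im q)" "Im p" "Im q" K] Kline[OF seg(4)] lt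
  by (auto dest!: integral_unique)
 have rev: "contour_integral (linepath q (Complex (Re p) (Im q))) K = - contour_integral (linepath (Complex (Re p) (Im q)) q) K"
   "contour_integral (linepath (Complex (Re p) (Im q)) p) K = - contour_integral (linepath p (Complex (Re p) (Im q))) K"
  using contour_integral_reverse_linepath[of "Complex (Re p) (Im q)" q K] contour_integral_reverse_linepath[of p "Complex (Re p) (Im q)" K]
   continuous_on_subset[OF Kcr seg(3)] continuous_on_subset[OF Kcr seg(4)] by (auto simp: closed_segment_commute)
 have main: "contour_integral (rectpath p q) K = \<i> * ((LINT w|lborel. indicator (cbox p q) w *\<^sub>R (kx w / (w - a)))
   + \<i> * (LINT w|lborel. indicator (cbox p q) w *\<^sub>R (ky w / (w - a))))"
  using lt by (subst contour_integral_rectpath_split(1)[OF _ _ Kcr]) (auto simp: H V rev X Y algebra_simps)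
 have "(LINT w|lborel. indicator (cbox p q) w *\<^sub>R (kx w / (w - a))) + \<i> * (LINT w|lborel. indicator (cbox p q) w *\<^sub>R (ky w / (w - a)))
   = (LINT w|lborel. indicator (cbox p q) w *\<^sub>R (kx w / (w - a)) + \<i> * (indicator (cbox p q) w *\<^sub>R (ky w / (w - a))))"
  by (subst Bochner_Integration.integral_add[OF ix integrable_mult_right[OF iy]], subst integral_mult_right_zero) simp
 also have "\<dots> = (LINT w|lborel. indicator (cbox p q) w *\<^sub>R ((D w 1 + \<i> * D w \<i>) / (w - a)))"
 proof (intro Bochner_Integration.integral_cong refl)
  \<comment> \<open>The quotient \<open>K\<close> cancels here because -K + i (-i K) = 0; only the
    d-bar derivative of \<open>g\<close> survives.\<close>
  have *: "(A - k) / u + \<i> * ((B - \<i> * k) / u) = (A + \<i> * B) / u" for A B k u :: complex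
   by (simp add: add_divide_distrib diff_divide_distrib algebra_simps)
  show "indicator (cbox p q) w *\<^sub>R (kx w / (w - a)) + \<i> * (indicator (cbox p q) w *\<^sub>R (ky w / (w - a)))
    = indicator (cbox p q) w *\<^sub>R ((D w 1 + \<i> * D w \<i>) / (w - a))" for w
   using *[of "D w 1" "K w" "w - a" "D w \<i>"] by (auto simp: kx_def ky_def indicator_def)
 qed
 finally have R: "contour_integral (rectpath p q) K = \<i> * (LINT w|lborel. indicator (cbox p q) w *\<^sub>R ((D w 1 + \<i> * D w \<i>) / (w - a)))"
  using main by simp
 have gca: "continuous_on (path_image (rectpath p q)) (\<lambda>w. g w / (w - a))"
  by (intro continuous_intros continuous_on_subset[OF gc]) (use a in \<open>auto simp: pim\<close>)
 have ica: "continuous_on (path_image (rectpath p q)) (\<lambda>w. g a * (1 / (w - a)))"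
  by (intro continuous_intros) (use a in \<open>auto simp: pim\<close>)
 have wn: "contour_integral (rectpath p q) (\<lambda>w. 1 / (w - a)) = 2 * of_real pi * \<i>"
 proof -
  have "a \<notin> path_image (rectpath p q)" using a by (simp add: pim)
  then show ?thesis
   using winding_number_valid_path[of "rectpath p q" a] winding_number_rectpath[OF a] by (simp add: field_simps)
 qed
 have "contour_integral (rectpath p q) K = contour_integral (rectpath p q) (\<lambda>w. g w / (w - a) - g a * (1 / (w - a)))"
  by (simp add: K_def diff_divide_distrib)
 also have "\<dots> = contour_integral (rectpath p q) (\<lambda>w. g w / (w - a)) - contour_integral (rectpath p q) (\<lambda>w. g a * (1 / (w - a)))"
  using lt by (intro contour_integral_diff contour_integral_rectpath_split(2) gca ica) auto
 also have "contour_integral (rectpath p q) (\<lambda>w. g a * (1 / (w - a))) = g a * (2 * of_real pi * \<i>)"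
 proof -
  have "continuous_on (path_image (rectpath p q)) (\<lambda>w. 1 / (w - a))"
   by (intro continuous_intros) (use a in \<open>auto simp: pim\<close>)
  then show ?thesis
   using lt by (subst contour_integral_lmul) (auto intro!: contour_integral_rectpath_split(2) simp: wn)
 qed
 finally show ?thesis using R by (simp add: mult_ac)
qed

lemma cauchy_rectpath_holomorphic:
 assumes "Re p < Re q" "Im p < Im q" and F: "continuous_on (path_image (rectpath p q)) F"
 shows "(\<lambda>z. contour_integral (rectpath p q) (\<lambda>w. F w / (w - z))) holomorphic_on box p q"
proof -
 have pim: "path_image (rectpath p q) = cbox p q - box p q"
  using assms by (intro path_image_rectpath_cbox_minus_box) auto
 have seg: "closed_segment p (Complex (Re q) (Im p)) \<subseteq> path_image (rectpath p q)"
   "closed_segment (Complex (Re q) (Im p)) q \<subseteq> path_image (rectpath p q)"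
   "closed_segment q (Complex (Re p) (Im q)) \<subseteq> path_image (rectpath p q)"
   "closed_segment (Complex (Re p) (Im q)) p \<subseteq> path_image (rectpath p q)"
  by (auto simp: rectpath_def Let_def path_image_join)
 have l: "(\<lambda>z. contour_integral (linepath a b) (\<lambda>w. F w / (w - z))) holomorphic_on box p q"
  if "closed_segment a b \<subseteq> path_image (rectpath p q)" for a b
  by (rule holomorphic_on_subset[OF cauchy_linepath_holomorphic[OF continuous_on_subset[OF F that]]])
   (use that in \<open>auto simp: pim\<close>)
 have "(\<lambda>z. contour_integral (linepath p (Complex (Re q) (Im p))) (\<lambda>w. F w / (w - z))
  + contour_integral (linepath (Complex (Re q) (Im p)) q) (\<lambda>w. F w / (w - z))
  + contour_integral (linepath q (Complex (Re p) (Im q))) (\<lambda>w. F w / (w - z))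
  + contour_integral (linepath (Complex (Re p) (Im q)) p) (\<lambda>w. F w / (w - z))) holomorphic_on box p q"
  by (intro holomorphic_on_add l seg)
 then show ?thesis
 proof (rule holomorphic_transform)
  fix z assume z: "z \<in> box p q"
  have "continuous_on (path_image (rectpath p q)) (\<lambda>w. F w / (w - z))"
   by (intro continuous_intros F) (use z in \<open>auto simp: pim\<close>)
  then show "contour_integral (linepath p (Complex (Re q) (Im p))) (\<lambda>w. F w / (w - z))
  + contour_integral (linepath (Complex (Re q) (Im p)) q) (\<lambda>w. F w / (w - z))
  + contour_integral (linepath q (Complex (Re p) (Im q))) (\<lambda>w. F w / (w - z))
  + contour_integral (linepath (Complex (Re p) (Im q)) p) (\<lambda>w. F w / (w - z)) = contour_integral (rectpath p q) (\<lambda>w. F w / (w - z))"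
   using contour_integral_rectpath_split(1)[OF assms(1,2)] by simp
 qed
qed

text \<open>\<open>k\<close> is the d-bar derivative of \<open>F\<close>. On a small box Pompeiu's
  formula writes \<open>F\<close>, plus the transform of the part of \<open>k\<close> in the box, as
  a Cauchy integral over the rectangle; the part of \<open>k\<close> outside the box has a transform
  that is holomorphic in the box.\<close>

lemma cauchy_transform_dbar_holomorphic:
 assumes U: "open U"
  and D: "\<And>w. w \<in> U \<Longrightarrow> (F has_derivative D w) (at w)"
  and c1: "continuous_on U (\<lambda>w. D w 1)" and c2: "continuous_on U (\<lambda>w. D w \<i>)"
  and k: "integrable lborel k" and kD: "\<And>w. w \<in> U \<Longrightarrow> k w = (D w 1 + \<i> * D w \<i>) / 2"
 shows "(\<lambda>a. F a + cauchy_transform k a / of_real pi) holomorphic_on U"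
proof -
 have km: "k \<in> borel_measurable borel" using k by auto
 have "\<exists>V. open V \<and> a0 \<in> V \<and> (\<lambda>a. F a + cauchy_transform k a / of_real pi) holomorphic_on V" if a0: "a0 \<in> U" for a0
 proof -
  obtain p q where pq: "cbox p q \<subseteq> U" "a0 \<in> box p q" "\<forall>i\<in>Basis. p \<bullet> i < q \<bullet> i"
   by (rule open_contains_cbox[OF U a0])
  have lt: "Re p < Re q" "Im p < Im q" using pq(2) by (auto simp: in_box_complex_iff)
  define k1 where "k1 = (\<lambda>w. indicator (cbox p q) w *\<^sub>R k w)"
  define k2 where "k2 = (\<lambda>w. indicator (- cbox p q) w *\<^sub>R k w)"
  have k1: "integrable lborel k1" and k2: "integrable lborel k2"
   unfolding k1_def k2_def by (rule integrable_mult_indicator; use k in auto)+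
  have "continuous_on U (\<lambda>w. (D w 1 + \<i> * D w \<i>) / 2)" by (intro continuous_intros c1 c2) auto
  then have "continuous_on U k" by (rule continuous_on_eq) (simp add: kD)
  then have "compact (k ` cbox p q)" by (intro compact_continuous_image continuous_on_subset[OF _ pq(1)] compact_cbox)
  then obtain B where B: "\<And>w. w \<in> cbox p q \<Longrightarrow> cmod (k w) \<le> B"
   using compact_imp_bounded bounded_iff by (metis imageI)
  have Fc: "continuous_on (path_image (rectpath p q)) F"
   using D pq(1) path_image_rectpath_subset_cbox[of p q] lt
   by (intro continuous_at_imp_continuous_on) (auto intro!: has_derivative_continuous)
  define P where "P = (\<lambda>z. contour_integral (rectpath p q) (\<lambda>w. F w / (w - z)))"
  have Ph: "P holomorphic_on box p q" unfolding P_def by (rule cauchy_rectpath_holomorphic[OF lt Fc])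
  have "(\<lambda>a. P a / (2 * of_real pi * \<i>) + cauchy_transform k2 a / of_real pi) holomorphic_on box p q"
   using Ph by (intro holomorphic_intros cauchy_transform_holomorphic[OF k2])
    (auto simp: k2_def indicator_def in_box_complex_iff in_cbox_complex_iff)
  then have "(\<lambda>a. F a + cauchy_transform k a / of_real pi) holomorphic_on box p q"
  proof (rule holomorphic_transform)
   fix a assume a: "a \<in> box p q"
   obtain r where r: "r > 0" "ball a r \<subseteq> box p q" using a open_box open_contains_ball by blast
   then have rb: "ball a r \<subseteq> cbox p q" using box_subset_cbox by blast
   have i1: "integrable lborel (\<lambda>w. k1 w / (w - a))"
    by (rule cauchy_transform_integrable[OF k1 r(1), of _ B]) (use B rb in \<open>auto simp: k1_def\<close>)
   have i2: "integrable lborel (\<lambda>w. k2 w / (w - a))"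
    by (rule cauchy_transform_integrable[OF k2 r(1), of _ 0]) (use rb in \<open>auto simp: k2_def\<close>)
   have "cauchy_transform k a = (LINT w|lborel. k1 w / (w - a) + k2 w / (w - a))"
    unfolding cauchy_transform_def by (intro Bochner_Integration.integral_cong) (auto simp: k1_def k2_def indicator_def)
   then have s: "cauchy_transform k a = cauchy_transform k1 a + cauchy_transform k2 a"
    unfolding cauchy_transform_def using i1 i2 by simp
   have "(LINT w|lborel. indicator (cbox p q) w *\<^sub>R ((D w 1 + \<i> * D w \<i>) / (w - a))) = (LINT w|lborel. 2 * (k1 w / (w - a)))"
   proof (intro Bochner_Integration.integral_cong refl)
    fix w
    have "D w 1 + \<i> * D w \<i> = 2 * k w" if "w \<in> cbox p q"
     using kD[of w] pq(1) that by (simp add: subset_eq mult.commute)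
    then show "indicator (cbox p q) w *\<^sub>R ((D w 1 + \<i> * D w \<i>) / (w - a)) = 2 * (k1 w / (w - a))"
     by (auto simp: k1_def indicator_def)
   qed
   also have "\<dots> = 2 * cauchy_transform k1 a"
    unfolding cauchy_transform_def by (rule integral_mult_right_zero)
   finally have "P a - 2 * of_real pi * \<i> * F a = \<i> * (2 * cauchy_transform k1 a)"
    using pompeiu_formula[OF pq(1) a D c1 c2] by (simp add: P_def)
   then have "P a = 2 * of_real pi * \<i> * F a + \<i> * (2 * cauchy_transform k1 a)" by (simp add: algebra_simps)
   then show "P a / (2 * of_real pi * \<i>) + cauchy_transform k2 a / of_real pi = F a + cauchy_transform k a / of_real pi"
    unfolding s by (simp add: field_simps)
  qed
  then show ?thesis using pq(2) open_box by blast
 qed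
 note loc = this
 show ?thesis
 proof (rule holomorphic_onI)
  fix a0 assume "a0 \<in> U"
  from loc[OF this] obtain V where V: "open V" "a0 \<in> V"
   "(\<lambda>a. F a + cauchy_transform k a / of_real pi) holomorphic_on V" by blast
  show "(\<lambda>a. F a + cauchy_transform k a / of_real pi) field_differentiable at a0 within U"
   by (rule field_differentiable_at_within, rule holomorphic_on_imp_differentiable_at[OF V(3,1,2)])
 qed
qed

section \<open>Cauchy integrals on the unit circle\<close>

definition circ :: "real \<Rightarrow> complex" where
 "circ t = exp (2 * of_real pi * \<i> * of_real t)"

lemma norm_circ [simp]: "cmod (circ t) = 1"
 by (simp add: circ_def norm_exp)

lemma circ_nz [simp]: "circ t \<noteq> 0"
 by (simp add: circ_def)

definition cmean :: "(complex \<Rightarrow> complex) \<Rightarrow> complex" where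
 "cmean v = integral {0..1} (\<lambda>t. v (circ t))"

lemma cmean_const [simp]: "cmean (\<lambda>xi. c) = c"
 unfolding cmean_def by simp

text \<open>The mean is taken with respect to normalized arc length d xi / (2 pi i xi); the factor
  \<open>xi\<close> turns it into the Cauchy integral of \<open>v\<close>.\<close>

definition cau :: "(complex \<Rightarrow> complex) \<Rightarrow> complex \<Rightarrow> complex" where
 "cau v z = cmean (\<lambda>xi. v xi * xi / (xi - z))"

text \<open>The conjugate reciprocal polynomial. On the circle it is \<open>xi ^ degree p\<close>
  times the conjugate of \<open>poly p xi\<close>, so conjugates of polynomials become rational
  there.\<close>

definition crefl :: "complex poly \<Rightarrow> complex poly" where
 "crefl p = reflect_poly (map_poly cnj p)"

lemma continuous_on_circ: "continuous_on X circ"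
 unfolding circ_def by (intro continuous_intros)

lemma circ_eq_circlepath: "circ = circlepath 0 1"
 by (auto simp: circ_def circlepath fun_eq_iff)

lemma sphere_circ:
 assumes "cmod xi = 1" obtains t where "t \<in> {0..1}" "xi = circ t"
proof -
 have "xi \<in> path_image (circlepath 0 1)" using assms by simp
 then show ?thesis using that unfolding path_image_def circ_eq_circlepath by auto
qed

lemma cnj_sphere: "cmod xi = 1 \<Longrightarrow> xi * cnj xi = 1"
 using complex_norm_square[of xi] by simp

lemma cnj_eq_inverse: "cmod xi = 1 \<Longrightarrow> cnj xi = inverse xi"
 by (metis cnj_sphere inverse_unique)

lemma cmean_integrable:
 fixes v :: "complex \<Rightarrow> complex"
 assumes "continuous_on (sphere 0 1) v"
 shows "(\<lambda>t. v (circ t)) integrable_on {0..1}"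
 by (intro integrable_continuous_interval continuous_on_compose2[OF assms continuous_on_circ]) auto

lemma cmean_cong: "(\<And>xi. cmod xi = 1 \<Longrightarrow> v xi = w xi) \<Longrightarrow> cmean v = cmean w"
 unfolding cmean_def by (intro integral_cong) auto

lemma cmean_add:
 "continuous_on (sphere 0 1) v \<Longrightarrow> continuous_on (sphere 0 1) w \<Longrightarrow> cmean (\<lambda>xi. v xi + w xi) = cmean v + cmean w"
 unfolding cmean_def by (intro integral_add cmean_integrable)

lemma cmean_diff:
 "continuous_on (sphere 0 1) v \<Longrightarrow> continuous_on (sphere 0 1) w \<Longrightarrow> cmean (\<lambda>xi. v xi - w xi) = cmean v - cmean w"
 unfolding cmean_def by (intro integral_diff cmean_integrable)

lemma cmean_cmult: "cmean (\<lambda>xi. c * v xi) = c * cmean v"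
 unfolding cmean_def by simp

lemma cmean_sum:
 "finite I \<Longrightarrow> (\<And>i. i \<in> I \<Longrightarrow> continuous_on (sphere 0 1) (v i)) \<Longrightarrow>
  cmean (\<lambda>xi. \<Sum>i\<in>I. v i xi) = (\<Sum>i\<in>I. cmean (v i))"
 unfolding cmean_def by (intro integral_sum cmean_integrable)

lemma cmean_cnj: "cmean (\<lambda>xi. cnj (v xi)) = cnj (cmean v)"
 unfolding cmean_def by (simp add: integral_cnj)

lemma cmean_bound:
 assumes "continuous_on (sphere 0 1) v" "\<And>xi. cmod xi = 1 \<Longrightarrow> cmod (v xi) \<le> B"
 shows "cmod (cmean v) \<le> B"
proof -
 have "cmod (integral {0..1} (\<lambda>t. v (circ t))) \<le> B * (1 - 0)"
  by (rule integral_bound) (auto intro!: continuous_on_compose2[OF assms(1) continuous_on_circ] assms(2))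
 then show ?thesis by (simp add: cmean_def)
qed

lemma contour_integral_circ: "contour_integral (circlepath 0 1) f = 2 * of_real pi * \<i> * cmean (\<lambda>xi. f xi * xi)"
proof -
 have "contour_integral (circlepath 0 1) f = integral {0..1} (\<lambda>t. 2 * of_real pi * \<i> * (f (circ t) * circ t))"
  unfolding contour_integral_integral
  unfolding circ_eq_circlepath
  by (intro integral_cong) (simp add: vector_derivative_circlepath, simp add: circlepath mult_ac)
 then show ?thesis by (simp add: cmean_def)
qed

lemma contour_integral_cau:
 "contour_integral (circlepath 0 1) (\<lambda>xi. v xi / (xi - z)) = 2 * of_real pi * \<i> * cau v z"
 unfolding contour_integral_circ cau_def by simp

lemma cau_kernel_cont:
 assumes "continuous_on (sphere 0 1) v" "cmod z \<noteq> 1"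
 shows "continuous_on (sphere 0 1) (\<lambda>xi. v xi * xi / (xi - z))"
 using assms by (intro continuous_intros) auto

lemma cau_diff:
 assumes "continuous_on (sphere 0 1) v" "continuous_on (sphere 0 1) w" "cmod z \<noteq> 1"
 shows "cau (\<lambda>xi. v xi - w xi) z = cau v z - cau w z"
proof -
 have "cau v z - cau w z = cmean (\<lambda>xi. v xi * xi / (xi - z) - w xi * xi / (xi - z))"
  unfolding cau_def by (intro cmean_diff[symmetric] cau_kernel_cont assms)
 then show ?thesis unfolding cau_def by (simp add: algebra_simps diff_divide_distrib)
qed

lemma cau_holomorphic:
 assumes "continuous_on (cball 0 1) F" "F holomorphic_on ball 0 1" "z \<in> ball 0 1"
 shows "cau F z = F z"
proof -
 have "((\<lambda>u. F u / (u - z)) has_contour_integral (2 * of_real pi * \<i> * F z)) (circlepath 0 1)"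
  by (rule Cauchy_integral_circlepath) (use assms in auto)
 then have "2 * of_real pi * \<i> * cau F z = 2 * of_real pi * \<i> * F z"
  using contour_integral_unique contour_integral_cau by metis
 then show ?thesis by simp
qed

lemma cau_poly: "z \<in> ball 0 1 \<Longrightarrow> cau (poly p) z = poly p z"
 by (rule cau_holomorphic) (auto intro!: continuous_intros holomorphic_intros)

lemma cau_continuous:
 assumes v: "continuous_on (sphere 0 1) v"
 shows "continuous_on (ball 0 1) (cau v)"
proof -
 have "isCont (\<lambda>z. 2 * of_real pi * \<i> * cau v z) w" if w: "w \<in> ball 0 1" for w
 proof (rule DERIV_isCont, rule Cauchy_next_derivative_circlepath(2)[where k=1 and f=v])
  fix z :: complex assume "z \<in> ball 0 1"
  then have "continuous_on (sphere 0 1) (\<lambda>xi. v xi / (xi - z))"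
   by (intro continuous_intros v) auto
  then have "(\<lambda>xi. v xi / (xi - z)) contour_integrable_on circlepath 0 1"
   by (intro contour_integrable_continuous_circlepath) simp
  from has_contour_integral_integral[OF this]
  show "((\<lambda>u. v u / (u - z) ^ 1) has_contour_integral 2 * of_real pi * \<i> * cau v z) (circlepath 0 1)"
   by (simp add: contour_integral_cau)
 qed (use v w in auto)
 then have "continuous_on (ball 0 1) (\<lambda>z. 2 * of_real pi * \<i> * cau v z / (2 * of_real pi * \<i>))"
  by (intro continuous_intros continuous_at_imp_continuous_on) auto
 then show ?thesis by simp
qed

text \<open>Dividing by \<open>xi\<close> on the circle turns the Cauchy integral into its difference quotient at 0,
so a vanishing Cauchy integral forces all Fourier coefficients of index \<open>\<ge> 0\<close> to vanish.\<close>

lemma cau_zero_imp_fourier_zero: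
 assumes v: "continuous_on (sphere 0 1) v" and z: "\<And>z. z \<in> ball 0 1 \<Longrightarrow> cau v z = 0"
 shows "cmean (\<lambda>xi. v xi * cnj xi ^ k) = 0"
proof -
 have c: "continuous_on (sphere 0 1) (\<lambda>xi. v xi / xi ^ k)" for k
  using v by (intro continuous_intros) auto
 have "\<forall>z\<in>ball 0 1. cau (\<lambda>xi. v xi / xi ^ k) z = 0" for k
 proof (induction k)
  case 0 then show ?case using z by simp
 next
  case (Suc k)
  let ?w = "\<lambda>xi. v xi / xi ^ k"
  have nz: "cau (\<lambda>xi. v xi / xi ^ Suc k) z = 0" if zb: "z \<in> ball 0 1" "z \<noteq> 0" for z
  proof -
   have "z * cau (\<lambda>xi. v xi / xi ^ Suc k) z = cmean (\<lambda>xi. ?w xi * xi / (xi - z) - ?w xi * xi / (xi - 0))"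
    unfolding cau_def cmean_cmult[symmetric]
   proof (rule cmean_cong)
    fix xi :: complex assume "cmod xi = 1"
    then have "xi \<noteq> 0" "xi \<noteq> z" using zb by auto
    then show "z * (v xi / xi ^ Suc k * xi / (xi - z)) = v xi / xi ^ k * xi / (xi - z) - v xi / xi ^ k * xi / (xi - 0)"
     by (simp add: field_simps)
   qed
   also have "\<dots> = cau ?w z - cau ?w 0"
    unfolding cau_def using zb by (intro cmean_diff cau_kernel_cont c) auto
   also have "\<dots> = 0" using Suc zb by simp
   finally show ?thesis using zb by simp
  qed
  \<comment> \<open>The difference quotient gives the value only for \<open>z \<noteq> 0\<close>;
    continuity recovers it at 0, the point where the Fourier coefficient is read off.\<close>
  have "cau (\<lambda>xi. v xi / xi ^ Suc k) 0 = 0"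
  proof (rule LIM_unique)
   have "isCont (cau (\<lambda>xi. v xi / xi ^ Suc k)) 0"
    using cau_continuous[OF c[of "Suc k"]] by (simp add: continuous_on_eq_continuous_at)
   then show "cau (\<lambda>xi. v xi / xi ^ Suc k) \<midarrow>0\<rightarrow> cau (\<lambda>xi. v xi / xi ^ Suc k) 0" by (simp add: isCont_def)
   have "eventually (\<lambda>z. z \<in> ball 0 1 - {0}) (at (0::complex))"
    by (intro eventually_at_in_open) auto
   then have "eventually (\<lambda>z. cau (\<lambda>xi. v xi / xi ^ Suc k) z = 0) (at 0)"
    by eventually_elim (use nz in auto)
   then show "cau (\<lambda>xi. v xi / xi ^ Suc k) \<midarrow>0\<rightarrow> 0" by (rule tendsto_eventually)
  qed
  then show ?case using nz by metis
 qed
 then have "cau (\<lambda>xi. v xi / xi ^ k) 0 = 0" by simp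
 moreover have "cau (\<lambda>xi. v xi / xi ^ k) 0 = cmean (\<lambda>xi. v xi * cnj xi ^ k)"
  unfolding cau_def by (rule cmean_cong) (auto simp: cnj_eq_inverse field_simps)
 ultimately show ?thesis by simp
qed

lemma cnj_pow_sphere:
 assumes "cmod xi = 1"
 shows "xi ^ i * cnj xi ^ j = (if j \<le> i then xi ^ (i - j) else cnj xi ^ (j - i))"
proof -
 have ne: "xi \<noteq> 0" using assms by auto
 show ?thesis
  unfolding cnj_eq_inverse[OF assms] using ne
  by (auto simp: power_diff power_inverse field_simps)
qed

lemma cmean_cnj_pow:
 assumes "m > 0" shows "cmean (\<lambda>xi. cnj xi ^ m) = 0"
proof -
 have "cmean (\<lambda>xi. cnj (xi ^ m)) = cnj (cau (\<lambda>xi. xi ^ m) 0)"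
  unfolding cau_def cmean_cnj[symmetric] by (rule cmean_cong) auto
 also have "cau (\<lambda>xi. xi ^ m) 0 = 0 ^ m"
  by (rule cau_holomorphic) (auto intro!: continuous_intros holomorphic_intros)
 finally show ?thesis using assms by simp
qed

lemma cmean_pow:
 assumes "m > 0" shows "cmean (\<lambda>xi. xi ^ m) = 0"
 using cmean_cnj_pow[OF assms] cmean_cnj[of "\<lambda>xi. xi ^ m"] by simp

lemma fourier_orthogonality:
 "cmean (\<lambda>xi. xi ^ i * cnj xi ^ j) = (if i = j then 1 else 0)"
proof -
 have "cmean (\<lambda>xi. xi ^ i * cnj xi ^ j) = cmean (\<lambda>xi. if j \<le> i then xi ^ (i - j) else cnj xi ^ (j - i))"
  by (rule cmean_cong) (simp add: cnj_pow_sphere)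
 also have "\<dots> = (if i = j then 1 else 0)"
  using cmean_pow[of "i - j"] cmean_cnj_pow[of "j - i"] by (cases "j \<le> i") auto
 finally show ?thesis .
qed

text \<open>Laurent polynomials, with negative powers of \<open>xi\<close> written as powers of
  \<open>cnj xi\<close>. The class contains Re and Im, hence every real polynomial in them; this
  connects Weierstrass approximation with Fourier coefficients.\<close>

definition laurent_on_circle :: "(complex \<Rightarrow> complex) \<Rightarrow> bool" where
 "laurent_on_circle g \<longleftrightarrow> (\<exists>p n. \<forall>xi. cmod xi = 1 \<longrightarrow> g xi = poly p xi * cnj xi ^ n)"

lemma laurent_on_circleI: "(\<And>xi. cmod xi = 1 \<Longrightarrow> g xi = poly p xi * cnj xi ^ n) \<Longrightarrow> laurent_on_circle g"
 by (auto simp: laurent_on_circle_def)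

lemma laurent_on_circle_basic: "laurent_on_circle (\<lambda>xi. poly p xi * cnj xi ^ n)"
 unfolding laurent_on_circle_def by blast

lemma laurent_on_circle_const: "laurent_on_circle (\<lambda>_. c)"
 by (rule laurent_on_circleI[of _ "[:c:]" 0]) simp

lemma laurent_on_circle_add:
 assumes "laurent_on_circle g" "laurent_on_circle h" shows "laurent_on_circle (\<lambda>xi. g xi + h xi)"
proof -
 obtain p n where 1: "\<And>xi. cmod xi = 1 \<Longrightarrow> g xi = poly p xi * cnj xi ^ n" using assms(1) by (auto simp: laurent_on_circle_def)
 obtain r m where 2: "\<And>xi. cmod xi = 1 \<Longrightarrow> h xi = poly r xi * cnj xi ^ m" using assms(2) by (auto simp: laurent_on_circle_def)
 show ?thesis
 proof (rule laurent_on_circleI[of _ "p * monom 1 m + r * monom 1 n" "n + m"])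
  fix xi :: complex assume x: "cmod xi = 1"
  have "xi ^ m * cnj xi ^ m = 1" "xi ^ n * cnj xi ^ n = 1"
   using cnj_sphere[OF x] by (simp_all flip: power_mult_distrib)
  then show "g xi + h xi = poly (p * monom 1 m + r * monom 1 n) xi * cnj xi ^ (n + m)"
   unfolding 1[OF x] 2[OF x] by (simp add: poly_monom power_add algebra_simps)
 qed
qed

lemma laurent_on_circle_mult:
 assumes "laurent_on_circle g" "laurent_on_circle h" shows "laurent_on_circle (\<lambda>xi. g xi * h xi)"
proof -
 obtain p n where 1: "\<And>xi. cmod xi = 1 \<Longrightarrow> g xi = poly p xi * cnj xi ^ n" using assms(1) by (auto simp: laurent_on_circle_def)
 obtain r m where 2: "\<And>xi. cmod xi = 1 \<Longrightarrow> h xi = poly r xi * cnj xi ^ m" using assms(2) by (auto simp: laurent_on_circle_def)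
 show ?thesis
  by (rule laurent_on_circleI[of _ "p * r" "n + m"]) (simp add: 1 2 power_add)
qed

lemma laurent_linear_part:
 "complex_of_real (Re xi * c + Im xi * d) = poly [:0, (of_real c - \<i> * of_real d) / 2:] xi * cnj xi ^ 0
   + poly [:(of_real c + \<i> * of_real d) / 2:] xi * cnj xi ^ 1"
proof -
 have "complex_of_real (Re xi) = (xi + cnj xi) / 2" "complex_of_real (Im xi) = \<i> * (cnj xi - xi) / 2"
  by (simp_all add: complex_eq_iff)
 then show ?thesis
  unfolding of_real_add of_real_mult by (simp only:) (simp add: algebra_simps add_divide_distrib diff_divide_distrib)
qed

lemma laurent_on_circle_real_polynomial:
 assumes "real_polynomial_function h" shows "laurent_on_circle (\<lambda>xi. of_real (h xi))"
 using assms
proof induction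
 case (linear f)
 interpret bounded_linear f by fact
 have f: "f z = Re z * f 1 + Im z * f \<i>" for z
 proof -
  have "f z = f (Re z *\<^sub>R 1 + Im z *\<^sub>R \<i>)"
   by (rule arg_cong[where f=f]) (simp add: complex_eq_iff)
  then show ?thesis by (simp only: add scaleR real_scaleR_def)
 qed
 define c d where "c = f 1" and "d = f \<i>"
 have eq: "(\<lambda>xi. complex_of_real (f xi)) = (\<lambda>xi. poly [:0, (of_real c - \<i> * of_real d) / 2:] xi * cnj xi ^ 0
   + poly [:(of_real c + \<i> * of_real d) / 2:] xi * cnj xi ^ 1)"
  by (rule ext, subst f, fold c_def d_def, rule laurent_linear_part)
 show ?case unfolding eq by (intro laurent_on_circle_add laurent_on_circle_basic)
next
 case (const c) then show ?case by (simp add: laurent_on_circle_const)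
next
 case (add f g) then show ?case using laurent_on_circle_add by simp
next
 case (mult f g) then show ?case using laurent_on_circle_mult by simp
qed

lemma laurent_on_circle_polynomial_function:
 fixes g :: "complex \<Rightarrow> complex"
 assumes "polynomial_function g" shows "laurent_on_circle g"
proof -
 have "real_polynomial_function (Re \<circ> g)" "real_polynomial_function (Im \<circ> g)"
  using assms unfolding polynomial_function_def by (blast intro: bounded_linear_Re bounded_linear_Im)+
 then have "laurent_on_circle (\<lambda>xi. of_real ((Re \<circ> g) xi) + \<i> * of_real ((Im \<circ> g) xi))"
  by (intro laurent_on_circle_add laurent_on_circle_mult laurent_on_circle_const laurent_on_circle_real_polynomial)
 then show ?thesis by (simp add: complex_eq[symmetric])
qed

text \<open>Vanishing coefficients make \<open>v\<close> orthogonal to every Laurent polynomial.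
  Approximating \<open>cnj v\<close> uniformly by such polynomials shows that the mean of |v|^2 is
  0.\<close>

lemma fourier_uniqueness:
 assumes v: "continuous_on (sphere 0 1) v"
  and pos: "\<And>k. cmean (\<lambda>xi. v xi * xi ^ k) = 0" and neg: "\<And>k. cmean (\<lambda>xi. v xi * cnj xi ^ k) = 0"
  and x: "cmod x = 1"
 shows "v x = 0"
proof -
 have lau: "cmean (\<lambda>xi. v xi * g xi) = 0" if g: "laurent_on_circle g" for g
 proof -
  obtain p n where 1: "\<And>xi. cmod xi = 1 \<Longrightarrow> g xi = poly p xi * cnj xi ^ n" using g by (auto simp: laurent_on_circle_def)
  have "cmean (\<lambda>xi. v xi * g xi) = cmean (\<lambda>xi. \<Sum>i\<le>degree p. coeff p i * (v xi * (xi ^ i * cnj xi ^ n)))"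
   by (rule cmean_cong) (simp add: 1 poly_altdef sum_distrib_left sum_distrib_right mult_ac)
  also have "\<dots> = (\<Sum>i\<le>degree p. coeff p i * cmean (\<lambda>xi. v xi * (xi ^ i * cnj xi ^ n)))"
   unfolding cmean_cmult[symmetric] by (intro cmean_sum) (auto intro!: continuous_intros v)
  also have "\<dots> = 0"
  proof (rule sum.neutral, rule ballI)
   fix i assume "i \<in> {..degree p}"
   have "cmean (\<lambda>xi. v xi * (xi ^ i * cnj xi ^ n))
     = cmean (\<lambda>xi. v xi * (if n \<le> i then xi ^ (i - n) else cnj xi ^ (n - i)))"
    by (rule cmean_cong) (simp add: cnj_pow_sphere)
   also have "\<dots> = 0" using pos[of "i - n"] neg[of "n - i"] by (cases "n \<le> i") auto
   finally show "coeff p i * cmean (\<lambda>xi. v xi * (xi ^ i * cnj xi ^ n)) = 0" by simp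
  qed
  finally show ?thesis .
 qed
 obtain B where B: "B > 0" "\<And>xi. cmod xi = 1 \<Longrightarrow> cmod (v xi) \<le> B"
 proof -
  have "bounded (v ` sphere 0 1)"
   by (intro compact_imp_bounded compact_continuous_image v) auto
  then obtain B where "\<forall>x\<in>v ` sphere 0 1. cmod x \<le> B" using bounded_iff by blast
  then show ?thesis by (intro that[of "max B 1"]) (auto simp: max.coboundedI1)
 qed
 have small: "cmod (cmean (\<lambda>xi. v xi * cnj (v xi))) \<le> B * e" if e: "e > 0" for e
 proof -
  have "continuous_on (sphere 0 1) (\<lambda>xi. cnj (v xi))" by (intro continuous_intros v)
  then obtain g where g: "polynomial_function g" "\<And>x. x \<in> sphere 0 1 \<Longrightarrow> cmod (cnj (v x) - g x) < e"
   using Stone_Weierstrass_polynomial_function[of "sphere 0 1" "\<lambda>xi. cnj (v xi)" e] e by auto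
  have gc: "continuous_on (sphere 0 1) g" using g(1) by (rule continuous_on_polymonial_function)
  have "cmean (\<lambda>xi. v xi * cnj (v xi)) = cmean (\<lambda>xi. v xi * cnj (v xi)) - cmean (\<lambda>xi. v xi * g xi)"
   using lau[OF laurent_on_circle_polynomial_function[OF g(1)]] by simp
  also have "\<dots> = cmean (\<lambda>xi. v xi * cnj (v xi) - v xi * g xi)"
   by (intro cmean_diff[symmetric] continuous_intros v gc)
  finally have eq: "cmean (\<lambda>xi. v xi * cnj (v xi)) = \<dots>" .
  show ?thesis unfolding eq
  proof (rule cmean_bound)
   fix xi :: complex assume xi: "cmod xi = 1"
   have "cmod (v xi * (cnj (v xi) - g xi)) \<le> B * e"
    unfolding norm_mult using B(1) B(2)[OF xi] g(2)[of xi] xi by (intro mult_mono) auto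
   then show "cmod (v xi * cnj (v xi) - v xi * g xi) \<le> B * e" by (simp add: right_diff_distrib)
  qed (intro continuous_intros v gc)
 qed
 have "cmod (cmean (\<lambda>xi. v xi * cnj (v xi))) \<le> 0 + e" if "e > 0" for e
  using small[of "e / B"] that B(1) by simp
 then have "cmean (\<lambda>xi. v xi * cnj (v xi)) = 0"
  using field_le_epsilon[of "cmod (cmean (\<lambda>xi. v xi * cnj (v xi)))" 0] by simp
 then have "integral {0..1} (\<lambda>t. complex_of_real ((cmod (v (circ t)))\<^sup>2)) = 0"
  by (simp add: cmean_def complex_norm_square[symmetric])
 moreover have "integral {0..1} (\<lambda>t. complex_of_real ((cmod (v (circ t)))\<^sup>2)) = of_real (integral {0..1} (\<lambda>t. (cmod (v (circ t)))\<^sup>2))"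
  by (intro integral_unique has_integral_of_real integrable_integral integrable_continuous_interval
    continuous_intros continuous_on_compose2[OF v continuous_on_circ]) auto
 ultimately have z: "integral {0..1} (\<lambda>t. (cmod (v (circ t)))\<^sup>2) = 0" by simp
 have "\<forall>t\<in>{0..1}. (cmod (v (circ t)))\<^sup>2 = 0"
  using z by (subst (asm) integral_eq_0_iff)
   (auto intro!: continuous_intros continuous_on_compose2[OF v continuous_on_circ])
 moreover obtain t where "t \<in> {0..1}" "x = circ t" using sphere_circ[OF x] .
 ultimately show ?thesis by auto
qed

section \<open>Rational functions on the unit circle\<close>

lemma poly_crefl: "z \<noteq> 0 \<Longrightarrow> poly (crefl p) z = z ^ degree p * cnj (poly p (inverse (cnj z)))"
proof -
 assume z: "z \<noteq> 0"
 have deg: "degree (map_poly cnj p) = degree p" by (rule degree_map_poly) auto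
 have "poly (crefl p) z = z ^ degree p * poly (map_poly cnj p) (inverse z)"
  unfolding crefl_def using z by (subst poly_reflect_poly_nz) (simp_all add: deg)
 also have "poly (map_poly cnj p) (inverse z) = cnj (poly p (inverse (cnj z)))"
  by (subst poly_cnj) simp
 finally show ?thesis .
qed

lemma poly_crefl_sphere: "cmod xi = 1 \<Longrightarrow> poly (crefl p) xi = xi ^ degree p * cnj (poly p xi)"
 using cnj_eq_inverse[of xi] by (subst poly_crefl) (auto simp flip: complex_cnj_inverse)

lemma crefl_nz: assumes "p \<noteq> 0" shows "crefl p \<noteq> 0"
proof
 assume "crefl p = 0"
 then have "map_poly cnj p = 0" by (simp add: crefl_def)
 then show False using assms by (simp add: map_poly_eq_0_iff)
qed

text \<open>At a root of \<open>q\<close> in \<open>U\<close> the relation forces \<open>p\<close>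
  to vanish too, so a linear factor can be divided out of both; the relation survives at that point
  as a limit, by continuity of \<open>E\<close>. Induction on the degree removes all roots of the
  denominator from \<open>U\<close>.\<close>

lemma cancel_common_roots:
 fixes p q :: "complex poly"
 assumes E: "continuous_on U E" and lim: "\<And>z. z \<in> U \<Longrightarrow> z islimpt U"
  and "q \<noteq> 0" and "\<And>z. z \<in> U \<Longrightarrow> poly q z * E z = poly p z"
 shows "\<exists>p' q'. q' \<noteq> 0 \<and> (\<forall>z\<in>U. poly q' z \<noteq> 0 \<and> E z = poly p' z / poly q' z)"
 using assms(3,4)
proof (induction "degree q" arbitrary: p q rule: less_induct)
 case less
 show ?case
 proof (cases "\<exists>z\<in>U. poly q z = 0")
  case False
  then show ?thesis using less.prems by (intro exI[of _ p] exI[of _ q]) (auto simp: field_simps)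
 next
  case True
  then obtain z0 where z0: "z0 \<in> U" "poly q z0 = 0" by blast
  then have "poly p z0 = 0" using less.prems(2)[of z0] by simp
  then obtain p1 q1 where pq: "p = [:- z0, 1:] * p1" "q = [:- z0, 1:] * q1"
   using z0 unfolding poly_eq_0_iff_dvd by (auto elim!: dvdE)
  have q1: "q1 \<noteq> 0" using less.prems(1) pq(2) by auto
  have "degree q = degree [:- z0, 1:] + degree q1"
   unfolding pq(2) using q1 by (intro degree_mult_eq) auto
  then have deg: "degree q1 < degree q" by simp
  have eq: "poly q1 z * E z = poly p1 z" if "z \<in> U - {z0}" for z
  proof -
   have "(z - z0) * (poly q1 z * E z) = (z - z0) * poly p1 z"
    using less.prems(2)[of z] that by (simp add: pq algebra_simps)
   then show ?thesis using that by simp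
  qed
  have "poly q1 z0 * E z0 = poly p1 z0"
  proof (rule tendsto_unique)
   show "at z0 within U \<noteq> bot" using lim[OF z0(1)] by (simp add: trivial_limit_within)
   have "continuous_on U (\<lambda>z. poly q1 z * E z)" by (intro continuous_intros E)
   then show "((\<lambda>z. poly q1 z * E z) \<longlongrightarrow> poly q1 z0 * E z0) (at z0 within U)"
    using z0 by (simp add: continuous_on_def)
   have "(poly p1 \<longlongrightarrow> poly p1 z0) (at z0 within U)"
    by (rule tendsto_within_subset[of _ _ _ UNIV]) (auto intro: poly_isCont[unfolded isCont_def])
   moreover have "eventually (\<lambda>z. poly p1 z = poly q1 z * E z) (at z0 within U)"
    using eq by (auto simp: eventually_at_filter)
   ultimately show "((\<lambda>z. poly q1 z * E z) \<longlongrightarrow> poly p1 z0) (at z0 within U)"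
    by (rule Lim_transform_eventually)
  qed
  with eq have "\<And>z. z \<in> U \<Longrightarrow> poly q1 z * E z = poly p1 z" by blast
  then show ?thesis using less.hyps[OF deg q1] by blast
 qed
qed

lemma islimpt_sphere: "z \<in> sphere (0::complex) 1 \<Longrightarrow> z islimpt sphere 0 1"
proof -
 assume z: "z \<in> sphere (0::complex) 1"
 have "connected (sphere (0::complex) 1)" by (intro connected_sphere) auto
 moreover have "- z \<in> sphere 0 1" "- z \<noteq> z" using z by auto
 ultimately have "sphere 0 1 \<noteq> {x}" for x :: complex using z by (metis singletonD)
 then show ?thesis using z \<open>connected (sphere (0::complex) 1)\<close> by (intro connected_imp_perfect)
qed

text \<open>The divided difference is split into powers of \<open>z\<close> with coefficients
  polynomial in \<open>xi\<close>, so that a functional acting on \<open>xi\<close> can be applied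
  term by term. The recursion is Horner's.\<close>

lemma poly_difference_quotient:
 fixes p :: "complex poly"
 shows "\<exists>N Q. \<forall>xi z. poly p xi - poly p z = (xi - z) * (\<Sum>j<N. z ^ j * poly (Q j) xi)"
proof (induction p)
 case 0 then show ?case by (auto intro!: exI[of _ 0])
next
 case (pCons a p)
 then obtain N Q where "\<And>xi z. poly p xi - poly p z = (xi - z) * (\<Sum>j<N. z ^ j * poly (Q j) xi)" by blast
 note IH = this
 define Q' where "Q' = (\<lambda>j. case j of 0 \<Rightarrow> p | Suc i \<Rightarrow> Q i)"
 have "poly (pCons a p) xi - poly (pCons a p) z = (xi - z) * (\<Sum>j<Suc N. z ^ j * poly (Q' j) xi)" for xi z
 proof -
  have "poly (pCons a p) xi - poly (pCons a p) z = (xi - z) * poly p xi + z * (poly p xi - poly p z)"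
   by (simp add: algebra_simps)
  also have "\<dots> = (xi - z) * (poly p xi + z * (\<Sum>j<N. z ^ j * poly (Q j) xi))"
   unfolding IH by (simp add: algebra_simps)
  also have "poly p xi + z * (\<Sum>j<N. z ^ j * poly (Q j) xi) = (\<Sum>j<Suc N. z ^ j * poly (Q' j) xi)"
   unfolding sum.lessThan_Suc_shift by (simp add: Q'_def sum_distrib_left mult_ac)
  finally show ?thesis .
 qed
 then show ?case by blast
qed

text \<open>The Cauchy integral sees only the Fourier coefficients of index >= 0. After
  multiplication by |q|^2 all but finitely many of these vanish, and as \<open>u\<close> is real the
  coefficients of negative index are their conjugates. Hence |q|^2 u is a trigonometric
  polynomial.\<close>

theorem rational_from_cauchy:
 assumes u: "continuous_on (sphere 0 1) u" and q: "q \<noteq> 0"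
  and eq: "\<And>z. z \<in> ball 0 1 \<Longrightarrow> poly q z * cau (\<lambda>xi. complex_of_real (u xi)) z = poly p z"
 shows "\<exists>A B. B \<noteq> 0 \<and> (\<forall>xi. cmod xi = 1 \<longrightarrow> poly B xi \<noteq> 0 \<and> complex_of_real (u xi) = poly A xi / poly B xi)"
proof -
 define v where "v = (\<lambda>xi. complex_of_real (u xi))"
 have v: "continuous_on (sphere 0 1) v" unfolding v_def by (intro continuous_intros u)
 obtain N Q where Q: "\<And>xi z. poly q xi - poly q z = (xi - z) * (\<Sum>j<N. z ^ j * poly (Q j) xi)"
  using poly_difference_quotient by blast
 \<comment> \<open>Replacing \<open>poly q xi\<close> by \<open>poly q z\<close> under the Cauchy
   kernel leaves a polynomial in \<open>z\<close> whose coefficients are moments of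
   \<open>v\<close>; \<open>p2\<close> absorbs it.\<close>
 define p2 where "p2 = p + (\<Sum>j<N. monom (cmean (\<lambda>xi. poly (Q j) xi * v xi * xi)) j)"
 define w1 where "w1 = (\<lambda>xi. poly q xi * v xi - poly p2 xi)"
 have qv: "continuous_on (sphere 0 1) (\<lambda>xi. poly q xi * v xi)" by (intro continuous_intros v)
 have w1: "continuous_on (sphere 0 1) w1" unfolding w1_def by (intro continuous_intros v)
 have "cau w1 z = 0" if z: "z \<in> ball 0 1" for z
 proof -
  have "cau (\<lambda>xi. poly q xi * v xi) z
   = cmean (\<lambda>xi. poly q z * (v xi * xi / (xi - z)) + (\<Sum>j<N. z ^ j * (poly (Q j) xi * v xi * xi)))"
   unfolding cau_def
  proof (rule cmean_cong)
   fix xi :: complex assume "cmod xi = 1"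
   then have ne: "xi - z \<noteq> 0" using z by auto
   have "poly q xi = poly q z + (xi - z) * (\<Sum>j<N. z ^ j * poly (Q j) xi)" using Q[of xi z] by (simp add: algebra_simps)
   have "(a + (xi - z) * S) * v xi * xi / (xi - z) = a * (v xi * xi / (xi - z)) + S * (v xi * xi)" for a S
    using ne by (simp add: field_simps)
   then have "poly q xi * v xi * xi / (xi - z) = poly q z * (v xi * xi / (xi - z)) + (\<Sum>j<N. z ^ j * poly (Q j) xi) * (v xi * xi)"
    by (simp only: \<open>poly q xi = poly q z + _\<close>)
   then show "poly q xi * v xi * xi / (xi - z) = poly q z * (v xi * xi / (xi - z)) + (\<Sum>j<N. z ^ j * (poly (Q j) xi * v xi * xi))"
    by (simp add: sum_distrib_left sum_distrib_right mult_ac)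
  qed
  also have "\<dots> = poly q z * cau v z + (\<Sum>j<N. z ^ j * cmean (\<lambda>xi. poly (Q j) xi * v xi * xi))"
   unfolding cau_def cmean_cmult[symmetric]
   by (subst cmean_add, (intro continuous_intros v; use z in auto), (intro continuous_intros v; use z in auto),
     subst cmean_sum) (auto intro!: continuous_intros v)
  also have "\<dots> = poly p2 z"
   using eq[OF z] by (simp add: p2_def v_def poly_sum poly_monom mult.commute)
  finally have "cau (\<lambda>xi. poly q xi * v xi) z = poly p2 z" .
  then show ?thesis
   unfolding w1_def using z by (subst cau_diff) (auto intro!: qv continuous_intros simp: cau_poly)
 qed
 then have w1_zero: "cmean (\<lambda>xi. w1 xi * cnj xi ^ k) = 0" for k
  by (rule cau_zero_imp_fourier_zero[OF w1])
 \<comment> \<open>Multiplication by \<open>cnj (poly q xi)\<close> only mixes in further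
   coefficients of index >= 0, all of which are zero.\<close>
 have w2_zero: "cmean (\<lambda>xi. cnj (poly q xi) * w1 xi * cnj xi ^ k) = 0" for k
 proof -
  have "cmean (\<lambda>xi. cnj (poly q xi) * w1 xi * cnj xi ^ k) = cmean (\<lambda>xi. \<Sum>j\<le>degree q. cnj (coeff q j) * (w1 xi * cnj xi ^ (j + k)))"
   by (rule cmean_cong) (simp add: poly_altdef sum_distrib_left sum_distrib_right power_add mult_ac)
  also have "\<dots> = (\<Sum>j\<le>degree q. cnj (coeff q j) * cmean (\<lambda>xi. w1 xi * cnj xi ^ (j + k)))"
   unfolding cmean_cmult[symmetric] by (intro cmean_sum) (auto intro!: continuous_intros w1)
  finally show ?thesis by (simp add: w1_zero)
 qed
 define s where "s = (\<lambda>xi. cnj (poly q xi) * poly q xi * v xi)"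
 have s: "continuous_on (sphere 0 1) s" unfolding s_def by (intro continuous_intros v)
 have s_real: "cnj (s xi) = s xi" for xi by (simp add: s_def v_def mult_ac)
 define c where "c = (\<lambda>k. cmean (\<lambda>xi. s xi * cnj xi ^ k))"
 have c_p2: "c k = cmean (\<lambda>xi. cnj (poly q xi) * poly p2 xi * cnj xi ^ k)" for k
 proof -
  have "c k - cmean (\<lambda>xi. cnj (poly q xi) * poly p2 xi * cnj xi ^ k) = cmean (\<lambda>xi. s xi * cnj xi ^ k - cnj (poly q xi) * poly p2 xi * cnj xi ^ k)"
   unfolding c_def by (intro cmean_diff[symmetric] continuous_intros s)
  also have "\<dots> = cmean (\<lambda>xi. cnj (poly q xi) * w1 xi * cnj xi ^ k)"
   by (rule cmean_cong) (simp add: s_def w1_def algebra_simps)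
  finally show ?thesis using w2_zero by simp
 qed
 define M where "M = degree p2"
 have c_zero: "c k = 0" if "k > M" for k
 proof -
  have "c k = cmean (\<lambda>xi. \<Sum>j\<le>degree q. \<Sum>i\<le>degree p2. cnj (coeff q j) * coeff p2 i * (xi ^ i * cnj xi ^ (j + k)))"
   unfolding c_p2
  proof (rule cmean_cong)
   fix xi :: complex
   have "cnj (poly q xi) = (\<Sum>j\<le>degree q. cnj (coeff q j) * cnj xi ^ j)" by (simp add: poly_altdef)
   then show "cnj (poly q xi) * poly p2 xi * cnj xi ^ k
     = (\<Sum>j\<le>degree q. \<Sum>i\<le>degree p2. cnj (coeff q j) * coeff p2 i * (xi ^ i * cnj xi ^ (j + k)))"
    unfolding poly_altdef[of p2] by (simp only: sum_distrib_right, intro sum.cong refl, simp add: sum_distrib_left sum_distrib_right power_add mult_ac)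
  qed
  also have "\<dots> = (\<Sum>j\<le>degree q. \<Sum>i\<le>degree p2. cnj (coeff q j) * coeff p2 i * cmean (\<lambda>xi. xi ^ i * cnj xi ^ (j + k)))"
  proof -
   let ?f = "\<lambda>j i xi. cnj (coeff q j) * coeff p2 i * (xi ^ i * cnj xi ^ (j + k))"
   have "cmean (\<lambda>xi. \<Sum>j\<le>degree q. \<Sum>i\<le>degree p2. ?f j i xi) = (\<Sum>j\<le>degree q. cmean (\<lambda>xi. \<Sum>i\<le>degree p2. ?f j i xi))"
    by (rule cmean_sum) (auto intro!: continuous_intros)
   also have "\<dots> = (\<Sum>j\<le>degree q. \<Sum>i\<le>degree p2. cmean (?f j i))"
    by (rule sum.cong[OF refl], rule cmean_sum) (auto intro!: continuous_intros)
   finally show ?thesis by (simp only: cmean_cmult)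
  qed
  also have "\<dots> = 0"
   unfolding fourier_orthogonality by (intro sum.neutral ballI) (use that in \<open>simp add: M_def\<close>)
  finally show ?thesis .
 qed
 define t where "t = (\<Sum>k\<le>M. monom (c k) k)"
 \<comment> \<open>The constant term occurs in both halves and is real, so it is subtracted
   once.\<close>
 define T where "T = (\<lambda>xi. poly t xi + cnj (poly t xi) - c 0)"
 have t_poly: "poly t xi = (\<Sum>k\<le>M. c k * xi ^ k)" for xi by (simp add: t_def poly_sum poly_monom)
 have T: "continuous_on (sphere 0 1) T" unfolding T_def by (intro continuous_intros)
 have "cnj (c 0) = cmean (\<lambda>xi. cnj (s xi))" unfolding cmean_cnj by (simp add: c_def)
 then have c0: "cnj (c 0) = c 0" by (simp add: s_real c_def)
 have T_real: "cnj (T xi) = T xi" for xi by (simp add: T_def c0)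
 have T_c: "cmean (\<lambda>xi. T xi * cnj xi ^ k) = c k" for k
 proof -
  have "cmean (\<lambda>xi. T xi * cnj xi ^ k) = cmean (\<lambda>xi. (\<Sum>i\<le>M. c i * (xi ^ i * cnj xi ^ k)) + (\<Sum>i\<le>M. cnj (c i) * (xi ^ 0 * cnj xi ^ (i + k))) - c 0 * (xi ^ 0 * cnj xi ^ k))"
   by (rule cmean_cong) (simp add: T_def t_poly sum_distrib_left sum_distrib_right power_add algebra_simps)
  also have "\<dots> = (\<Sum>i\<le>M. c i * cmean (\<lambda>xi. xi ^ i * cnj xi ^ k)) + (\<Sum>i\<le>M. cnj (c i) * cmean (\<lambda>xi. xi ^ 0 * cnj xi ^ (i + k))) - c 0 * cmean (\<lambda>xi. xi ^ 0 * cnj xi ^ k)"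
   unfolding cmean_cmult[symmetric]
   by (subst cmean_diff, (intro continuous_intros), (intro continuous_intros), subst cmean_add, (intro continuous_intros), (intro continuous_intros),
     subst cmean_sum, simp, (intro continuous_intros), subst cmean_sum, simp, (intro continuous_intros), rule refl)
  also have "\<dots> = (if k \<le> M then c k else 0) + (if k = 0 then cnj (c 0) else 0) - (if k = 0 then c 0 else 0)"
  proof -
   have 1: "(\<Sum>i\<le>M. c i * cmean (\<lambda>xi. xi ^ i * cnj xi ^ k)) = (if k \<le> M then c k else 0)"
    unfolding fourier_orthogonality by (simp add: if_distrib[where f="\<lambda>x. _ * x"] sum.delta cong: if_cong)
   have "(\<Sum>i\<le>M. cnj (c i) * cmean (\<lambda>xi. xi ^ 0 * cnj xi ^ (i + k))) = (\<Sum>i\<le>M. if i = 0 then (if k = 0 then cnj (c 0) else 0) else 0)"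
    by (rule sum.cong[OF refl]) (unfold fourier_orthogonality, auto)
   then have 2: "(\<Sum>i\<le>M. cnj (c i) * cmean (\<lambda>xi. xi ^ 0 * cnj xi ^ (i + k))) = (if k = 0 then cnj (c 0) else 0)"
    by simp
   have 3: "c 0 * cmean (\<lambda>xi. xi ^ 0 * cnj xi ^ k) = (if k = 0 then c 0 else 0)"
    unfolding fourier_orthogonality by auto
   show ?thesis unfolding 1 2 3 ..
  qed
  also have "\<dots> = c k" using c_zero[of k] c0 by auto
  finally show ?thesis .
 qed
 have sT: "s xi = T xi" if "cmod xi = 1" for xi
 proof -
  have d: "continuous_on (sphere 0 1) (\<lambda>xi. s xi - T xi)" by (intro continuous_intros s T)
  have neg: "cmean (\<lambda>xi. (s xi - T xi) * cnj xi ^ k) = 0" for k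
  proof -
   have "cmean (\<lambda>xi. (s xi - T xi) * cnj xi ^ k) = cmean (\<lambda>xi. s xi * cnj xi ^ k - T xi * cnj xi ^ k)"
    by (simp add: left_diff_distrib)
   also have "\<dots> = c k - c k" unfolding T_c[symmetric] c_def by (subst cmean_diff) (auto intro!: continuous_intros s T simp: T_c c_def)
   finally show ?thesis by simp
  qed
  have pos: "cmean (\<lambda>xi. (s xi - T xi) * xi ^ k) = 0" for k
   using cmean_cnj[of "\<lambda>xi. (s xi - T xi) * cnj xi ^ k"] neg[of k] by (simp add: s_real T_real)
  from fourier_uniqueness[OF d pos neg that] show ?thesis by simp
 qed
 \<comment> \<open>Both sides of \<open>s = T\<close> are multiplied by
   \<open>xi ^ (degree q + degree t)\<close>, which turns the conjugates of \<open>q\<close> and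
   \<open>t\<close> into their reciprocal polynomials.\<close>
 define B where "B = q * crefl q * monom 1 (degree t)"
 define A where "A = monom 1 (degree q) * (t * monom 1 (degree t) + crefl t - monom (c 0) (degree t))"
 have B: "B \<noteq> 0" using q crefl_nz[OF q] by (auto simp: B_def)
 have "poly B xi * v xi = poly A xi" if "xi \<in> sphere 0 1" for xi
 proof -
  have x: "cmod xi = 1" using that by simp
  have "poly B xi * v xi = xi ^ degree q * xi ^ degree t * s xi"
   by (simp add: B_def poly_crefl_sphere[OF x] poly_monom s_def mult_ac)
  also have "\<dots> = poly A xi"
   unfolding sT[OF x] T_def by (simp add: A_def poly_crefl_sphere[OF x] poly_monom algebra_simps)
  finally show ?thesis .
 qed
 from cancel_common_roots[OF v islimpt_sphere B this]
 show ?thesis by (simp only: v_def Ball_def mem_sphere_0)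
qed

text \<open>Writing \<open>A xi = A z + (xi - z) \<Sum>j z^j A\<^sub>j xi\<close> (and likewise for \<open>B\<close>) shows that the Cauchy integral
of a rational function against any linear functional is a rational function of \<open>z\<close> together with
the functional applied to the Cauchy kernel itself.\<close>

lemma functional_of_rational_cauchy_kernel:
 fixes \<Lambda> :: "(complex \<Rightarrow> complex) \<Rightarrow> complex"
 assumes lin: "\<And>c d f g. f \<in> C \<Longrightarrow> g \<in> C \<Longrightarrow> \<Lambda> (\<lambda>xi. c * f xi + d * g xi) = c * \<Lambda> f + d * \<Lambda> g"
  and C: "\<And>c d f g. f \<in> C \<Longrightarrow> g \<in> C \<Longrightarrow> (\<lambda>xi. c * f xi + d * g xi) \<in> C"
  and cong: "\<And>f g. (\<And>xi. xi \<in> K \<Longrightarrow> f xi = g xi) \<Longrightarrow> \<Lambda> f = \<Lambda> g"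
  and rat: "\<And>P. (\<lambda>xi. poly P xi / poly B xi) \<in> C"
  and ker: "\<And>z. z \<notin> K \<Longrightarrow> (\<lambda>xi. 1 / (xi - z)) \<in> C"
  and B: "\<And>xi. xi \<in> K \<Longrightarrow> poly B xi \<noteq> 0"
 shows "\<exists>T0 T1. \<forall>z. z \<notin> K \<longrightarrow> poly B z \<noteq> 0 \<longrightarrow>
   \<Lambda> (\<lambda>xi. poly A xi / (poly B xi * (xi - z))) = poly T0 z + poly A z / poly B z * (\<Lambda> (\<lambda>xi. 1 / (xi - z)) - poly T1 z)"
proof -
 obtain N Q where Q: "\<And>xi z. poly A xi - poly A z = (xi - z) * (\<Sum>j<N. z ^ j * poly (Q j) xi)"
  using poly_difference_quotient by blast
 obtain M R where R: "\<And>xi z. poly B xi - poly B z = (xi - z) * (\<Sum>j<M. z ^ j * poly (R j) xi)"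
  using poly_difference_quotient by blast
 have sum: "(\<lambda>xi. \<Sum>j<n. z ^ j * (poly (Q j) xi / poly B xi)) \<in> C \<and>
   \<Lambda> (\<lambda>xi. \<Sum>j<n. z ^ j * (poly (Q j) xi / poly B xi)) = (\<Sum>j<n. z ^ j * \<Lambda> (\<lambda>xi. poly (Q j) xi / poly B xi))" for n Q z
 proof (induction n)
  case 0
  have "(\<lambda>xi. 0) \<in> C" using rat[of 0] by simp
  moreover have "\<Lambda> (\<lambda>xi. 0) = 0" using lin[OF rat[of 0] rat[of 0], of 0 0] by simp
  ultimately show ?case by simp
 next
  case (Suc n)
  let ?S = "\<lambda>xi. \<Sum>j<n. z ^ j * (poly (Q j) xi / poly B xi)"
  have e: "(\<lambda>xi. \<Sum>j<Suc n. z ^ j * (poly (Q j) xi / poly B xi)) = (\<lambda>xi. 1 * ?S xi + z ^ n * (poly (Q n) xi / poly B xi))"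
   by (simp add: fun_eq_iff)
  show ?case unfolding e using Suc C[OF _ rat, of ?S 1 "z ^ n" "Q n"] lin[OF _ rat, of ?S 1 "z ^ n" "Q n"] by simp
 qed
 define T0 where "T0 = (\<Sum>j<N. monom (\<Lambda> (\<lambda>xi. poly (Q j) xi / poly B xi)) j)"
 define T1 where "T1 = (\<Sum>j<M. monom (\<Lambda> (\<lambda>xi. poly (R j) xi / poly B xi)) j)"
 have "\<Lambda> (\<lambda>xi. poly A xi / (poly B xi * (xi - z))) = poly T0 z + poly A z / poly B z * (\<Lambda> (\<lambda>xi. 1 / (xi - z)) - poly T1 z)"
  if z: "z \<notin> K" "poly B z \<noteq> 0" for z
 proof -
  define r where "r = poly A z / poly B z"
  let ?SA = "\<lambda>xi. \<Sum>j<N. z ^ j * (poly (Q j) xi / poly B xi)"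
  let ?SB = "\<lambda>xi. \<Sum>j<M. z ^ j * (poly (R j) xi / poly B xi)"
  have "\<Lambda> (\<lambda>xi. poly A xi / (poly B xi * (xi - z))) = \<Lambda> (\<lambda>xi. 1 * ?SA xi + r * (1 * (1 / (xi - z)) + (- 1) * ?SB xi))"
  proof (rule cong)
   fix xi assume xi: "xi \<in> K"
   define a b where "a = (\<Sum>j<N. z ^ j * poly (Q j) xi)" and "b = (\<Sum>j<M. z ^ j * poly (R j) xi)"
   have ne: "xi - z \<noteq> 0" "poly B xi \<noteq> 0" using xi z B by auto
   have Ax: "poly A xi = poly A z + (xi - z) * a" and Bx: "poly B z = poly B xi - (xi - z) * b"
    using Q[of xi z] R[of xi z] by (simp_all add: a_def b_def algebra_simps)
   have S: "?SA xi = a / poly B xi" "?SB xi = b / poly B xi" by (simp_all add: a_def b_def sum_divide_distrib)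
   have id: "(p + d * a) / (q * d) = a / q + p / q' * (1 / d - b / q)"
    if "q \<noteq> 0" "d \<noteq> 0" "q' \<noteq> 0" "q' = q - d * b" for p d q q' :: complex
   proof -
    have "1 / d - b / q = q' / (d * q)" using that by (simp add: field_simps)
    then show ?thesis using that(1-3) by (simp add: add_divide_distrib mult.commute)
   qed
   show "poly A xi / (poly B xi * (xi - z)) = 1 * ?SA xi + r * (1 * (1 / (xi - z)) + (- 1) * ?SB xi)"
    unfolding Ax S r_def using id[OF ne(2,1) z(2) Bx, of "poly A z"] by simp
  qed
  also have "\<dots> = (\<Sum>j<N. z ^ j * \<Lambda> (\<lambda>xi. poly (Q j) xi / poly B xi))
    + r * (\<Lambda> (\<lambda>xi. 1 / (xi - z)) - (\<Sum>j<M. z ^ j * \<Lambda> (\<lambda>xi. poly (R j) xi / poly B xi)))"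
   using sum[of z Q N] sum[of z R M] ker[OF z(1)]
   by (subst lin) (auto intro!: C simp: lin[of "\<lambda>xi. 1 / (xi - z)" ?SB 1 "- 1", simplified] C[of "\<lambda>xi. 1 / (xi - z)" ?SB 1 "- 1", simplified])
  finally show ?thesis by (simp add: r_def T0_def T1_def poly_sum poly_monom mult.commute)
 qed
 then show ?thesis by blast
qed

lemma islimpt_ball: "z \<in> ball (0::complex) 1 \<Longrightarrow> z islimpt ball 0 1"
 by (simp add: interior_limit_point)

text \<open>For |z| < 1 the kernel itself has Cauchy integral 1, so the preceding lemma, with the
  mean over the circle as functional, makes \<open>B\<close> times the Cauchy integral a polynomial
  off the roots of \<open>B\<close>.\<close>

theorem cauchy_from_rational:
 assumes B: "B \<noteq> 0" "\<And>xi. cmod xi = 1 \<Longrightarrow> poly B xi \<noteq> 0"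
  and v: "\<And>xi. cmod xi = 1 \<Longrightarrow> v xi = poly A xi / poly B xi"
 shows "\<exists>p q. q \<noteq> 0 \<and> (\<forall>z\<in>ball 0 1. poly q z \<noteq> 0 \<and> cau v z = poly p z / poly q z)"
proof -
 have vc: "continuous_on (sphere 0 1) v"
  by (subst continuous_on_cong[OF refl v]) (auto intro!: continuous_intros B)
 have "\<exists>T0 T1. \<forall>z. z \<notin> sphere 0 1 \<longrightarrow> poly B z \<noteq> 0 \<longrightarrow>
   cmean (\<lambda>xi. poly A xi / (poly B xi * (xi - z)) * xi) = poly T0 z + poly A z / poly B z * (cmean (\<lambda>xi. 1 / (xi - z) * xi) - poly T1 z)"
 proof (rule functional_of_rational_cauchy_kernel[where \<Lambda>="\<lambda>f. cmean (\<lambda>xi. f xi * xi)" and C="{f. continuous_on (sphere 0 1) f}" and K="sphere 0 1"])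
  fix c d :: complex and f g :: "complex \<Rightarrow> complex"
  assume "f \<in> {f. continuous_on (sphere 0 1) f}" "g \<in> {f. continuous_on (sphere 0 1) f}"
  then have fg: "continuous_on (sphere 0 1) f" "continuous_on (sphere 0 1) g" by auto
  have "cmean (\<lambda>xi. (c * f xi + d * g xi) * xi) = cmean (\<lambda>xi. c * (f xi * xi) + d * (g xi * xi))"
   by (simp add: algebra_simps)
  also have "\<dots> = c * cmean (\<lambda>xi. f xi * xi) + d * cmean (\<lambda>xi. g xi * xi)"
   unfolding cmean_cmult[symmetric] by (intro cmean_add continuous_intros fg)
  finally show "cmean (\<lambda>xi. (c * f xi + d * g xi) * xi) = c * cmean (\<lambda>xi. f xi * xi) + d * cmean (\<lambda>xi. g xi * xi)" .
  show "(\<lambda>xi. c * f xi + d * g xi) \<in> {f. continuous_on (sphere 0 1) f}" by (auto intro!: continuous_intros fg)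
 next
  fix f g :: "complex \<Rightarrow> complex" assume "\<And>xi. xi \<in> sphere 0 1 \<Longrightarrow> f xi = g xi"
  then show "cmean (\<lambda>xi. f xi * xi) = cmean (\<lambda>xi. g xi * xi)" by (intro cmean_cong) auto
 qed (use B in \<open>auto intro!: continuous_intros\<close>)
 then obtain T0 T1 where T: "\<And>z. z \<notin> sphere 0 1 \<Longrightarrow> poly B z \<noteq> 0 \<Longrightarrow>
   cmean (\<lambda>xi. poly A xi / (poly B xi * (xi - z)) * xi) = poly T0 z + poly A z / poly B z * (cmean (\<lambda>xi. 1 / (xi - z) * xi) - poly T1 z)"
  by blast
 define p where "p = B * T0 + A * (1 - T1)"
 have eq: "poly B z * cau v z = poly p z" if z: "z \<in> ball 0 1" "poly B z \<noteq> 0" for z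
 proof -
  have "cau v z = cmean (\<lambda>xi. poly A xi / (poly B xi * (xi - z)) * xi)"
   unfolding cau_def by (rule cmean_cong) (simp add: v)
  also have "\<dots> = poly T0 z + poly A z / poly B z * (cmean (\<lambda>xi. 1 / (xi - z) * xi) - poly T1 z)"
   using T z by auto
  also have "cmean (\<lambda>xi. 1 / (xi - z) * xi) = 1"
   using cau_poly[of z 1] z by (simp add: cau_def)
  finally show ?thesis using z(2) by (simp add: p_def field_simps)
 qed
 \<comment> \<open>The identity can fail only at roots of \<open>B\<close>, a finite set, while the
   set where it fails is open by continuity; so that set is empty.\<close>
 have "poly B z * cau v z = poly p z" if z: "z \<in> ball 0 1" for z
 proof (rule ccontr)
  assume ne: "poly B z * cau v z \<noteq> poly p z"
  have c: "continuous_on (ball 0 1) (\<lambda>z. poly B z * cau v z - poly p z)"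
   by (intro continuous_intros cau_continuous vc)
  have "open ((\<lambda>z. poly B z * cau v z - poly p z) -` (- {0}) \<inter> ball 0 1)"
   using iffD1[OF continuous_on_open_vimage[OF open_ball] c] open_Compl[OF closed_singleton[of 0]] by blast
  moreover have "(\<lambda>z. poly B z * cau v z - poly p z) -` (- {0}) \<inter> ball 0 1 \<subseteq> {z. poly B z = 0}"
  proof
   fix x assume "x \<in> (\<lambda>z. poly B z * cau v z - poly p z) -` (- {0}) \<inter> ball 0 1"
   then show "x \<in> {z. poly B z = 0}" using eq[of x] by auto
  qed
  then have "finite ((\<lambda>z. poly B z * cau v z - poly p z) -` (- {0}) \<inter> ball 0 1)"
   using poly_roots_finite[OF B(1)] finite_subset by blast
  ultimately have "(\<lambda>z. poly B z * cau v z - poly p z) -` (- {0}) \<inter> ball 0 1 = {}"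
   using finite_imp_not_open by blast
  then show False using ne z by auto
 qed
 from cancel_common_roots[OF cau_continuous[OF vc] islimpt_ball B(1) this]
 show ?thesis by blast
qed

text \<open>Each step divides out one zero with its full multiplicity and lowers the number of
  distinct zeros. In this way the zeros of a holomorphic function are transferred to a polynomial,
  which can serve as a denominator.\<close>

lemma factor_out_zeros:
 assumes "X holomorphic_on S" "open S" "connected S" "finite {z\<in>S. X z = 0}" "\<exists>z\<in>S. X z \<noteq> 0"
 shows "\<exists>q X0. q \<noteq> 0 \<and> (\<forall>z. poly q z = 0 \<longleftrightarrow> z \<in> S \<and> X z = 0) \<and> X0 holomorphic_on S \<and>
   (\<forall>z\<in>S. X0 z \<noteq> 0 \<and> X z = poly q z * X0 z)"
 using assms
proof (induction "card {z\<in>S. X z = 0}" arbitrary: X)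
 case 0
 then have "\<forall>z\<in>S. X z \<noteq> 0" by auto
 then show ?case using 0 by (intro exI[of _ 1] exI[of _ X]) auto
next
 case (Suc n)
 have "{z\<in>S. X z = 0} \<noteq> {}"
 proof
  assume "{z\<in>S. X z = 0} = {}"
  with Suc.hyps(2) show False by (simp only: card.empty)
 qed
 then obtain e where e: "e \<in> S" "X e = 0" by blast
 have nonconst: "\<not> X constant_on S"
 proof
  assume "X constant_on S"
  then obtain c where "\<And>z. z \<in> S \<Longrightarrow> X z = c" unfolding constant_on_def by blast
  then show False using e Suc.prems(5) by auto
 qed
 obtain g r n' where g: "0 < n'" "0 < r" "ball e r \<subseteq> S" "g holomorphic_on ball e r"
   "\<And>w. w \<in> ball e r \<Longrightarrow> X w = (w - e)^n' * g w" "\<And>w. w \<in> ball e r \<Longrightarrow> g w \<noteq> 0"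
  by (rule holomorphic_factor_zero_nonconstant[OF Suc.prems(1-3) e nonconst], rule that, assumption+)
 define X1 where "X1 = (\<lambda>w. if w = e then g e else X w / (w - e)^n')"
 have X1g: "X1 w = g w" if "w \<in> ball e r" for w
  using g(5)[OF that] by (auto simp: X1_def)
 have h1: "X1 holomorphic_on ball e r" by (rule holomorphic_transform[OF g(4)]) (simp add: X1g)
 have "(\<lambda>w. X w / (w - e)^n') holomorphic_on S - {e}"
  by (intro holomorphic_intros holomorphic_on_subset[OF Suc.prems(1)]) auto
 then have h2: "X1 holomorphic_on S - {e}" by (rule holomorphic_transform) (auto simp: X1_def)
 have "X1 holomorphic_on ball e r \<union> (S - {e})"
  using h1 h2 Suc.prems(2) by (intro holomorphic_on_Un) (auto intro: open_delete)
 also have "ball e r \<union> (S - {e}) = S" using g(2,3) e by auto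
 finally have X1: "X1 holomorphic_on S" .
 have XX: "X z = (z - e)^n' * X1 z" if "z \<in> S" for z
  using e g(1) by (auto simp: X1_def)
 have X1e: "X1 e \<noteq> 0" using X1g[of e] g(2,6) by simp
 have zs: "{z\<in>S. X1 z = 0} = {z\<in>S. X z = 0} - {e}" using XX X1e by auto
 have card: "n = card {z\<in>S. X1 z = 0}" using Suc.hyps(2) Suc.prems(4) e unfolding zs by simp
 have "\<exists>q X0. q \<noteq> 0 \<and> (\<forall>z. poly q z = 0 \<longleftrightarrow> z \<in> S \<and> X1 z = 0) \<and> X0 holomorphic_on S \<and>
   (\<forall>z\<in>S. X0 z \<noteq> 0 \<and> X1 z = poly q z * X0 z)"
  by (rule Suc.hyps(1)[OF card X1 Suc.prems(2,3)]) (use Suc.prems(4) X1e e in \<open>auto simp: zs\<close>)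
 then obtain q X0 where q: "q \<noteq> 0" "\<And>z. poly q z = 0 \<longleftrightarrow> z \<in> S \<and> X1 z = 0" "X0 holomorphic_on S"
   "\<And>z. z \<in> S \<Longrightarrow> X0 z \<noteq> 0 \<and> X1 z = poly q z * X0 z" by blast
 have p: "poly ([:- e, 1:]^n' * q) z = (z - e)^n' * poly q z" for z by simp
 show ?case
 proof (rule exI[of _ "[:- e, 1:]^n' * q"], rule exI[of _ X0], intro conjI allI ballI)
  show "[:- e, 1:]^n' * q \<noteq> 0" using q(1) by simp
  fix z
  show "poly ([:- e, 1:]^n' * q) z = 0 \<longleftrightarrow> z \<in> S \<and> X z = 0"
   unfolding p using q(2)[of z] XX[of z] e g(1) by auto
 qed (use q XX p in auto)
qed

text \<open>On the circle \<open>F z / z^n\<close> is real, so the Fourier coefficients of \<open>F\<close> are symmetric about \<open>n\<close>.\<close>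

lemma disk_algebra_real_imp_poly:
 assumes F: "continuous_on (cball 0 1) F" "F holomorphic_on ball 0 1"
  and real: "\<And>xi. cmod xi = 1 \<Longrightarrow> cnj (F xi) * xi ^ (2 * n) = F xi"
 shows "\<exists>P. \<forall>z\<in>ball 0 1. F z = poly P z"
proof -
 define c where "c = (\<lambda>k. (deriv ^^ k) F 0 / fact k)"
 have c_eq: "c k = cmean (\<lambda>xi. F xi * cnj xi ^ k)" for k
 proof -
  have "contour_integral (circlepath 0 1) (\<lambda>u. F u / (u - 0) ^ Suc k) = 2 * of_real pi * \<i> * cmean (\<lambda>xi. F xi / (xi - 0) ^ Suc k * xi)"
   by (rule contour_integral_circ)
  also have "cmean (\<lambda>xi. F xi / (xi - 0) ^ Suc k * xi) = cmean (\<lambda>xi. F xi * cnj xi ^ k)"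
  proof (rule cmean_cong)
   fix xi :: complex assume xi: "cmod xi = 1"
   then have "xi \<noteq> 0" by auto
   then show "F xi / (xi - 0) ^ Suc k * xi = F xi * cnj xi ^ k"
    unfolding cnj_eq_inverse[OF xi] by (simp add: field_simps)
  qed
  finally have "2 * of_real pi * \<i> * c k = 2 * of_real pi * \<i> * cmean (\<lambda>xi. F xi * cnj xi ^ k)"
   using Cauchy_contour_integral_circlepath[OF F, of 0 k] by (simp add: c_def)
  then show ?thesis by simp
 qed
 have z: "c k = 0" if k: "k > 2 * n" for k
 proof -
  have "cnj (c k) = cmean (\<lambda>xi. cnj (F xi * cnj xi ^ k))" unfolding c_eq by (rule cmean_cnj[symmetric])
  also have "\<dots> = cau (\<lambda>xi. F xi * xi ^ (k - 2 * n)) 0"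
   unfolding cau_def
  proof (rule cmean_cong)
   fix xi :: complex assume xi: "cmod xi = 1"
   then have ne: "xi \<noteq> 0" by auto
   have "cnj (F xi) * xi ^ k = cnj (F xi) * xi ^ (2 * n) * xi ^ (k - 2 * n)"
    using k by (simp flip: power_add)
   then show "cnj (F xi * cnj xi ^ k) = F xi * xi ^ (k - 2 * n) * xi / (xi - 0)"
    using real[OF xi] ne by simp
  qed
  also have "\<dots> = F 0 * 0 ^ (k - 2 * n)"
   by (rule cau_holomorphic) (auto intro!: continuous_intros holomorphic_intros F)
  finally have "cnj (c k) = 0" using k by simp
  then show ?thesis by simp
 qed
 have "F w = poly (\<Sum>k\<le>2 * n. monom (c k) k) w" if w: "w \<in> ball 0 1" for w
 proof -
  have s: "(\<lambda>k. c k * w ^ k) sums F w"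
   using holomorphic_power_series[OF F(2) w] by (simp add: c_def)
  have "(\<lambda>k. c k * w ^ k) sums (\<Sum>k\<le>2 * n. c k * w ^ k)"
   by (rule sums_finite) (auto simp: z)
  from sums_unique2[OF s this] show ?thesis by (simp add: poly_sum poly_monom)
 qed
 then show ?thesis by blast
qed

lemma continuous_on_cball_eq_from_ball:
 assumes "continuous_on (cball 0 1) f" "continuous_on (cball 0 1) g" "\<And>z. z \<in> ball (0::complex) 1 \<Longrightarrow> f z = g z"
  "z \<in> cball 0 1"
 shows "f z = (g z :: complex)"
proof -
 have cl: "closure (ball (0::complex) 1) = cball 0 1" by simp
 have "continuous_on (closure (ball (0::complex) 1)) (\<lambda>z. f z - g z)"
  unfolding cl by (intro continuous_intros assms)
 from continuous_constant_on_closure[OF this, of 0 z] assms(3,4) show ?thesis by (auto simp: cl)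
qed

text \<open>Let \<open>q\<close> collect the zeros of \<open>X\<close> in the disk. Then
  \<open>crefl q\<close> times \<open>q Y / X\<close> lies in the disk algebra, and on the circle it
  is \<open>xi ^ degree q\<close> times the real function |q|^2 u; this symmetry forces it to be a
  polynomial.\<close>

theorem rational_from_disk_quotient:
 assumes X: "continuous_on (cball 0 1) X" "X holomorphic_on ball 0 1"
  and Y: "continuous_on (cball 0 1) Y" "Y holomorphic_on ball 0 1"
  and Xnz: "\<And>xi. cmod xi = 1 \<Longrightarrow> X xi \<noteq> 0"
  and u: "\<And>xi. cmod xi = 1 \<Longrightarrow> X xi * complex_of_real (u xi) = Y xi"
 shows "\<exists>A B. B \<noteq> 0 \<and> (\<forall>xi. cmod xi = 1 \<longrightarrow> poly B xi \<noteq> 0 \<and> complex_of_real (u xi) = poly A xi / poly B xi)"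
proof -
 define Z where "Z = {z \<in> cball 0 1. X z = 0}"
 have nc: "\<exists>z\<in>ball 0 1. X z \<noteq> 0"
 proof (rule ccontr)
  assume "\<not> ?thesis"
  then have "X 1 = 0" by (intro continuous_on_cball_eq_from_ball[OF X(1), of "\<lambda>_. 0" 1]) auto
  then show False using Xnz[of 1] by simp
 qed
 have Zb: "Z \<subseteq> ball 0 1" using Xnz unfolding Z_def by (force simp: le_less)
 have "compact Z"
 proof -
  have "closedin (top_of_set (cball 0 1)) (cball 0 1 \<inter> X -` {0})"
   by (rule continuous_closedin_preimage[OF X(1) closed_singleton])
  moreover have "cball 0 1 \<inter> X -` {0} = Z" by (auto simp: Z_def)
  ultimately have "closed Z" using closedin_closed_trans closed_cball by metis
  then show ?thesis using bounded_subset[OF bounded_ball Zb] compact_eq_bounded_closed by blast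
 qed
 have Zeq: "Z = {z \<in> ball 0 1. X z = 0}" using Zb by (auto simp: Z_def)
 have finZ: "finite {z \<in> ball 0 1. X z = 0}"
 proof (cases "\<exists>z\<in>ball 0 1. X z = 0")
  case True
  have "\<not> X constant_on ball 0 1"
  proof
   assume "X constant_on ball 0 1"
   then obtain c where "\<And>z. z \<in> ball 0 1 \<Longrightarrow> X z = c" unfolding constant_on_def by blast
   then show False using True nc by auto
  qed
  from holomorphic_compact_finite_zeros[OF X(2) open_ball connected_ball \<open>compact Z\<close> Zb this]
  show ?thesis by (rule rev_finite_subset) (auto simp: Zeq)
 next
  case False
  then have "{z \<in> ball 0 1. X z = 0} = {}" by blast
  then show ?thesis by (metis finite.emptyI)
 qed
 obtain q X0 where q: "q \<noteq> 0" "\<And>z. poly q z = 0 \<longleftrightarrow> z \<in> ball 0 1 \<and> X z = 0" "X0 holomorphic_on ball 0 1"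
   "\<And>z. z \<in> ball 0 1 \<Longrightarrow> X0 z \<noteq> 0 \<and> X z = poly q z * X0 z"
  using factor_out_zeros[OF X(2) open_ball connected_ball finZ nc] by blast
 have qs: "poly q xi \<noteq> 0" if "cmod xi = 1" for xi using q(2)[of xi] that by auto
 \<comment> \<open>The first formula has a zero-free denominator in the disk, the second one extends
   to the circle, where \<open>X\<close> does not vanish. They agree off the zeros of
   \<open>X\<close>, so the pieces can be glued.\<close>
 define F where "F = (\<lambda>z. if z \<in> ball 0 1 then poly (crefl q) z * Y z / X0 z else poly (crefl q) z * poly q z * Y z / X z)"
 have F1: "F holomorphic_on ball 0 1"
  by (rule holomorphic_transform[of "\<lambda>z. poly (crefl q) z * Y z / X0 z"])
   (use q(3,4) Y in \<open>auto intro!: holomorphic_intros simp: F_def\<close>)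
 have "continuous_on (cball 0 1 - Z) F"
 proof (rule continuous_on_eq)
  show "continuous_on (cball 0 1 - Z) (\<lambda>z. poly (crefl q) z * poly q z * Y z / X z)"
   by (intro continuous_intros continuous_on_subset[OF X(1)] continuous_on_subset[OF Y(1)]) (auto simp: Z_def)
  fix z assume z: "z \<in> cball 0 1 - Z"
  show "poly (crefl q) z * poly q z * Y z / X z = F z"
  proof (cases "z \<in> ball 0 1")
   case True
   then have "poly q z \<noteq> 0" using q(2)[of z] z by (auto simp: Z_def)
   then show ?thesis using q(4)[OF True] True by (simp add: F_def)
  qed (simp add: F_def)
 qed
 moreover have "continuous_on (ball 0 1) F" using F1 by (rule holomorphic_on_imp_continuous_on)
 ultimately have "continuous_on (ball 0 1 \<union> (cball 0 1 - Z)) F"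
 proof (intro continuous_on_Un_local_open)
  have eq: "ball 0 1 \<union> (cball 0 1 - Z) = cball 0 1" using ball_subset_cball Zb by auto
  show "openin (top_of_set (ball 0 1 \<union> (cball 0 1 - Z))) (ball 0 1)"
   unfolding eq by (rule open_subset) auto
  have "openin (top_of_set (cball 0 1)) (cball 0 1 \<inter> (- Z))"
   using \<open>compact Z\<close> compact_imp_closed by (intro openin_open_Int) auto
  then show "openin (top_of_set (ball 0 1 \<union> (cball 0 1 - Z))) (cball 0 1 - Z)"
   unfolding eq by (simp add: Diff_eq)
 qed auto
 moreover have "ball 0 1 \<union> (cball 0 1 - Z) = cball 0 1" using ball_subset_cball Zb by auto
 ultimately have F2: "continuous_on (cball 0 1) F" by simp
 have Fs: "F xi = xi ^ degree q * of_real ((cmod (poly q xi))\<^sup>2 * u xi)" if xi: "cmod xi = 1" for xi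
 proof -
  have "F xi = poly (crefl q) xi * poly q xi * Y xi / X xi" using xi by (simp add: F_def)
  also have "Y xi / X xi = of_real (u xi)" using u[OF xi] Xnz[OF xi] by (simp add: field_simps)
  then have "poly (crefl q) xi * poly q xi * Y xi / X xi = poly (crefl q) xi * poly q xi * of_real (u xi)"
   by (metis times_divide_eq_right)
  finally show ?thesis unfolding poly_crefl_sphere[OF xi] using complex_norm_square[of "poly q xi"] by simp
 qed
 have "cnj (F xi) * xi ^ (2 * degree q) = F xi" if xi: "cmod xi = 1" for xi
 proof -
  have "cnj xi ^ degree q * xi ^ degree q = 1"
   using cnj_sphere[OF xi] by (simp add: mult.commute flip: power_mult_distrib)
  then have "cnj xi ^ degree q * xi ^ (2 * degree q) = xi ^ degree q"
   by (simp add: mult_2 power_add flip: mult.assoc)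
  then show ?thesis unfolding Fs[OF xi] by (simp add: mult_ac)
 qed
 from disk_algebra_real_imp_poly[OF F2 F1 this]
 obtain P where P: "\<And>z. z \<in> ball 0 1 \<Longrightarrow> F z = poly P z" by blast
 have PF: "F z = poly P z" if "z \<in> cball 0 1" for z
  by (rule continuous_on_cball_eq_from_ball[OF F2 _ P that]) (auto intro!: continuous_intros)
 show ?thesis
 proof (rule exI[of _ P], rule exI[of _ "crefl q * q"], intro conjI allI impI)
  show "crefl q * q \<noteq> 0" using q(1) crefl_nz by auto
  fix xi :: complex assume xi: "cmod xi = 1"
  then have ne: "xi \<noteq> 0" by auto
  show nz: "poly (crefl q * q) xi \<noteq> 0" using qs[OF xi] ne by (simp add: poly_crefl_sphere[OF xi])
  have "poly P xi = F xi" using PF[of xi] xi by simp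
  also have "\<dots> = poly (crefl q * q) xi * of_real (u xi)"
   unfolding Fs[OF xi] using complex_norm_square[of "poly q xi"] by (simp add: poly_crefl_sphere[OF xi])
  finally show "complex_of_real (u xi) = poly P xi / poly (crefl q * q) xi" using nz by (simp add: field_simps)
 qed
qed

section \<open>The Schwarz integral and rational exponents of the outer factor\<close>

definition schw :: "(complex \<Rightarrow> real) \<Rightarrow> complex \<Rightarrow> complex" where
 "schw u z = cmean (\<lambda>xi. (xi + z) / (xi - z) * of_real (u xi))"

definition rational_on_circle :: "(complex \<Rightarrow> real) \<Rightarrow> bool" where
 "rational_on_circle u \<longleftrightarrow> (\<exists>A B. B \<noteq> 0 \<and>
   (\<forall>xi. cmod xi = 1 \<longrightarrow> poly B xi \<noteq> 0 \<and> complex_of_real (u xi) = poly A xi / poly B xi))"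

lemma schw_eq_contour_integral:
 "contour_integral (circlepath 0 1) (\<lambda>xi. (xi + z) / (xi - z) * of_real (u xi) / xi) / (2 * of_real pi * \<i>) = schw u z"
proof -
 have "cmean (\<lambda>xi. (xi + z) / (xi - z) * of_real (u xi) / xi * xi) = schw u z"
  unfolding schw_def by (rule cmean_cong) auto
 then show ?thesis unfolding contour_integral_circ by simp
qed

lemma schw_eq_cau:
 assumes u: "continuous_on (sphere 0 1) u" and z: "cmod z < 1"
 shows "schw u z = 2 * cau (\<lambda>xi. of_real (u xi)) z - cau (\<lambda>xi. of_real (u xi)) 0"
proof -
 have v: "continuous_on (sphere 0 1) (\<lambda>xi. complex_of_real (u xi))" by (intro continuous_intros u)
 have "schw u z = cmean (\<lambda>xi. 2 * (of_real (u xi) * xi / (xi - z)) - of_real (u xi) * xi / (xi - 0))"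
  unfolding schw_def
 proof (rule cmean_cong)
  fix xi :: complex assume "cmod xi = 1"
  then have ne: "xi \<noteq> 0" "xi - z \<noteq> 0" using z by auto
  have "(xi + z) / (xi - z) = 2 * (xi / (xi - z)) - 1" using ne by (simp add: field_simps)
  then show "(xi + z) / (xi - z) * of_real (u xi) = 2 * (of_real (u xi) * xi / (xi - z)) - of_real (u xi) * xi / (xi - 0)"
   using ne by (simp only:) (simp add: algebra_simps)
 qed
 also have "\<dots> = 2 * cau (\<lambda>xi. of_real (u xi)) z - cau (\<lambda>xi. of_real (u xi)) 0"
  unfolding cau_def cmean_cmult[symmetric]
  using z by (intro cmean_diff continuous_on_mult_left cau_kernel_cont v) auto
 finally show ?thesis .
qed

lemma schw_continuous:
 assumes u: "continuous_on (sphere 0 1) u"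
 shows "continuous_on (ball 0 1) (schw u)"
proof -
 have v: "continuous_on (sphere 0 1) (\<lambda>xi. complex_of_real (u xi))" by (intro continuous_intros u)
 have "continuous_on (ball 0 1) (\<lambda>z. 2 * cau (\<lambda>xi. of_real (u xi)) z - cau (\<lambda>xi. of_real (u xi)) 0)"
  by (intro continuous_intros cau_continuous v)
 then show ?thesis by (rule continuous_on_eq) (simp add: schw_eq_cau[OF u])
qed

text \<open>Reflection in the circle turns the Schwarz kernel into minus its conjugate. This reduces
  the exterior of the disk, where the contour is reversed, to the interior.\<close>

lemma schw_reflect:
 assumes "z \<noteq> 0"
 shows "- schw u z = cnj (schw u (inverse (cnj z)))"
proof -
 have "cnj (schw u (inverse (cnj z))) = cmean (\<lambda>xi. (- 1) * ((xi + z) / (xi - z) * of_real (u xi)))"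
  unfolding schw_def cmean_cnj[symmetric]
 proof (rule cmean_cong)
  fix xi :: complex assume x: "cmod xi = 1"
  then have ne: "xi \<noteq> 0" by auto
  have "(inverse xi + inverse z) / (inverse xi - inverse z) = - ((xi + z) / (xi - z))"
  proof (cases "xi = z")
   case False
   then have "inverse xi \<noteq> inverse z" by simp
   then show ?thesis using ne assms False by (simp add: divide_simps) (simp add: algebra_simps)
  qed auto
  moreover have "cnj ((xi + inverse (cnj z)) / (xi - inverse (cnj z)) * of_real (u xi))
    = (inverse xi + inverse z) / (inverse xi - inverse z) * of_real (u xi)"
   by (simp add: cnj_eq_inverse[OF x])
  ultimately show "cnj ((xi + inverse (cnj z)) / (xi - inverse (cnj z)) * of_real (u xi)) = (- 1) * ((xi + z) / (xi - z) * of_real (u xi))"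
   by (simp only:) simp
 qed
 then show ?thesis unfolding cmean_cmult schw_def by simp
qed

text \<open>The difference takes values in the discrete set of multiples of 2 pi i, so it is
  constant on a connected set. Hence an exponential determines its continuous exponent up to a
  constant, which does not affect rationality.\<close>

lemma exp_eq_imp_diff_const:
 assumes S: "connected S" and f: "continuous_on S f" and g: "continuous_on S g"
  and eq: "\<And>z. z \<in> S \<Longrightarrow> exp (f z) = exp (g z :: complex)"
 obtains c where "\<And>z. z \<in> S \<Longrightarrow> f z = g z + c"
proof -
 have "(\<lambda>z. f z - g z) constant_on S"
 proof (rule continuous_discrete_range_constant[OF S])
  show "continuous_on S (\<lambda>z. f z - g z)" by (intro continuous_intros f g)
  fix x assume x: "x \<in> S"
  obtain n :: int where n: "f x = g x + (of_int (2 * n) * pi) * \<i>" using eq[OF x] exp_eq by blast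
  have "2 * pi \<le> cmod (f y - g y - (f x - g x))" if y: "y \<in> S" "f y - g y \<noteq> f x - g x" for y
  proof -
   obtain m :: int where m: "f y = g y + (of_int (2 * m) * pi) * \<i>" using eq[OF y(1)] exp_eq by blast
   have "f y - g y - (f x - g x) = of_real (2 * pi * of_int (m - n)) * \<i>"
    unfolding n m by (simp add: algebra_simps)
   then have "cmod (f y - g y - (f x - g x)) = 2 * pi * \<bar>of_int (m - n)\<bar>"
    by (simp only: norm_mult norm_of_real norm_ii) (simp add: abs_mult)
   moreover have "m \<noteq> n" using y(2) n m by auto
   then have "\<bar>of_int (m - n)\<bar> \<ge> (1::real)" by linarith
   ultimately show ?thesis by (simp add: mult_le_cancel_left1)
  qed
  then show "\<exists>e>0. \<forall>y. y \<in> S \<and> f y - g y \<noteq> f x - g x \<longrightarrow> e \<le> cmod (f y - g y - (f x - g x))"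
   by (intro exI[of _ "2 * pi"]) auto
 qed
 then show ?thesis using that unfolding constant_on_def by (metis add.commute diff_add_cancel)
qed

lemma rational_on_circle_from_schw:
 assumes u: "continuous_on (sphere 0 1) u" and q: "q \<noteq> 0"
  and eq: "\<And>z. z \<in> ball 0 1 \<Longrightarrow> poly q z * schw u z = poly p z"
 shows "rational_on_circle u"
 unfolding rational_on_circle_def
proof (rule rational_from_cauchy[OF u q])
 fix z :: complex assume z: "z \<in> ball 0 1"
 define c where "c = cau (\<lambda>xi. of_real (u xi)) 0"
 have "cau (\<lambda>xi. of_real (u xi)) z = (schw u z + c) / 2"
  using schw_eq_cau[OF u, of z] z by (simp add: c_def)
 then have E: "poly q z * cau (\<lambda>xi. of_real (u xi)) z = (poly q z * schw u z + poly q z * c) / 2"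
  by (simp only:) (simp add: algebra_simps)
 show "poly q z * cau (\<lambda>xi. of_real (u xi)) z = poly (smult (1/2) (p + smult c q)) z"
  unfolding E eq[OF z] by (simp add: algebra_simps add_divide_distrib)
qed

lemma schw_from_rational_on_circle:
 assumes u: "continuous_on (sphere 0 1) u" and r: "rational_on_circle u"
 obtains p q where "q \<noteq> 0" "\<And>z. z \<in> ball 0 1 \<Longrightarrow> poly q z \<noteq> 0" "\<And>z. z \<in> ball 0 1 \<Longrightarrow> schw u z / 2 = poly p z / poly q z"
proof -
 obtain A B where AB: "B \<noteq> 0" "\<And>xi. cmod xi = 1 \<Longrightarrow> poly B xi \<noteq> 0"
   "\<And>xi. cmod xi = 1 \<Longrightarrow> complex_of_real (u xi) = poly A xi / poly B xi"
  using r unfolding rational_on_circle_def by blast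
 obtain p q where pq: "q \<noteq> 0" "\<And>z. z \<in> ball 0 1 \<Longrightarrow> poly q z \<noteq> 0"
   "\<And>z. z \<in> ball 0 1 \<Longrightarrow> cau (\<lambda>xi. of_real (u xi)) z = poly p z / poly q z"
  using cauchy_from_rational[OF AB] by blast
 define c where "c = cau (\<lambda>xi. of_real (u xi)) 0"
 show ?thesis
 proof (rule that[of q "p - smult (c / 2) q"])
  fix z :: complex assume z: "z \<in> ball 0 1"
  have "schw u z / 2 = poly p z / poly q z - c / 2"
   using schw_eq_cau[OF u, of z] pq(3)[OF z] z by (simp add: c_def diff_divide_distrib)
  then show "schw u z / 2 = poly (p - smult (c / 2) q) z / poly q z"
   using pq(2)[OF z] by (simp add: diff_divide_distrib)
 qed (use pq in auto)
qed

theorem disk_rational_iff: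
 assumes u: "continuous_on (sphere 0 1) u"
 shows "(\<exists>p q. q \<noteq> 0 \<and> (\<forall>z\<in>ball 0 1. poly q z \<noteq> 0) \<and> (\<forall>z\<in>ball 0 1. exp (schw u z / 2) = exp (poly p z / poly q z)))
   \<longleftrightarrow> rational_on_circle u"
proof
 assume "\<exists>p q. q \<noteq> 0 \<and> (\<forall>z\<in>ball 0 1. poly q z \<noteq> 0) \<and> (\<forall>z\<in>ball 0 1. exp (schw u z / 2) = exp (poly p z / poly q z))"
 then obtain p q where pq: "q \<noteq> 0" "\<And>z. z \<in> ball 0 1 \<Longrightarrow> poly q z \<noteq> 0"
   "\<And>z. z \<in> ball 0 1 \<Longrightarrow> exp (schw u z / 2) = exp (poly p z / poly q z)" by blast
 have c1: "continuous_on (ball 0 1) (\<lambda>z. schw u z / 2)" by (intro continuous_intros schw_continuous u) auto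
 have c2: "continuous_on (ball 0 1) (\<lambda>z. poly p z / poly q z)" using pq(2) by (intro continuous_intros) auto
 obtain c where c: "\<And>z. z \<in> ball 0 1 \<Longrightarrow> schw u z / 2 = poly p z / poly q z + c"
  by (rule exp_eq_imp_diff_const[OF connected_ball c1 c2 pq(3)]) auto
 show "rational_on_circle u"
 proof (rule rational_on_circle_from_schw[OF u pq(1)])
  fix z :: complex assume z: "z \<in> ball 0 1"
  show "poly q z * schw u z = poly (smult 2 (p + smult c q)) z"
   using c[OF z] pq(2)[OF z] by (simp add: field_simps)
 qed
next
 assume rat: "rational_on_circle u"
 obtain p q where "q \<noteq> 0" "\<And>z. z \<in> ball 0 1 \<Longrightarrow> poly q z \<noteq> 0" "\<And>z. z \<in> ball 0 1 \<Longrightarrow> schw u z / 2 = poly p z / poly q z"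
  by (rule schw_from_rational_on_circle[OF u rat], rule that, assumption+)
 note pq = this
 show "\<exists>p q. q \<noteq> 0 \<and> (\<forall>z\<in>ball 0 1. poly q z \<noteq> 0) \<and> (\<forall>z\<in>ball 0 1. exp (schw u z / 2) = exp (poly p z / poly q z))"
  by (rule exI[of _ p], rule exI[of _ q]) (use pq in auto)
qed

lemma poly_crefl_scaled:
 assumes "z \<noteq> 0"
 shows "poly (crefl p * monom 1 (degree q)) z = z ^ (degree p + degree q) * cnj (poly p (inverse (cnj z)))"
 using assms by (simp add: poly_crefl poly_monom power_add)

text \<open>Reflecting \<open>z\<close> to 1 / cnj z carries the quotient \<open>p / q\<close> on
  one side of the circle to a quotient of reciprocal polynomials on the other, and
  \<open>schw_reflect\<close> does the same for the Schwarz integral.\<close>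

theorem exterior_rational_iff:
 assumes u: "continuous_on (sphere 0 1) u"
 shows "(\<exists>p q. q \<noteq> 0 \<and> (\<forall>z\<in>- cball 0 1. poly q z \<noteq> 0) \<and> (\<forall>z\<in>- cball 0 1. exp (- schw u z / 2) = exp (poly p z / poly q z)))
   \<longleftrightarrow> rational_on_circle u"
proof
 assume "\<exists>p q. q \<noteq> 0 \<and> (\<forall>z\<in>- cball 0 1. poly q z \<noteq> 0) \<and> (\<forall>z\<in>- cball 0 1. exp (- schw u z / 2) = exp (poly p z / poly q z))"
 then obtain p q where pq: "q \<noteq> 0" "\<And>z. z \<in> - cball 0 1 \<Longrightarrow> poly q z \<noteq> 0"
   "\<And>z. z \<in> - cball 0 1 \<Longrightarrow> exp (- schw u z / 2) = exp (poly p z / poly q z)" by blast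
 have conn: "connected (- cball (0::complex) 1)" by (intro connected_complement_bounded_convex) auto
 have inv_in: "inverse (cnj z) \<in> ball 0 1" if "z \<in> - cball 0 1" for z
 proof -
  have "1 < cmod z" using that by auto
  then show ?thesis by (simp add: norm_inverse inverse_less_1_iff)
 qed
 have "continuous_on (- cball 0 1) (\<lambda>z. cnj (schw u (inverse (cnj z))))"
  by (intro continuous_intros continuous_on_compose2[OF schw_continuous[OF u]]) (use inv_in in auto)
 then have "continuous_on (- cball 0 1) (\<lambda>z. cnj (schw u (inverse (cnj z))) / 2)"
  by (rule continuous_on_divide[OF _ continuous_on_const]) auto
 then have c1: "continuous_on (- cball 0 1) (\<lambda>z. - schw u z / 2)"
 proof (rule continuous_on_eq)
  fix z :: complex assume "z \<in> - cball 0 1"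
  then have "z \<noteq> 0" by auto
  then show "cnj (schw u (inverse (cnj z))) / 2 = - schw u z / 2" using schw_reflect[of z u] by simp
 qed
 have c2: "continuous_on (- cball 0 1) (\<lambda>z. poly p z / poly q z)" using pq(2) by (intro continuous_intros) auto
 obtain c where c: "\<And>z. z \<in> - cball 0 1 \<Longrightarrow> - schw u z / 2 = poly p z / poly q z + c"
  by (rule exp_eq_imp_diff_const[OF conn c1 c2 pq(3)]) auto
 \<comment> \<open>The powers are crossed, \<open>degree p\<close> with \<open>crefl q\<close> and
   \<open>degree q\<close> with \<open>crefl p\<close>, so that numerator and denominator carry the
   same factor \<open>z ^ (degree p + degree q)\<close>.\<close>
 define q' where "q' = crefl q * monom 1 (degree p)"
 define p' where "p' = smult 2 (crefl p * monom 1 (degree q) + smult (cnj c) q')"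
 have q': "q' \<noteq> 0" using crefl_nz[OF pq(1)] by (auto simp: q'_def)
 have eq: "poly q' z * schw u z = poly p' z" if z: "z \<in> ball 0 1" "z \<noteq> 0" for z
 proof -
  define w where "w = inverse (cnj z)"
  have w: "w \<in> - cball 0 1" "inverse (cnj w) = z" "w \<noteq> 0"
   using z by (auto simp: w_def norm_inverse one_less_inverse_iff not_le)
  have "cnj (schw u z) = - schw u w" using schw_reflect[OF w(3), of u] w(2) by simp
  then have "schw u z = cnj (- schw u w)" by (metis complex_cnj_cnj)
  also have "- schw u w = 2 * (poly p w / poly q w + c)" using c[OF w(1)] by (simp add: field_simps)
  finally have s: "schw u z = 2 * (cnj (poly p w) / cnj (poly q w) + cnj c)" by simp
  have nz: "cnj (poly q w) \<noteq> 0" using pq(2)[OF w(1)] by simp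
  have "poly q' z = z ^ (degree q + degree p) * cnj (poly q w)" "poly (crefl p * monom 1 (degree q)) z = z ^ (degree q + degree p) * cnj (poly p w)"
   using poly_crefl_scaled[OF z(2), of q p] poly_crefl_scaled[OF z(2), of p q]
   by (simp_all only: q'_def w_def add.commute[of "degree p" "degree q"])
  then show ?thesis unfolding s p'_def using nz by (simp add: field_simps)
 qed
 \<comment> \<open>The origin is the reflection of infinity, which is not in the finite exterior;
   its value is obtained by continuity.\<close>
 have "poly q' z * schw u z = poly p' z" if z: "z \<in> ball 0 1" for z
 proof (cases "z = 0")
  case True
  have c: "isCont (\<lambda>z. poly q' z * schw u z) 0"
   using schw_continuous[OF u] by (intro continuous_intros) (auto simp: continuous_on_eq_continuous_at)
  have "eventually (\<lambda>z. z \<in> ball 0 1 - {0}) (at (0::complex))" by (intro eventually_at_in_open) auto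
  then have "eventually (\<lambda>z. poly p' z = poly q' z * schw u z) (at 0)"
   by eventually_elim (use eq in auto)
  moreover have "(poly p' \<longlongrightarrow> poly p' 0) (at 0)" using poly_isCont[where p=p' and x=0] by (simp add: isCont_def)
  ultimately have "((\<lambda>z. poly q' z * schw u z) \<longlongrightarrow> poly p' 0) (at 0)"
   by (rule Lim_transform_eventually[rotated])
  then show ?thesis using c True unfolding isCont_def by (blast intro: LIM_unique)
 qed (use eq z in auto)
 then show "rational_on_circle u" by (rule rational_on_circle_from_schw[OF u q'])
next
 assume rat: "rational_on_circle u"
 obtain p q where pq: "q \<noteq> 0" "\<And>z. z \<in> ball 0 1 \<Longrightarrow> poly q z \<noteq> 0"
   "\<And>z. z \<in> ball 0 1 \<Longrightarrow> schw u z / 2 = poly p z / poly q z"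
  by (rule schw_from_rational_on_circle[OF u rat], rule that, assumption+)
 show "\<exists>p q. q \<noteq> 0 \<and> (\<forall>z\<in>- cball 0 1. poly q z \<noteq> 0) \<and> (\<forall>z\<in>- cball 0 1. exp (- schw u z / 2) = exp (poly p z / poly q z))"
 proof (rule exI[of _ "crefl p * monom 1 (degree q)"], rule exI[of _ "crefl q * monom 1 (degree p)"], intro conjI ballI)
  show "crefl q * monom 1 (degree p) \<noteq> 0" using crefl_nz[OF pq(1)] by auto
  fix z :: complex assume z: "z \<in> - cball 0 1"
  then have z1: "1 < cmod z" "z \<noteq> 0" by auto
  have w: "inverse (cnj z) \<in> ball 0 1" using z1 by (simp add: norm_inverse inverse_less_1_iff)
  have P: "poly (crefl p * monom 1 (degree q)) z = z ^ (degree q + degree p) * cnj (poly p (inverse (cnj z)))"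
    "poly (crefl q * monom 1 (degree p)) z = z ^ (degree q + degree p) * cnj (poly q (inverse (cnj z)))"
   using poly_crefl_scaled[OF z1(2), of q p] poly_crefl_scaled[OF z1(2), of p q]
   by (simp_all only: add.commute[of "degree p" "degree q"])
  show "poly (crefl q * monom 1 (degree p)) z \<noteq> 0" unfolding P using pq(2)[OF w] z1 by simp
  have "- schw u z / 2 = cnj (schw u (inverse (cnj z)) / 2)"
   using schw_reflect[OF z1(2), of u] by simp
  also have "\<dots> = cnj (poly p (inverse (cnj z))) / cnj (poly q (inverse (cnj z)))" unfolding pq(3)[OF w] by simp
  also have "\<dots> = poly (crefl p * monom 1 (degree q)) z / poly (crefl q * monom 1 (degree p)) z"
   unfolding P using z1 by simp
  finally show "exp (- schw u z / 2) = exp (poly (crefl p * monom 1 (degree q)) z / poly (crefl q * monom 1 (degree p)) z)" by simp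
 qed
qed

section \<open>Integrability in the plane, logarithmic primitives and removable
  singularities\<close>

lemma nn_integral_inverse_one_plus_square: "(\<integral>\<^sup>+x. ennreal (inverse (1 + x\<^sup>2)) \<partial>lborel) < \<infinity>"
proof -
 have half: "(\<integral>\<^sup>+x. ennreal (inverse (1 + x\<^sup>2)) * indicator {0..} x \<partial>lborel) = ennreal (pi / 2 - arctan 0)"
  by (rule nn_integral_FTC_atLeast[where F=arctan and T="pi/2"]) (simp_all add: DERIV_arctan tendsto_arctan_at_top)
 have half': "(\<integral>\<^sup>+x. ennreal (inverse (1 + x\<^sup>2)) * indicator {0..} (- x) \<partial>lborel) = ennreal (pi / 2 - arctan 0)"
  using nn_integral_real_affine[of "\<lambda>x. ennreal (inverse (1 + x\<^sup>2)) * indicator {0..} x" "-1" 0] half by simp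
 have "(\<integral>\<^sup>+x. ennreal (inverse (1 + x\<^sup>2)) \<partial>lborel)
   \<le> (\<integral>\<^sup>+x. ennreal (inverse (1 + x\<^sup>2)) * indicator {0..} x + ennreal (inverse (1 + x\<^sup>2)) * indicator {0..} (- x) \<partial>lborel)"
  by (intro nn_integral_mono) (auto simp: indicator_def)
 also have "\<dots> = ennreal (pi / 2) + ennreal (pi / 2)"
  by (subst nn_integral_add) (use half half' in auto)
 finally show ?thesis by (rule le_less_trans) (simp add: ennreal_plus[symmetric] del: ennreal_plus)
qed

text \<open>For |w| >= d the product (1 + x^2) (1 + y^2) is at most (1 + |w|^2)^2 <= (1 / d^2 + 1)^2
  |w|^4, so the quartic decay is dominated by a product of two integrable functions of one
  variable.\<close>

lemma integrable_inverse_quartic: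
 assumes d: "d > 0"
 shows "integrable lborel (\<lambda>w::complex. indicator (- ball b d) w / cmod (w - b) ^ 4)"
proof -
 have [measurable]: "- ball b d \<in> sets borel" "- ball 0 d \<in> sets borel" by auto
 define g where "g = (\<lambda>w::complex. indicator (- ball 0 d) w / cmod w ^ 4)"
 have gm [measurable]: "g \<in> borel_measurable borel" unfolding g_def by measurable
 define c where "c = (1 / d\<^sup>2 + 1)\<^sup>2"
 have c0: "c \<ge> 0" by (simp add: c_def)
 have le: "g (Complex x y) \<le> c * (inverse (1 + x\<^sup>2) * inverse (1 + y\<^sup>2))" for x y
 proof (cases "Complex x y \<in> ball 0 d")
  case False
  define n where "n = (cmod (Complex x y))\<^sup>2"
  have n: "n = x\<^sup>2 + y\<^sup>2" by (simp add: n_def cmod_def)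
  have dn: "d\<^sup>2 \<le> n" using False d unfolding n_def by (intro power_mono) auto
  then have n0: "n > 0" using d by (meson less_le_trans zero_less_power)
  have "1 + n \<le> (1 / d\<^sup>2 + 1) * n" using dn d by (simp add: field_simps)
  then have "(1 + n)\<^sup>2 \<le> ((1 / d\<^sup>2 + 1) * n)\<^sup>2" using n0 by (intro power_mono) auto
  then have 1: "(1 + n)\<^sup>2 \<le> c * n\<^sup>2" by (simp add: c_def power_mult_distrib)
  have "(1 + x\<^sup>2) * (1 + y\<^sup>2) \<le> (1 + n) * (1 + n)" unfolding n by (intro mult_mono) auto
  then have 2: "(1 + x\<^sup>2) * (1 + y\<^sup>2) \<le> c * n\<^sup>2" using 1 by (simp add: power2_eq_square)
  have pos: "(1 + x\<^sup>2) * (1 + y\<^sup>2) > 0" by (intro mult_pos_pos add_pos_nonneg) auto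
  have "inverse (n\<^sup>2) \<le> c * inverse ((1 + x\<^sup>2) * (1 + y\<^sup>2))"
   using 2 pos n0 by (simp add: field_simps)
  moreover have "g (Complex x y) = inverse (n\<^sup>2)"
   using False by (simp add: g_def n_def divide_inverse flip: power_mult)
  ultimately show ?thesis by (simp add: inverse_mult_distrib)
 qed (auto simp: g_def c0)
 have "(\<integral>\<^sup>+w. ennreal (g w) \<partial>lborel) = (\<integral>\<^sup>+x. \<integral>\<^sup>+y. ennreal (g (Complex x y)) \<partial>lborel \<partial>lborel)"
  by (rule nn_integral_complex) auto
 also have "\<dots> \<le> (\<integral>\<^sup>+x. \<integral>\<^sup>+y. ennreal c * ennreal (inverse (1 + x\<^sup>2)) * ennreal (inverse (1 + y\<^sup>2)) \<partial>lborel \<partial>lborel)"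
 proof (intro nn_integral_mono)
  fix x y :: real
  have "ennreal (g (Complex x y)) \<le> ennreal (c * inverse (1 + x\<^sup>2) * inverse (1 + y\<^sup>2))"
   using le[of x y] by (intro ennreal_leI) (simp add: mult.assoc)
  also have "\<dots> = ennreal c * ennreal (inverse (1 + x\<^sup>2)) * ennreal (inverse (1 + y\<^sup>2))"
   using c0 by (simp add: ennreal_mult')
  finally show "ennreal (g (Complex x y)) \<le> \<dots>" .
 qed
 also have "\<dots> = ennreal c * (\<integral>\<^sup>+x. ennreal (inverse (1 + x\<^sup>2)) \<partial>lborel) * (\<integral>\<^sup>+x. ennreal (inverse (1 + x\<^sup>2)) \<partial>lborel)"
  by (simp add: nn_integral_cmult nn_integral_multc)
 also have "\<dots> < \<infinity>"
  using nn_integral_inverse_one_plus_square by (auto simp: ennreal_mult_less_top)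
 finally have "(\<integral>\<^sup>+w. ennreal (g w) \<partial>lborel) < \<infinity>" .
 then have "(\<integral>\<^sup>+w. ennreal (g (- b + w)) \<partial>lborel) < \<infinity>"
  using nn_integral_distr[of "(+) (- b)" lborel borel "\<lambda>w. ennreal (g w)"] by (simp add: lborel_distr_plus)
 moreover have eq: "g (- b + w) = indicator (- ball b d) w / cmod (w - b) ^ 4" for w
  by (auto simp: g_def indicator_def dist_norm norm_minus_commute)
 ultimately have "(\<integral>\<^sup>+w. ennreal (indicator (- ball b d) w / cmod (w - b) ^ 4) \<partial>lborel) < \<infinity>" by simp
 then show ?thesis
  by (intro integrableI_bounded) auto
qed

text \<open>As \<open>G\<close> is holomorphic, the d-bar derivative falls on the logarithm alone
  and equals \<open>k\<close>; the normalized transform of \<open>k\<close> cancels it. The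
  derivative \<open>D\<close> is written as a real-linear map because the sum is formed from a
  function that is not holomorphic.\<close>

lemma log_primitive_holomorphic:
 assumes U: "open U" "0 \<notin> U" and G: "G holomorphic_on U"
  and k: "integrable lborel k" and kG: "\<And>w. w \<in> U \<Longrightarrow> k w = G w / cnj w"
 shows "(\<lambda>a. G a * of_real (ln ((cmod a)\<^sup>2)) + cauchy_transform k a / of_real pi) holomorphic_on U"
proof -
 define D where "D = (\<lambda>w h. G w * of_real (2 * (w \<bullet> h) / (cmod w)\<^sup>2) + deriv G w * h * of_real (ln ((cmod w)\<^sup>2)))"
 show ?thesis
 proof (rule cauchy_transform_dbar_holomorphic[OF U(1), where D=D])
  fix w assume w: "w \<in> U"
  then have w0: "w \<noteq> 0" using U(2) by auto
  have "(G has_field_derivative deriv G w) (at w)" using holomorphic_derivI[OF G U(1) w] .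
  then have 1: "(G has_derivative (\<lambda>h. deriv G w * h)) (at w)" by (simp add: has_field_derivative_def)
  have n: "((\<lambda>w. (cmod w)\<^sup>2) has_derivative (\<lambda>h. 2 * (w \<bullet> h))) (at w)"
   unfolding power2_norm_eq_inner by (auto intro!: derivative_eq_intros simp: inner_commute)
  have "((\<lambda>w. ln ((cmod w)\<^sup>2)) has_derivative (\<lambda>h. 2 * (w \<bullet> h) * inverse ((cmod w)\<^sup>2))) (at w)"
   by (rule has_derivative_ln[OF _ n]) (use w0 in auto)
  then have 2: "((\<lambda>w. complex_of_real (ln ((cmod w)\<^sup>2))) has_derivative (\<lambda>h. of_real (2 * (w \<bullet> h) / (cmod w)\<^sup>2))) (at w)"
   unfolding divide_inverse by (rule has_derivative_of_real)
  show "((\<lambda>a. G a * of_real (ln ((cmod a)\<^sup>2))) has_derivative D w) (at w)"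
   unfolding D_def by (rule has_derivative_mult[OF 1 2])
  have "D w 1 + \<i> * D w \<i> = G w * (2 * (of_real (Re w) + \<i> * of_real (Im w)) / of_real ((cmod w)\<^sup>2))"
   by (simp add: D_def inner_complex_def algebra_simps add_divide_distrib)
  also have "\<dots> = G w * (2 * w / (w * cnj w))"
   by (simp only: complex_eq[symmetric] complex_norm_square)
  also have "\<dots> = 2 * (G w / cnj w)" using w0 by simp
  finally show "k w = (D w 1 + \<i> * D w \<i>) / 2" using kG[OF w] by simp
 next
  have c: "continuous_on U G" "continuous_on U (deriv G)"
   using G U(1) by (auto intro: holomorphic_on_imp_continuous_on holomorphic_deriv)
  have nz: "w \<noteq> 0" if "w \<in> U" for w using that U(2) by auto
  show "continuous_on U (\<lambda>w. D w 1)" "continuous_on U (\<lambda>w. D w \<i>)"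
   unfolding D_def using nz by (auto intro!: continuous_intros c)
 qed (rule k)
qed

text \<open>When the weighted integrand is integrable over all of \<open>S\<close>, the principal
  value is a dominated limit, so the cutoff radius disappears.\<close>

lemma area_int0_eq:
 assumes k: "integrable lborel k" and S: "S \<in> sets borel"
  and eq: "\<And>w. k w = indicator S w *\<^sub>R (F w / of_real ((cmod w)\<^sup>2))"
 shows "area_int0 S F = (LINT w|lborel. k w) / of_real pi"
proof -
 have km [measurable]: "k \<in> borel_measurable borel" using k by auto
 let ?f = "\<lambda>w. F w / of_real ((cmod w)\<^sup>2)"
 have int: "integral (S \<inter> ball 0 R) ?f = (LINT w|lborel. indicator (ball 0 R) w *\<^sub>R k w)" for R
 proof -
  have e: "(\<lambda>w. indicator (S \<inter> ball 0 R) w *\<^sub>R ?f w) = (\<lambda>w. indicator (ball 0 R) w *\<^sub>R k w)"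
   by (auto simp: eq indicator_def fun_eq_iff)
  have "integrable lborel (\<lambda>w. indicator (ball 0 R) w *\<^sub>R k w)"
   by (rule integrable_mult_indicator) (use k in auto)
  then have "set_integrable lborel (S \<inter> ball 0 R) ?f" unfolding set_integrable_def e .
  from set_borel_integral_eq_integral(2)[OF this] show ?thesis
   unfolding set_lebesgue_integral_def e by simp
 qed
 have "((\<lambda>R. LINT w|lborel. indicator (ball 0 R) w *\<^sub>R k w) \<longlongrightarrow> (LINT w|lborel. k w)) at_top"
 proof (rule integral_dominated_convergence_at_top[where w="\<lambda>w. cmod (k w)"])
  have [measurable]: "ball (0::complex) R \<in> sets borel" for R by simp
  show "(\<lambda>w. indicator (ball 0 R) w *\<^sub>R k w) \<in> borel_measurable lborel" for R by measurable
  show "AE w in lborel. ((\<lambda>R. indicator (ball 0 R) w *\<^sub>R k w) \<longlongrightarrow> k w) at_top"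
  proof (intro AE_I2 tendsto_eventually)
   fix w show "\<forall>\<^sub>F R in at_top. indicator (ball 0 R) w *\<^sub>R k w = k w"
    using eventually_gt_at_top[of "cmod w"] by eventually_elim (simp add: indicator_def)
  qed
  show "\<forall>\<^sub>F R in at_top. AE w in lborel. norm (indicator (ball 0 R) w *\<^sub>R k w) \<le> cmod (k w)"
   by (intro always_eventually allI AE_I2) (auto simp: indicator_def)
 qed (use k in auto)
 then have "((\<lambda>R. integral (S \<inter> ball 0 R) ?f / of_real pi) \<longlongrightarrow> (LINT w|lborel. k w) / of_real pi) at_top"
  unfolding int by (intro tendsto_intros) auto
 then show ?thesis unfolding area_int0_def by (intro tendsto_Lim) auto
qed

text \<open>The Riemann map on the disk may have a pole, so polynomials in it are unbounded.
  Dividing by a high power of \<open>w - b\<close>, with \<open>b\<close> outside the closure of the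
  domain, makes them bounded and hence extendable over the pole.\<close>

lemma poly_div_power_bounded:
 assumes d: "d > 0" and L: "degree p \<le> L"
 shows "\<exists>C. \<forall>w. cmod (w - b) \<ge> d \<longrightarrow> cmod (poly p w / (w - b) ^ L) \<le> C"
proof -
 define r where "r = pcompose p [:b, 1:]"
 have r: "poly p w = poly r (w - b)" for w by (simp add: r_def poly_pcompose)
 have dr: "degree r \<le> L" using L by (simp add: r_def degree_pcompose)
 have "cmod (poly p w / (w - b) ^ L) \<le> (\<Sum>i\<le>degree r. cmod (coeff r i) * inverse (d ^ (L - i)))" if w: "cmod (w - b) \<ge> d" for w
 proof -
  have ne: "w - b \<noteq> 0" using w d by auto
  have "poly p w / (w - b) ^ L = (\<Sum>i\<le>degree r. coeff r i * ((w - b) ^ i / (w - b) ^ L))"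
   by (simp add: r[of w] poly_altdef[of r] sum_divide_distrib)
  also have "cmod \<dots> \<le> (\<Sum>i\<le>degree r. cmod (coeff r i) * inverse (d ^ (L - i)))"
  proof (rule sum_norm_le)
   fix i assume "i \<in> {..degree r}"
   then have i: "i \<le> L" using dr by auto
   have "(w - b) ^ i / (w - b) ^ L = inverse ((w - b) ^ (L - i))"
    using ne i by (simp add: power_diff field_simps)
   moreover have "cmod (inverse ((w - b) ^ (L - i))) \<le> inverse (d ^ (L - i))"
    unfolding norm_inverse norm_power using w d by (intro le_imp_inverse_le power_mono) auto
   ultimately show "cmod (coeff r i * ((w - b) ^ i / (w - b) ^ L)) \<le> cmod (coeff r i) * inverse (d ^ (L - i))"
    by (simp only: norm_mult mult_left_mono norm_ge_zero)
  qed
  finally show ?thesis .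
 qed
 then show ?thesis by blast
qed

lemma holomorphic_extend_finite_lim:
 assumes "finite F" "open U" "F \<subseteq> U" "f holomorphic_on U - F" "\<And>\<zeta>. \<zeta> \<in> F \<Longrightarrow> ((\<lambda>z. (z - \<zeta>) * f z) \<longlongrightarrow> 0) (at \<zeta>)"
 shows "\<exists>g. g holomorphic_on U \<and> (\<forall>z\<in>U - F. g z = f z)"
 using assms
proof (induction F arbitrary: U)
 case empty then show ?case by auto
next
 case (insert e F)
 have o: "open (U - {e})" using insert.prems(1) by (simp add: open_Diff)
 have "\<exists>g. g holomorphic_on U - {e} \<and> (\<forall>z\<in>U - {e} - F. g z = f z)"
 proof (rule insert.IH[OF o])
  show "F \<subseteq> U - {e}" using insert.prems(2) insert.hyps(2) by blast
  have "U - {e} - F = U - insert e F" by blast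
  then show "f holomorphic_on U - {e} - F" using insert.prems(3) by simp
 qed (use insert.prems(4) in simp)
 then obtain g where g: "g holomorphic_on U - {e}" "\<And>z. z \<in> U - {e} - F \<Longrightarrow> g z = f z" by blast
 have e: "e \<in> U - F" using insert by auto
 have "open (U - F)" using insert.prems(1) insert.hyps(1) by (simp add: finite_imp_closed open_Diff)
 then have "\<forall>\<^sub>F z in at e. z \<in> U - F - {e}" using e by (rule eventually_at_in_open)
 then have "\<forall>\<^sub>F z in at e. (z - e) * f z = (z - e) * g z" by eventually_elim (use g(2) in auto)
 then have "((\<lambda>z. (z - e) * g z) \<longlongrightarrow> 0) (at e)"
  by (rule Lim_transform_eventually[rotated]) (use insert.prems(4) in auto)
 then have "\<exists>h. h holomorphic_on U \<and> (\<forall>z\<in>U - {e}. h z = g z)"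
  using holomorphic_on_extend_lim[OF g(1), of] insert.prems(1) e by (simp add: interior_open)
 then obtain h where h: "h holomorphic_on U" "\<And>z. z \<in> U - {e} \<Longrightarrow> h z = g z" by blast
 show ?case by (rule exI[of _ h]) (use h g(2) in auto)
qed

lemma holomorphic_extend_finite:
 assumes F: "finite F" "open U" "F \<subseteq> U" "f holomorphic_on U - F" and B: "\<And>z. z \<in> U - F \<Longrightarrow> cmod (f z) \<le> B"
 shows "\<exists>g. g holomorphic_on U \<and> (\<forall>z\<in>U - F. g z = f z)"
proof (rule holomorphic_extend_finite_lim[OF F])
 fix \<zeta> assume z: "\<zeta> \<in> F"
 have "open (U - (F - {\<zeta>}))" using F by (simp add: finite_imp_closed open_Diff)
 then have "\<forall>\<^sub>F z in at \<zeta>. z \<in> U - (F - {\<zeta>}) - {\<zeta>}" by (rule eventually_at_in_open) (use z F in auto)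
 then have "\<forall>\<^sub>F z in at \<zeta>. cmod ((z - \<zeta>) * f z) \<le> cmod (z - \<zeta>) * B"
  by eventually_elim (auto simp: norm_mult intro!: mult_left_mono B)
 moreover have "((\<lambda>z. cmod (z - \<zeta>) * B) \<longlongrightarrow> cmod (\<zeta> - \<zeta>) * B) (at \<zeta>)" by (intro tendsto_intros)
 then have "((\<lambda>z. cmod (z - \<zeta>) * B) \<longlongrightarrow> 0) (at \<zeta>)" by simp
 ultimately show "((\<lambda>z. (z - \<zeta>) * f z) \<longlongrightarrow> 0) (at \<zeta>)" by (rule Lim_null_comparison)
qed

lemma disk_extend:
 assumes F: "finite F" "F \<subseteq> ball (0::complex) 1" and g: "g holomorphic_on ball 0 1" "\<And>z. z \<in> ball 0 1 - F \<Longrightarrow> g z = f z"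
  and f: "continuous_on (cball 0 1 - F) f"
 shows "\<exists>h. continuous_on (cball 0 1) h \<and> h holomorphic_on ball 0 1 \<and> (\<forall>z\<in>cball 0 1 - F. h z = f z)"
proof -
 define h where "h = (\<lambda>z. if z \<in> ball 0 1 then g z else f z)"
 have h1: "h holomorphic_on ball 0 1" by (rule holomorphic_transform[OF g(1)]) (simp add: h_def)
 have hf: "h z = f z" if "z \<in> cball 0 1 - F" for z using g(2) that by (auto simp: h_def)
 have c1: "continuous_on (ball 0 1) h" using h1 by (rule holomorphic_on_imp_continuous_on)
 have c2: "continuous_on (cball 0 1 - F) h" by (rule continuous_on_eq[OF f]) (simp add: hf)
 have eq: "ball 0 1 \<union> (cball 0 1 - F) = cball (0::complex) 1" using F(2) ball_subset_cball by auto
 have "continuous_on (ball 0 1 \<union> (cball 0 1 - F)) h"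
 proof (rule continuous_on_Un_local_open[OF _ _ c1 c2])
  show "openin (top_of_set (ball 0 1 \<union> (cball 0 1 - F))) (ball 0 1)"
   unfolding eq by (rule open_subset) auto
  have "openin (top_of_set (cball 0 1)) (cball 0 1 \<inter> (- F))"
   using F(1) by (intro openin_open_Int open_Compl finite_imp_closed)
  then show "openin (top_of_set (ball 0 1 \<union> (cball 0 1 - F))) (cball 0 1 - F)"
   unfolding eq by (simp add: Diff_eq)
 qed
 then show ?thesis using h1 hf unfolding eq by blast
qed

lemma disk_extend_finite:
 assumes F: "finite F" "F \<subseteq> ball (0::complex) 1" and f: "f holomorphic_on ball 0 1 - F" "continuous_on (cball 0 1 - F) f"
  and B: "\<And>z. z \<in> ball 0 1 - F \<Longrightarrow> cmod (f z) \<le> B"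
 shows "\<exists>g. continuous_on (cball 0 1) g \<and> g holomorphic_on ball 0 1 \<and> (\<forall>z\<in>cball 0 1 - F. g z = f z)"
proof -
 obtain g where g: "g holomorphic_on ball 0 1" "\<And>z. z \<in> ball 0 1 - F \<Longrightarrow> g z = f z"
  using holomorphic_extend_finite[OF F(1) open_ball F(2) f(1) B] by blast
 show ?thesis by (rule disk_extend[OF F g f(2)])
qed

section \<open>The Riemann map\<close>

lemma rational_on_circle_cong:
 assumes "\<And>xi. cmod xi = 1 \<Longrightarrow> u xi = v xi"
 shows "rational_on_circle u \<longleftrightarrow> rational_on_circle v"
 unfolding rational_on_circle_def using assms by simp

lemma rational_on_circle_cnj:
 assumes "rational_on_circle u"
 shows "rational_on_circle (\<lambda>xi. u (cnj xi))"
proof -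
 obtain A B where AB: "B \<noteq> 0" "\<And>xi. cmod xi = 1 \<Longrightarrow> poly B xi \<noteq> 0"
   "\<And>xi. cmod xi = 1 \<Longrightarrow> complex_of_real (u xi) = poly A xi / poly B xi"
  using assms unfolding rational_on_circle_def by blast
 have c: "poly (map_poly cnj p) xi = cnj (poly p (cnj xi))" for p xi
  using poly_cnj[of p "cnj xi"] by simp
 show ?thesis unfolding rational_on_circle_def
 proof (rule exI[of _ "map_poly cnj A"], rule exI[of _ "map_poly cnj B"], intro conjI allI impI)
  show "map_poly cnj B \<noteq> 0" using AB(1) by (simp add: map_poly_eq_0_iff)
  fix xi :: complex assume xi: "cmod xi = 1"
  then have xi': "cmod (cnj xi) = 1" by simp
  show "poly (map_poly cnj B) xi \<noteq> 0" unfolding c using AB(2)[OF xi'] by simp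
  have "complex_of_real (u (cnj xi)) = cnj (complex_of_real (u (cnj xi)))" by simp
  also have "\<dots> = poly (map_poly cnj A) xi / poly (map_poly cnj B) xi"
   unfolding AB(3)[OF xi'] c by simp
  finally show "complex_of_real (u (cnj xi)) = poly (map_poly cnj A) xi / poly (map_poly cnj B) xi" .
 qed
qed

text \<open>From |ln x| <= x + 1 / x. One inequality controls the logarithm near 0 and near
  infinity, where the domain may be unbounded.\<close>

lemma abs_mult_ln_square_le:
 fixes x :: real
 assumes "x \<ge> 0" shows "x * \<bar>ln (x\<^sup>2)\<bar> \<le> 2 * (1 + x\<^sup>2)"
proof (cases "x = 0")
 case False
 then have x: "x > 0" using assms by simp
 have "ln x \<le> x + 1 / x" using ln_le_minus_one[OF x] x by (simp add: add_increasing2)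
 moreover have "- ln x \<le> x + 1 / x" using ln_le_minus_one[of "1 / x"] x by (simp add: ln_div)
 ultimately have "\<bar>ln x\<bar> \<le> x + 1 / x" by simp
 then have "x * \<bar>ln x\<bar> \<le> x * (x + 1 / x)" using x by (intro mult_left_mono) auto
 also have "\<dots> = 1 + x\<^sup>2" using x by (simp add: power2_eq_square algebra_simps)
 finally show ?thesis using x by (simp add: ln_realpow abs_mult)
qed simp

locale rmap =
 fixes S :: "complex set" and \<phi> :: "complex \<Rightarrow> complex"
 assumes sd: "sphere_domain S"
  and ssc: "sphere_simply_connected S"
  and zero_frontier: "0 \<notin> frontier S"
  and int_closure: "interior (closure S) = S"
  and rm: "riemann_map S \<phi>"
begin

text \<open>The Riemann map transported to the unit disk in both cases: in the unbounded case
\<open>\<psi>\<close> has a pole at 0.\<close>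

definition \<psi> :: "complex \<Rightarrow> complex" where
 "\<psi> z = (if bounded S then \<phi> z else \<phi> (inverse z))"

definition pole0 :: "complex set" where
 "pole0 = (if bounded S then {} else {0})"

definition u :: "complex \<Rightarrow> real" where
 "u xi = ln ((cmod (\<psi> xi))\<^sup>2)"

lemma S_open: "open S" and S_conn: "connected S" and S_ne: "S \<noteq> {}" and frontier_bounded: "bounded (frontier S)"
 using sd by (auto simp: sphere_domain_def)

lemma S_borel [measurable]: "S \<in> sets borel" using S_open by auto

lemma frontier_disjoint: "a \<in> frontier S \<Longrightarrow> a \<notin> S"
 using S_open by (simp add: frontier_def interior_open)

lemma closure_eq: "closure S = S \<union> frontier S"
 using closure_subset[of S] S_open by (auto simp: frontier_def interior_open)

lemma inverse_outside: "z \<in> ball 0 1 - {0} \<Longrightarrow> inverse z \<in> - cball (0::complex) 1"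
 by (auto simp: norm_inverse one_less_inverse_iff not_le)

lemma psi_hol: "\<psi> holomorphic_on ball 0 1 - pole0"
proof (cases "bounded S")
 case True
 then have "\<psi> = \<phi>" by (auto simp: \<psi>_def)
 then show ?thesis using rm True by (simp add: riemann_map_def pole0_def)
next
 case False
 have "(\<phi> \<circ> inverse) holomorphic_on ball 0 1 - {0}"
  using rm False inverse_outside
  by (intro holomorphic_on_compose_gen[of _ _ _ "- cball 0 1"] holomorphic_intros) (auto simp: riemann_map_def)
 moreover have "\<psi> = \<phi> \<circ> inverse" using False by (auto simp: \<psi>_def)
 ultimately show ?thesis using False by (simp add: pole0_def)
qed

lemma psi_cont: "continuous_on (cball 0 1 - pole0) \<psi>"
proof (cases "bounded S")
 case True
 then have "\<psi> = \<phi>" by (auto simp: \<psi>_def)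
 then show ?thesis using rm True by (simp add: riemann_map_def pole0_def)
next
 case False
 have "continuous_on (- ball 0 1) \<phi>" using rm False by (simp add: riemann_map_def)
 then have "continuous_on (cball 0 1 - {0}) (\<lambda>z. \<phi> (inverse z))"
 proof (rule continuous_on_compose2)
  have "1 \<le> cmod (inverse z)" if "z \<in> cball 0 1 - {0}" for z :: complex
   unfolding norm_inverse by (rule one_le_inverse) (use that in auto)
  then show "inverse ` (cball 0 1 - {0}) \<subseteq> - ball (0::complex) 1" by force
 qed (auto intro!: continuous_intros)
 moreover have "\<psi> = (\<lambda>z. \<phi> (inverse z))" using False by (auto simp: \<psi>_def)
 ultimately show ?thesis using False by (simp add: pole0_def)
qed

lemma psi_inj: "inj_on \<psi> (ball 0 1 - pole0)"
proof (cases "bounded S")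
 case True
 then have "\<psi> = \<phi>" by (auto simp: \<psi>_def)
 then show ?thesis using rm True by (simp add: riemann_map_def pole0_def)
next
 case False
 then have inj: "inj_on \<phi> (- cball 0 1)" using rm by (simp add: riemann_map_def)
 show ?thesis
 proof (rule inj_onI)
  fix x y assume xy: "x \<in> ball 0 1 - pole0" "y \<in> ball 0 1 - pole0" "\<psi> x = \<psi> y"
  then have "inverse x \<in> - cball 0 1" "inverse y \<in> - cball 0 1"
   using inverse_outside False by (auto simp: pole0_def)
  then have "inverse x = inverse y" using inj_onD[OF inj, of "inverse x" "inverse y"] xy(3) False by (simp add: \<psi>_def)
  then show "x = y" by simp
 qed
qed

lemma psi_image: "\<psi> ` (ball 0 1 - pole0) = S"
proof (cases "bounded S")
 case True
 then have "\<psi> = \<phi>" by (auto simp: \<psi>_def)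
 then show ?thesis using rm True by (simp add: riemann_map_def pole0_def)
next
 case False
 then have im: "\<phi> ` (- cball 0 1) = S" using rm by (simp add: riemann_map_def)
 show ?thesis
 proof
  show "\<psi> ` (ball 0 1 - pole0) \<subseteq> S"
   using inverse_outside False im by (auto simp: pole0_def \<psi>_def)
  show "S \<subseteq> \<psi> ` (ball 0 1 - pole0)"
  proof
   fix w assume "w \<in> S"
   then obtain z where z: "z \<in> - cball 0 1" "w = \<phi> z" using im by auto
   then have "1 < cmod z" by auto
   then have "inverse z \<in> ball 0 1 - pole0" "w = \<psi> (inverse z)"
    using z False by (auto simp: pole0_def \<psi>_def norm_inverse inverse_less_1_iff)
   then show "w \<in> \<psi> ` (ball 0 1 - pole0)" by blast
  qed
 qed
qed

lemma psi_in_S: "z \<in> ball 0 1 \<Longrightarrow> z \<notin> pole0 \<Longrightarrow> \<psi> z \<in> S"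
 using psi_image by blast

lemma psi_at_infinity: "\<not> bounded S \<Longrightarrow> filterlim \<psi> at_infinity (at 0)"
proof -
 assume n: "\<not> bounded S"
 have "filterlim (\<lambda>z. \<phi> (inverse z)) at_infinity (at 0)"
  using rm n filterlim_compose[OF _ filterlim_inverse_at_infinity] by (auto simp: riemann_map_def)
 moreover have "\<psi> = (\<lambda>z. \<phi> (inverse z))" using n by (auto simp: \<psi>_def)
 ultimately show ?thesis by simp
qed

lemma pole0_sphere: "cmod xi = 1 \<Longrightarrow> xi \<notin> pole0"
 by (auto simp: pole0_def)

lemma pole0_sub: "pole0 \<subseteq> ball 0 1" and pole0_finite: "finite pole0"
 by (auto simp: pole0_def)

text \<open>The boundary value is a limit of points of \<open>S\<close>. If it were itself in
  \<open>S\<close>, the open mapping theorem at its preimage \<open>z0\<close> and injectivity would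
  force points approaching the circle to lie near \<open>z0\<close>.\<close>

lemma psi_boundary:
 assumes xi: "cmod xi = 1" shows "\<psi> xi \<in> frontier S"
proof -
 \<comment> \<open>The radii 1 - 1 / (n + 2) start at 1/2; with n + 1 the first point would be the
   origin, which is a pole in the unbounded case.\<close>
 define X where "X = (\<lambda>n. of_real (1 - inverse (real (Suc (Suc n)))) * xi)"
 have nX: "cmod (X n) = 1 - inverse (real (Suc (Suc n)))" for n
 proof -
  have "inverse (real (Suc (Suc n))) \<le> 1" by (simp add: inverse_le_1_iff)
  then show ?thesis using xi by (simp add: X_def norm_mult del: of_real_diff)
 qed
 have inv: "inverse (real (Suc (Suc n))) < 1" "inverse (real (Suc (Suc n))) > 0" for n by (auto simp: inverse_less_1_iff)
 have Xin: "X n \<in> ball 0 1 - pole0" for n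
  using nX[of n] inv[of n] by (auto simp: pole0_def)
 have l0: "(\<lambda>n. inverse (real (Suc (Suc n)))) \<longlonglongrightarrow> 0"
  using LIMSEQ_Suc[OF LIMSEQ_inverse_real_of_nat] by simp
 have "(\<lambda>n. complex_of_real (1 - inverse (real (Suc (Suc n))))) \<longlonglongrightarrow> of_real (1 - 0)"
  by (intro tendsto_of_real tendsto_diff tendsto_const l0)
 then have "X \<longlonglongrightarrow> of_real (1 - 0) * xi" unfolding X_def by (intro tendsto_mult tendsto_const)
 then have Xl: "X \<longlonglongrightarrow> xi" by simp
 have psiX: "(\<lambda>n. \<psi> (X n)) \<longlonglongrightarrow> \<psi> xi"
  by (rule continuous_on_tendsto_compose[OF psi_cont Xl])
   (use Xin xi pole0_sphere ball_subset_cball in \<open>auto intro!: always_eventually less_imp_le\<close>)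
 have "\<psi> xi \<in> closure S"
  by (rule closed_sequentially[OF closed_closure _ psiX]) (use Xin psi_image closure_subset in blast)
 moreover have "\<psi> xi \<notin> S"
 proof
  assume "\<psi> xi \<in> S"
  then obtain z0 where z0: "z0 \<in> ball 0 1 - pole0" "\<psi> xi = \<psi> z0" using psi_image by blast
  have o: "open (ball 0 1 - pole0)" using pole0_finite by (simp add: open_Diff finite_imp_closed)
  obtain r where r: "r > 0" "ball z0 r \<subseteq> ball 0 1 - pole0" using o z0 open_contains_ball by blast
  \<comment> \<open>The disk about \<open>z0\<close> reaches at most halfway to the circle, while
    \<open>X n\<close> eventually comes closer to the circle than that.\<close>
  define s where "s = min r ((1 - cmod z0) / 2)"
  have s: "s > 0" "ball z0 s \<subseteq> ball 0 1 - pole0" using r z0 subset_ball[of s r z0] by (auto simp: s_def)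
  have "open (\<psi> ` ball z0 s)"
   by (rule open_mapping_thm3[OF holomorphic_on_subset[OF psi_hol s(2)] open_ball inj_on_subset[OF psi_inj s(2)]])
  moreover have "\<psi> xi \<in> \<psi> ` ball z0 s" using s(1) z0 by auto
  ultimately have "eventually (\<lambda>n. \<psi> (X n) \<in> \<psi> ` ball z0 s) sequentially"
   using topological_tendstoD[OF psiX] by blast
  moreover have "eventually (\<lambda>n. inverse (real (Suc (Suc n))) < (1 - cmod z0) / 2) sequentially"
   by (rule order_tendstoD(2)[OF l0]) (use z0 in auto)
  ultimately have "eventually (\<lambda>n. False) sequentially"
  proof eventually_elim
   case (elim n)
   then obtain x where x: "x \<in> ball z0 s" "\<psi> (X n) = \<psi> x" by blast
   then have "X n = x" using inj_onD[OF psi_inj x(2) Xin[of n]] s(2) by blast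
   then have "X n \<in> ball z0 s" using x(1) by simp
   then have 1: "cmod (z0 - X n) < (1 - cmod z0) / 2" by (simp add: s_def dist_norm)
   have 2: "cmod (X n) \<le> cmod z0 + cmod (z0 - X n)" by (metis norm_minus_commute norm_triangle_sub)
   have "False" if "a < (1 - z) / 2" "x \<le> z + a" "x = 1 - e" "e < (1 - z) / 2" for a x z e :: real
   proof -
    have "a + e < (1 - z) / 2 + (1 - z) / 2" by (rule add_strict_mono[OF that(1,4)])
    then have "a + e < 1 - z" by (simp only: field_sum_of_halves)
    then show False using that(2,3) by simp
   qed
   from this[OF 1 2 nX elim(2)] show False .
  qed
  then show False by simp
 qed
 ultimately show ?thesis using S_open by (simp add: frontier_def interior_open)
qed

lemma u_continuous: "continuous_on (sphere 0 1) u"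
proof -
 have c: "continuous_on (sphere 0 1) \<psi>"
  by (rule continuous_on_subset[OF psi_cont]) (use pole0_sphere in auto)
 have "\<psi> xi \<noteq> 0" if "cmod xi = 1" for xi using psi_boundary[OF that] zero_frontier by auto
 then show ?thesis unfolding u_def by (intro continuous_intros c) auto
qed

text \<open>On the circle division by \<open>z\<close> leaves the modulus unchanged and inversion is
  conjugation. So the data of the unbounded case are u(cnj xi), and the orientation of the contour
  contributes the minus sign in the exponent.\<close>

theorem phi_out_rational_iff:
 "(\<exists>p q :: complex poly. q \<noteq> 0 \<and> (\<forall>z\<in>riemann_disk S. poly q z \<noteq> 0) \<and>
    (\<forall>z\<in>riemann_disk S. phi_out S \<phi> z = exp (poly p z / poly q z))) \<longleftrightarrow> rational_on_circle u"
proof (cases "bounded S")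
 case True
 then have psi: "\<psi> = \<phi>" by (auto simp: \<psi>_def)
 have "phi_out S \<phi> z = exp (schw u z / 2)" for z
  using schw_eq_contour_integral[of z u] True by (simp add: phi_out_def outer_part_def u_def psi)
 moreover have "riemann_disk S = ball 0 1" using True by (simp add: riemann_disk_def)
 ultimately show ?thesis using disk_rational_iff[OF u_continuous] by simp
next
 case False
 define v where "v = (\<lambda>xi. ln ((cmod (\<phi> xi / xi))\<^sup>2))"
 have vu: "v xi = u (cnj xi)" if "cmod xi = 1" for xi
  using that False cnj_eq_inverse[of "cnj xi"] by (simp add: v_def u_def \<psi>_def norm_divide)
 have "continuous_on (sphere 0 1) (\<lambda>xi. u (cnj xi))"
  by (rule continuous_on_compose2[OF u_continuous]) (auto intro!: continuous_intros)
 then have vc: "continuous_on (sphere 0 1) v" by (rule continuous_on_eq) (simp add: vu)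
 have "phi_out S \<phi> z = exp (- schw v z / 2)" for z
  using schw_eq_contour_integral[of z v] False
  by (simp add: phi_out_def outer_part_def v_def contour_integral_reversepath)
 moreover have "riemann_disk S = - cball 0 1" using False by (simp add: riemann_disk_def)
 moreover have "rational_on_circle v \<longleftrightarrow> rational_on_circle u"
 proof
  assume "rational_on_circle v"
  then have "rational_on_circle (\<lambda>xi. u (cnj xi))" using rational_on_circle_cong[of v "\<lambda>xi. u (cnj xi)", OF vu] by simp
  from rational_on_circle_cnj[OF this] show "rational_on_circle u" by simp
 next
  assume "rational_on_circle u"
  from rational_on_circle_cnj[OF this] show "rational_on_circle v" using rational_on_circle_cong[of v "\<lambda>xi. u (cnj xi)", OF vu] by simp
 qed
 ultimately show ?thesis using exterior_rational_iff[OF vc] by simp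
qed

text \<open>If the closure were the whole plane, regularity of the domain would give
  \<open>S = UNIV\<close>; but in the unbounded case simple connectivity provides a finite point
  outside \<open>S\<close>. The open exterior then has a point other than 0.\<close>

lemma exterior_point: "\<exists>b. b \<notin> closure S \<and> b \<noteq> 0"
proof -
 have ne: "- closure S \<noteq> {}"
 proof
  assume "- closure S = {}"
  then have "closure S = UNIV" by blast
  then have U: "S = UNIV" using int_closure by simp
  then show False using ssc not_bounded_UNIV by (auto simp: sphere_simply_connected_def)
 qed
 have "infinite (- closure S)"
  using ne finite_imp_not_open[of "- closure S"] by auto
 then have "infinite (- closure S - {0})" by simp
 then have "- closure S - {0} \<noteq> {}" by (metis finite.emptyI)
 then show ?thesis by blast
qed

lemma frontier_exterior:
 assumes "a \<in> frontier S" shows "a \<in> closure (- closure S)"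
proof -
 have "a \<notin> interior (closure S)" using frontier_disjoint[OF assms] by (simp add: int_closure)
 then show ?thesis by (simp add: closure_complement)
qed

end

section \<open>From the quadrature identity to a rational outer factor\<close>

text \<open>In the coordinate z = 1 / w the function becomes z^3 / ((1 - a z) (1 - b z)^4), which is
  regular at 0 and vanishes there.\<close>

lemma analytic_at_infinity_test_function:
 "analytic_at_infinity (\<lambda>w. w\<^sup>2 / ((w - a) * (w - b) ^ 4))"
proof -
 define g where "g = (\<lambda>z::complex. z ^ 3 / ((1 - a * z) * (1 - b * z) ^ 4))"
 have eq: "(1 / z)\<^sup>2 / ((1 / z - a) * (1 / z - b) ^ 4) = g z" if "z \<noteq> 0" for z
 proof -
  have 1: "1 / z - a = (1 - a * z) / z" "1 / z - b = (1 - b * z) / z" using that by (simp_all add: field_simps)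
  show ?thesis unfolding 1 g_def using that
   by (simp add: power_divide divide_divide_eq_right numeral_eq_Suc)
 qed
 define U where "U = {z. (1 - a * z) * (1 - b * z) ^ 4 \<noteq> 0}"
 have "open U" unfolding U_def by (intro open_Collect_neq continuous_intros)
 moreover have "0 \<in> U" by (simp add: U_def)
 moreover have "g holomorphic_on U" unfolding g_def U_def by (intro holomorphic_intros) auto
 ultimately have ga: "g analytic_on {0}" by (auto simp: analytic_on_holomorphic)
 have geq: "(\<lambda>z. if z = 0 then 0 else (1 / z)\<^sup>2 / ((1 / z - a) * (1 / z - b) ^ 4)) = g"
  using eq by (auto simp: fun_eq_iff g_def)
 have "isCont g 0" using analytic_at_imp_isCont[OF ga] .
 then have "g \<midarrow>0\<rightarrow> 0" by (simp add: isCont_def g_def)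
 then have "((\<lambda>w. w\<^sup>2 / ((w - a) * (w - b) ^ 4)) \<circ> inverse) \<midarrow>0\<rightarrow> 0"
 proof (rule Lim_transform_eventually)
  show "\<forall>\<^sub>F z in at 0. g z = ((\<lambda>w. w\<^sup>2 / ((w - a) * (w - b) ^ 4)) \<circ> inverse) z"
   using eq by (auto simp: eventually_at_filter inverse_eq_divide)
 qed
 then have "((\<lambda>w. w\<^sup>2 / ((w - a) * (w - b) ^ 4)) \<longlongrightarrow> 0) at_infinity"
  by (simp add: lim_at_infinity_0)
 then show ?thesis unfolding analytic_at_infinity_def using geq ga by (intro exI[of _ 0]) auto
qed

lemma contour_integrable_ratfun:
 assumes "valid_path \<gamma>" "\<And>z. z \<in> path_image \<gamma> \<Longrightarrow> poly q z \<noteq> 0"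
 shows "(\<lambda>xi. poly p xi / poly q xi) contour_integrable_on \<gamma>"
proof (rule contour_integrable_holomorphic_simple)
 show "(\<lambda>xi. poly p xi / poly q xi) holomorphic_on {z. poly q z \<noteq> 0}" by (intro holomorphic_intros) auto
 show "open {z. poly q z \<noteq> 0}" by (intro open_Collect_neq continuous_intros)
qed (use assms in auto)

lemma sum_list_lin:
 fixes f g :: "'a \<Rightarrow> complex"
 shows "sum_list (map (\<lambda>x. c * f x + d * g x) xs) = c * sum_list (map f xs) + d * sum_list (map g xs)"
 by (induction xs) (simp_all add: algebra_simps)

context rmap
begin

theorem QD0_imp_rational:
 assumes "QD0 S" shows "rational_on_circle u"
proof -
 obtain p q where QD: "QD0_with S p q" using assms by (auto simp: QD0_def)
 have q: "q \<noteq> 0" "\<And>z. poly q z = 0 \<Longrightarrow> z \<in> S"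
  using QD by (auto simp: QD0_with_def quad_fun_ok_def)
 obtain \<Gamma> where G: "pos_boundary_cycle S \<Gamma>" using QD by (auto simp: QD0_with_def)
 have QI: "area_int0 S f = bdry_int \<Gamma> (\<lambda>w. f w * (poly p w / poly q w))" if "f \<in> L1a_rho0 S" for f
  using QD G that by (auto simp: QD0_with_def)
 have Gv: "valid_path \<gamma>" "pathfinish \<gamma> = pathstart \<gamma>" "path_image \<gamma> \<subseteq> frontier S" if "\<gamma> \<in> set \<Gamma>" for \<gamma>
  using G that by (auto simp: pos_boundary_cycle_def)
 define n :: complex where "n = (if bounded S then 0 else - 1)"
 have Gn: "sum_list (map (\<lambda>\<gamma>. winding_number \<gamma> z) \<Gamma>) = n" if "z \<notin> closure S" for z
  using G that closure_subset[of S] unfolding pos_boundary_cycle_def n_def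
  by (auto simp: closure_eq)
 obtain b where b: "b \<notin> closure S" "b \<noteq> 0" using exterior_point by blast
 obtain d where d: "d > 0" "ball b d \<subseteq> - closure S"
  using b open_contains_ball[of "- closure S"] by auto
 have far: "d \<le> cmod (w - b)" if "w \<in> closure S" for w
  using d that by (auto simp: subset_eq dist_norm norm_minus_commute not_less)
 have frS: "a \<in> closure S" if "a \<in> frontier S" for a using that by (simp add: frontier_def)
 \<comment> \<open>The density is chosen so that \<open>\<kappa> w / (w - a)\<close> is the weighted
   test function: all area integrals become values of the Cauchy transform of one bounded integrable
   density.\<close>
 define \<kappa> where "\<kappa> = (\<lambda>w. indicator S w *\<^sub>R (w / (cnj w * (w - b) ^ 4)))"
 have \<kappa>_le: "cmod (\<kappa> w) \<le> indicator (- ball b d) w / cmod (w - b) ^ 4" for w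
 proof (cases "w \<in> S")
  case True
  have "w \<notin> ball b d" using far[of w] closure_subset[of S] True by (auto simp: dist_norm norm_minus_commute)
  then show ?thesis using True
   by (simp add: \<kappa>_def norm_divide norm_mult norm_power)
 qed (auto simp: \<kappa>_def)
 have [measurable]: "cnj \<in> borel_measurable borel" by (intro borel_measurable_continuous_onI continuous_intros)
 have \<kappa>m: "\<kappa> \<in> borel_measurable borel" unfolding \<kappa>_def by measurable
 have \<kappa>: "integrable lborel \<kappa>"
  by (rule Bochner_Integration.integrable_bound[OF integrable_inverse_quartic[OF d(1), of b]])
   (use \<kappa>m \<kappa>_le in auto)
 have \<kappa>M: "cmod (\<kappa> w) \<le> 1 / d ^ 4" for w
 proof (cases "w \<in> ball b d")
  case True then show ?thesis using \<kappa>_le[of w] d(1) by (simp add: order_trans)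
 next
  case False
  then have "d ^ 4 \<le> cmod (w - b) ^ 4" using d(1) by (intro power_mono) (auto simp: dist_norm norm_minus_commute)
  then have "inverse (cmod (w - b) ^ 4) \<le> inverse (d ^ 4)" using d(1) by (intro le_imp_inverse_le) auto
  then have "1 / cmod (w - b) ^ 4 \<le> 1 / d ^ 4" by (simp only: inverse_eq_divide)
  then show ?thesis using \<kappa>_le[of w] False by simp
 qed
 define V where "V = cauchy_transform \<kappa>"
 have Vc: "continuous_on X V" for X
  unfolding V_def using cauchy_transform_isCont[OF \<kappa> zero_less_one \<kappa>M]
  by (intro continuous_at_imp_continuous_on) auto
 obtain MV where MV: "\<And>a. cmod (V a) \<le> MV"
  using cauchy_transform_bound[OF \<kappa> zero_less_one \<kappa>M] unfolding V_def by blast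
 define f where "f = (\<lambda>a w. w\<^sup>2 / ((w - a) * (w - b) ^ 4))"
 have k_eq: "\<kappa> w / (w - a) = indicator S w *\<^sub>R (f a w / of_real ((cmod w)\<^sup>2))" for a w
 proof (cases "w = 0")
  case False
  then show ?thesis unfolding complex_norm_square \<kappa>_def f_def
   by (simp add: power2_eq_square mult_ac scaleR_conv_of_real)
 qed (simp add: \<kappa>_def f_def)
 have ki: "integrable lborel (\<lambda>w. \<kappa> w / (w - a))" for a
  by (rule cauchy_transform_integrable[OF \<kappa> zero_less_one \<kappa>M])
 have f_L1a: "f a \<in> L1a_rho0 S" if a: "a \<notin> closure S" for a
 proof -
  have ne: "w - a \<noteq> 0" "w - b \<noteq> 0" if "w \<in> closure S" for w using that a b by auto
  have "f a holomorphic_on S"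
   unfolding f_def using ne closure_subset[of S] by (intro holomorphic_intros) auto
  moreover have "continuous_on (closure S) (f a)"
   unfolding f_def using ne by (intro continuous_intros) auto
  moreover have "analytic_at_infinity (f a)" unfolding f_def by (rule analytic_at_infinity_test_function)
  moreover have "(\<lambda>w. f a w / of_real ((cmod w)\<^sup>2)) absolutely_integrable_on S"
   unfolding set_integrable_def k_eq[symmetric]
   using ki[of a] by (simp add: integrable_completion)
  ultimately show ?thesis by (simp add: L1a_rho0_def A_space_def)
 qed
 have area: "area_int0 S (f a) = V a / of_real pi" for a
  unfolding V_def cauchy_transform_def by (rule area_int0_eq[OF ki S_borel k_eq])
 define A where "A = monom 1 2 * p"
 define B where "B = [:- b, 1:] ^ 4 * q"
 have pB: "poly B w = (w - b) ^ 4 * poly q w" for w by (simp add: B_def)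
 have pA: "poly A w = w\<^sup>2 * poly p w" for w by (simp add: A_def poly_monom)
 have B_fr: "poly B w \<noteq> 0" if "w \<in> frontier S" for w
  using q(2)[of w] frontier_disjoint[OF that] frS[OF that] b by (auto simp: pB)
 have "\<exists>T0 T1. \<forall>z. z \<notin> frontier S \<longrightarrow> poly B z \<noteq> 0 \<longrightarrow>
   bdry_int \<Gamma> (\<lambda>xi. poly A xi / (poly B xi * (xi - z))) = poly T0 z + poly A z / poly B z * (bdry_int \<Gamma> (\<lambda>xi. 1 / (xi - z)) - poly T1 z)"
 proof (rule functional_of_rational_cauchy_kernel[where C="{f. \<forall>\<gamma>\<in>set \<Gamma>. f contour_integrable_on \<gamma>}" and K="frontier S"])
  fix c d :: complex and f g
  assume "f \<in> {f. \<forall>\<gamma>\<in>set \<Gamma>. f contour_integrable_on \<gamma>}" "g \<in> {f. \<forall>\<gamma>\<in>set \<Gamma>. f contour_integrable_on \<gamma>}"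
  then have fg: "f contour_integrable_on \<gamma>" "g contour_integrable_on \<gamma>" if "\<gamma> \<in> set \<Gamma>" for \<gamma> using that by auto
  have "contour_integral \<gamma> (\<lambda>xi. c * f xi + d * g xi) = c * contour_integral \<gamma> f + d * contour_integral \<gamma> g" if "\<gamma> \<in> set \<Gamma>" for \<gamma>
   using fg[OF that] by (simp add: contour_integral_add contour_integrable_lmul contour_integral_lmul)
  then have "sum_list (map (\<lambda>\<gamma>. contour_integral \<gamma> (\<lambda>xi. c * f xi + d * g xi)) \<Gamma>)
    = sum_list (map (\<lambda>\<gamma>. c * contour_integral \<gamma> f + d * contour_integral \<gamma> g) \<Gamma>)"
   by (intro arg_cong[where f=sum_list] map_cong refl) auto
  then show "bdry_int \<Gamma> (\<lambda>xi. c * f xi + d * g xi) = c * bdry_int \<Gamma> f + d * bdry_int \<Gamma> g"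
   by (simp add: bdry_int_def sum_list_lin add_divide_distrib)
  show "(\<lambda>xi. c * f xi + d * g xi) \<in> {f. \<forall>\<gamma>\<in>set \<Gamma>. f contour_integrable_on \<gamma>}"
   using fg by (auto intro!: contour_integrable_add contour_integrable_lmul)
 next
  fix f g :: "complex \<Rightarrow> complex" assume fg: "\<And>xi. xi \<in> frontier S \<Longrightarrow> f xi = g xi"
  have "contour_integral \<gamma> f = contour_integral \<gamma> g" if "\<gamma> \<in> set \<Gamma>" for \<gamma>
   by (rule contour_integral_eq) (use Gv(3)[OF that] fg in auto)
  then have "map (\<lambda>\<gamma>. contour_integral \<gamma> f) \<Gamma> = map (\<lambda>\<gamma>. contour_integral \<gamma> g) \<Gamma>" by simp
  then show "bdry_int \<Gamma> f = bdry_int \<Gamma> g" by (simp only: bdry_int_def)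
 next
  fix P show "(\<lambda>xi. poly P xi / poly B xi) \<in> {f. \<forall>\<gamma>\<in>set \<Gamma>. f contour_integrable_on \<gamma>}"
   using contour_integrable_ratfun Gv B_fr by blast
 next
  fix z assume z: "z \<notin> frontier S"
  have "(\<lambda>xi. poly 1 xi / poly [:- z, 1:] xi) contour_integrable_on \<gamma>" if "\<gamma> \<in> set \<Gamma>" for \<gamma>
   by (rule contour_integrable_ratfun) (use Gv[OF that] z in auto)
  then show "(\<lambda>xi. 1 / (xi - z)) \<in> {f. \<forall>\<gamma>\<in>set \<Gamma>. f contour_integrable_on \<gamma>}" by simp
 qed (rule B_fr)
 then obtain T0 T1 where T: "\<And>z. z \<notin> frontier S \<Longrightarrow> poly B z \<noteq> 0 \<Longrightarrow>
   bdry_int \<Gamma> (\<lambda>xi. poly A xi / (poly B xi * (xi - z))) = poly T0 z + poly A z / poly B z * (bdry_int \<Gamma> (\<lambda>xi. 1 / (xi - z)) - poly T1 z)"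
  by blast
 have wn: "bdry_int \<Gamma> (\<lambda>xi. 1 / (xi - z)) = n" if z: "z \<notin> closure S" for z
 proof -
  have "contour_integral \<gamma> (\<lambda>xi. 1 / (xi - z)) = 2 * of_real pi * \<i> * winding_number \<gamma> z" if "\<gamma> \<in> set \<Gamma>" for \<gamma>
  proof -
   have "z \<notin> path_image \<gamma>" using Gv(3)[OF that] frS z by blast
   then show ?thesis using winding_number_valid_path[OF Gv(1)[OF that]] by simp
  qed
  then have m: "map (\<lambda>\<gamma>. contour_integral \<gamma> (\<lambda>xi. 1 / (xi - z))) \<Gamma> = map (\<lambda>\<gamma>. 2 * of_real pi * \<i> * winding_number \<gamma> z) \<Gamma>" by simp
  have "bdry_int \<Gamma> (\<lambda>xi. 1 / (xi - z)) = sum_list (map (\<lambda>\<gamma>. winding_number \<gamma> z) \<Gamma>)"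
   unfolding bdry_int_def m sum_list_const_mult by simp
  then show ?thesis using Gn[OF z] by simp
 qed
 \<comment> \<open>Outside the closure the total winding number is the constant \<open>n\<close>,
   which replaces the kernel integral; multiplication by \<open>B\<close> then turns the right side
   into a polynomial in \<open>a\<close>.\<close>
 define P where "P = B * T0 + A * ([:n:] - T1)"
 have V_ext: "poly B a * (V a / of_real pi) = poly P a" if a: "a \<in> - closure S" "a \<noteq> b" for a
 proof -
  have Ba: "poly B a \<noteq> 0" using q(2)[of a] a closure_subset[of S] by (auto simp: pB)
  have afr: "a \<notin> frontier S" using a frS by blast
  have "V a / of_real pi = bdry_int \<Gamma> (\<lambda>w. f a w * (poly p w / poly q w))"
   using QI[OF f_L1a, of a] a area[of a] by simp
  also have "(\<lambda>w. f a w * (poly p w / poly q w)) = (\<lambda>xi. poly A xi / (poly B xi * (xi - a)))"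
   by (simp add: fun_eq_iff f_def pA pB mult_ac)
  also have "bdry_int \<Gamma> \<dots> = poly T0 a + poly A a / poly B a * (n - poly T1 a)"
   using T[OF afr Ba] wn a by simp
  finally have e: "V a / of_real pi = poly T0 a + poly A a / poly B a * (n - poly T1 a)" .
  show ?thesis unfolding e using Ba by (simp add: P_def distrib_left)
 qed
 \<comment> \<open>The frontier is reached from outside by continuity of \<open>V\<close>; that it
   is approached by exterior points comes from regularity of the domain. The point \<open>b\<close>
   is a root of \<open>B\<close>, so it was excluded and is recovered by density.\<close>
 have V_fr: "poly B a * (V a / of_real pi) = poly P a" if a: "a \<in> frontier S" for a
 proof -
  have "closed {a. poly B a * (V a / of_real pi) = poly P a}"
   by (intro closed_Collect_eq continuous_intros Vc) auto
  moreover have "- closure S - {b} \<subseteq> {a. poly B a * (V a / of_real pi) = poly P a}" using V_ext by auto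
  ultimately have sub: "closure (- closure S - {b}) \<subseteq> {a. poly B a * (V a / of_real pi) = poly P a}"
   by (rule closure_minimal[rotated])
  have "b islimpt (- closure S)" using b by (intro interior_limit_point, subst interior_open) auto
  then have "b \<in> closure (- closure S - {b})" by (simp add: islimpt_in_closure)
  then have "- closure S \<subseteq> closure (- closure S - {b})"
   using closure_subset[of "- closure S - {b}"] by (auto simp: subset_iff)
  then have "closure (- closure S) \<subseteq> closure (- closure S - {b})" by (intro closure_minimal) auto
  then show ?thesis using sub frontier_exterior[OF a] by blast
 qed
 define F where "F = (\<lambda>a. a / (a - b) ^ 4 * of_real (ln ((cmod a)\<^sup>2)))"
 \<comment> \<open>Inside \<open>S\<close> the two summands have opposite d-bar derivatives. On the
   frontier \<open>V\<close> is known, so \<open>E\<close> differs there from the logarithmic term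
   \<open>F\<close> by a rational function.\<close>
 define E where "E = (\<lambda>a. F a + V a / of_real pi)"
 have E_hol: "E holomorphic_on S - {0}"
  unfolding E_def F_def V_def
 proof (rule log_primitive_holomorphic[OF _ _ _ \<kappa>])
  show "open (S - {0})" using S_open by (simp add: open_Diff)
  show "(\<lambda>a. a / (a - b) ^ 4) holomorphic_on S - {0}"
   using b closure_subset[of S] by (intro holomorphic_intros) auto
  show "\<kappa> w = w / (w - b) ^ 4 / cnj w" if "w \<in> S - {0}" for w
   using that by (simp add: \<kappa>_def mult.commute)
 qed auto
 have E_cont: "continuous_on (- {0, b}) E"
  unfolding E_def F_def by (intro continuous_intros Vc) auto
 obtain C1 where C1: "\<And>w. d \<le> cmod (w - b) \<Longrightarrow> cmod (poly 1 w / (w - b) ^ 4) \<le> C1"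
  using poly_div_power_bounded[OF d(1), of 1 4 b] by auto
 obtain C2 where C2: "\<And>w. d \<le> cmod (w - b) \<Longrightarrow> cmod (poly (monom 1 2) w / (w - b) ^ 4) \<le> C2"
  using poly_div_power_bounded[OF d(1), of "monom 1 2" 4 b] by (auto simp: degree_monom_eq)
 have F_bd: "cmod (F w) \<le> 2 * (C1 + C2)" if w: "w \<in> closure S" for w
 proof -
  have "cmod (F w) = cmod w * \<bar>ln ((cmod w)\<^sup>2)\<bar> / cmod (w - b) ^ 4"
   by (simp add: F_def norm_mult norm_divide norm_power)
  also have "\<dots> \<le> 2 * (1 + (cmod w)\<^sup>2) / cmod (w - b) ^ 4"
   by (intro divide_right_mono abs_mult_ln_square_le) auto
  also have "\<dots> = 2 * (cmod (poly 1 w / (w - b) ^ 4) + cmod (poly (monom 1 2) w / (w - b) ^ 4))"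
   by (simp add: norm_divide norm_power poly_monom add_divide_distrib)
  also have "\<dots> \<le> 2 * (C1 + C2)" using C1[OF far[OF w]] C2[OF far[OF w]] by simp
  finally show ?thesis .
 qed
 define ME where "ME = 2 * (C1 + C2) + MV / pi"
 have E_bd: "cmod (E w) \<le> ME" if w: "w \<in> closure S" for w
 proof -
  have "cmod (V w / of_real pi) \<le> MV / pi" using MV[of w] by (simp add: norm_divide divide_right_mono)
  then show ?thesis unfolding E_def ME_def using F_bd[OF w] by (intro norm_triangle_le add_mono)
 qed
 define L where "L = degree ([:0, 1:] * q) + degree B + degree P"
 obtain D1 where D1: "\<And>w. d \<le> cmod (w - b) \<Longrightarrow> cmod (poly ([:0, 1:] * q) w / (w - b) ^ L) \<le> D1"
  using poly_div_power_bounded[OF d(1), of "[:0, 1:] * q" L b] unfolding L_def by auto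
 obtain D2 where D2: "\<And>w. d \<le> cmod (w - b) \<Longrightarrow> cmod (poly B w / (w - b) ^ L) \<le> D2"
  using poly_div_power_bounded[OF d(1), of B L b] unfolding L_def by auto
 obtain D3 where D3: "\<And>w. d \<le> cmod (w - b) \<Longrightarrow> cmod (poly P w / (w - b) ^ L) \<le> D3"
  using poly_div_power_bounded[OF d(1), of P L b] unfolding L_def by auto
 define X0 where "X0 = (\<lambda>w. poly ([:0, 1:] * q) w / (w - b) ^ L)"
 define Y0 where "Y0 = (\<lambda>w. poly B w / (w - b) ^ L * E w - poly P w / (w - b) ^ L)"
 have key: "X0 a * of_real (ln ((cmod a)\<^sup>2)) = Y0 a" if a: "a \<in> frontier S" for a
 proof -
  have ne: "a - b \<noteq> 0" using frS[OF a] b by auto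
  have "poly B a * E a - poly P a = poly B a * F a"
   using V_fr[OF a] by (simp add: E_def algebra_simps)
  also have "\<dots> = poly ([:0, 1:] * q) a * of_real (ln ((cmod a)\<^sup>2))"
   using ne by (simp add: pB F_def)
  finally have "(poly B a * E a - poly P a) / (a - b) ^ L = poly ([:0, 1:] * q) a * of_real (ln ((cmod a)\<^sup>2)) / (a - b) ^ L" by simp
  then show ?thesis by (simp add: X0_def Y0_def diff_divide_distrib)
 qed
 \<comment> \<open>A zero of \<psi> is excluded together with its pole, because \<open>E\<close> is
   known to be holomorphic only off 0. All functions involved are bounded, so these singularities
   are removable.\<close>
 define Z0 where "Z0 = pole0 \<union> (\<psi> -` {0} \<inter> (ball 0 1 - pole0))"
 have Z0: "finite Z0" "Z0 \<subseteq> ball 0 1"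
  unfolding Z0_def using pole0_finite pole0_sub finite_vimage_IntI[OF _ psi_inj, of "{0}"] by auto
 have psi1: "\<psi> ` (ball 0 1 - Z0) \<subseteq> S - {0}"
  using psi_in_S by (auto simp: Z0_def)
 have psi_cl: "\<psi> z \<in> closure S - {0}" if "z \<in> cball 0 1 - Z0" for z
 proof (cases "z \<in> ball 0 1")
  case True then show ?thesis using psi1 that closure_subset by blast
 next
  case False
  then have "cmod z = 1" using that by auto
  then show ?thesis using psi_boundary[of z] frS zero_frontier by auto
 qed
 have psi_b: "\<psi> z \<noteq> b" if "z \<in> cball 0 1 - Z0" for z using psi_cl[OF that] b by auto
 have hol: "\<psi> holomorphic_on ball 0 1 - Z0" by (rule holomorphic_on_subset[OF psi_hol]) (auto simp: Z0_def)
 have cont: "continuous_on (cball 0 1 - Z0) \<psi>" by (rule continuous_on_subset[OF psi_cont]) (auto simp: Z0_def)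
 have E_psi: "(\<lambda>z. E (\<psi> z)) holomorphic_on ball 0 1 - Z0"
  using holomorphic_on_compose_gen[OF hol E_hol psi1] by (simp add: comp_def)
 have E_psi_c: "continuous_on (cball 0 1 - Z0) (\<lambda>z. E (\<psi> z))"
 proof (rule continuous_on_compose2[OF E_cont cont], rule image_subsetI)
  fix z assume z: "z \<in> cball 0 1 - Z0"
  show "\<psi> z \<in> - {0, b}" using psi_cl[OF z] psi_b[OF z] by simp
 qed
 have ph: "(\<lambda>z. poly r (\<psi> z) / (\<psi> z - b) ^ L) holomorphic_on ball 0 1 - Z0"
  and pc: "continuous_on (cball 0 1 - Z0) (\<lambda>z. poly r (\<psi> z) / (\<psi> z - b) ^ L)" for r
 proof -
  have "(\<psi> z - b) ^ L \<noteq> 0" if "z \<in> cball 0 1 - Z0" for z using psi_b[OF that] by simp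
  then have ne: "\<forall>z\<in>cball 0 1 - Z0. (\<psi> z - b) ^ L \<noteq> 0" by blast
  then have "\<forall>z\<in>ball 0 1 - Z0. (\<psi> z - b) ^ L \<noteq> 0" by force
  then show "(\<lambda>z. poly r (\<psi> z) / (\<psi> z - b) ^ L) holomorphic_on ball 0 1 - Z0"
   by (intro holomorphic_intros hol) blast
  show "continuous_on (cball 0 1 - Z0) (\<lambda>z. poly r (\<psi> z) / (\<psi> z - b) ^ L)"
   using ne by (intro continuous_intros cont)
 qed
 have X0b: "cmod (X0 (\<psi> z)) \<le> D1" if "z \<in> ball 0 1 - Z0" for z
  unfolding X0_def using D1 far psi_cl[of z] that by auto
 have Y0b: "cmod (Y0 (\<psi> z)) \<le> D2 * ME + D3" if "z \<in> ball 0 1 - Z0" for z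
 proof -
  have w: "\<psi> z \<in> closure S" using psi_cl[of z] that by auto
  have "0 \<le> D2" using order_trans[OF norm_ge_zero D2[OF far[OF w]]] .
  then have "cmod (poly B (\<psi> z) / (\<psi> z - b) ^ L * E (\<psi> z)) \<le> D2 * ME"
   unfolding norm_mult using D2[OF far[OF w]] E_bd[OF w] by (intro mult_mono) auto
  then show ?thesis unfolding Y0_def using D3[OF far[OF w]] by (intro norm_triangle_le_diff add_mono)
 qed
 obtain X where X: "continuous_on (cball 0 1) X" "X holomorphic_on ball 0 1" "\<forall>z\<in>cball 0 1 - Z0. X z = X0 (\<psi> z)"
  using disk_extend_finite[OF Z0, of "\<lambda>z. X0 (\<psi> z)" D1] ph pc X0b unfolding X0_def by blast
 obtain Y where Y: "continuous_on (cball 0 1) Y" "Y holomorphic_on ball 0 1" "\<forall>z\<in>cball 0 1 - Z0. Y z = Y0 (\<psi> z)"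
 proof -
  have "(\<lambda>z. Y0 (\<psi> z)) holomorphic_on ball 0 1 - Z0" "continuous_on (cball 0 1 - Z0) (\<lambda>z. Y0 (\<psi> z))"
   unfolding Y0_def by (intro holomorphic_intros continuous_intros ph pc E_psi E_psi_c)+
  from disk_extend_finite[OF Z0 this Y0b] show ?thesis using that by blast
 qed
 have sph: "xi \<in> cball 0 1 - Z0" if "cmod xi = 1" for xi using that Z0(2) by auto
 show ?thesis unfolding rational_on_circle_def
 proof (rule rational_from_disk_quotient[OF X(1,2) Y(1,2)])
  fix xi :: complex assume xi: "cmod xi = 1"
  have fr: "\<psi> xi \<in> frontier S" by (rule psi_boundary[OF xi])
  show "X xi \<noteq> 0"
   using X(3) sph[OF xi] psi_b[OF sph[OF xi]] psi_cl[OF sph[OF xi]] q(2)[of "\<psi> xi"] frontier_disjoint[OF fr]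
   by (auto simp: X0_def)
  show "X xi * complex_of_real (u xi) = Y xi"
   using X(3) Y(3) sph[OF xi] key[OF fr] by (auto simp: u_def)
 qed
qed

end

section \<open>The boundary curve\<close>

text \<open>The covering of the punctured plane normalized to period 1: the real line goes to the
  circle and the upper half-plane to the punctured disk, so reflection in the circle becomes complex
  conjugation.\<close>

definition unit_exp :: "complex \<Rightarrow> complex" where
 "unit_exp v = exp (2 * of_real pi * \<i> * v)"

lemma unit_exp_holomorphic [holomorphic_intros]:
 "f holomorphic_on A \<Longrightarrow> (\<lambda>v. unit_exp (f v)) holomorphic_on A"
 unfolding unit_exp_def by (intro holomorphic_intros)

lemma norm_unit_exp: "cmod (unit_exp v) = exp (- (2 * pi * Im v))"
 by (simp add: unit_exp_def)

lemma unit_exp_cnj: "unit_exp (cnj v) = inverse (cnj (unit_exp v))"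
proof -
 have "unit_exp (cnj v) = exp (- cnj (2 * of_real pi * \<i> * v))" by (simp add: unit_exp_def)
 then show ?thesis by (simp only: exp_minus exp_cnj[symmetric] unit_exp_def)
qed

lemma unit_exp_eq_iff: "unit_exp v = unit_exp w \<longleftrightarrow> (\<exists>n::int. v = w + of_int n)"
proof -
 have "2 * of_real pi * \<i> * v = 2 * of_real pi * \<i> * w + of_int (2 * n) * of_real pi * \<i> \<longleftrightarrow> v = w + of_int n" for n
 proof -
  have "2 * of_real pi * \<i> * w + of_int (2 * n) * of_real pi * \<i> = 2 * of_real pi * \<i> * (w + of_int n)" by (simp add: algebra_simps)
  then show ?thesis by simp
 qed
 then show ?thesis unfolding unit_exp_def exp_eq by simp
qed

text \<open>The upper half of the strip parametrizes a collar inside \<open>S\<close>, one to one up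
  to the period. Injectivity is not assumed on the real line, since the boundary may touch itself,
  and the lower half carries no information beyond analytic continuation.\<close>

locale boundary_curve =
 fixes S :: "complex set" and C0 :: "complex \<Rightarrow> complex" and \<eta> :: real
 assumes eta_pos: "0 < \<eta>"
  and curve_hol: "C0 holomorphic_on {v. \<bar>Im v\<bar> < \<eta>}"
  and curve_periodic: "C0 (v + 1) = C0 v"
  and curve_upper: "0 < Im v \<Longrightarrow> Im v < \<eta> \<Longrightarrow> C0 v \<in> S"
  and curve_inj: "0 < Im v \<Longrightarrow> Im v < \<eta> \<Longrightarrow> 0 < Im v' \<Longrightarrow> Im v' < \<eta> \<Longrightarrow> C0 v = C0 v' \<Longrightarrow> unit_exp v = unit_exp v'"
  and curve_real: "C0 (of_real s) \<in> frontier S"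
  and curve_onto: "z \<in> frontier S \<Longrightarrow> \<exists>s. z = C0 (of_real s)"
  and domain_open: "open S"
  and domain_interior: "interior (closure S) = S"
begin

definition strip :: "complex set" where "strip = {v. \<bar>Im v\<bar> < \<eta>}"

lemma strip_eq: "strip = {v. Im v < \<eta>} \<inter> {v. - \<eta> < Im v}"
 by (auto simp: strip_def)

lemma strip_open: "open strip"
 unfolding strip_eq by (intro open_Int open_halfspace_Im_lt open_halfspace_Im_gt)

lemma strip_connected: "connected strip"
 unfolding strip_eq by (intro convex_connected convex_Int convex_halfspace_Im_lt convex_halfspace_Im_gt)

lemma strip_cnj: "cnj ` strip = strip"
proof -
 have "v \<in> cnj ` strip" if "v \<in> strip" for v
  by (rule image_eqI[of _ _ "cnj v"]) (use that in \<open>auto simp: strip_def\<close>)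
 then show ?thesis by (auto simp: strip_def)
qed

lemma strip_real [simp]: "of_real s \<in> strip" using eta_pos by (simp add: strip_def)

lemma frontier_notin: "z \<in> frontier S \<Longrightarrow> z \<notin> S"
 using domain_open by (simp add: frontier_def interior_open)

lemma C0_hol: "C0 holomorphic_on strip" using curve_hol by (simp add: strip_def)

lemma C0_nonconstant: "\<not> C0 constant_on strip"
proof
 assume "C0 constant_on strip"
 moreover have "\<i> * of_real (\<eta> / 2) \<in> strip" using eta_pos by (simp add: strip_def)
 ultimately have "C0 (of_real 0) = C0 (\<i> * of_real (\<eta> / 2))"
  using strip_real[of 0] unfolding constant_on_def by metis
 moreover have "C0 (\<i> * of_real (\<eta> / 2)) \<in> S" by (rule curve_upper) (use eta_pos in auto)
 ultimately show False using curve_real[of 0] frontier_notin by auto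
qed

lemma factorization:
 assumes s0: "s0 \<in> strip"
 obtains g r m where "0 < m" "0 < r" "ball s0 r \<subseteq> strip" "g holomorphic_on ball s0 r"
  "\<And>v. v \<in> ball s0 r \<Longrightarrow> C0 v - C0 s0 = (v - s0) ^ m * g v" "\<And>v. v \<in> ball s0 r \<Longrightarrow> g v \<noteq> 0"
proof -
 have h: "(\<lambda>v. C0 v - C0 s0) holomorphic_on strip" by (intro holomorphic_intros C0_hol)
 have n: "\<not> (\<lambda>v. C0 v - C0 s0) constant_on strip"
 proof
  assume "(\<lambda>v. C0 v - C0 s0) constant_on strip"
  then obtain c where "\<forall>v\<in>strip. C0 v - C0 s0 = c" unfolding constant_on_def by blast
  then have "\<forall>v\<in>strip. C0 v = c + C0 s0" by (simp add: diff_eq_eq)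
  then show False using C0_nonconstant unfolding constant_on_def by blast
 qed
 show ?thesis
  by (rule holomorphic_factor_zero_nonconstant[OF h strip_open strip_connected s0 _ n]) (simp, rule that, assumption+)
qed

text \<open>An m-th root of \<open>C0 - C0 s0\<close> is a local coordinate; \<open>z\<close> is its
  inverse, in which the curve is a pure power even at a cusp. The last clause says that parameters
  near \<open>s0\<close> come from small values of the new coordinate.\<close>

lemma normal_form:
 assumes s0: "s0 \<in> strip"
 obtains m d z where "0 < m" "0 < d" "z holomorphic_on ball 0 d" "z ` ball 0 d \<subseteq> strip" "z 0 = s0"
  "\<And>x. x \<in> ball 0 d \<Longrightarrow> C0 (z x) = C0 s0 + x ^ m"
  "\<And>\<delta>. 0 < \<delta> \<Longrightarrow> \<exists>r>0. \<forall>v\<in>ball s0 r. \<exists>x\<in>ball 0 \<delta>. x \<in> ball 0 d \<and> z x = v"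
proof -
 obtain g r m where g: "0 < m" "0 < r" "ball s0 r \<subseteq> strip" "g holomorphic_on ball s0 r"
  "\<And>v. v \<in> ball s0 r \<Longrightarrow> C0 v - C0 s0 = (v - s0) ^ m * g v" "\<And>v. v \<in> ball s0 r \<Longrightarrow> g v \<noteq> 0"
  by (rule factorization[OF s0], rule that, assumption+)
 have s0b: "s0 \<in> ball s0 r" using g(2) by simp
 obtain l where l: "l holomorphic_on ball s0 r" "\<And>v. v \<in> ball s0 r \<Longrightarrow> exp (l v) = g v"
  by (rule holomorphic_logarithm_exists[OF convex_ball open_ball g(4) g(6) s0b]) (assumption, rule that, assumption+)
 define \<sigma> where "\<sigma> = (\<lambda>v. (v - s0) * exp (l v / of_nat m))"
 have sh: "\<sigma> holomorphic_on ball s0 r" unfolding \<sigma>_def by (intro holomorphic_intros l) (use g(1) in auto)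
 have s: "C0 v = C0 s0 + \<sigma> v ^ m" if "v \<in> ball s0 r" for v
 proof -
  have "exp (l v / of_nat m) ^ m = exp (l v)" using g(1) by (simp add: exp_of_nat_mult[symmetric])
  then have "\<sigma> v ^ m = (v - s0) ^ m * g v" using l(2)[OF that] by (simp add: \<sigma>_def power_mult_distrib)
  then show ?thesis using g(5)[OF that] by (simp add: diff_eq_eq add.commute)
 qed
 have "((\<lambda>v. (v - s0) * exp (l v / of_nat m)) has_field_derivative exp (l s0 / of_nat m)) (at s0)"
 proof -
  have "(l has_field_derivative deriv l s0) (at s0)" by (rule holomorphic_derivI[OF l(1) open_ball s0b])
  then show ?thesis using g(1) by (auto intro!: derivative_eq_intros)
 qed
 then have "deriv \<sigma> s0 \<noteq> 0" unfolding \<sigma>_def by (simp add: DERIV_imp_deriv)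
 then obtain r' where r': "r' > 0" "ball s0 r' \<subseteq> ball s0 r" "inj_on \<sigma> (ball s0 r')"
  by (rule has_complex_derivative_locally_injective[OF sh s0b open_ball]) (rule that, assumption+)
 have sh': "\<sigma> holomorphic_on ball s0 r'" using holomorphic_on_subset[OF sh r'(2)] .
 obtain z where z: "z holomorphic_on \<sigma> ` ball s0 r'" "\<And>v. v \<in> ball s0 r' \<Longrightarrow> z (\<sigma> v) = v"
  by (rule holomorphic_has_inverse[OF sh' open_ball r'(3)]) (rule that, assumption+)
 have "open (\<sigma> ` ball s0 r')" by (rule open_mapping_thm3[OF sh' open_ball r'(3)])
 moreover have "0 \<in> \<sigma> ` ball s0 r'" by (rule image_eqI[of _ _ s0]) (use r'(1) in \<open>auto simp: \<sigma>_def\<close>)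
 ultimately obtain d where d: "d > 0" "ball 0 d \<subseteq> \<sigma> ` ball s0 r'" using open_contains_ball by blast
 have zz: "z x \<in> ball s0 r' \<and> \<sigma> (z x) = x" if "x \<in> ball 0 d" for x
 proof -
  obtain v where "v \<in> ball s0 r'" "x = \<sigma> v" using d(2) \<open>x \<in> ball 0 d\<close> by blast
  then show ?thesis using z(2) by simp
 qed
 show ?thesis
 proof (rule that[OF g(1) d(1)])
  show "z holomorphic_on ball 0 d" by (rule holomorphic_on_subset[OF z(1) d(2)])
  show "z ` ball 0 d \<subseteq> strip" using zz r'(2) g(3) by blast
  have "\<sigma> s0 = 0" by (simp add: \<sigma>_def)
  then show "z 0 = s0" using z(2)[of s0] r'(1) by simp
  show "C0 (z x) = C0 s0 + x ^ m" if "x \<in> ball 0 d" for x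
  proof -
   have "z x \<in> ball s0 r" using zz[OF that] r'(2) by blast
   from s[OF this] show ?thesis using zz[OF that] by simp
  qed
  fix \<delta> :: real assume \<delta>: "0 < \<delta>"
  have "continuous_on (ball s0 r') \<sigma>" using sh' holomorphic_on_imp_continuous_on by blast
  then have "isCont \<sigma> s0" using r'(1) by (simp add: continuous_on_eq_continuous_at)
  then obtain q where q: "q > 0" "\<And>v. dist v s0 < q \<Longrightarrow> dist (\<sigma> v) (\<sigma> s0) < min \<delta> d"
   using \<delta> d(1) unfolding continuous_at_eps_delta dist_norm by (metis min_less_iff_conj)
  show "\<exists>r>0. \<forall>v\<in>ball s0 r. \<exists>x\<in>ball 0 \<delta>. x \<in> ball 0 d \<and> z x = v"
  proof (rule exI[of _ "min q r'"], intro conjI ballI)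
   fix v assume v: "v \<in> ball s0 (min q r')"
   have "dist (\<sigma> v) 0 < min \<delta> d" using q(2)[of v] v \<open>\<sigma> s0 = 0\<close> by (simp add: dist_commute)
   moreover have "z (\<sigma> v) = v" using z(2) v by simp
   ultimately show "\<exists>x\<in>ball 0 \<delta>. x \<in> ball 0 d \<and> z x = v" by (intro bexI[of _ "\<sigma> v"]) auto
  qed (use q r' in auto)
 qed
qed

text \<open>If two boundary branches agreed, then reflecting shows that the curve covers a full
neighbourhood of \<open>p\<close> by points of the closure of \<open>S\<close>, contradicting \<open>interior (closure S) = S\<close>.\<close>

lemma branches_coincide:
 assumes d: "0 < d" and n: "0 < n" and p: "p \<in> frontier S"
  and al: "\<alpha> holomorphic_on ball 0 d" "\<alpha> ` ball 0 d \<subseteq> strip" "\<And>t. t \<in> ball 0 d \<Longrightarrow> C0 (\<alpha> t) = p + t ^ n"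
  and be: "\<beta> holomorphic_on ball 0 d" "\<beta> ` ball 0 d \<subseteq> strip" "\<And>t. t \<in> ball 0 d \<Longrightarrow> C0 (\<beta> t) = p + t ^ n"
 shows "\<exists>\<delta>>0. \<forall>t. cmod t < \<delta> \<longrightarrow> t \<noteq> 0 \<longrightarrow> \<alpha> t \<in> \<real> \<longrightarrow> \<beta> t \<in> \<real> \<longrightarrow> unit_exp (\<alpha> t) = unit_exp (\<beta> t)"
proof (rule ccontr)
 assume neg: "\<not> ?thesis"
 define Bad where "Bad = {t\<in>ball 0 d. \<alpha> t \<in> \<real> \<and> \<beta> t \<in> \<real> \<and> unit_exp (\<alpha> t) \<noteq> unit_exp (\<beta> t)}"
 have Bx: "\<exists>t\<in>Bad. t \<noteq> 0 \<and> dist t 0 < e" if e: "e > 0" for e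
 proof -
  have "0 < min e d" using e d by simp
  then obtain t where "cmod t < min e d" "t \<noteq> 0" "\<alpha> t \<in> \<real>" "\<beta> t \<in> \<real>" "unit_exp (\<alpha> t) \<noteq> unit_exp (\<beta> t)"
   using neg by blast
  then show ?thesis by (intro bexI[of _ t]) (auto simp: Bad_def)
 qed
 then have lim: "0 islimpt Bad" by (simp add: islimpt_approachable)
 have sub: "Bad \<subseteq> ball 0 d" by (auto simp: Bad_def)
 define Cs where "Cs = cnj \<circ> C0 \<circ> cnj"
 have Csh: "Cs holomorphic_on strip"
  unfolding Cs_def by (rule holomorphic_on_compose_cnj_cnj[OF _ strip_open]) (simp add: strip_cnj C0_hol)
 have comp: "(\<lambda>t. Cs (f t)) holomorphic_on ball 0 d" if "f holomorphic_on ball 0 d" "f ` ball 0 d \<subseteq> strip" for f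
  using holomorphic_on_compose_gen[OF that(1) Csh that(2)] by (simp add: comp_def)
 \<comment> \<open>At the points of \<open>Bad\<close> both branches are real, so conjugation does
   not change them and the values agree; as these points accumulate at 0, the identity theorem
   spreads the equality to the whole ball.\<close>
 have D0: "Cs (\<alpha> t) - Cs (\<beta> t) = 0" if t: "t \<in> ball 0 d" for t
 proof (rule analytic_continuation[OF _ open_ball connected_ball sub _ lim _ t])
  show "(\<lambda>t. Cs (\<alpha> t) - Cs (\<beta> t)) holomorphic_on ball 0 d" by (intro holomorphic_intros comp al be)
  show "Cs (\<alpha> x) - Cs (\<beta> x) = 0" if x: "x \<in> Bad" for x
  proof -
   have r: "cnj (\<alpha> x) = \<alpha> x" "cnj (\<beta> x) = \<beta> x" and xd: "x \<in> ball 0 d"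
    using x by (auto simp: Bad_def Reals_cnj_iff)
   show ?thesis using al(3)[OF xd] be(3)[OF xd] by (simp add: Cs_def r)
  qed
 qed (use d in auto)
 have D: "C0 (cnj (\<alpha> t)) = C0 (cnj (\<beta> t))" if "t \<in> ball 0 d" for t
  using D0[OF that] by (simp add: Cs_def)
 obtain b where b: "b \<in> Bad" using Bx[OF zero_less_one] by blast
 have "\<forall>\<^sub>F w in at 0. unit_exp (\<alpha> w) - unit_exp (\<beta> w) \<noteq> 0 \<and> w \<in> ball 0 d"
  by (rule non_zero_neighbour_alt[of _ _ _ b])
   (use b sub d in \<open>auto simp: Bad_def intro!: holomorphic_intros al be\<close>)
 then obtain \<delta> where del: "\<delta> > 0" "\<And>w. w \<noteq> 0 \<Longrightarrow> dist w 0 < \<delta> \<Longrightarrow> unit_exp (\<alpha> w) \<noteq> unit_exp (\<beta> w) \<and> w \<in> ball 0 d"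
  unfolding eventually_at by auto
 have cl: "p + t ^ n \<in> closure S" if t: "t \<noteq> 0" "cmod t < \<delta>" for t
 proof -
  have td: "t \<in> ball 0 d" and ne: "unit_exp (\<alpha> t) \<noteq> unit_exp (\<beta> t)" using del(2)[of t] t by auto
  have st: "\<bar>Im (\<alpha> t)\<bar> < \<eta>" "\<bar>Im (\<beta> t)\<bar> < \<eta>" using al(2) be(2) td unfolding strip_def by blast+
  have e: "C0 (\<alpha> t) = C0 (\<beta> t)" using al(3)[OF td] be(3)[OF td] by simp
  have real: "C0 v \<in> frontier S" "cnj v = v" if "Im v = 0" for v
  proof -
   have v: "v = of_real (Re v)" using that by (simp add: complex_eq_iff)
   show "C0 v \<in> frontier S" by (subst v) (rule curve_real)
   show "cnj v = v" using that by (simp add: complex_eq_iff)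
  qed
  consider "Im (\<alpha> t) > 0" | "Im (\<alpha> t) = 0" | "Im (\<alpha> t) < 0" by linarith
  then have "C0 (\<alpha> t) \<in> S \<union> frontier S"
  proof cases
   case 1 then show ?thesis using curve_upper[of "\<alpha> t"] st by auto
  next
   case 2 then show ?thesis using real by auto
  next
   \<comment> \<open>Here the reflected value lies in \<open>S\<close>. A real
     \<open>\<beta> t\<close> would put the same value on the frontier, and a lower one would
     identify the branches by injectivity; so \<open>\<beta> t\<close> is in the upper half and the
     common value is in \<open>S\<close>.\<close>
   case 3
   have S1: "C0 (cnj (\<alpha> t)) \<in> S" using curve_upper[of "cnj (\<alpha> t)"] st 3 by auto
   consider "Im (\<beta> t) > 0" | "Im (\<beta> t) = 0" | "Im (\<beta> t) < 0" by linarith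
   then show ?thesis
   proof cases
    case 1 then show ?thesis using curve_upper[of "\<beta> t"] st e by auto
   next
    case 2 then show ?thesis using real[of "\<beta> t"] D[OF td] S1 frontier_notin by auto
   next
    case 3
    have "unit_exp (cnj (\<alpha> t)) = unit_exp (cnj (\<beta> t))"
     by (rule curve_inj) (use st 3 \<open>Im (\<alpha> t) < 0\<close> D[OF td] in auto)
    then show ?thesis using ne by (simp add: unit_exp_cnj)
   qed
  qed
  then show ?thesis using al(3)[OF td] closure_subset[of S] by (auto simp: frontier_def)
 qed
 have "ball p (\<delta> ^ n) \<subseteq> closure S"
 proof
  fix x assume x: "x \<in> ball p (\<delta> ^ n)"
  obtain t where t: "x - p = t ^ n" using exists_complex_root[of n "x - p"] n by auto
  show "x \<in> closure S"
  proof (cases "t = 0")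
   case True
   then have "x = p" using t n by (simp add: power_0_left)
   then show ?thesis using p by (simp add: frontier_def)
  next
   case False
   have "cmod (x - p) < \<delta> ^ n" using x by (simp add: dist_norm norm_minus_commute)
   then have "cmod t ^ n < \<delta> ^ n" unfolding t norm_power .
   then have "cmod t < \<delta>" using del(1) by (simp add: power_less_imp_less_base)
   moreover have "x = p + t ^ n" using t by (simp add: algebra_simps)
   ultimately show ?thesis using cl[OF False] by simp
  qed
 qed
 then have "p \<in> interior (closure S)" using del(1) by (auto simp: mem_interior intro!: exI[of _ "\<delta> ^ n"])
 then show False using p frontier_notin domain_interior by auto
qed

text \<open>In normal coordinates a coincidence reads x^m = y^l. Setting x = t^l gives y = \<omega>
  t^m with an l-th root of unity \<omega>, so only finitely many pairs of branches occur, each of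
  the form p + t^(m l), and \<open>branches_coincide\<close> treats them one by one.\<close>

lemma double_points_isolated:
 fixes s0 s0' :: real
 assumes eq: "C0 (of_real s0) = C0 (of_real s0')"
 shows "\<exists>\<epsilon>>0. \<forall>s s'. \<bar>s - s0\<bar> < \<epsilon> \<longrightarrow> \<bar>s' - s0'\<bar> < \<epsilon> \<longrightarrow> C0 (of_real s) = C0 (of_real s') \<longrightarrow>
  C0 (of_real s) = C0 (of_real s0) \<or> unit_exp (of_real s) = unit_exp (of_real s')"
proof -
 define p where "p = C0 (of_real s0)"
 have pf: "p \<in> frontier S" unfolding p_def by (rule curve_real)
 obtain m d z where z: "0 < m" "0 < d" "z holomorphic_on ball 0 d" "z ` ball 0 d \<subseteq> strip" "z 0 = of_real s0"
  "\<And>x. x \<in> ball 0 d \<Longrightarrow> C0 (z x) = C0 (of_real s0) + x ^ m"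
  "\<And>\<delta>. 0 < \<delta> \<Longrightarrow> \<exists>r>0. \<forall>v\<in>ball (of_real s0) r. \<exists>x\<in>ball 0 \<delta>. x \<in> ball 0 d \<and> z x = v"
  by (rule normal_form[OF strip_real[of s0]], rule that, assumption+)
 obtain l d' z' where z': "0 < l" "0 < d'" "z' holomorphic_on ball 0 d'" "z' ` ball 0 d' \<subseteq> strip" "z' 0 = of_real s0'"
  "\<And>x. x \<in> ball 0 d' \<Longrightarrow> C0 (z' x) = C0 (of_real s0') + x ^ l"
  "\<And>\<delta>. 0 < \<delta> \<Longrightarrow> \<exists>r>0. \<forall>v\<in>ball (of_real s0') r. \<exists>x\<in>ball 0 \<delta>. x \<in> ball 0 d' \<and> z' x = v"
  by (rule normal_form[OF strip_real[of s0']], rule that, assumption+)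
 define e where "e = min 1 (min d d')"
 have e: "0 < e" "e \<le> 1" "e \<le> d" "e \<le> d'" using z z' by (auto simp: e_def)
 have pw: "\<omega> * t ^ k \<in> ball 0 e" if "t \<in> ball 0 e" "0 < k" "cmod \<omega> = 1" for t \<omega> k
 proof -
  have "cmod t ^ k \<le> cmod t" using that(1,2) e(2) power_decreasing[of 1 k "cmod t"] by simp
  then show ?thesis using that by (simp add: norm_mult norm_power)
 qed
 define \<Omega> where "\<Omega> = {\<omega>::complex. \<omega> ^ l = 1}"
 have fin: "finite \<Omega>" unfolding \<Omega>_def using z'(1) by (intro finite_roots_unity) auto
 have w1: "cmod \<omega> = 1" if "\<omega> \<in> \<Omega>" for \<omega>
 proof -
  have "cmod \<omega> ^ l = 1 ^ l" using that by (simp add: \<Omega>_def norm_power[symmetric])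
  then show ?thesis using power_eq_iff_eq_base[OF z'(1), of "cmod \<omega>" 1] by simp
 qed
 define P where "P = (\<lambda>\<omega> t. z (t ^ l) \<in> \<real> \<longrightarrow> z' (\<omega> * t ^ m) \<in> \<real> \<longrightarrow> unit_exp (z (t ^ l)) = unit_exp (z' (\<omega> * t ^ m)))"
 have "\<forall>\<^sub>F t in at 0. P \<omega> t" if w: "\<omega> \<in> \<Omega>" for \<omega>
 proof -
  have "\<exists>\<delta>>0. \<forall>t. cmod t < \<delta> \<longrightarrow> t \<noteq> 0 \<longrightarrow> z (t ^ l) \<in> \<real> \<longrightarrow> z' (\<omega> * t ^ m) \<in> \<real> \<longrightarrow> unit_exp (z (t ^ l)) = unit_exp (z' (\<omega> * t ^ m))"
  proof (rule branches_coincide[OF e(1), of "m * l" p])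
   have 1: "(\<lambda>t::complex. t ^ l) ` ball 0 e \<subseteq> ball 0 d" using pw[of _ l 1] z'(1) e(3) by (force simp: subset_iff)
   have 2: "(\<lambda>t. \<omega> * t ^ m) ` ball 0 e \<subseteq> ball 0 d'" using pw[of _ m \<omega>] z(1) e(4) w1[OF w] by (force simp: subset_iff)
   show "(\<lambda>t. z (t ^ l)) holomorphic_on ball 0 e"
    by (rule holomorphic_on_compose_gen[OF _ z(3) 1, unfolded comp_def]) (intro holomorphic_intros)
   show "(\<lambda>t. z' (\<omega> * t ^ m)) holomorphic_on ball 0 e"
    by (rule holomorphic_on_compose_gen[OF _ z'(3) 2, unfolded comp_def]) (intro holomorphic_intros)
   show "(\<lambda>t. z (t ^ l)) ` ball 0 e \<subseteq> strip" using 1 z(4) by blast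
   show "(\<lambda>t. z' (\<omega> * t ^ m)) ` ball 0 e \<subseteq> strip" using 2 z'(4) by blast
   show "C0 (z (t ^ l)) = p + t ^ (m * l)" if "t \<in> ball 0 e" for t
   proof -
    have "t ^ l \<in> ball 0 d" using 1 that by blast
    then show ?thesis using z(6) by (simp add: p_def mult.commute[of m] power_mult)
   qed
   show "C0 (z' (\<omega> * t ^ m)) = p + t ^ (m * l)" if "t \<in> ball 0 e" for t
   proof -
    have "\<omega> * t ^ m \<in> ball 0 d'" using 2 that by blast
    then show ?thesis using z'(6) w eq by (simp add: p_def \<Omega>_def power_mult power_mult_distrib)
   qed
  qed (use z z' pf in auto)
  then show ?thesis unfolding eventually_at P_def by auto
 qed
 then have "\<forall>\<^sub>F t in at 0. \<forall>\<omega>\<in>\<Omega>. P \<omega> t" using fin by (simp add: eventually_ball_finite)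
 then obtain \<delta> where del: "\<delta> > 0" "\<And>t \<omega>. t \<noteq> 0 \<Longrightarrow> cmod t < \<delta> \<Longrightarrow> \<omega> \<in> \<Omega> \<Longrightarrow> P \<omega> t"
  unfolding eventually_at by auto
 obtain r where r: "r > 0" "\<forall>v\<in>ball (of_real s0) r. \<exists>x\<in>ball 0 (\<delta> ^ l). x \<in> ball 0 d \<and> z x = v"
  using z(7)[of "\<delta> ^ l"] del(1) by auto
 obtain r' where r': "r' > 0" "\<forall>v\<in>ball (of_real s0') r'. \<exists>x\<in>ball 0 1. x \<in> ball 0 d' \<and> z' x = v"
  using z'(7)[of 1] by auto
 show ?thesis
 proof (rule exI[of _ "min r r'"], intro conjI allI impI)
  show "0 < min r r'" using r r' by simp
  fix s s' :: real
  assume s: "\<bar>s - s0\<bar> < min r r'" "\<bar>s' - s0'\<bar> < min r r'" and ss: "C0 (of_real s) = C0 (of_real s')"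
  have db: "dist (of_real a) (of_real b :: complex) = \<bar>b - a\<bar>" for a b :: real
   by (simp add: dist_norm of_real_diff[symmetric] abs_minus_commute del: of_real_diff)
  obtain x where x: "x \<in> ball 0 (\<delta> ^ l)" "x \<in> ball 0 d" "z x = of_real s" 
  proof -
   have "of_real s \<in> ball (of_real s0 :: complex) r" using s(1) db[of s0 s] by simp
   then show ?thesis using r(2) that by blast
  qed
  obtain y where y: "y \<in> ball 0 d'" "z' y = of_real s'" 
  proof -
   have "of_real s' \<in> ball (of_real s0' :: complex) r'" using s(2) db[of s0' s'] by simp
   then show ?thesis using r'(2) that by blast
  qed
  have xy: "x ^ m = y ^ l" using z(6)[OF x(2)] z'(6)[OF y(1)] x(3) y(2) ss eq by simp
  obtain t where t: "x = t ^ l" using exists_complex_root[of l x] z'(1) by auto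
  show "C0 (of_real s) = C0 (of_real s0) \<or> unit_exp (of_real s) = unit_exp (of_real s')"
  proof (cases "t = 0")
   case True then show ?thesis using x z(5) t z'(1) by (simp add: power_0_left)
  next
   case False
   define \<omega> where "\<omega> = y / t ^ m"
   have w: "\<omega> \<in> \<Omega>" using False xy t by (simp add: \<Omega>_def \<omega>_def power_divide flip: power_mult) (simp add: mult.commute)
   have yt: "y = \<omega> * t ^ m" using False by (simp add: \<omega>_def)
   have "cmod t ^ l < \<delta> ^ l" using x(1) t by (simp add: norm_power)
   then have "cmod t < \<delta>" using del(1) by (simp add: power_less_imp_less_base)
   then show ?thesis using del(2)[OF False _ w] x(3) y(2) t yt by (simp add: P_def)
  qed
 qed
qed

end

section \<open>Primitives along the boundary curve\<close>

context boundary_curve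
begin

definition c :: "real \<Rightarrow> complex" where "c s = C0 (of_real s)"

definition c' :: "real \<Rightarrow> complex" where "c' s = deriv C0 (of_real s)"

text \<open>The primitive of \<open>g\<close> along the curve. The lifts used later lie in {-1..2};
  the base point -2 and the window up to 3 leave a margin for two-sided derivatives there.\<close>

definition prim :: "(complex \<Rightarrow> complex) \<Rightarrow> real \<Rightarrow> complex" where
 "prim g s = integral {-2..s} (\<lambda>t. g (c t) * c' t)"

lemma c_deriv: "(c has_vector_derivative c' s) (at s)"
proof -
 have "(C0 has_field_derivative deriv C0 (of_real s)) (at (of_real s))"
  by (rule holomorphic_derivI[OF C0_hol strip_open strip_real])
 then show ?thesis unfolding c_def[abs_def] c'_def by (rule has_vector_derivative_real_field)
qed

lemma c_cont: "continuous_on A c"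
 by (intro continuous_at_imp_continuous_on ballI has_vector_derivative_continuous[OF c_deriv])

lemma c'_cont: "continuous_on A c'"
proof -
 have "continuous_on strip (deriv C0)"
  by (intro holomorphic_on_imp_continuous_on holomorphic_deriv C0_hol strip_open)
 then have "continuous_on A (\<lambda>s. deriv C0 (of_real s))"
  by (rule continuous_on_compose2) (auto intro!: continuous_intros)
 then show ?thesis by (simp add: c'_def[abs_def])
qed

lemma c_frontier: "c s \<in> frontier S" by (simp add: c_def curve_real)

lemma C0_shift: "C0 (v + of_int n) = C0 v"
proof -
 have nat: "C0 (v + of_nat k) = C0 v" for v k
 proof (induction k)
  case (Suc k)
  have "C0 (v + of_nat (Suc k)) = C0 ((v + of_nat k) + 1)" by (simp add: ac_simps)
  then show ?case using curve_periodic[of "v + of_nat k"] Suc by simp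
 qed simp
 show ?thesis
 proof (cases "n \<ge> 0")
  case True
  then show ?thesis using nat[of v "nat n"] by simp
 next
  case False
  then have "of_nat (nat (- n)) = (- of_int n :: complex)" by simp
  then show ?thesis using nat[of "v + of_int n" "nat (- n)"] by simp
 qed
qed

lemma c_shift: "c (s + of_int n) = c s"
 using C0_shift[of "of_real s" n] by (simp add: c_def)

lemma c_onto: assumes "q \<in> frontier S" shows "\<exists>s\<in>{0..<1}. c s = q"
proof -
 obtain s where s: "q = c s" using curve_onto[OF assms] by (auto simp: c_def)
 have "c (frac s) = q" using c_shift[of s "- floor s"] s by (simp add: frac_def)
 then show ?thesis by (intro bexI[of _ "frac s"]) (simp_all add: frac_lt_1)
qed

lemma frontier_compact: "compact (frontier S)"
proof -
 have "frontier S = c ` {0..1}" using c_onto c_frontier by force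
 then show ?thesis using compact_continuous_image[OF c_cont compact_Icc] by metis
qed

lemma gc_cont:
 assumes "continuous_on (frontier S) g"
 shows "continuous_on A (\<lambda>s. g (c s))"
 by (rule continuous_on_compose2[OF assms c_cont]) (auto simp: c_frontier)

lemma prim_deriv:
 assumes g: "continuous_on (frontier S) g" and s: "-2 < s" "s < 3"
 shows "(prim g has_vector_derivative g (c s) * c' s) (at s)"
proof -
 have "(prim g has_vector_derivative g (c s) * c' s) (at s within {-2..3})"
  unfolding prim_def[abs_def] using s
  by (intro integral_has_vector_derivative continuous_intros gc_cont[OF g] c'_cont) auto
 then show ?thesis using s by (simp add: at_within_Icc_at)
qed

text \<open>Says that \<open>prim g\<close> has derivative \<open>g\<close> with respect to the
  point on the curve, even where the speed vanishes. If \<open>c - c s0\<close> has order m, then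
  |c'| = O(|s - s0|^(m-1)), so the error is o(|s - s0|^m); this is o(|c s - c s0|), because the
  distance is at least \<mu> |s - s0|^m.\<close>

lemma prim_estimate:
 assumes g: "continuous_on (frontier S) g" and s0: "-2 < s0" "s0 < 3" and e: "0 < e"
 shows "\<exists>\<delta>>0. \<forall>s. -2 < s \<longrightarrow> s < 3 \<longrightarrow> \<bar>s - s0\<bar> < \<delta> \<longrightarrow>
  cmod (prim g s - prim g s0 - g (c s0) * (c s - c s0)) \<le> e * cmod (c s - c s0)"
proof -
 obtain h r m where h: "0 < m" "0 < r" "ball (of_real s0) r \<subseteq> strip" "h holomorphic_on ball (of_real s0) r"
  "\<And>v. v \<in> ball (of_real s0) r \<Longrightarrow> C0 v - C0 (of_real s0) = (v - of_real s0) ^ m * h v" "\<And>v. v \<in> ball (of_real s0) r \<Longrightarrow> h v \<noteq> 0"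
  by (rule factorization[OF strip_real[of s0]], rule that, assumption+)
 define \<mu> where "\<mu> = cmod (h (of_real s0)) / 2"
 have mu: "\<mu> > 0" using h(2,6) by (simp add: \<mu>_def)
 define M where "M = real m * (cmod (h (of_real s0)) + 1) + (cmod (deriv h (of_real s0)) + 1)"
 have M: "M > 0" unfolding M_def by (intro add_nonneg_pos) (auto simp: add_nonneg_pos)
 define e2 where "e2 = e * \<mu> / M"
 have e2: "e2 > 0" using e mu M by (simp add: e2_def)
 have ct: "isCont h (of_real s0)" "isCont (deriv h) (of_real s0)"
  using h(2,4) holomorphic_deriv[OF h(4) open_ball]
  by (auto dest!: holomorphic_on_imp_continuous_on simp: continuous_on_eq_continuous_at)
 have ev1: "\<forall>\<^sub>F v in at (of_real s0). dist (h v) (h (of_real s0)) < min 1 \<mu>"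
 proof -
  have "0 < min 1 \<mu>" using mu by simp
  then show ?thesis using ct(1) unfolding isCont_def tendsto_iff by blast
 qed
 have ev2: "\<forall>\<^sub>F v in at (of_real s0). dist (deriv h v) (deriv h (of_real s0)) < 1"
  using ct(2) unfolding isCont_def tendsto_iff by simp
 obtain d1 where d1: "d1 > 0" "\<And>v. v \<noteq> of_real s0 \<Longrightarrow> dist v (of_real s0) < d1 \<Longrightarrow> dist (h v) (h (of_real s0)) < min 1 \<mu> \<and> dist (deriv h v) (deriv h (of_real s0)) < 1"
  using eventually_conj[OF ev1 ev2] unfolding eventually_at by auto
 have "isCont (\<lambda>s. g (c s)) s0" using gc_cont[OF g, of UNIV] by (simp add: continuous_on_eq_continuous_at)
 then obtain d2 where d2: "d2 > 0" "\<And>s. \<bar>s - s0\<bar> < d2 \<Longrightarrow> cmod (g (c s) - g (c s0)) < e2"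
  using e2 unfolding continuous_at_eps_delta dist_norm real_norm_def by blast
 define \<delta> where "\<delta> = min (min d1 d2) (min r 1)"
 have del: "0 < \<delta>" using d1 d2 h(2) by (simp add: \<delta>_def)
 define F where "F = (\<lambda>s. prim g s - g (c s0) * c s)"
 have db: "dist (of_real a) (of_real b :: complex) = \<bar>a - b\<bar>" for a b :: real
  by (simp add: dist_norm of_real_diff[symmetric] del: of_real_diff)
 have Fd: "(F has_vector_derivative (g (c s) - g (c s0)) * c' s) (at s)" if "-2 < s" "s < 3" for s
  unfolding F_def left_diff_distrib
  by (intro has_vector_derivative_diff prim_deriv[OF g that] has_vector_derivative_mult_right c_deriv)
 have bd: "cmod (c' t) \<le> M * \<bar>t - s0\<bar> ^ (m - 1)" and lo: "\<mu> * \<bar>t - s0\<bar> ^ m \<le> cmod (c t - c s0)"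
  if t: "t \<noteq> s0" "\<bar>t - s0\<bar> < \<delta>" for t
 proof -
  let ?v = "of_real t :: complex"
  have tb: "?v \<in> ball (of_real s0) r" using t by (simp add: dist_real_def abs_minus_commute \<delta>_def)
  have near: "dist (h ?v) (h (of_real s0)) < min 1 \<mu>" "dist (deriv h ?v) (deriv h (of_real s0)) < 1"
   using d1(2)[of ?v] t by (auto simp: dist_real_def \<delta>_def)
  have tr: "cmod x \<le> cmod y + dist x y" "cmod y \<le> cmod x + dist x y" for x y :: complex
   using norm_triangle_sub[of x y] norm_triangle_sub[of y x] by (auto simp: dist_norm norm_minus_commute)
  have n1: "cmod (h ?v) \<le> cmod (h (of_real s0)) + 1" "\<mu> \<le> cmod (h ?v)" "cmod (deriv h ?v) \<le> cmod (deriv h (of_real s0)) + 1"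
   using near tr(1)[of "h ?v" "h (of_real s0)"] tr(2)[of "h (of_real s0)" "h ?v"] tr(1)[of "deriv h ?v" "deriv h (of_real s0)"]
   by (auto simp: \<mu>_def)
  have nt: "cmod (?v - of_real s0) = \<bar>t - s0\<bar>" by (metis db dist_norm)
  have "C0 ?v - C0 (of_real s0) = (?v - of_real s0) ^ m * h ?v" by (rule h(5)[OF tb])
  then have "cmod (c t - c s0) = \<bar>t - s0\<bar> ^ m * cmod (h ?v)" by (simp add: c_def norm_mult norm_power nt)
  then show "\<mu> * \<bar>t - s0\<bar> ^ m \<le> cmod (c t - c s0)" using mult_right_mono[OF n1(2), of "\<bar>t - s0\<bar> ^ m"] by (simp add: mult.commute)
  have hd: "(h has_field_derivative deriv h ?v) (at ?v)" by (rule holomorphic_derivI[OF h(4) open_ball tb])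
  have "((\<lambda>v. C0 (of_real s0) + (v - of_real s0) ^ m * h v) has_field_derivative
    of_nat m * (?v - of_real s0) ^ (m - 1) * h ?v + (?v - of_real s0) ^ m * deriv h ?v) (at ?v)"
   by (auto intro!: derivative_eq_intros hd)
  moreover have "\<forall>\<^sub>F v in nhds ?v. v \<in> ball (of_real s0) r" using tb by (intro eventually_nhds_in_open) auto
  then have "\<forall>\<^sub>F v in nhds ?v. C0 (of_real s0) + (v - of_real s0) ^ m * h v = C0 v"
   by eventually_elim (use h(5) in \<open>simp add: algebra_simps\<close>)
  ultimately have "(C0 has_field_derivative of_nat m * (?v - of_real s0) ^ (m - 1) * h ?v + (?v - of_real s0) ^ m * deriv h ?v) (at ?v)"
   by (simp add: DERIV_cong_ev)
  then have c'eq: "c' t = of_nat m * (?v - of_real s0) ^ (m - 1) * h ?v + (?v - of_real s0) ^ m * deriv h ?v"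
   by (simp add: c'_def DERIV_imp_deriv)
  have "cmod (c' t) \<le> real m * \<bar>t - s0\<bar> ^ (m - 1) * cmod (h ?v) + \<bar>t - s0\<bar> ^ m * cmod (deriv h ?v)"
   unfolding c'eq using norm_triangle_ineq by (simp add: norm_mult norm_power nt norm_triangle_le)
  also have "\<dots> \<le> real m * \<bar>t - s0\<bar> ^ (m - 1) * (cmod (h (of_real s0)) + 1) + \<bar>t - s0\<bar> ^ (m - 1) * (cmod (deriv h (of_real s0)) + 1)"
   using n1 t by (intro add_mono mult_mono power_decreasing) (auto simp: \<delta>_def)
  also have "\<dots> = M * \<bar>t - s0\<bar> ^ (m - 1)" by (simp add: M_def algebra_simps)
  finally show "cmod (c' t) \<le> M * \<bar>t - s0\<bar> ^ (m - 1)" .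
 qed
 show ?thesis
 proof (rule exI[of _ \<delta>], intro conjI allI impI del)
  fix s assume s: "-2 < s" "s < 3" "\<bar>s - s0\<bar> < \<delta>"
  define B where "B = e2 * (M * \<bar>s - s0\<bar> ^ (m - 1))"
  have seg: "cmod (F b - F a) \<le> B * b - B * a" if ab: "a < b" "a = s0 \<and> b = s \<or> a = s \<and> b = s0" for a b
  proof (rule differentiable_bound_general[OF ab(1)])
   fix x assume x: "a < x" "x < b"
   have x': "-2 < x" "x < 3" "x \<noteq> s0" "\<bar>x - s0\<bar> < \<delta>" "\<bar>x - s0\<bar> \<le> \<bar>s - s0\<bar>" using x ab s s0 by auto
   show "(F has_vector_derivative (g (c x) - g (c s0)) * c' x) (at x)" by (rule Fd[OF x'(1,2)])
   show "((\<lambda>y. B * y) has_vector_derivative B) (at x)"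
    by (auto intro!: derivative_eq_intros simp: has_real_derivative_iff_has_vector_derivative[symmetric])
   have "cmod (g (c x) - g (c s0)) \<le> e2" using d2(2)[of x] x'(4) by (simp add: \<delta>_def less_imp_le)
   moreover have "cmod (c' x) \<le> M * \<bar>s - s0\<bar> ^ (m - 1)"
    by (rule order_trans[OF bd[OF x'(3,4)]]) (use x'(5) M in \<open>auto intro!: mult_left_mono power_mono\<close>)
   ultimately show "cmod ((g (c x) - g (c s0)) * c' x) \<le> B"
    unfolding B_def norm_mult using e2 by (intro mult_mono) auto
  next
   have "continuous_on {-2<..<3} F"
    by (intro continuous_at_imp_continuous_on ballI has_vector_derivative_continuous[OF Fd]) auto
   then show "continuous_on {a..b} F" by (rule continuous_on_subset) (use ab s s0 in auto)
  qed (intro continuous_intros)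
  have "cmod (F s - F s0) \<le> B * \<bar>s - s0\<bar>"
  proof (cases s s0 rule: linorder_cases)
   case less then show ?thesis using seg[of s s0] by (simp add: norm_minus_commute algebra_simps)
  next
   case greater then show ?thesis using seg[of s0 s] by (simp add: algebra_simps)
  qed simp
  also have "\<dots> = e2 * M * \<bar>s - s0\<bar> ^ m" using h(1) by (cases m) (simp_all add: B_def)
  also have "\<dots> = e * (\<mu> * \<bar>s - s0\<bar> ^ m)" using M by (simp add: e2_def)
  also have "\<dots> \<le> e * cmod (c s - c s0)"
   using lo[of s] s(3) e h(1) by (cases "s = s0") (auto intro!: mult_left_mono simp: power_0_left)
  finally show "cmod (prim g s - prim g s0 - g (c s0) * (c s - c s0)) \<le> e * cmod (c s - c s0)"
   by (simp add: F_def algebra_simps)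
 qed
qed

text \<open>A limit argument on the compact parameter interval: a parameter whose value is close to
  \<open>q\<close> is itself close to some exact lift of \<open>q\<close>. Properties known near
  each lift thus hold for all boundary points near \<open>q\<close>.\<close>

lemma nearby_lift:
 assumes "\<And>t. t \<in> {a..b} \<Longrightarrow> c t = q \<Longrightarrow> \<exists>\<delta>>0. \<forall>s\<in>{a..b}. \<bar>s - t\<bar> < \<delta> \<longrightarrow> Q t s"
 shows "\<exists>\<delta>>0. \<forall>s\<in>{a..b}. cmod (c s - q) < \<delta> \<longrightarrow> (\<exists>t\<in>{a..b}. c t = q \<and> Q t s)"
proof (rule ccontr)
 assume neg: "\<not> ?thesis"
 have "\<exists>s\<in>{a..b}. cmod (c s - q) < inverse (real (Suc n)) \<and> \<not> (\<exists>t\<in>{a..b}. c t = q \<and> Q t s)" for n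
 proof (rule ccontr)
  assume "\<not> ?thesis"
  then have "\<exists>\<delta>>0. \<forall>s\<in>{a..b}. cmod (c s - q) < \<delta> \<longrightarrow> (\<exists>t\<in>{a..b}. c t = q \<and> Q t s)"
   by (intro exI[of _ "inverse (real (Suc n))"]) auto
  then show False using neg by blast
 qed
 then obtain X where X: "\<And>n. X n \<in> {a..b}" "\<And>n. cmod (c (X n) - q) < inverse (real (Suc n))"
   "\<And>n. \<not> (\<exists>t\<in>{a..b}. c t = q \<and> Q t (X n))" by metis
 have "\<forall>f::nat \<Rightarrow> real. (\<forall>n. f n \<in> {a..b}) \<longrightarrow> (\<exists>l\<in>{a..b}. \<exists>r. strict_mono r \<and> (f \<circ> r) \<longlonglongrightarrow> l)"
  using compact_Icc[of a b] unfolding compact_def .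
 then obtain t \<rho> where t: "t \<in> {a..b}" "strict_mono \<rho>" "(X \<circ> \<rho>) \<longlonglongrightarrow> t"
  using X(1) by blast
 have "(\<lambda>n. c (X n) - q) \<longlonglongrightarrow> 0"
  by (rule Lim_null_comparison[OF _ LIMSEQ_inverse_real_of_nat]) (intro always_eventually allI less_imp_le X(2))
 from LIMSEQ_subseq_LIMSEQ[OF this t(2)] have "(\<lambda>n. c ((X \<circ> \<rho>) n) - q) \<longlonglongrightarrow> 0" by (simp add: comp_def)
 moreover have "isCont c t" using c_cont[of UNIV] by (simp add: continuous_on_eq_continuous_at)
 from tendsto_diff[OF isCont_tendsto_compose[OF this t(3)] tendsto_const]
 have "(\<lambda>n. c ((X \<circ> \<rho>) n) - q) \<longlonglongrightarrow> c t - q" .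
 ultimately have "0 = c t - q" by (rule LIMSEQ_unique)
 then have "c t = q" by simp
 from assms[OF t(1) this] obtain \<delta> where \<delta>: "\<delta> > 0" "\<forall>s\<in>{a..b}. \<bar>s - t\<bar> < \<delta> \<longrightarrow> Q t s" by blast
 obtain n where "dist ((X \<circ> \<rho>) n) t < \<delta>" 
  using eventually_happens'[OF sequentially_bot tendstoD[OF t(3) \<delta>(1)]] by blast
 then have "Q t (X (\<rho> n))" using \<delta>(2) X(1) by (simp add: dist_real_def)
 then show False using X(3)[of "\<rho> n"] t(1) \<open>c t = q\<close> by blast
qed

end

section \<open>Contour integrals inside the boundary\<close>

context boundary_curve
begin

lemma lifts_finite: "finite {t\<in>{0..<1}. c t = p}"
proof -
 have f: "(\<lambda>v. C0 v - p) holomorphic_on strip" by (intro holomorphic_intros C0_hol)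
 have nc: "\<not> (\<lambda>v. C0 v - p) constant_on strip"
 proof
  assume "(\<lambda>v. C0 v - p) constant_on strip"
  then obtain k where "\<forall>v\<in>strip. C0 v - p = k" unfolding constant_on_def by blast
  then have "\<forall>v\<in>strip. C0 v = k + p" by (simp add: diff_eq_eq)
  then show False using C0_nonconstant unfolding constant_on_def by blast
 qed
 have "compact (of_real ` {0..1::real} :: complex set)"
  by (intro compact_continuous_image continuous_intros compact_Icc)
 moreover have "of_real ` {0..1::real} \<subseteq> strip" by auto
 ultimately have "finite {z \<in> of_real ` {0..1::real}. C0 z - p = 0}"
  by (rule holomorphic_compact_finite_zeros[OF f strip_open strip_connected _ _ nc])
 then
 have "finite {z \<in> of_real ` {0..1::real}. C0 z - p = 0}" by auto
 then have "finite (of_real -` {z \<in> of_real ` {0..1::real}. C0 z - p = 0} :: real set)"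
  by (rule finite_vimageI) (simp add: inj_of_real)
 then show ?thesis by (rule rev_finite_subset) (auto simp: c_def)
qed

lemma lift_isolated:
 "\<exists>\<epsilon>>0. \<forall>s. \<bar>s - t\<bar> < \<epsilon> \<longrightarrow> c s = c t \<longrightarrow> s = t"
proof -
 obtain h r m where h: "0 < m" "0 < r" "ball (of_real t) r \<subseteq> strip" "h holomorphic_on ball (of_real t) r"
  "\<And>v. v \<in> ball (of_real t) r \<Longrightarrow> C0 v - C0 (of_real t) = (v - of_real t) ^ m * h v" "\<And>v. v \<in> ball (of_real t) r \<Longrightarrow> h v \<noteq> 0"
  by (rule factorization[OF strip_real[of t]], rule that, assumption+)
 show ?thesis
 proof (rule exI[of _ r], intro conjI allI impI h(2))
  fix s assume s: "\<bar>s - t\<bar> < r" "c s = c t"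
  then have b: "of_real s \<in> ball (of_real t :: complex) r" by (simp add: dist_real_def)
  show "s = t" using h(5)[OF b] h(6)[OF b] s(2) by (simp add: c_def)
 qed
qed

text \<open>Near a pair of lifts of the same point the only coincidences are trivial: both
  parameters sit at the lifts, or the parameters are equal. By \<open>double_points_isolated\<close>
  any other coincidence would be a shift by an integer.\<close>

lemma unique_lifts_pair:
 assumes t: "t \<in> {0..<1}" "t' \<in> {0..<1}" "c t = c t'"
 shows "\<forall>\<^sub>F \<epsilon> in at_right 0. \<forall>s s'. \<bar>s - t\<bar> \<le> \<epsilon> \<longrightarrow> \<bar>s' - t'\<bar> \<le> \<epsilon> \<longrightarrow> c s = c s' \<longrightarrow>
  (s = t \<and> s' = t') \<or> (s = s' \<and> t = t')"
proof -
 obtain e1 where e1: "e1 > 0" "\<And>s. \<bar>s - t\<bar> < e1 \<Longrightarrow> c s = c t \<Longrightarrow> s = t" using lift_isolated[of t] by blast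
 obtain e2 where e2: "e2 > 0" "\<And>s. \<bar>s - t'\<bar> < e2 \<Longrightarrow> c s = c t' \<Longrightarrow> s = t'" using lift_isolated[of t'] by blast
 obtain e3 where e3: "e3 > 0" "\<And>s s'. \<bar>s - t\<bar> < e3 \<Longrightarrow> \<bar>s' - t'\<bar> < e3 \<Longrightarrow> c s = c s' \<Longrightarrow>
   c s = c t \<or> unit_exp (of_real s) = unit_exp (of_real s')"
  using double_points_isolated[of t t'] t(3) unfolding c_def by blast
 \<comment> \<open>For distinct lifts in [0, 1) this is half the distance from \<open>t - t'\<close>
   to the nearest integer; for equal lifts 1/2 suffices to exclude a nonzero integer shift.\<close>
 define e4 where "e4 = (if t = t' then 1 else min \<bar>t - t'\<bar> (1 - \<bar>t - t'\<bar>)) / 2"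
 have e4: "e4 > 0" using t by (auto simp: e4_def)
 define e where "e = min (min e1 e2) (min e3 e4)"
 have "e > 0" using e1 e2 e3 e4 by (simp add: e_def)
 have "\<forall>s s'. \<bar>s - t\<bar> \<le> \<epsilon> \<longrightarrow> \<bar>s' - t'\<bar> \<le> \<epsilon> \<longrightarrow> c s = c s' \<longrightarrow> (s = t \<and> s' = t') \<or> (s = s' \<and> t = t')"
  if "\<epsilon> < e" for \<epsilon>
 proof (intro allI impI)
  fix s s' assume s: "\<bar>s - t\<bar> \<le> \<epsilon>" "\<bar>s' - t'\<bar> \<le> \<epsilon>" "c s = c s'"
  have l: "\<bar>s - t\<bar> < e1" "\<bar>s' - t'\<bar> < e2" "\<bar>s - t\<bar> < e3" "\<bar>s' - t'\<bar> < e3" "\<bar>s - t\<bar> < e4" "\<bar>s' - t'\<bar> < e4"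
   using s(1,2) that by (auto simp: e_def)
  from e3(2)[OF l(3,4) s(3)] show "(s = t \<and> s' = t') \<or> (s = s' \<and> t = t')"
  proof
   assume a: "c s = c t"
   have "c s' = c t'" using a s(3) t(3) by simp
   then show ?thesis using e1(2)[OF l(1) a] e2(2)[OF l(2)] by simp
  next
   assume "unit_exp (of_real s) = unit_exp (of_real s')"
   then obtain n :: int where "of_real s = (of_real s' + of_int n :: complex)" unfolding unit_exp_eq_iff by blast
   then have "of_real s = (of_real (s' + of_int n) :: complex)" by simp
   then have n: "s = s' + of_int n" by (simp only: of_real_eq_iff)
   show ?thesis
   proof (cases "t = t'")
    case True
    have "of_int n = (s - t) - (s' - t')" "e4 = 1 / 2" using n True by (simp_all add: e4_def)
    then have "\<bar>of_int n :: real\<bar> < 1" using l(5,6) by linarith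
    then have "n = 0" by linarith
    then show ?thesis using n True by simp
   next
    case False
    have "\<bar>of_int n - (t - t')\<bar> < 2 * e4" using l(5,6) n by linarith
    then have d: "\<bar>of_int n - (t - t')\<bar> < \<bar>t - t'\<bar>" "\<bar>of_int n - (t - t')\<bar> < 1 - \<bar>t - t'\<bar>"
     using False by (auto simp: e4_def)
    then have "\<bar>of_int n :: real\<bar> < 1" by linarith
    then have "n = 0" by linarith
    then show ?thesis using d(1) by simp
   qed
  qed
 qed
 then show ?thesis unfolding eventually_at_right_field using \<open>e > 0\<close> by blast
qed

text \<open>Every boundary point \<open>q\<close> near \<open>p\<close> is reached along a branch of
  the curve from a lift \<open>\<tau> q\<close> of \<open>p\<close> to a lift
  \<open>\<sigma> q\<close>. The increment of \<open>prim g\<close> along it defines a primitive of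
  \<open>g\<close> on the frontier near \<open>p\<close>; branches meet only at \<open>p\<close>,
  where all increments are 0, so the choices fit together.\<close>

lemma local_primitive:
 assumes p: "p \<in> frontier S"
 obtains \<rho> \<tau> \<sigma> where "\<rho> > 0" "\<And>q. \<tau> q \<in> {-1..2::real}" "\<And>q. \<sigma> q \<in> {-1..2::real}"
  "\<And>g q. continuous_on (frontier S) g \<Longrightarrow> q \<in> frontier S \<inter> ball p \<rho> \<Longrightarrow>
   ((\<lambda>x. prim g (\<sigma> x) - prim g (\<tau> x)) has_field_derivative g q) (at q within frontier S)"
proof -
 define P where "P = {t\<in>{0..<1}. c t = p}"
 have finP: "finite P" unfolding P_def by (rule lifts_finite)
 have "\<forall>\<^sub>F \<epsilon> in at_right 0. \<forall>t\<in>P. \<forall>t'\<in>P. \<forall>s s'. \<bar>s - t\<bar> \<le> \<epsilon> \<longrightarrow> \<bar>s' - t'\<bar> \<le> \<epsilon> \<longrightarrow> c s = c s' \<longrightarrow>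
  (s = t \<and> s' = t') \<or> (s = s' \<and> t = t')"
  using unique_lifts_pair by (intro eventually_ball_finite finP ballI) (auto simp: P_def)
 moreover have "\<forall>\<^sub>F \<epsilon> in at_right (0::real). \<epsilon> \<in> {0<..<1}" by (rule eventually_at_right_real) simp
 ultimately have "\<forall>\<^sub>F \<epsilon> in at_right 0. \<epsilon> \<in> {0<..<1} \<and> (\<forall>t\<in>P. \<forall>t'\<in>P. \<forall>s s'. \<bar>s - t\<bar> \<le> \<epsilon> \<longrightarrow> \<bar>s' - t'\<bar> \<le> \<epsilon> \<longrightarrow> c s = c s' \<longrightarrow>
  (s = t \<and> s' = t') \<or> (s = s' \<and> t = t'))" by eventually_elim auto
 then obtain \<epsilon> where ep: "0 < \<epsilon>" "\<epsilon> < 1" and U: "\<And>t t' s s'. t \<in> P \<Longrightarrow> t' \<in> P \<Longrightarrow> \<bar>s - t\<bar> \<le> \<epsilon> \<Longrightarrow> \<bar>s' - t'\<bar> \<le> \<epsilon> \<Longrightarrow> c s = c s' \<Longrightarrow>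
  (s = t \<and> s' = t') \<or> (s = s' \<and> t = t')"
  using eventually_happens'[OF trivial_limit_at_right_real] by (smt (verit, best) greaterThanLessThan_iff)
 have "\<exists>\<delta>>0. \<forall>s\<in>{0..1}. cmod (c s - p) < \<delta> \<longrightarrow> (\<exists>t\<in>{0..1}. c t = p \<and> \<bar>s - t\<bar> < \<epsilon>)"
  by (rule nearby_lift) (use ep in blast)
 then obtain \<rho> where rho: "\<rho> > 0" "\<And>s. s \<in> {0..1} \<Longrightarrow> cmod (c s - p) < \<rho> \<Longrightarrow> \<exists>t\<in>{0..1}. c t = p \<and> \<bar>s - t\<bar> < \<epsilon>"
  by blast
 have "\<exists>t s. t \<in> P \<and> \<bar>s - t\<bar> \<le> \<epsilon> \<and> c s = q" if q: "q \<in> frontier S \<inter> ball p \<rho>" for q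
 proof -
  obtain s where s: "s \<in> {0..<1}" "c s = q" using c_onto q by blast
  have "cmod (c s - p) < \<rho>" using s(2) q by (simp add: dist_norm norm_minus_commute)
  then obtain t where t: "t \<in> {0..1}" "c t = p" "\<bar>s - t\<bar> < \<epsilon>" using rho(2)[of s] s(1) by auto
  show ?thesis
  proof (cases "t = 1")
   case False
   then have "t \<in> P" using t by (auto simp: P_def)
   then show ?thesis using s(2) t(3) less_imp_le by blast
  next
   case True
   have "c 0 = p" using c_shift[of 0 1] t(2) True by simp
   then have "0 \<in> P" by (simp add: P_def)
   moreover have "c (s - 1) = q" using c_shift[of s "-1"] s(2) by simp
   moreover have "\<bar>(s - 1) - 0\<bar> \<le> \<epsilon>" using t(3) True by simp
   ultimately show ?thesis by blast
  qed
 qed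
 \<comment> \<open>The choice of lifts is arbitrary but independent of \<open>g\<close>, so that one
   weight can later serve all integrands.\<close>
 then obtain \<tau>0 \<sigma>0 where ts0: "\<And>q. q \<in> frontier S \<inter> ball p \<rho> \<Longrightarrow> \<tau>0 q \<in> P \<and> \<bar>\<sigma>0 q - \<tau>0 q\<bar> \<le> \<epsilon> \<and> c (\<sigma>0 q) = q"
  by metis
 define \<tau> where "\<tau> q = (if q \<in> frontier S \<inter> ball p \<rho> then \<tau>0 q else 0)" for q
 define \<sigma> where "\<sigma> q = (if q \<in> frontier S \<inter> ball p \<rho> then \<sigma>0 q else 0)" for q
 have ts: "\<tau> q \<in> P" "\<bar>\<sigma> q - \<tau> q\<bar> \<le> \<epsilon>" "c (\<sigma> q) = q" if "q \<in> frontier S \<inter> ball p \<rho>" for q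
  using ts0[OF that] that by (auto simp: \<tau>_def \<sigma>_def)
 have range: "\<tau> q \<in> {-1..2}" "\<sigma> q \<in> {-1..2}" for q
 proof -
  have "\<tau> q \<in> {-1..2} \<and> \<sigma> q \<in> {-1..2}"
  proof (cases "q \<in> frontier S \<inter> ball p \<rho>")
   case True then show ?thesis using ts(1,2)[OF True] ep by (auto simp: P_def)
  next
   case False then show ?thesis by (auto simp: \<tau>_def \<sigma>_def)
  qed
  then show "\<tau> q \<in> {-1..2}" "\<sigma> q \<in> {-1..2}" by auto
 qed
 show ?thesis
 proof (rule that[OF rho(1) range])
  fix g :: "complex \<Rightarrow> complex" and q assume g: "continuous_on (frontier S) g" and q: "q \<in> frontier S \<inter> ball p \<rho>"
  define \<Phi> where "\<Phi> x = prim g (\<sigma> x) - prim g (\<tau> x)" for x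
  have "\<exists>d>0. \<forall>y\<in>frontier S. cmod (y - q) < d \<longrightarrow> cmod (\<Phi> y - \<Phi> q - g q * (y - q)) \<le> e * cmod (y - q)" if e: "e > 0" for e
  proof -
   define Q where "Q t s \<longleftrightarrow> cmod (prim g s - prim g t - g q * (c s - q)) \<le> e * cmod (c s - q)" for t s
   have "\<forall>\<^sub>F \<delta> in at_right 0. \<forall>s\<in>{t-\<epsilon>..t+\<epsilon>}. cmod (c s - q) < \<delta> \<longrightarrow> (\<exists>t'\<in>{t-\<epsilon>..t+\<epsilon>}. c t' = q \<and> Q t' s)" if t: "t \<in> P" for t
   proof -
    have "\<exists>\<delta>>0. \<forall>s\<in>{t-\<epsilon>..t+\<epsilon>}. cmod (c s - q) < \<delta> \<longrightarrow> (\<exists>t'\<in>{t-\<epsilon>..t+\<epsilon>}. c t' = q \<and> Q t' s)"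
    proof (rule nearby_lift)
     fix t' assume t': "t' \<in> {t-\<epsilon>..t+\<epsilon>}" "c t' = q"
     have tb: "0 \<le> t" "t < 1" using t by (auto simp: P_def)
     have b: "-2 < t'" "t' < 3" using t' tb ep by auto
     obtain \<delta> where d: "\<delta> > 0" "\<And>s. -2 < s \<Longrightarrow> s < 3 \<Longrightarrow> \<bar>s - t'\<bar> < \<delta> \<Longrightarrow> Q t' s"
      using prim_estimate[OF g b e] t'(2) unfolding Q_def by blast
     show "\<exists>\<delta>>0. \<forall>s\<in>{t-\<epsilon>..t+\<epsilon>}. \<bar>s - t'\<bar> < \<delta> \<longrightarrow> Q t' s"
      by (rule exI[of _ \<delta>], intro conjI ballI impI d) (use tb ep in auto)
    qed
    then obtain \<delta> where d: "\<delta> > 0" "\<forall>s\<in>{t-\<epsilon>..t+\<epsilon>}. cmod (c s - q) < \<delta> \<longrightarrow> (\<exists>t'\<in>{t-\<epsilon>..t+\<epsilon>}. c t' = q \<and> Q t' s)" by blast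
    show ?thesis unfolding eventually_at_right_field
     by (rule exI[of _ \<delta>], intro conjI d(1) allI impI ballI, rule d(2)[rule_format]) auto
   qed
   then have "\<forall>\<^sub>F \<delta> in at_right 0. \<forall>t\<in>P. \<forall>s\<in>{t-\<epsilon>..t+\<epsilon>}. cmod (c s - q) < \<delta> \<longrightarrow> (\<exists>t'\<in>{t-\<epsilon>..t+\<epsilon>}. c t' = q \<and> Q t' s)"
    by (intro eventually_ball_finite finP) auto
   moreover have "\<forall>\<^sub>F \<delta> in at_right (0::real). \<delta> > 0" by (rule eventually_at_right_less)
   ultimately obtain \<delta> where d: "\<delta> > 0" "\<forall>t\<in>P. \<forall>s\<in>{t-\<epsilon>..t+\<epsilon>}. cmod (c s - q) < \<delta> \<longrightarrow> (\<exists>t'\<in>{t-\<epsilon>..t+\<epsilon>}. c t' = q \<and> Q t' s)"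
    using eventually_happens'[OF trivial_limit_at_right_real eventually_conj] by blast
   define d' where "d' = min \<delta> (\<rho> - dist p q)"
   show ?thesis
   proof (rule exI[of _ d'], intro conjI ballI impI)
    show "d' > 0" using d q by (auto simp: d'_def)
    fix y assume y: "y \<in> frontier S" "cmod (y - q) < d'"
    have "dist p y \<le> dist p q + cmod (y - q)" using dist_triangle[of p y q] by (simp add: dist_norm norm_minus_commute)
    then have yb: "y \<in> frontier S \<inter> ball p \<rho>" using y by (auto simp: d'_def)
    have sy: "\<sigma> y \<in> {\<tau> y - \<epsilon>..\<tau> y + \<epsilon>}" using ts(2)[OF yb] by auto
    have "cmod (c (\<sigma> y) - q) < \<delta>" using ts(3)[OF yb] y(2) by (simp add: d'_def)
    then obtain t' where t': "t' \<in> {\<tau> y - \<epsilon>..\<tau> y + \<epsilon>}" "c t' = q" "Q t' (\<sigma> y)"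
     using d(2) ts(1)[OF yb] sy by blast
    have "\<bar>t' - \<tau> y\<bar> \<le> \<epsilon>" using t'(1) by auto
    \<comment> \<open>Either \<open>q\<close> is the base point and its own increment is 0, or
      \<open>q\<close> lies on the same branch as \<open>y\<close>; in both cases the difference is
      the increment of \<open>prim g\<close> from \<open>t'\<close> to
      \<open>\<sigma> y\<close>.\<close>
    then have "(t' = \<tau> y \<and> \<sigma> q = \<tau> q) \<or> (t' = \<sigma> q \<and> \<tau> y = \<tau> q)"
     by (rule U[OF ts(1)[OF yb] ts(1)[OF q] _ ts(2)[OF q]]) (simp add: t'(2) ts(3)[OF q])
    then have "\<Phi> y - \<Phi> q = prim g (\<sigma> y) - prim g t'" by (auto simp: \<Phi>_def)
    then show "cmod (\<Phi> y - \<Phi> q - g q * (y - q)) \<le> e * cmod (y - q)"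
     using t'(3) ts(3)[OF yb] by (simp add: Q_def)
   qed
  qed
  then have "(\<Phi> has_field_derivative g q) (at q within frontier S)"
   unfolding has_field_derivative_def has_derivative_within_alt by (auto intro: bounded_linear_mult_right)
  then show "((\<lambda>x. prim g (\<sigma> x) - prim g (\<tau> x)) has_field_derivative g q) (at q within frontier S)"
   by (simp add: \<Phi>_def[abs_def])
 qed
qed

text \<open>A bounded multiplicity on the parameter line. It plays the role of a measure carried by
  the boundary and records with sign how often each piece of the curve is traversed.\<close>

definition weight :: "(real \<Rightarrow> real) \<Rightarrow> bool" where
 "weight m \<longleftrightarrow> m \<in> borel_measurable borel \<and> (\<exists>B. \<forall>s. \<bar>m s\<bar> \<le> B) \<and> (\<forall>s. s \<notin> {-2..3} \<longrightarrow> m s = 0)"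

definition wint :: "(real \<Rightarrow> real) \<Rightarrow> (complex \<Rightarrow> complex) \<Rightarrow> complex" where
 "wint m g = (LINT s|lborel. m s *\<^sub>R (g (c s) * c' s))"

lemma weight_integrable:
 fixes F :: "real \<Rightarrow> complex"
 assumes m: "weight m" and F: "continuous_on {-2..3} F"
 shows "integrable lborel (\<lambda>s. m s *\<^sub>R F s)"
proof -
 obtain B where B: "\<And>s. \<bar>m s\<bar> \<le> B" using m by (auto simp: weight_def)
 have [measurable]: "m \<in> borel_measurable borel" using m by (simp add: weight_def)
 have i: "integrable lborel (\<lambda>s. indicator {-2..3} s *\<^sub>R F s)" by (rule borel_integrable_compact[OF compact_Icc F])
 then have [measurable]: "(\<lambda>s. indicator {-2..3} s *\<^sub>R F s) \<in> borel_measurable borel" by simp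
 have eq: "m s *\<^sub>R F s = m s *\<^sub>R (indicator {-2..3} s *\<^sub>R F s)" for s
  using m by (auto simp: weight_def indicator_def)
 show ?thesis unfolding eq
 proof (rule Bochner_Integration.integrable_bound)
  show "integrable lborel (\<lambda>s. B *\<^sub>R (indicator {-2..3} s *\<^sub>R F s))" by (intro integrable_scaleR_right i)
  show "AE s in lborel. norm (m s *\<^sub>R (indicator {-2..3} s *\<^sub>R F s)) \<le> norm (B *\<^sub>R (indicator {-2..3} s *\<^sub>R F s))"
  proof (rule AE_I2)
   fix s show "norm (m s *\<^sub>R (indicator {-2..3} s *\<^sub>R F s)) \<le> norm (B *\<^sub>R (indicator {-2..3} s *\<^sub>R F s))"
    unfolding norm_scaleR using B[of s] by (intro mult_right_mono) auto
  qed
 qed measurable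
qed

lemma wint_integrable:
 assumes "weight m" "continuous_on (frontier S) g"
 shows "integrable lborel (\<lambda>s. m s *\<^sub>R (g (c s) * c' s))"
 using assms by (intro weight_integrable continuous_intros gc_cont c'_cont)

lemma weight_add: assumes "weight m" "weight m'" shows "weight (\<lambda>s. m s + m' s)"
proof -
 obtain B B' where "\<And>s. \<bar>m s\<bar> \<le> B" "\<And>s. \<bar>m' s\<bar> \<le> B'" using assms unfolding weight_def by blast
 then have "\<bar>m s + m' s\<bar> \<le> B + B'" for s by (meson abs_triangle_ineq add_mono order_trans)
 then show ?thesis using assms unfolding weight_def by auto
qed

lemma weight_scale: assumes "weight m" shows "weight (\<lambda>s. a * m s)"
proof -
 obtain B where "\<And>s. \<bar>m s\<bar> \<le> B" using assms unfolding weight_def by blast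
 then have "\<bar>a * m s\<bar> \<le> \<bar>a\<bar> * B" for s by (simp add: abs_mult mult_left_mono)
 then show ?thesis using assms unfolding weight_def by auto
qed

lemma weight_indicator: "b \<le> 3 \<Longrightarrow> weight (indicator {-2..b})"
 unfolding weight_def by (auto simp: indicator_def intro!: exI[of _ 1])

lemma wint_add:
 assumes "weight m" "weight m'" "continuous_on (frontier S) g"
 shows "wint (\<lambda>s. m s + m' s) g = wint m g + wint m' g"
 unfolding wint_def scaleR_add_left using assms by (intro Bochner_Integration.integral_add wint_integrable)

lemma wint_scale: "wint (\<lambda>s. a * m s) g = a *\<^sub>R wint m g"
 unfolding wint_def by (simp flip: scaleR_scaleR)

lemma wint_indicator:
 assumes g: "continuous_on (frontier S) g" and b: "b \<in> {-2..3}"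
 shows "wint (indicator {-2..b}) g = prim g b"
proof -
 have "set_integrable lborel {-2..b} (\<lambda>s. g (c s) * c' s)"
  unfolding set_integrable_def using wint_integrable[OF weight_indicator g, of b] b by simp
 from set_borel_integral_eq_integral(2)[OF this] show ?thesis
  by (simp add: wint_def prim_def set_lebesgue_integral_def)
qed

text \<open>On a short piece of the path the local primitive composed with \<gamma> satisfies the
  fundamental theorem with finitely many exceptional points, so no bound on the speed of \<gamma>
  enters. Having a common weight for all integrands is additive in the interval, and bisection
  assembles the pieces.\<close>

lemma contour_integral_representation:
 assumes \<gamma>: "valid_path \<gamma>" "path_image \<gamma> \<subseteq> frontier S"
 shows "\<exists>m. weight m \<and> (\<forall>g. continuous_on (frontier S) g \<longrightarrow> (g has_contour_integral wint m g) \<gamma>)"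
proof -
 define F where "F = (\<lambda>g t. g (\<gamma> t) * vector_derivative \<gamma> (at t))"
 define R where "R a b \<longleftrightarrow> (0 \<le> a \<and> b \<le> 1 \<longrightarrow>
   (\<exists>m. weight m \<and> (\<forall>g. continuous_on (frontier S) g \<longrightarrow> (F g has_integral wint m g) {a..b})))" for a b
 have g_in: "\<gamma> t \<in> frontier S" if "t \<in> {0..1}" for t using \<gamma>(2) that by (auto simp: path_image_def)
 have gc: "continuous_on {0..1} \<gamma>" using \<gamma>(1) by (simp add: valid_path_imp_path path_def[symmetric])
 obtain Z where Z: "finite Z" "\<gamma> C1_differentiable_on ({0..1} - Z)"
  using \<gamma>(1) by (auto simp: valid_path_def piecewise_C1_differentiable_on_def)
 have gd: "(\<gamma> has_vector_derivative vector_derivative \<gamma> (at t)) (at t)" if "t \<in> {0..1} - Z" for t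
  using Z(2) that C1_differentiable_on_eq vector_derivative_works by blast
 have "R 0 1"
 proof (rule Bolzano)
  fix a b d assume R1: "R a b" and R2: "R b d" and ab: "a \<le> b" "b \<le> d"
  show "R a d" unfolding R_def
  proof (intro impI)
   assume ad: "0 \<le> a \<and> d \<le> 1"
   obtain m1 where m1: "weight m1" "\<And>g. continuous_on (frontier S) g \<Longrightarrow> (F g has_integral wint m1 g) {a..b}"
    using R1 ad ab unfolding R_def by force
   obtain m2 where m2: "weight m2" "\<And>g. continuous_on (frontier S) g \<Longrightarrow> (F g has_integral wint m2 g) {b..d}"
    using R2 ad ab unfolding R_def by force
   show "\<exists>m. weight m \<and> (\<forall>g. continuous_on (frontier S) g \<longrightarrow> (F g has_integral wint m g) {a..d})"
   proof (rule exI[of _ "\<lambda>s. m1 s + m2 s"], intro conjI allI impI weight_add m1 m2)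
    fix g :: "complex \<Rightarrow> complex" assume g: "continuous_on (frontier S) g"
    show "(F g has_integral wint (\<lambda>s. m1 s + m2 s) g) {a..d}"
     unfolding wint_add[OF m1(1) m2(1) g] by (rule has_integral_combine[OF ab m1(2)[OF g] m2(2)[OF g]])
   qed
  qed
 next
  fix x :: real assume x: "0 \<le> x" "x \<le> 1"
  define p where "p = \<gamma> x"
  have p: "p \<in> frontier S" using g_in x by (simp add: p_def)
  obtain \<rho> \<tau> \<sigma> where L: "\<rho> > 0" "\<And>q. \<tau> q \<in> {-1..2::real}" "\<And>q. \<sigma> q \<in> {-1..2::real}"
   "\<And>g q. continuous_on (frontier S) g \<Longrightarrow> q \<in> frontier S \<inter> ball p \<rho> \<Longrightarrow>
    ((\<lambda>x. prim g (\<sigma> x) - prim g (\<tau> x)) has_field_derivative g q) (at q within frontier S)"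
   by (rule local_primitive[OF p], rule that, assumption+)
  obtain d where d: "d > 0" "\<And>t. t \<in> {0..1} \<Longrightarrow> dist t x < d \<Longrightarrow> dist (\<gamma> t) p < \<rho>"
   using gc L(1) x unfolding continuous_on_iff p_def by (meson atLeastAtMost_iff)
  show "\<exists>d>0. \<forall>a b. a \<le> x \<and> x \<le> b \<and> b - a < d \<longrightarrow> R a b"
  proof (rule exI[of _ d], intro conjI d(1) allI impI)
   fix a b assume ab: "a \<le> x \<and> x \<le> b \<and> b - a < d"
   show "R a b" unfolding R_def
   proof (intro impI)
    assume ab1: "0 \<le> a \<and> b \<le> 1"
    \<comment> \<open>The increment of the local primitive is a combination of four values of
      \<open>prim g\<close>, and each such value is the integral against the indicator of an
      interval starting at -2.\<close>
    define m :: "real \<Rightarrow> real" where "m s = (indicator {-2..\<sigma> (\<gamma> b)} s + (-1) * indicator {-2..\<tau> (\<gamma> b)} s)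
      + (-1) * (indicator {-2..\<sigma> (\<gamma> a)} s + (-1) * indicator {-2..\<tau> (\<gamma> a)} s)" for s :: real
    have le: "\<sigma> q \<le> 3" "\<tau> q \<le> 3" "\<sigma> q \<in> {-2..3}" "\<tau> q \<in> {-2..3}" for q using L(2,3)[of q] by auto
    have wm: "weight m" unfolding m_def[abs_def]
     by (intro weight_add weight_scale weight_indicator le)
    have wg: "wint m g = (prim g (\<sigma> (\<gamma> b)) - prim g (\<tau> (\<gamma> b))) - (prim g (\<sigma> (\<gamma> a)) - prim g (\<tau> (\<gamma> a)))"
     if g: "continuous_on (frontier S) g" for g
     unfolding m_def[abs_def]
     by (simp only: wint_add wint_scale g weight_add weight_scale weight_indicator le wint_indicator) simp
    have "(F g has_integral wint m g) {a..b}" if g: "continuous_on (frontier S) g" for g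
    proof -
     define \<Phi> where "\<Phi> = (\<lambda>x. prim g (\<sigma> x) - prim g (\<tau> x))"
     have tin: "\<gamma> t \<in> frontier S \<inter> ball p \<rho>" if "t \<in> {a..b}" for t
     proof -
      have "t \<in> {0..1}" "dist t x < d" using that ab ab1 by (auto simp: dist_real_def)
      then show ?thesis using d(2) g_in by (simp add: dist_commute)
     qed
     have Pd: "(\<Phi> has_field_derivative g (\<gamma> t)) (at (\<gamma> t) within frontier S)" if "t \<in> {a..b}" for t
      unfolding \<Phi>_def by (rule L(4)[OF g tin[OF that]])
     have img: "\<gamma> ` {a..b} \<subseteq> frontier S" using tin by blast
     have "continuous_on (\<gamma> ` {a..b}) \<Phi>"
      unfolding continuous_on_eq_continuous_within
      using Pd img by (blast intro: DERIV_continuous continuous_within_subset)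
     then have cont: "continuous_on {a..b} (\<Phi> \<circ> \<gamma>)"
      using gc ab1 by (intro continuous_on_compose continuous_on_subset[OF gc]) auto
     have der: "((\<Phi> \<circ> \<gamma>) has_vector_derivative F g t) (at t)" if t: "t \<in> {a<..<b} - Z" for t
     proof -
      have t1: "t \<in> {a..b}" "t \<in> {0..1} - Z" using t ab1 by auto
      have g1: "(\<gamma> has_vector_derivative vector_derivative \<gamma> (at t)) (at t within {a..b})"
       using gd[OF t1(2)] has_vector_derivative_at_within by blast
      have P1: "(\<Phi> has_field_derivative g (\<gamma> t)) (at (\<gamma> t) within \<gamma> ` {a..b})"
       by (rule DERIV_subset[OF Pd[OF t1(1)] img])
      have "((\<Phi> \<circ> \<gamma>) has_vector_derivative F g t) (at t within {a..b})"
       using field_vector_diff_chain_within[OF g1 P1] by (simp add: F_def mult.commute)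
      then show ?thesis using t by (simp add: at_within_Icc_at)
     qed
     have "(F g has_integral ((\<Phi> \<circ> \<gamma>) b - (\<Phi> \<circ> \<gamma>) a)) {a..b}"
      by (rule fundamental_theorem_of_calculus_interior_strong[OF Z(1) _ der cont]) (use ab in auto)
     then show ?thesis using wg[OF g] by (simp add: \<Phi>_def)
    qed
    then show "\<exists>m. weight m \<and> (\<forall>g. continuous_on (frontier S) g \<longrightarrow> (F g has_integral wint m g) {a..b})"
     using wm by blast
   qed
  qed
 qed simp
 then show ?thesis unfolding R_def F_def has_contour_integral by simp
qed

end

section \<open>Compactly supported functions as Cauchy transforms, and vanishing of boundary
  weights\<close>

lemma has_derivative_square_max:
 fixes t :: real
 shows "((\<lambda>t. (max 0 t)\<^sup>2) has_real_derivative 2 * max 0 t) (at t)"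
proof (cases t "0::real" rule: linorder_cases)
 case less
 have "((\<lambda>t. 0) has_real_derivative 2 * max 0 t) (at t)" using less by (auto intro!: derivative_eq_intros)
 moreover have "\<forall>\<^sub>F x in nhds t. x \<in> {..<0}" using less by (intro eventually_nhds_in_open) auto
 then have "\<forall>\<^sub>F x in nhds t. 0 = (max 0 x)\<^sup>2" by eventually_elim simp
 ultimately show ?thesis by (rule DERIV_cong_ev[OF refl _ refl, THEN iffD1, rotated])
next
 case greater
 have "((\<lambda>t. t\<^sup>2) has_real_derivative 2 * max 0 t) (at t)" using greater by (auto intro!: derivative_eq_intros)
 moreover have "\<forall>\<^sub>F x in nhds t. x \<in> {0<..}" using greater by (intro eventually_nhds_in_open) auto
 then have "\<forall>\<^sub>F x in nhds t. x\<^sup>2 = (max 0 x)\<^sup>2" by eventually_elim simp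
 ultimately show ?thesis by (rule DERIV_cong_ev[OF refl _ refl, THEN iffD1, rotated])
next
 case equal
 have "((\<lambda>h. (max 0 h)\<^sup>2 / h) \<longlongrightarrow> 0) (at (0::real))"
 proof (rule Lim_null_comparison)
  have "norm ((max 0 h)\<^sup>2 / h) \<le> \<bar>h\<bar>" for h :: real
   by (cases "h > 0") (auto simp: max_def power2_eq_square)
  then show "\<forall>\<^sub>F h in at 0. norm ((max 0 h)\<^sup>2 / h) \<le> \<bar>h\<bar>" for h :: real by simp
  show "((\<lambda>h. \<bar>h\<bar>) \<longlongrightarrow> 0) (at (0::real))" by (rule tendsto_rabs_zero) (rule tendsto_ident_at)
 qed
 then show ?thesis using equal by (simp add: DERIV_def)
qed

definition C1_real :: "(complex \<Rightarrow> real) \<Rightarrow> bool" where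
 "C1_real f \<longleftrightarrow> (\<exists>D. (\<forall>w. (f has_derivative D w) (at w)) \<and> (\<forall>h. continuous_on UNIV (\<lambda>w. D w h)))"

lemma C1_real_mult:
 assumes "C1_real f" "C1_real g" shows "C1_real (\<lambda>w. f w * g w)"
proof -
 obtain D E where D: "\<And>w. (f has_derivative D w) (at w)" "\<And>h. continuous_on UNIV (\<lambda>w. D w h)"
  and E: "\<And>w. (g has_derivative E w) (at w)" "\<And>h. continuous_on UNIV (\<lambda>w. E w h)"
  using assms unfolding C1_real_def by blast
 have "continuous_on UNIV f" "continuous_on UNIV g"
  by (intro continuous_at_imp_continuous_on ballI has_derivative_continuous[OF D(1)] has_derivative_continuous[OF E(1)])+
 then show ?thesis unfolding C1_real_def
  by (intro exI[of _ "\<lambda>w h. f w * E w h + D w h * g w"] conjI allI has_derivative_mult D E continuous_intros)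
qed

lemma C1_real_polynomial:
 assumes "real_polynomial_function f" shows "C1_real f"
 using assms
proof induction
 case (linear f)
 show ?case unfolding C1_real_def
  by (intro exI[of _ "\<lambda>w. f"] conjI allI bounded_linear_imp_has_derivative linear continuous_intros)
next
 case (const d)
 show ?case unfolding C1_real_def by (intro exI[of _ "\<lambda>w h. 0"] conjI allI has_derivative_const continuous_intros)
next
 case (add f g)
 obtain D E where D: "\<And>w. (f has_derivative D w) (at w)" "\<And>h. continuous_on UNIV (\<lambda>w. D w h)"
  and E: "\<And>w. (g has_derivative E w) (at w)" "\<And>h. continuous_on UNIV (\<lambda>w. E w h)"
  using add.IH unfolding C1_real_def by blast
 then show ?case unfolding C1_real_def
  by (intro exI[of _ "\<lambda>w h. D w h + E w h"] conjI allI has_derivative_add D E continuous_intros)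
next
 case (mult f g) then show ?case by (intro C1_real_mult)
qed

lemma C1_real_cutoff: "C1_real (\<lambda>w. (max 0 (R\<^sup>2 - (cmod w)\<^sup>2))\<^sup>2)"
proof -
 have 1: "((\<lambda>w. R\<^sup>2 - (cmod w)\<^sup>2) has_derivative (\<lambda>h. - (2 * (w \<bullet> h)))) (at w)" for w
  unfolding power2_norm_eq_inner by (auto intro!: derivative_eq_intros simp: inner_commute)
 have "((\<lambda>w. (max 0 (R\<^sup>2 - (cmod w)\<^sup>2))\<^sup>2) has_derivative (\<lambda>h. 2 * max 0 (R\<^sup>2 - (cmod w)\<^sup>2) * (- (2 * (w \<bullet> h))))) (at w)" for w
  using has_derivative_compose[OF 1 has_derivative_square_max[unfolded has_field_derivative_def]] by simp
 then show ?thesis unfolding C1_real_def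
  by (intro exI[of _ "\<lambda>w h. 2 * max 0 (R\<^sup>2 - (cmod w)\<^sup>2) * (- (2 * (w \<bullet> h)))"] conjI allI continuous_intros) auto
qed

text \<open>Pompeiu's formula on the square of half-side \<open>R\<close>: every boundary point has
  modulus at least \<open>R\<close>, so the contour term vanishes. The density is -1 / pi times the
  d-bar derivative of \<open>f\<close>.\<close>

lemma C1_compact_support_cauchy_transform:
 assumes f: "C1_real f" and R: "R > 0" "\<And>w. cmod w \<ge> R \<Longrightarrow> f w = 0"
 obtains k M where "integrable lborel k" "\<And>w. cmod (k w) \<le> M"
  "\<And>a. cmod a < R \<Longrightarrow> of_real (f a) = cauchy_transform k a"
proof -
 obtain D where D: "\<And>w. (f has_derivative D w) (at w)" "\<And>h. continuous_on UNIV (\<lambda>w. D w h)"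
  using f unfolding C1_real_def by blast
 define p q where "p = Complex (- R) (- R)" and "q = Complex R R"
 define d where "d = (\<lambda>w. of_real (D w 1) + \<i> * of_real (D w \<i>) :: complex)"
 have dc: "continuous_on A d" for A unfolding d_def by (intro continuous_intros continuous_on_subset[OF D(2)]) auto
 define k where "k = (\<lambda>w. (- 1 / (2 * of_real pi)) * (indicator (cbox p q) w *\<^sub>R d w))"
 have "compact (d ` cbox p q)" by (intro compact_continuous_image dc compact_cbox)
 from compact_imp_bounded[OF this] have "\<exists>M. \<forall>x\<in>d ` cbox p q. cmod x \<le> M" unfolding bounded_iff .
 then obtain M where M: "\<And>w. w \<in> cbox p q \<Longrightarrow> cmod (d w) \<le> M" by blast
 have M0: "M \<ge> 0" using order_trans[OF norm_ge_zero M[of 0]] R(1) by (simp add: p_def q_def in_cbox_complex_iff)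
 show ?thesis
 proof (rule that)
  show "integrable lborel k" unfolding k_def
   by (intro integrable_mult_right borel_integrable_compact compact_cbox dc)
  show "cmod (k w) \<le> M" for w
  proof -
   have "cmod (k w) \<le> 1 * M" unfolding k_def norm_mult
    using M[of w] M0 pi_gt3 by (intro mult_mono) (auto simp: norm_divide norm_mult indicator_def)
   then show ?thesis by simp
  qed
  fix a assume a: "cmod a < R"
  have ab: "a \<in> box p q" using abs_Re_le_cmod[of a] abs_Im_le_cmod[of a] a by (auto simp: in_box_complex_iff p_def q_def)
  have eq: "contour_integral (rectpath p q) (\<lambda>w. of_real (f w) / (w - a)) - 2 * of_real pi * \<i> * of_real (f a)
   = \<i> * (LINT w|lborel. indicator (cbox p q) w *\<^sub>R ((of_real (D w 1) + \<i> * of_real (D w \<i>)) / (w - a)))"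
  proof (rule pompeiu_formula[where U=UNIV and D="\<lambda>w h. of_real (D w h)"])
   show "((\<lambda>w. complex_of_real (f w)) has_derivative (\<lambda>h. of_real (D w h))) (at w)" for w
    by (intro has_derivative_of_real D)
  qed (use ab in \<open>auto intro!: continuous_intros D\<close>)
  have "contour_integral (rectpath p q) (\<lambda>w. of_real (f w) / (w - a)) = contour_integral (rectpath p q) (\<lambda>w. 0)"
  proof (rule contour_integral_eq)
   fix w assume "w \<in> path_image (rectpath p q)"
   then have "w \<in> cbox p q - box p q" using R(1) by (subst (asm) path_image_rectpath_cbox_minus_box) (auto simp: p_def q_def)
   then have "R \<le> \<bar>Re w\<bar> \<or> R \<le> \<bar>Im w\<bar>" by (auto simp: in_box_complex_iff in_cbox_complex_iff p_def q_def)
   then have "cmod w \<ge> R" using abs_Re_le_cmod[of w] abs_Im_le_cmod[of w] by linarith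
   then show "of_real (f w) / (w - a) = 0" using R(2) by simp
  qed
  then have "- (2 * of_real pi * \<i> * of_real (f a)) = \<i> * (LINT w|lborel. indicator (cbox p q) w *\<^sub>R (d w / (w - a)))"
   using eq by (simp add: d_def)
  then have "2 * of_real pi * \<i> * of_real (f a) = - (\<i> * (LINT w|lborel. indicator (cbox p q) w *\<^sub>R (d w / (w - a))))"
   by (rule minus_equation_iff[THEN iffD1, THEN sym])
  then have "\<i> * (2 * of_real pi * of_real (f a)) = \<i> * - (LINT w|lborel. indicator (cbox p q) w *\<^sub>R (d w / (w - a)))"
   by (simp add: mult_ac)
  then have "2 * of_real pi * of_real (f a) = - (LINT w|lborel. indicator (cbox p q) w *\<^sub>R (d w / (w - a)))"
   by (simp only: mult_cancel_left) simp
  then have "of_real (f a) = (- 1 / (2 * of_real pi)) * (LINT w|lborel. indicator (cbox p q) w *\<^sub>R (d w / (w - a)))"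
   by (simp add: field_simps)
  also have "\<dots> = (LINT w|lborel. (- 1 / (2 * of_real pi)) * (indicator (cbox p q) w *\<^sub>R (d w / (w - a))))"
   by (rule integral_mult_right_zero[symmetric])
  also have "\<dots> = cauchy_transform k a"
   unfolding cauchy_transform_def k_def by (intro Bochner_Integration.integral_cong refl) (simp only: scaleR_conv_of_real times_divide_eq_right)
  finally show "of_real (f a) = cauchy_transform k a" .
 qed
qed

context boundary_curve
begin

lemma c_measurable [measurable]: "c \<in> borel_measurable borel" "c' \<in> borel_measurable borel"
 by (auto intro!: borel_measurable_continuous_onI c_cont c'_cont)

text \<open>Fubini. A bound for \<open>k\<close> near the curve makes the inner integral of |k / (w
  - c s)| uniformly bounded, which gives absolute convergence. The minus sign comes from reversing
  \<open>w - c s\<close>.\<close>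

lemma wint_cauchy_transform:
 assumes m: "weight m" and k: "integrable lborel k" and r: "r > 0" and M: "\<And>s w. w \<in> ball (c s) r \<Longrightarrow> cmod (k w) \<le> M"
 shows "wint m (cauchy_transform k) = - (LINT w|lborel. k w * wint m (\<lambda>z. 1 / (z - w)))"
proof -
 have [measurable]: "m \<in> borel_measurable borel" "k \<in> borel_measurable borel" using m k by (auto simp: weight_def)
 define f where "f s w = m s *\<^sub>R (k w / (w - c s) * c' s)" for s w
 have fm: "(\<lambda>(s, w). f s w) \<in> borel_measurable (lborel \<Otimes>\<^sub>M lborel)" unfolding f_def by measurable
 have ik: "integrable lborel (\<lambda>w. k w / (w - c s))" for s by (rule cauchy_transform_integrable[OF k r M])
 define B where "B = 16 * M * r + (LINT w|lborel. cmod (k w)) / r"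
 have B: "(LINT w|lborel. cmod (k w / (w - c s))) \<le> B" for s
  unfolding B_def by (rule cauchy_transform_norm_bound[OF k r M])
 have nf: "(LINT w|lborel. norm (f s w)) = norm (m s *\<^sub>R c' s) * (LINT w|lborel. cmod (k w / (w - c s)))" for s
 proof -
  have "(LINT w|lborel. norm (f s w)) = (LINT w|lborel. norm (m s *\<^sub>R c' s) * cmod (k w / (w - c s)))"
   unfolding f_def by (intro Bochner_Integration.integral_cong refl) (simp only: norm_scaleR norm_mult mult_ac)
  then show ?thesis by simp
 qed
 have int: "integrable (lborel \<Otimes>\<^sub>M lborel) (\<lambda>(s, w). f s w)"
 proof (rule lborel_pair.Fubini_integrable[OF fm])
  have [measurable]: "(\<lambda>s. LINT w|lborel. cmod (k w / (w - c s))) \<in> borel_measurable borel" by measurable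
  have "integrable lborel (\<lambda>s. norm (m s *\<^sub>R c' s) * (LINT w|lborel. cmod (k w / (w - c s))))"
  proof (rule Bochner_Integration.integrable_bound)
   show "integrable lborel (\<lambda>s. norm (m s *\<^sub>R c' s) * B)"
    by (intro integrable_mult_left integrable_norm weight_integrable m c'_cont)
   show "AE s in lborel. norm (norm (m s *\<^sub>R c' s) * (LINT w|lborel. cmod (k w / (w - c s)))) \<le> norm (norm (m s *\<^sub>R c' s) * B)"
   proof (rule AE_I2)
    fix s
    have "0 \<le> (LINT w|lborel. cmod (k w / (w - c s)))" by simp
    then show "norm (norm (m s *\<^sub>R c' s) * (LINT w|lborel. cmod (k w / (w - c s)))) \<le> norm (norm (m s *\<^sub>R c' s) * B)"
     unfolding norm_mult using B[of s] by (intro mult_left_mono) auto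
   qed
  qed measurable
  then show "integrable lborel (\<lambda>s. LINT w|lborel. norm (case (s, w) of (s, w) \<Rightarrow> f s w))" by (simp add: nf)
  show "AE s in lborel. integrable lborel (\<lambda>w. case (s, w) of (s, w) \<Rightarrow> f s w)"
   unfolding f_def prod.case by (intro AE_I2 integrable_scaleR_right integrable_mult_left ik)
 qed
 have "wint m (cauchy_transform k) = (LINT s|lborel. LINT w|lborel. f s w)"
  by (simp only: wint_def cauchy_transform_def f_def integral_scaleR_right integral_mult_left_zero)
 also have "\<dots> = (LINT w|lborel. LINT s|lborel. f s w)"
  by (rule lborel_pair.Fubini_integral[OF int, symmetric])
 also have "\<dots> = (LINT w|lborel. - (k w * wint m (\<lambda>z. 1 / (z - w))))"
 proof (intro Bochner_Integration.integral_cong refl)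
  fix w
  have "f s w = - k w * (m s *\<^sub>R (1 / (c s - w) * c' s))" for s
  proof -
   have "k w / (w - c s) = - k w * (1 / (c s - w))" using minus_divide_right[of "k w" "c s - w"] by simp
   then show ?thesis by (simp add: f_def)
  qed
  then have "(LINT s|lborel. f s w) = (LINT s|lborel. - k w * (m s *\<^sub>R (1 / (c s - w) * c' s)))" by simp
  then show "(LINT s|lborel. f s w) = - (k w * wint m (\<lambda>z. 1 / (z - w)))"
   by (simp only: integral_mult_right_zero wint_def) simp
 qed
 finally show ?thesis by simp
qed

text \<open>A differentiable image of the line is negligible in the plane. Kernel integrals are
  known only for \<open>w\<close> off the frontier, and this makes that knowledge sufficient under
  an area integral.\<close>

lemma frontier_null: "frontier S \<in> null_sets lborel"
proof -
 have "frontier S = c ` UNIV" using c_onto c_frontier by blast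
 moreover have "negligible (c ` UNIV)"
 proof (rule negligible_differentiable_image_lowdim)
  show "DIM(real) < DIM(complex)" by simp
  show "c differentiable_on UNIV" using c_deriv unfolding differentiable_on_def has_vector_derivative_def
   by (auto intro: differentiableI)
 qed
 ultimately have "frontier S \<in> null_sets (completion lborel)" by (simp add: negligible_iff_null_sets)
 moreover have "frontier S \<in> sets lborel" by simp
 ultimately show ?thesis by (simp add: null_sets_completion_iff)
qed

lemma wint_bound:
 assumes m: "weight m"
 shows "\<exists>C. \<forall>g e. continuous_on (frontier S) g \<longrightarrow> (\<forall>z\<in>frontier S. cmod (g z) \<le> e) \<longrightarrow> cmod (wint m g) \<le> e * C"
proof (rule exI[of _ "LINT s|lborel. norm (m s *\<^sub>R c' s)"], intro allI impI)
 fix g :: "complex \<Rightarrow> complex" and e assume g: "continuous_on (frontier S) g" "\<forall>z\<in>frontier S. cmod (g z) \<le> e"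
 have "cmod (wint m g) \<le> (LINT s|lborel. e * norm (m s *\<^sub>R c' s))"
  unfolding wint_def
 proof (rule Bochner_Integration.integral_norm_bound_integral)
  fix s
  have "cmod (g (c s)) * norm (m s *\<^sub>R c' s) \<le> e * norm (m s *\<^sub>R c' s)"
   using g(2) c_frontier by (intro mult_right_mono) auto
  then show "norm (m s *\<^sub>R (g (c s) * c' s)) \<le> e * norm (m s *\<^sub>R c' s)" by (simp add: norm_mult mult_ac)
 qed (intro wint_integrable m g integrable_mult_right integrable_norm weight_integrable c'_cont)+
 then show "cmod (wint m g) \<le> e * (LINT s|lborel. norm (m s *\<^sub>R c' s))" by simp
qed

lemma wint_lin:
 assumes m: "weight m" and g: "continuous_on (frontier S) g1" "continuous_on (frontier S) g2"
 shows "wint m (\<lambda>z. a * g1 z + b * g2 z) = a * wint m g1 + b * wint m g2"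
proof -
 have "wint m (\<lambda>z. a * g1 z + b * g2 z) = (LINT s|lborel. a * (m s *\<^sub>R (g1 (c s) * c' s)) + b * (m s *\<^sub>R (g2 (c s) * c' s)))"
  unfolding wint_def by (intro Bochner_Integration.integral_cong refl) (simp add: algebra_simps)
 also have "\<dots> = a * wint m g1 + b * wint m g2"
  unfolding wint_def Bochner_Integration.integral_add[OF integrable_mult_right[OF wint_integrable[OF m g(1)]] integrable_mult_right[OF wint_integrable[OF m g(2)]]]
  by (simp only: integral_mult_right_zero)
 finally show ?thesis .
qed

lemma wint_cong: "(\<And>z. z \<in> frontier S \<Longrightarrow> f z = g z) \<Longrightarrow> wint m f = wint m g"
 by (simp add: wint_def c_frontier)

text \<open>The Hartogs--Rosenthal theorem for the null set \<open>frontier S\<close>, in dual form.\<close>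

lemma wint_eq_0:
 assumes m: "weight m" and z: "\<And>w. w \<notin> frontier S \<Longrightarrow> wint m (\<lambda>z. 1 / (z - w)) = 0"
  and g: "continuous_on (frontier S) g"
 shows "wint m g = 0"
proof -
 obtain C where C: "\<And>g e. continuous_on (frontier S) g \<Longrightarrow> \<forall>z\<in>frontier S. cmod (g z) \<le> e \<Longrightarrow> cmod (wint m g) \<le> e * C"
  using wint_bound[OF m] by blast
 obtain R0 where R0: "\<And>z. z \<in> frontier S \<Longrightarrow> cmod z \<le> R0"
  using compact_imp_bounded[OF frontier_compact] unfolding bounded_iff by blast
 define R where "R = \<bar>R0\<bar> + 1"
 have R: "R > 0" "\<And>z. z \<in> frontier S \<Longrightarrow> cmod z < R"
 proof -
  show "R > 0" by (simp add: R_def)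
  show "cmod z < R" if "z \<in> frontier S" for z using R0[OF that] by (simp add: R_def)
 qed
 \<comment> \<open>Vanishing from radius \<open>R\<close> on and positive on the frontier; the outer
   square makes the truncated function continuously differentiable.\<close>
 define cut where "cut w = (max 0 (R\<^sup>2 - (cmod w)\<^sup>2))\<^sup>2" for w :: complex
 have chi_c: "C1_real cut" unfolding cut_def[abs_def] by (rule C1_real_cutoff)
 have sq: "R\<^sup>2 - (cmod z)\<^sup>2 > 0" if "z \<in> frontier S" for z
  using power_strict_mono[OF R(2)[OF that], of 2] by simp
 have chi_pos: "cut z > 0" if "z \<in> frontier S" for z using sq[OF that] by (simp add: cut_def)
 have chi_le: "cut z \<le> R ^ 4" if "z \<in> frontier S" for z
 proof -
  have "cut z \<le> (R\<^sup>2)\<^sup>2" unfolding cut_def using sq[OF that] by (intro power_mono) auto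
  then show ?thesis by (simp flip: power_mult)
 qed
 have chi_cont: "continuous_on A cut" for A unfolding cut_def[abs_def] by (intro continuous_intros)
 have poly0: "wint m (\<lambda>w. of_real (f w * cut w)) = 0" if f: "real_polynomial_function f" for f
 proof -
  have "C1_real (\<lambda>w. f w * cut w)" by (intro C1_real_mult C1_real_polynomial f chi_c)
  moreover have "f w * cut w = 0" if "cmod w \<ge> R" for w
  proof -
   have "R\<^sup>2 \<le> (cmod w)\<^sup>2" using that R(1) by (intro power_mono) auto
   then show ?thesis by (simp add: cut_def)
  qed
  ultimately obtain k M where k: "integrable lborel k" "\<And>w. cmod (k w) \<le> M"
   "\<And>a. cmod a < R \<Longrightarrow> of_real (f a * cut a) = cauchy_transform k a"
   using C1_compact_support_cauchy_transform[OF _ R(1)] by blast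
  have "wint m (\<lambda>w. of_real (f w * cut w)) = wint m (cauchy_transform k)"
   by (rule wint_cong) (use k(3) R(2) in blast)
  also have "\<dots> = - (LINT w|lborel. k w * wint m (\<lambda>z. 1 / (z - w)))"
   by (rule wint_cauchy_transform[OF m k(1) zero_less_one k(2)])
  also have "(LINT w|lborel. k w * wint m (\<lambda>z. 1 / (z - w))) = 0"
   by (rule integral_eq_zero_AE) (use AE_not_in[OF frontier_null] z in \<open>auto elim: eventually_mono\<close>)
  finally show ?thesis by simp
 qed
 have real0: "wint m (\<lambda>z. of_real (f z)) = 0" if f: "continuous_on (frontier S) f" for f :: "complex \<Rightarrow> real"
 proof -
  have "cmod (wint m (\<lambda>z. of_real (f z))) \<le> e * R ^ 4 * C" if e: "e > 0" for e
  proof -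
   \<comment> \<open>Annihilation is known for polynomials times \<open>cut\<close>, so it is
     \<open>f / cut\<close> that is approximated; multiplying back costs at most the factor
     \<open>R ^ 4\<close>.\<close>
   have "continuous_on (frontier S) (\<lambda>z. f z / cut z)" using chi_pos by (intro continuous_intros f chi_cont) force
   from Stone_Weierstrass_real_polynomial_function[OF frontier_compact this e]
   obtain P where P: "real_polynomial_function P" "\<And>z. z \<in> frontier S \<Longrightarrow> \<bar>f z / cut z - P z\<bar> < e" by blast
   have Pc: "continuous_on (frontier S) P"
    using continuous_on_polymonial_function P(1) real_polynomial_function_eq by blast
   have "wint m (\<lambda>z. 1 * of_real (f z) + (-1) * of_real (P z * cut z)) = wint m (\<lambda>z. of_real (f z))"
    by (subst wint_lin[OF m]) (auto intro!: continuous_intros f Pc chi_cont simp: poly0[OF P(1), simplified])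
   moreover have "cmod (wint m (\<lambda>z. 1 * of_real (f z) + (-1) * of_real (P z * cut z))) \<le> (e * R ^ 4) * C"
   proof (rule C)
    show "\<forall>z\<in>frontier S. cmod (1 * of_real (f z) + (-1) * of_real (P z * cut z)) \<le> e * R ^ 4"
    proof
     fix z assume zf: "z \<in> frontier S"
     have "1 * of_real (f z) + (-1) * of_real (P z * cut z) = (of_real (f z - P z * cut z) :: complex)" by simp
     then have "cmod (1 * of_real (f z) + (-1) * of_real (P z * cut z)) = \<bar>f z - P z * cut z\<bar>" by (simp only: norm_of_real)
     also have "f z - P z * cut z = (f z / cut z - P z) * cut z" using chi_pos[OF zf] by (simp add: field_simps)
     also have "\<bar>\<dots>\<bar> \<le> e * R ^ 4"
      unfolding abs_mult using P(2)[OF zf] chi_pos[OF zf] chi_le[OF zf] e by (intro mult_mono) auto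
     finally show "cmod (1 * of_real (f z) + (-1) * of_real (P z * cut z)) \<le> e * R ^ 4" .
    qed
   qed (intro continuous_intros f Pc chi_cont)
   ultimately show ?thesis by simp
  qed
  then have "\<forall>\<^sub>F e in at_right 0. cmod (wint m (\<lambda>z. of_real (f z))) \<le> e * R ^ 4 * C"
   using eventually_at_right_less[of "0::real"] by (auto elim: eventually_mono)
  moreover have "((\<lambda>e. e * R ^ 4 * C) \<longlongrightarrow> 0 * R ^ 4 * C) (at_right 0)" by (intro tendsto_intros)
  ultimately have "cmod (wint m (\<lambda>z. of_real (f z))) \<le> 0 * R ^ 4 * C"
   by (intro tendsto_lowerbound) auto
  then show ?thesis by simp
 qed
 have "wint m g = wint m (\<lambda>z. 1 * of_real (Re (g z)) + \<i> * of_real (Im (g z)))"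
  by (intro wint_cong) (simp add: complex_eq)
 also have "\<dots> = 0"
  by (subst wint_lin[OF m]) (auto intro!: continuous_intros g simp: real0[OF continuous_on_Re[OF g]] real0[OF continuous_on_Im[OF g]])
 finally show ?thesis .
qed

end

section \<open>Residues\<close>

text \<open>Subtracting the principal parts leaves a function of the disk algebra, whose integral
  vanishes. Continuity up to the circle replaces holomorphy across it, and the poles enter through
  limits alone.\<close>

lemma circle_integral_simple_poles:
 assumes Z: "finite Z" "Z \<subseteq> ball 0 1" and Tc: "continuous_on (cball 0 1 - Z) T" and Th: "T holomorphic_on ball 0 1 - Z"
  and r: "\<And>\<zeta>. \<zeta> \<in> Z \<Longrightarrow> ((\<lambda>z. (z - \<zeta>) * T z) \<longlongrightarrow> r \<zeta>) (at \<zeta>)"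
 shows "(T has_contour_integral 2 * of_real pi * \<i> * (\<Sum>\<zeta>\<in>Z. r \<zeta>)) (circlepath 0 1)"
proof -
 define P where "P = (\<lambda>z. \<Sum>\<zeta>\<in>Z. r \<zeta> / (z - \<zeta>))"
 have Ph: "P holomorphic_on A" if "A \<inter> Z = {}" for A
  unfolding P_def using that by (auto intro!: holomorphic_intros)
 have lim: "((\<lambda>z. (z - \<zeta>) * (T z - P z)) \<longlongrightarrow> 0) (at \<zeta>)" if z: "\<zeta> \<in> Z" for \<zeta>
 proof -
  define Q where "Q = (\<lambda>z. \<Sum>\<omega>\<in>Z - {\<zeta>}. r \<omega> / (z - \<omega>))"
  have "((\<lambda>z. (z - \<zeta>) * T z - r \<zeta> - (z - \<zeta>) * Q z) \<longlongrightarrow> r \<zeta> - r \<zeta> - (\<zeta> - \<zeta>) * Q \<zeta>) (at \<zeta>)"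
   unfolding Q_def by (intro tendsto_intros r z) auto
  moreover have "\<forall>\<^sub>F z in at \<zeta>. (z - \<zeta>) * T z - r \<zeta> - (z - \<zeta>) * Q z = (z - \<zeta>) * (T z - P z)"
   unfolding eventually_at_filter
  proof (intro always_eventually allI impI)
   fix z assume "z \<noteq> \<zeta>"
   then show "(z - \<zeta>) * T z - r \<zeta> - (z - \<zeta>) * Q z = (z - \<zeta>) * (T z - P z)"
    unfolding P_def Q_def sum.remove[OF Z(1) z] by (simp add: algebra_simps) (simp add: field_simps)
  qed
  ultimately show ?thesis by (simp add: Lim_transform_eventually)
 qed
 have "\<exists>g. g holomorphic_on ball 0 1 \<and> (\<forall>z\<in>ball 0 1 - Z. g z = T z - P z)"
  by (rule holomorphic_extend_finite_lim[OF Z(1) open_ball Z(2) _ lim]) (auto intro!: holomorphic_intros Th Ph)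
 then obtain g where g: "g holomorphic_on ball 0 1" "\<And>z. z \<in> ball 0 1 - Z \<Longrightarrow> g z = T z - P z" by blast
 have "continuous_on (cball 0 1 - Z) (\<lambda>z. T z - P z)"
  by (intro continuous_intros Tc holomorphic_on_imp_continuous_on Ph) auto
 from disk_extend[OF Z g this]
 obtain h where hc: "continuous_on (cball 0 1) h" and hh: "h holomorphic_on ball 0 1"
  and hT: "\<forall>z\<in>cball 0 1 - Z. h z = T z - P z" by blast
 have "(h has_contour_integral 0) (circlepath 0 1)"
  by (rule Cauchy_theorem_convex[OF hc, where K="{}"]) (use hh in \<open>auto intro: holomorphic_on_imp_differentiable_at\<close>)
 moreover have "(P has_contour_integral (\<Sum>\<zeta>\<in>Z. 2 * of_real pi * \<i> * r \<zeta>)) (circlepath 0 1)"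
  unfolding P_def
 proof (rule has_contour_integral_sum[OF Z(1)])
  fix \<zeta> assume "\<zeta> \<in> Z"
  then show "((\<lambda>z. r \<zeta> / (z - \<zeta>)) has_contour_integral 2 * of_real pi * \<i> * r \<zeta>) (circlepath 0 1)"
   using Z(2) by (intro Cauchy_integral_circlepath_simple) auto
 qed
 ultimately have "((\<lambda>z. h z + P z) has_contour_integral 0 + (\<Sum>\<zeta>\<in>Z. 2 * of_real pi * \<i> * r \<zeta>)) (circlepath 0 1)"
  by (rule has_contour_integral_add)
 then have "((\<lambda>z. h z + P z) has_contour_integral 2 * of_real pi * \<i> * (\<Sum>\<zeta>\<in>Z. r \<zeta>)) (circlepath 0 1)"
  by (simp add: sum_distrib_left)
 then show ?thesis
 proof (rule has_contour_integral_eq)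
  fix x assume "x \<in> path_image (circlepath 0 1)"
  then have "x \<in> cball 0 1 - Z" using Z(2) by auto
  then show "h x + P x = T x" using hT by simp
 qed
qed

lemma unit_exp_onto:
 assumes "cmod xi = 1" shows "unit_exp (of_real (Arg xi / (2 * pi))) = xi"
proof -
 have "2 * of_real pi * \<i> * of_real (Arg xi / (2 * pi)) = \<i> * of_real (Arg xi)" by simp
 moreover have "xi \<noteq> 0" using assms by auto
 then have "exp (\<i> * of_real (Arg xi)) = xi" using Arg_eq[of xi] assms by simp
 ultimately show ?thesis by (simp add: unit_exp_def)
qed

lemma unit_exp_local_inverse:
 assumes v0: "Im v0 = 0" and e: "\<eta> > 0"
 shows "\<exists>L. isCont L (unit_exp v0) \<and> L (unit_exp v0) = v0 \<and> (\<forall>\<^sub>F z in nhds (unit_exp v0). unit_exp (L z) = z \<and> Im (L z) < \<eta>)"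
proof -
 define xi where "xi = unit_exp v0"
 define L where "L = (\<lambda>z. v0 + Ln (z / xi) / (2 * of_real pi * \<i>))"
 have x0: "xi \<noteq> 0" by (simp add: xi_def unit_exp_def)
 have c: "isCont L xi" unfolding L_def using x0 by (intro continuous_intros) auto
 have L0: "L xi = v0" using x0 by (simp add: L_def)
 have "(L \<longlongrightarrow> L xi) (nhds xi)" using c unfolding isCont_def tendsto_at_iff_tendsto_nhds .
 then have "(L \<longlongrightarrow> v0) (nhds xi)" by (simp only: L0)
 then have "((\<lambda>z. Im (L z)) \<longlongrightarrow> Im v0) (nhds xi)" by (rule tendsto_Im)
 then have "\<forall>\<^sub>F z in nhds xi. Im (L z) < \<eta>" using v0 e by (intro order_tendstoD(2)) auto
 moreover have "\<forall>\<^sub>F z in nhds xi. z \<in> - {0}" using x0 by (intro eventually_nhds_in_open) auto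
 ultimately have "\<forall>\<^sub>F z in nhds xi. unit_exp (L z) = z \<and> Im (L z) < \<eta>"
 proof eventually_elim
  case (elim z)
  have "unit_exp (L z) = unit_exp v0 * exp (Ln (z / xi))"
   by (simp add: L_def unit_exp_def distrib_left exp_add)
  then show ?case using elim x0 by (simp add: xi_def[symmetric])
 qed
 then show ?thesis using c L0 unfolding xi_def by blast
qed

text \<open>The residue theorem in the coordinate \<open>v\<close> with z =
  \<open>unit_exp v\<close>, where T dz = H dv. \<open>T\<close> lives inside the disk; its boundary
  values are taken from \<open>H\<close>, which is continuous down to the real line.\<close>

lemma strip_residue:
 assumes Z: "finite Z" "Z \<subseteq> ball 0 1" and Th: "T holomorphic_on ball 0 1 - Z" and e: "\<eta> > 0"
  and r: "\<And>\<zeta>. \<zeta> \<in> Z \<Longrightarrow> ((\<lambda>z. (z - \<zeta>) * T z) \<longlongrightarrow> r \<zeta>) (at \<zeta>)"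
  and Hc: "continuous_on {v. 0 \<le> Im v \<and> Im v < \<eta>} H"
  and per: "\<And>s n. H (of_real (s + of_int n)) = H (of_real s)"
  and TH: "\<And>v. 0 < Im v \<Longrightarrow> Im v < \<eta> \<Longrightarrow> T (unit_exp v) * (2 * of_real pi * \<i> * unit_exp v) = H v"
 shows "((\<lambda>s. H (of_real s)) has_integral 2 * of_real pi * \<i> * (\<Sum>\<zeta>\<in>Z. r \<zeta>)) {0..1}"
proof -
 \<comment> \<open>Periodicity of \<open>H\<close> on the real line makes the value on the circle
   independent of the choice of the argument.\<close>
 define T' where "T' = (\<lambda>z. if cmod z < 1 then T z else H (of_real (Arg z / (2 * pi))) / (2 * of_real pi * \<i> * z))"
 have une: "unit_exp v \<noteq> 0" for v by (simp add: unit_exp_def)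
 have real: "T' (unit_exp v) = H v / (2 * of_real pi * \<i> * unit_exp v)" if v: "Im v = 0" for v
 proof -
  have n1: "cmod (unit_exp v) = 1" using v by (simp add: norm_unit_exp)
  obtain n where n: "v = of_real (Arg (unit_exp v) / (2 * pi)) + of_int n"
   using unit_exp_onto[OF n1] unit_exp_eq_iff by metis
  define a where "a = Arg (unit_exp v) / (2 * pi)"
  have "v = of_real (a + of_int n)" using n by (simp add: a_def)
  then have "H v = H (of_real a)" using per by simp
  then show ?thesis using n1 by (simp add: T'_def a_def)
 qed
 have T'H: "T' (unit_exp v) = H v / (2 * of_real pi * \<i> * unit_exp v)" if v: "0 \<le> Im v" "Im v < \<eta>" for v
 proof (cases "Im v = 0")
  case False
  then have "cmod (unit_exp v) < 1" using v by (simp add: norm_unit_exp)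
  then show ?thesis using TH[of v] v False une[of v] by (simp add: T'_def field_simps)
 qed (rule real)
 have Tc: "continuous_on (cball 0 1 - Z) T'"
  unfolding continuous_on_eq_continuous_within
 proof
  fix x assume x: "x \<in> cball 0 1 - Z"
  show "continuous (at x within (cball 0 1 - Z)) T'"
  proof (cases "cmod x < 1")
   case True
   have o: "open (ball 0 1 - Z)" using Z(1) by (simp add: finite_imp_closed open_Diff)
   have "continuous_on (ball 0 1 - Z) T'"
    by (rule continuous_on_eq[OF holomorphic_on_imp_continuous_on[OF Th]]) (simp add: T'_def)
   then have "isCont T' x" using o x True by (simp add: continuous_on_eq_continuous_at)
   then show ?thesis by (rule continuous_at_imp_continuous_at_within)
  next
   case False
   define v0 where "v0 = (of_real (Arg x / (2 * pi)) :: complex)"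
   have x1: "cmod x = 1" using False x by auto
   have ux: "unit_exp v0 = x" unfolding v0_def by (rule unit_exp_onto[OF x1])
   have "Im v0 = 0" by (simp add: v0_def)
   from unit_exp_local_inverse[OF this e] obtain L where L: "isCont L x" "L x = v0"
     "\<forall>\<^sub>F z in nhds x. unit_exp (L z) = z \<and> Im (L z) < \<eta>"
    unfolding ux by blast
   define W where "W = {v. 0 \<le> Im v \<and> Im v < \<eta>}"
   define N where "N = {z\<in>cball 0 1. unit_exp (L z) = z \<and> Im (L z) < \<eta>}"
   have N: "L z \<in> W" if "z \<in> N" for z
   proof -
    have "exp (- (2 * pi * Im (L z))) \<le> 1" using that norm_unit_exp[of "L z"] by (simp add: N_def)
    then have "0 \<le> 2 * pi * Im (L z)" by simp
    then have "0 \<le> Im (L z)" using mult_pos_neg[of "2 * pi" "Im (L z)"] pi_gt_zero by (intro leI notI) simp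
    then show ?thesis using that by (simp add: W_def N_def)
   qed
   have xN: "x \<in> N" using ux L(2) x1 e by (simp add: N_def v0_def)
   have "continuous (at x within N) (\<lambda>z. H (L z) / (2 * of_real pi * \<i> * z))"
   proof (rule continuous_at_within_divide)
    have "continuous (at (L x) within W) H" using Hc N[OF xN] unfolding W_def by (simp add: continuous_on_eq_continuous_within)
    then have "continuous (at (L x) within L ` N) H" by (rule continuous_within_subset) (use N in blast)
    with continuous_at_imp_continuous_at_within[OF L(1)] show "continuous (at x within N) (\<lambda>z. H (L z))"
     by (rule continuous_within_compose2)
   qed (use x1 in \<open>auto intro!: continuous_intros\<close>)
   then have c1: "((\<lambda>z. H (L z) / (2 * of_real pi * \<i> * z)) \<longlongrightarrow> H (L x) / (2 * of_real pi * \<i> * x)) (at x within N)"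
    by (simp add: continuous_within)
   have eqN: "T' z = H (L z) / (2 * of_real pi * \<i> * z)" if "z \<in> N" for z
    using T'H[of "L z"] N[OF that] that by (simp add: W_def N_def)
   have "(T' \<longlongrightarrow> T' x) (at x within N)"
    unfolding eqN[OF xN] by (rule Lim_transform_eventually[OF c1]) (auto simp: eventually_at_filter eqN)
   moreover have "at x within N = at x within cball 0 1"
   proof -
    obtain S where S: "open S" "x \<in> S" "\<And>z. z \<in> S \<Longrightarrow> unit_exp (L z) = z \<and> Im (L z) < \<eta>"
     using L(3) unfolding eventually_nhds by blast
    show ?thesis by (rule at_within_nhd[OF S(2,1)]) (use S(3) in \<open>auto simp: N_def\<close>)
   qed
   ultimately have "continuous (at x within cball 0 1) T'" by (simp add: continuous_within)
   then show ?thesis by (rule continuous_within_subset) auto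
  qed
 qed
 have T'h: "T' holomorphic_on ball 0 1 - Z" by (rule holomorphic_transform[OF Th]) (simp add: T'_def)
 have T'r: "((\<lambda>z. (z - \<zeta>) * T' z) \<longlongrightarrow> r \<zeta>) (at \<zeta>)" if z: "\<zeta> \<in> Z" for \<zeta>
 proof -
  have "\<forall>\<^sub>F z in at \<zeta>. z \<in> ball 0 1 - {\<zeta>}" using Z(2) z by (intro eventually_at_in_open) auto
  then have "\<forall>\<^sub>F z in at \<zeta>. (z - \<zeta>) * T z = (z - \<zeta>) * T' z" by eventually_elim (simp add: T'_def)
  then show ?thesis by (rule Lim_transform_eventually[OF r[OF z]])
 qed
 from circle_integral_simple_poles[OF Z Tc T'h T'r]
 have "(T' has_contour_integral 2 * of_real pi * \<i> * (\<Sum>\<zeta>\<in>Z. r \<zeta>)) (circlepath 0 1)" .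
 then have "((\<lambda>s. T' (circlepath 0 1 s) * vector_derivative (circlepath 0 1) (at s)) has_integral 2 * of_real pi * \<i> * (\<Sum>\<zeta>\<in>Z. r \<zeta>)) {0..1}"
  unfolding has_contour_integral .
 then show ?thesis
 proof (rule has_integral_eq[rotated])
  fix s :: real
  have cp: "circlepath 0 1 s = unit_exp (of_real s)" by (simp add: circlepath unit_exp_def mult_ac)
  have "vector_derivative (circlepath 0 1) (at s) = 2 * of_real pi * \<i> * unit_exp (of_real s)"
   by (simp add: vector_derivative_circlepath unit_exp_def mult_ac)
  then show "T' (circlepath 0 1 s) * vector_derivative (circlepath 0 1) (at s) = H (of_real s)"
   unfolding cp using T'H[of "of_real s"] e une[of "of_real s"] by simp
 qed
qed

text \<open>Division with remainder of a holomorphic function by a polynomial, one root at a time;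
  \<open>P\<close> is the Hermite interpolant of \<open>E\<close> at the roots of \<open>Q\<close>.
  Dividing by \<open>Q\<close> shows that \<open>P / Q\<close> is the sum of the principal parts of
  \<open>E / Q\<close>.\<close>

lemma hermite_division:
 assumes "E holomorphic_on U" "open U" "Q \<noteq> 0" "\<And>z. poly Q z = 0 \<Longrightarrow> z \<in> U"
 shows "\<exists>P g. g holomorphic_on U \<and> (\<forall>w\<in>U. E w = poly P w + poly Q w * g w) \<and> (P = 0 \<or> degree P < degree Q)"
 using assms
proof (induction "degree Q" arbitrary: Q E)
 case 0
 then obtain a where a: "Q = [:a:]" "a \<noteq> 0" by (metis degree_eq_zeroE pCons_0_0)
 show ?case
  by (rule exI[of _ 0], rule exI[of _ "\<lambda>w. E w / a"]) (use a 0 in \<open>auto intro!: holomorphic_intros\<close>)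
next
 case (Suc n)
 have "degree Q > 0" using Suc.hyps(2) by simp
 then have "\<exists>i\<in>{1..degree Q}. coeff Q i \<noteq> 0" using Suc.prems(3) by (intro bexI[of _ "degree Q"]) auto
 then obtain r where "(\<Sum>i\<le>degree Q. coeff Q i * r ^ i) = 0"
  using fundamental_theorem_of_algebra[of "coeff Q" "degree Q"] by blast
 then have r: "poly Q r = 0" by (simp add: poly_altdef)
 then obtain Q1 where Q1: "Q = [:- r, 1:] * Q1" by (auto simp: poly_eq_0_iff_dvd)
 have Q1n: "Q1 \<noteq> 0" using Suc.prems(3) Q1 by auto
 have dQ: "degree Q = Suc (degree Q1)" using Q1n unfolding Q1 by (subst degree_mult_eq) auto
 define E1 where "E1 = (\<lambda>z. if z = r then deriv E r else (E z - E r) / (z - r))"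
 have E1h: "E1 holomorphic_on U" unfolding E1_def by (rule pole_lemma_open[OF Suc.prems(1,2)])
 have "\<exists>P g. g holomorphic_on U \<and> (\<forall>w\<in>U. E1 w = poly P w + poly Q1 w * g w) \<and> (P = 0 \<or> degree P < degree Q1)"
  by (rule Suc.hyps(1)) (use Suc.hyps(2) dQ E1h Suc.prems Q1n Q1 in auto)
 then obtain P g where g: "g holomorphic_on U" "\<And>w. w \<in> U \<Longrightarrow> E1 w = poly P w + poly Q1 w * g w" "P = 0 \<or> degree P < degree Q1"
  by blast
 show ?case
 proof (rule exI[of _ "[:E r:] + [:- r, 1:] * P"], rule exI[of _ g], intro conjI ballI g(1))
  fix w assume w: "w \<in> U"
  have "E w = E r + (w - r) * E1 w" by (simp add: E1_def)
  then show "E w = poly ([:E r:] + [:- r, 1:] * P) w + poly Q w * g w"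
   unfolding g(2)[OF w] Q1 by (simp add: algebra_simps)
 next
  have "degree ([:E r:] + [:- r, 1:] * P) < degree Q"
  proof (cases "P = 0")
   case False
   then have d: "degree ([:- r, 1:] * P) = Suc (degree P)" by (subst degree_mult_eq) auto
   have "degree ([:E r:] + [:- r, 1:] * P) \<le> max (degree [:E r:]) (degree ([:- r, 1:] * P))" by (rule degree_add_le_max)
   then show ?thesis using d g(3) False dQ by simp
  qed (simp add: dQ)
  then show "[:E r:] + [:- r, 1:] * P = 0 \<or> degree ([:E r:] + [:- r, 1:] * P) < degree Q" ..
 qed
qed

text \<open>By scale invariance a function of size d / |w|^2 has mass at least d / 8 on every square
  [t, 2t] x [t, 2t]: the area is t^2 and |w|^2 <= 8 t^2 there. If each point eventually leaves the
  squares, dominated convergence would send the mass to 0. Used both with t tending to 0 and to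
  infinity.\<close>

lemma inverse_square_not_integrable:
 fixes k :: "complex \<Rightarrow> complex"
 assumes k: "integrable lborel k" and t: "\<And>n. t n > 0" and away: "\<And>x. x > 0 \<Longrightarrow> \<forall>\<^sub>F n in sequentially. \<not> (t n \<le> x \<and> x \<le> 2 * t n)"
  and d: "d > 0" and low: "\<forall>\<^sub>F n in sequentially. \<forall>w\<in>cbox (Complex (t n) (t n)) (Complex (2 * t n) (2 * t n)). cmod (k w) \<ge> d / (cmod w)\<^sup>2"
 shows False
proof -
 define B where "B n = cbox (Complex (t n) (t n)) (Complex (2 * t n) (2 * t n))" for n
 have [measurable]: "k \<in> borel_measurable borel" "B n \<in> sets borel" for n using k by (auto simp: B_def)
 have memB: "w \<in> B n \<longleftrightarrow> t n \<le> Re w \<and> Re w \<le> 2 * t n \<and> t n \<le> Im w \<and> Im w \<le> 2 * t n" for w n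
  by (auto simp: B_def in_cbox_complex_iff)
 have lim: "(\<lambda>n. LINT w|lborel. indicator (B n) w * cmod (k w)) \<longlonglongrightarrow> (LINT w::complex|lborel. 0)"
 proof (rule integral_dominated_convergence)
  show "integrable lborel (\<lambda>w. cmod (k w))" using k by simp
  have "(\<lambda>n. indicator (B n) w * cmod (k w)) \<longlonglongrightarrow> 0" for w
  proof (cases "Re w > 0")
   case True
   have "\<forall>\<^sub>F n in sequentially. indicator (B n) w * cmod (k w) = 0"
    using away[OF True] by eventually_elim (auto simp: indicator_def memB)
   then show ?thesis by (rule tendsto_eventually)
  next
   case False
   have "\<not> t n \<le> Re w" for n using t[of n] False by linarith
   then show ?thesis by (simp add: indicator_def memB)
  qed
  then show "AE w in lborel. (\<lambda>n. indicator (B n) w * cmod (k w)) \<longlonglongrightarrow> 0" by simp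
  show "AE w in lborel. norm (indicator (B n) w * cmod (k w)) \<le> cmod (k w)" for n
   by (rule AE_I2) (auto simp: indicator_def)
 qed measurable
 have "\<forall>\<^sub>F n in sequentially. d / 8 \<le> (LINT w|lborel. indicator (B n) w * cmod (k w))"
  using low
 proof eventually_elim
  case (elim n)
  have "measure lborel (B n) = (\<Prod>b\<in>Basis. (Complex (2 * t n) (2 * t n) - Complex (t n) (t n)) \<bullet> b)"
   unfolding B_def by (subst measure_lborel_cbox_eq) (use t[of n] in \<open>auto simp: Basis_complex_def inner_complex_def\<close>)
  also have "\<dots> = (t n)\<^sup>2" by (simp add: Basis_complex_def inner_complex_def power2_eq_square complex_eq_iff)
  finally have mB: "measure lborel (B n) = (t n)\<^sup>2" .
  have fB: "emeasure lborel (B n) < \<infinity>" unfolding B_def by (rule emeasure_lborel_cbox_finite)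
  have iB: "integrable lborel (indicator (B n) :: complex \<Rightarrow> real)" using fB by (intro integrable_real_indicator) auto
  have "d / 8 = (d / (8 * (t n)\<^sup>2)) * measure lborel (B n)" unfolding mB using t[of n] by simp
  also have "\<dots> = (LINT w|lborel. indicator (B n) w * (d / (8 * (t n)\<^sup>2)))" using fB by simp
  also have "\<dots> \<le> (LINT w|lborel. indicator (B n) w * cmod (k w))"
  proof (rule integral_mono)
   show "integrable lborel (\<lambda>w. indicator (B n) w * (d / (8 * (t n)\<^sup>2)))" using iB by (rule integrable_mult_left)
   have "integrable lborel (\<lambda>w. indicator (B n) w *\<^sub>R cmod (k w))"
    using k by (intro integrable_mult_indicator) auto
   then show "integrable lborel (\<lambda>w. indicator (B n) w * cmod (k w))" by simp
   fix w :: complex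
   show "indicator (B n) w * (d / (8 * (t n)\<^sup>2)) \<le> indicator (B n) w * cmod (k w)"
   proof (cases "w \<in> B n")
    case True
    have w: "0 < Re w" "Re w \<le> 2 * t n" "0 \<le> Im w" "Im w \<le> 2 * t n" using True t[of n] by (auto simp: memB)
    have "(Re w)\<^sup>2 \<le> (2 * t n)\<^sup>2" by (rule power_mono) (use w in auto)
    moreover have "(Im w)\<^sup>2 \<le> (2 * t n)\<^sup>2" by (rule power_mono) (use w in auto)
    ultimately
    have le: "(cmod w)\<^sup>2 \<le> 8 * (t n)\<^sup>2" by (simp add: cmod_power2)
    have "w \<noteq> 0" using w(1) by auto
    then have "d / (8 * (t n)\<^sup>2) \<le> d / (cmod w)\<^sup>2" using le d t[of n] by (intro divide_left_mono) auto
    also have "\<dots> \<le> cmod (k w)" using elim True by (auto simp: B_def)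
    finally show ?thesis using True by simp
   qed simp
  qed
  finally show ?case .
 qed
 then have "d / 8 \<le> (LINT w::complex|lborel. 0)" using lim by (intro tendsto_lowerbound[OF lim]) auto
 then show False using d by simp
qed

lemma strip_avoids_finite:
 assumes "finite F" "\<And>z. z \<in> F \<Longrightarrow> cmod z \<noteq> 1"
 shows "\<exists>\<eta>>0. \<forall>v. \<bar>Im v\<bar> < \<eta> \<longrightarrow> unit_exp v \<notin> F"
proof -
 have "\<forall>\<^sub>F \<eta> in at_right 0. \<forall>v. \<bar>Im v\<bar> < \<eta> \<longrightarrow> unit_exp v \<noteq> z" if z: "z \<in> F" for z
 proof (cases "z = 0")
  case True then show ?thesis by (simp add: unit_exp_def)
 next
  case False
  define e where "e = \<bar>ln (cmod z)\<bar> / (2 * pi)"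
  have "ln (cmod z) \<noteq> 0" using False assms(2)[OF z] by simp
  then have e: "e > 0" by (simp add: e_def)
  have "unit_exp v \<noteq> z" if "\<bar>Im v\<bar> < e" for v
  proof
   assume "unit_exp v = z"
   then have "ln (cmod z) = - (2 * pi * Im v)" using norm_unit_exp[of v] by simp
   then have "e = \<bar>Im v\<bar>" by (simp add: e_def abs_mult)
   then show False using that by simp
  qed
  then show ?thesis unfolding eventually_at_right_field using e by (intro exI[of _ e]) auto
 qed
 then have "\<forall>\<^sub>F \<eta> in at_right 0. \<forall>z\<in>F. \<forall>v. \<bar>Im v\<bar> < \<eta> \<longrightarrow> unit_exp v \<noteq> z"
  using assms(1) by (simp add: eventually_ball_finite)
 moreover have "\<forall>\<^sub>F \<eta> in at_right (0::real). \<eta> > 0" by (rule eventually_at_right_less)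
 ultimately show ?thesis using eventually_happens'[OF trivial_limit_at_right_real eventually_conj] by blast
qed

locale rmap_curve = rmap S \<phi> + boundary_curve S C0 \<eta>
 for S :: "complex set" and \<phi> C0 :: "complex \<Rightarrow> complex" and \<eta> :: real +
 fixes A B :: "complex poly"
 assumes C0_psi: "0 \<le> Im v \<Longrightarrow> Im v < \<eta> \<Longrightarrow> C0 v = \<psi> (unit_exp v)"
  and psi_nz: "0 \<le> Im v \<Longrightarrow> Im v < \<eta> \<Longrightarrow> \<psi> (unit_exp v) \<noteq> 0"
  and B_nz: "0 \<le> Im v \<Longrightarrow> Im v < \<eta> \<Longrightarrow> poly B (unit_exp v) \<noteq> 0"
  and u_rational: "cmod xi = 1 \<Longrightarrow> complex_of_real (u xi) = poly A xi / poly B xi"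

context rmap
begin

text \<open>Points of \<open>S\<close> near \<open>z0\<close> have preimages in a compact part of
  the closed disk, since near a pole the values are too large. A limit of preimages cannot lie in
  the open disk, because \<psi> would send it into \<open>S\<close>.\<close>

lemma frontier_covered:
 assumes z0: "z0 \<in> frontier S" shows "\<exists>xi. cmod xi = 1 \<and> z0 = \<psi> xi"
proof -
 have "\<exists>K. compact K \<and> K \<subseteq> cball 0 1 - pole0 \<and> (\<forall>y\<in>ball 0 1 - pole0 - K. cmod z0 + 1 < cmod (\<psi> y))"
 proof (cases "bounded S")
  case True then show ?thesis by (intro exI[of _ "cball 0 1"]) (auto simp: pole0_def)
 next
  case False
  have "\<forall>\<^sub>F y in at 0. cmod z0 + 1 < cmod (\<psi> y)"
   using psi_at_infinity[OF False] unfolding filterlim_at_infinity_conv_norm_at_top filterlim_at_top_dense by blast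
  then obtain e where e: "e > 0" "\<And>y. y \<noteq> 0 \<Longrightarrow> dist y 0 < e \<Longrightarrow> cmod z0 + 1 < cmod (\<psi> y)"
   unfolding eventually_at by auto
  have "compact (cball 0 1 - ball 0 e :: complex set)" by (intro compact_diff compact_cball open_ball)
  then show ?thesis using e False by (intro exI[of _ "cball 0 1 - ball 0 e"]) (auto simp: pole0_def)
 qed
 then obtain K where K: "compact K" "K \<subseteq> cball 0 1 - pole0" "\<And>y. y \<in> ball 0 1 - pole0 - K \<Longrightarrow> cmod z0 + 1 < cmod (\<psi> y)" by blast
 have cl: "closed (\<psi> ` K)"
  by (intro compact_imp_closed compact_continuous_image K(1) continuous_on_subset[OF psi_cont K(2)])
 have "z0 \<in> closure (\<psi> ` K)"
  unfolding closure_approachable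
 proof (intro allI impI)
  fix e :: real assume e: "e > 0"
  have "z0 \<in> closure S" using z0 by (simp add: frontier_def)
  then obtain x where x: "x \<in> S" "dist x z0 < min e 1" using e unfolding closure_approachable by (metis min_less_iff_conj zero_less_one)
  obtain y where y: "y \<in> ball 0 1 - pole0" "x = \<psi> y" using x(1) psi_image by blast
  have "cmod x \<le> cmod z0 + dist x z0" using norm_triangle_sub[of x z0] by (simp add: dist_norm)
  then have "y \<in> K" using K(3)[of y] x(2) y by force
  then show "\<exists>x\<in>\<psi> ` K. dist x z0 < e" using x(2) y(2) by auto
 qed
 then obtain y where y: "y \<in> K" "z0 = \<psi> y" using cl by (auto simp: closure_closed)
 have "\<not> cmod y < 1" using psi_in_S[of y] y K(2) frontier_disjoint[OF z0] by auto
 then show ?thesis using y K(2) by (intro exI[of _ y]) auto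
qed

text \<open>The quotient of exp (A / B) by the conjugate of \<psi> at the reflected point agrees
  with \<psi> on the circle; being holomorphic on the other side, it continues \<psi> across the
  real line of the strip.\<close>

lemma rational_curve:
 assumes B: "\<And>xi. cmod xi = 1 \<Longrightarrow> poly B xi \<noteq> 0"
  and ur: "\<And>xi. cmod xi = 1 \<Longrightarrow> complex_of_real (u xi) = poly A xi / poly B xi"
 shows "\<exists>C0 \<eta>. rmap_curve S \<phi> C0 \<eta> A B"
proof -
 have Bn: "B \<noteq> 0" using B[of 1] by auto
 \<comment> \<open>The continuation divides by values of \<psi> and of \<open>B\<close>, and \<psi>
   may have a pole. The strip is made thin enough to avoid these finitely many points.\<close>
 define F where "F = (\<psi> -` {0} \<inter> (ball 0 1 - pole0)) \<union> pole0 \<union> {z. poly B z = 0}"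
 have F: "finite F" unfolding F_def
  using pole0_finite finite_vimage_IntI[OF _ psi_inj, of "{0}"] poly_roots_finite[OF Bn] by auto
 have F1: "cmod z \<noteq> 1" if "z \<in> F" for z using that B pole0_sphere by (auto simp: F_def)
 obtain \<eta> where eta: "\<eta> > 0" "\<And>v. \<bar>Im v\<bar> < \<eta> \<Longrightarrow> unit_exp v \<notin> F"
  using strip_avoids_finite[OF F F1] by blast
 have inball: "unit_exp v \<in> ball 0 1" if "0 < Im v" for v using that by (simp add: norm_unit_exp)
 have incball: "unit_exp v \<in> cball 0 1" if "0 \<le> Im v" for v using that by (simp add: norm_unit_exp)
 have Bnz: "poly B (unit_exp v) \<noteq> 0" and npole: "unit_exp v \<notin> pole0" if "\<bar>Im v\<bar> < \<eta>" for v
  using eta(2)[OF that] by (auto simp: F_def)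
 have un1: "cmod (unit_exp v) = 1" if "Im v = 0" for v using that by (simp add: norm_unit_exp)
 have pnz: "\<psi> (unit_exp v) \<noteq> 0" if v: "0 \<le> Im v" "Im v < \<eta>" for v
 proof (cases "Im v = 0")
  case True then show ?thesis using psi_boundary[OF un1[OF True]] zero_frontier by auto
 next
  case False
  have "\<bar>Im v\<bar> < \<eta>" using v by simp
  then show ?thesis using eta(2)[of v] inball[of v] npole[of v] False v by (auto simp: F_def)
 qed
 define W where "W = {v. \<bar>Im v\<bar> < \<eta>}"
 have Wo: "open W"
 proof -
  have "W = {v. Im v < \<eta>} \<inter> {v. - \<eta> < Im v}" by (auto simp: W_def)
  then show ?thesis by (simp only:) (intro open_Int open_halfspace_Im_lt open_halfspace_Im_gt)
 qed
 define f1 where "f1 = (\<lambda>v. \<psi> (unit_exp v))"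
 define f2 where "f2 = (\<lambda>v. exp (poly A (unit_exp v) / poly B (unit_exp v)) / cnj (\<psi> (unit_exp (cnj v))))"
 define C0 where "C0 = (\<lambda>v. if Im v \<le> 0 then f2 v else f1 v)"
 have glue: "f2 v = f1 v" if v: "Im v = 0" for v
 proof -
  have c: "cnj v = v" using v by (simp add: complex_eq_iff)
  have n1: "cmod (unit_exp v) = 1" by (rule un1[OF v])
  have p: "\<psi> (unit_exp v) \<noteq> 0" using pnz[of v] v eta(1) by simp
  have "exp (poly A (unit_exp v) / poly B (unit_exp v)) = exp (of_real (u (unit_exp v)))" using ur[OF n1] by simp
  also have "\<dots> = of_real ((cmod (\<psi> (unit_exp v)))\<^sup>2)"
   by (simp only: u_def exp_of_real) (use p in simp)
  also have "\<dots> = \<psi> (unit_exp v) * cnj (\<psi> (unit_exp v))" by (simp only: complex_norm_square)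
  finally show ?thesis using p by (simp add: f1_def f2_def c)
 qed
 have uc: "continuous_on X unit_exp" for X unfolding unit_exp_def[abs_def] by (intro continuous_intros)
 have c1: "continuous_on {v\<in>W. 0 \<le> Im v} f1"
  unfolding f1_def by (rule continuous_on_compose2[OF psi_cont uc]) (use incball npole in \<open>auto simp: W_def\<close>)
 have c2: "continuous_on {v\<in>W. Im v \<le> 0} f2"
  unfolding f2_def
 proof (intro continuous_intros uc)
  show "continuous_on {v\<in>W. Im v \<le> 0} (\<lambda>v. \<psi> (unit_exp (cnj v)))"
   by (rule continuous_on_compose2[OF c1[unfolded f1_def]]) (auto simp: W_def intro!: continuous_intros)
 qed (use Bnz pnz in \<open>auto simp: W_def\<close>)
 have C0c: "continuous_on W C0"
  unfolding C0_def by (rule continuous_on_cases_le[OF c2 c1]) (auto intro!: continuous_intros glue)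
 have C0u: "C0 v = f1 v" if "0 \<le> Im v" for v using that glue[of v] by (auto simp: C0_def)
 have h1: "f1 holomorphic_on {v\<in>W. 0 < Im v}"
  unfolding f1_def
 proof (rule holomorphic_on_compose_gen[OF _ psi_hol, unfolded comp_def])
  show "unit_exp holomorphic_on {v\<in>W. 0 < Im v}" unfolding unit_exp_def[abs_def] by (intro holomorphic_intros)
 qed (use inball npole in \<open>auto simp: W_def\<close>)
 have o2: "open {v\<in>W. Im v < 0}" using Wo open_halfspace_Im_lt[of 0] by (simp add: Collect_conj_eq open_Int)
 have img: "cnj ` {v\<in>W. Im v < 0} = {v\<in>W. 0 < Im v}"
 proof -
  have "v \<in> cnj ` {v\<in>W. Im v < 0}" if "v \<in> {v\<in>W. 0 < Im v}" for v
   by (rule image_eqI[of _ _ "cnj v"]) (use that in \<open>auto simp: W_def\<close>)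
  then show ?thesis by (auto simp: W_def)
 qed
 have "cnj \<circ> f1 \<circ> cnj holomorphic_on {v\<in>W. Im v < 0}"
  by (rule holomorphic_on_compose_cnj_cnj[OF _ o2]) (simp only: img h1)
 then have h2': "(\<lambda>v. cnj (\<psi> (unit_exp (cnj v)))) holomorphic_on {v\<in>W. Im v < 0}" by (simp add: comp_def f1_def)
 have h2: "f2 holomorphic_on {v\<in>W. Im v < 0}"
  unfolding f2_def by (intro holomorphic_intros h2') (use Bnz pnz in \<open>auto simp: W_def\<close>)
 have C0h: "C0 holomorphic_on W"
 proof (rule holomorphic_on_paste_across_line[OF Wo, of \<i> C0 0])
  show "C0 holomorphic_on W \<inter> {z. \<i> \<bullet> z < 0}"
   by (rule holomorphic_transform[OF holomorphic_on_subset[OF h2]]) (auto simp: C0_def inner_complex_def)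
  show "C0 holomorphic_on W \<inter> {z. 0 < \<i> \<bullet> z}"
   by (rule holomorphic_transform[OF holomorphic_on_subset[OF h1]]) (auto simp: C0_def inner_complex_def)
 qed (auto simp: C0c)
 have ue1: "unit_exp (v + 1) = unit_exp v" for v unfolding unit_exp_eq_iff by (intro exI[of _ 1]) simp
 have "rmap_curve S \<phi> C0 \<eta> A B"
 proof unfold_locales
  show "0 < \<eta>" by (rule eta)
  show "C0 holomorphic_on {v. \<bar>Im v\<bar> < \<eta>}" using C0h by (simp add: W_def)
  show "C0 (v + 1) = C0 v" for v
   using ue1[of v] ue1[of "cnj v"] by (simp add: C0_def f1_def f2_def)
  show "C0 v \<in> S" if "0 < Im v" "Im v < \<eta>" for v
   using that psi_in_S[OF inball npole] by (simp add: C0u f1_def)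
  show "unit_exp v = unit_exp v'" if "0 < Im v" "Im v < \<eta>" "0 < Im v'" "Im v' < \<eta>" "C0 v = C0 v'" for v v'
   using that inj_onD[OF psi_inj, of "unit_exp v" "unit_exp v'"] inball npole by (simp add: C0u f1_def)
  show "C0 (of_real s) \<in> frontier S" for s
   using psi_boundary[OF un1, of "of_real s"] by (simp add: C0u f1_def)
  show "\<exists>s. z = C0 (of_real s)" if z: "z \<in> frontier S" for z
  proof -
   obtain xi where xi: "cmod xi = 1" "z = \<psi> xi" using frontier_covered[OF z] by blast
   show ?thesis using unit_exp_onto[OF xi(1)] xi(2)
    by (intro exI[of _ "Arg xi / (2 * pi)"]) (simp add: C0u f1_def)
  qed
  show "open S" by (rule S_open)
  show "interior (closure S) = S" by (rule int_closure)
  show "C0 v = \<psi> (unit_exp v)" if "0 \<le> Im v" "Im v < \<eta>" for v using that by (simp add: C0u f1_def)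
  show "poly B (unit_exp v) \<noteq> 0" if "0 \<le> Im v" "Im v < \<eta>" for v using that Bnz by simp
 qed (use pnz ur in blast)+
 then show ?thesis by blast
qed

end

context rmap_curve
begin

definition loop :: "real \<Rightarrow> real" where "loop = indicator {0..1}"

lemma weight_loop: "weight loop"
 unfolding weight_def loop_def by (auto simp: indicator_def intro!: exI[of _ 1])

lemma wint_loop:
 assumes g: "continuous_on (frontier S) g" and I: "((\<lambda>s. g (c s) * c' s) has_integral I) {0..1}"
 shows "wint loop g = I"
proof -
 have "set_integrable lborel {0..1} (\<lambda>s. g (c s) * c' s)"
  unfolding set_integrable_def using wint_integrable[OF weight_loop g] by (simp add: loop_def)
 from set_borel_integral_eq_integral(2)[OF this] show ?thesis
  using integral_unique[OF I] by (simp add: wint_def loop_def set_lebesgue_integral_def)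
qed

lemma c'_shift: "c' (s + of_int n) = c' s"
proof -
 have "C0 \<circ> (+) (of_real (s + of_int n)) = C0 \<circ> (+) (of_real s)"
 proof
  fix x
  show "(C0 \<circ> (+) (of_real (s + of_int n))) x = (C0 \<circ> (+) (of_real s)) x"
   using C0_shift[of "of_real s + x" n] by (simp add: ac_simps)
 qed
 then show ?thesis unfolding c'_def by (subst (1 2) deriv_shift_0) simp
qed

lemma unit_exp_upper: "0 < Im v \<Longrightarrow> unit_exp v \<in> ball 0 1 - pole0"
 by (auto simp: norm_unit_exp pole0_def unit_exp_def)

lemma psi_domain_open: "open (ball 0 1 - pole0)"
 using pole0_finite by (simp add: finite_imp_closed open_Diff)

lemma deriv_C0:
 assumes v: "0 < Im v" "Im v < \<eta>"
 shows "deriv C0 v = deriv \<psi> (unit_exp v) * (2 * of_real pi * \<i> * unit_exp v)"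
proof -
 have 1: "(\<psi> has_field_derivative deriv \<psi> (unit_exp v)) (at (unit_exp v))"
  by (rule holomorphic_derivI[OF psi_hol psi_domain_open unit_exp_upper[OF v(1)]])
 have 2: "(unit_exp has_field_derivative 2 * of_real pi * \<i> * unit_exp v) (at v)"
  unfolding unit_exp_def[abs_def] by (auto intro!: derivative_eq_intros)
 have "((\<lambda>v. \<psi> (unit_exp v)) has_field_derivative deriv \<psi> (unit_exp v) * (2 * of_real pi * \<i> * unit_exp v)) (at v)"
  by (rule DERIV_chain2[OF 1 2])
 moreover have "open ({v. 0 < Im v} \<inter> {v. Im v < \<eta>})" by (intro open_Int open_halfspace_Im_lt open_halfspace_Im_gt)
 then have "\<forall>\<^sub>F x in nhds v. x \<in> {v. 0 < Im v} \<inter> {v. Im v < \<eta>}" by (rule eventually_nhds_in_open) (use v in auto)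
 then have "\<forall>\<^sub>F x in nhds v. \<psi> (unit_exp x) = C0 x" by eventually_elim (use C0_psi in auto)
 ultimately have "(C0 has_field_derivative deriv \<psi> (unit_exp v) * (2 * of_real pi * \<i> * unit_exp v)) (at v)"
  by (rule DERIV_cong_ev[OF refl _ refl, THEN iffD1, rotated])
 then show ?thesis by (rule DERIV_imp_deriv)
qed

text \<open>The residue theorem on \<open>S\<close>, pulled back to the disk. The boundary values
  are prescribed through \<open>GS\<close> on the strip because \<open>G\<close> need not extend
  continuously to the frontier as a function of the point: a double point is approached along
  several branches.\<close>

lemma loop_residue:
 assumes Z: "finite Z" "Z \<subseteq> ball 0 1" "pole0 \<subseteq> Z"
  and G: "G holomorphic_on \<psi> ` (ball 0 1 - Z)"
  and r: "\<And>\<zeta>. \<zeta> \<in> Z \<Longrightarrow> ((\<lambda>z. (z - \<zeta>) * (G (\<psi> z) * deriv \<psi> z)) \<longlongrightarrow> r \<zeta>) (at \<zeta>)"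
  and e1: "0 < \<epsilon>" "\<epsilon> \<le> \<eta>"
  and GSc: "continuous_on {v. 0 \<le> Im v \<and> Im v < \<epsilon>} GS"
  and GSu: "\<And>v. 0 < Im v \<Longrightarrow> Im v < \<epsilon> \<Longrightarrow> GS v = G (C0 v)"
  and GSr: "\<And>s. GS (of_real s) = g (c s)"
  and g: "continuous_on (frontier S) g"
 shows "wint loop g = 2 * of_real pi * \<i> * (\<Sum>\<zeta>\<in>Z. r \<zeta>)"
proof (rule wint_loop[OF g])
 have "((\<lambda>s. GS (of_real s) * deriv C0 (of_real s)) has_integral 2 * of_real pi * \<i> * (\<Sum>\<zeta>\<in>Z. r \<zeta>)) {0..1}"
 proof (rule strip_residue[OF Z(1,2) _ e1(1) r])
  have ph: "\<psi> holomorphic_on ball 0 1 - Z" by (rule holomorphic_on_subset[OF psi_hol]) (use Z(3) in auto)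
  have "deriv \<psi> holomorphic_on ball 0 1 - pole0" by (intro holomorphic_deriv psi_hol psi_domain_open)
  then have dh: "deriv \<psi> holomorphic_on ball 0 1 - Z" by (rule holomorphic_on_subset) (use Z(3) in auto)
  have "(\<lambda>z. G (\<psi> z)) holomorphic_on ball 0 1 - Z"
   by (rule holomorphic_on_compose_gen[OF ph G, unfolded comp_def]) simp
  then show "(\<lambda>z. G (\<psi> z) * deriv \<psi> z) holomorphic_on ball 0 1 - Z" by (intro holomorphic_intros dh)
  have sub: "{v. 0 \<le> Im v \<and> Im v < \<epsilon>} \<subseteq> strip" using e1 by (auto simp: strip_def)
  have "continuous_on strip (deriv C0)" by (intro holomorphic_on_imp_continuous_on holomorphic_deriv C0_hol strip_open)
  then show "continuous_on {v. 0 \<le> Im v \<and> Im v < \<epsilon>} (\<lambda>v. GS v * deriv C0 v)"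
   by (intro continuous_intros GSc continuous_on_subset[OF _ sub])
  show "GS (of_real (s + of_int n)) * deriv C0 (of_real (s + of_int n)) = GS (of_real s) * deriv C0 (of_real s)" for s n
   unfolding GSr using c_shift[of s n] c'_shift[of s n] by (simp only: c'_def)
  show "G (\<psi> (unit_exp v)) * deriv \<psi> (unit_exp v) * (2 * of_real pi * \<i> * unit_exp v) = GS v * deriv C0 v"
   if "0 < Im v" "Im v < \<epsilon>" for v
   using that e1 by (simp add: GSu C0_psi deriv_C0)
 qed
 then show "((\<lambda>s. g (c s) * c' s) has_integral 2 * of_real pi * \<i> * (\<Sum>\<zeta>\<in>Z. r \<zeta>)) {0..1}"
  by (simp add: GSr c'_def)
qed

lemma deriv_psi_nz: "z \<in> ball 0 1 - pole0 \<Longrightarrow> deriv \<psi> z \<noteq> 0"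
 by (rule holomorphic_injective_imp_regular[OF psi_hol psi_domain_open psi_inj])

lemma deriv_psi_tendsto: "z0 \<in> ball 0 1 - pole0 \<Longrightarrow> (deriv \<psi> \<longlongrightarrow> deriv \<psi> z0) (at z0)"
 using holomorphic_on_imp_continuous_on[OF holomorphic_deriv[OF psi_hol psi_domain_open]] psi_domain_open
 by (auto simp: continuous_on_eq_continuous_at isCont_def)

lemma residue_simple:
 assumes z0: "z0 \<in> ball 0 1 - pole0"
 shows "((\<lambda>z. (z - z0) * (1 / (\<psi> z - \<psi> z0) * deriv \<psi> z)) \<longlongrightarrow> 1) (at z0)"
proof -
 have d: "(\<psi> has_field_derivative deriv \<psi> z0) (at z0)" by (rule holomorphic_derivI[OF psi_hol psi_domain_open z0])
 have nz: "deriv \<psi> z0 \<noteq> 0" by (rule deriv_psi_nz[OF z0])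
 note deriv_psi_tendsto[OF z0]
 moreover have "((\<lambda>z. (\<psi> z - \<psi> z0) / (z - z0)) \<longlongrightarrow> deriv \<psi> z0) (at z0)" using d by (simp add: has_field_derivative_iff)
 ultimately have "((\<lambda>z. deriv \<psi> z / ((\<psi> z - \<psi> z0) / (z - z0))) \<longlongrightarrow> deriv \<psi> z0 / deriv \<psi> z0) (at z0)"
  by (intro tendsto_divide nz)
 then show ?thesis using nz by (simp add: mult.commute)
qed

text \<open>The reciprocal of \<psi> extends injectively over 0, so the pole is simple and
  \<open>F\<close> is a local coordinate at infinity.\<close>

lemma psi_reciprocal:
 assumes nb: "\<not> bounded S"
 obtains F e where "0 < e" "e \<le> 1" "F holomorphic_on ball 0 e" "inj_on F (ball 0 e)" "F 0 = 0"
  "\<And>z. z \<in> ball 0 e - {0} \<Longrightarrow> \<psi> z \<noteq> 0 \<and> F z = 1 / \<psi> z"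
proof -
 have p0: "pole0 = {0}" using nb by (simp add: pole0_def)
 note inf = psi_at_infinity[OF nb]
 have "\<forall>\<^sub>F y in at 0. 1 < cmod (\<psi> y)"
  using inf unfolding filterlim_at_infinity_conv_norm_at_top filterlim_at_top_dense by blast
 then obtain e0 where e0: "e0 > 0" "\<And>y. y \<noteq> 0 \<Longrightarrow> dist y 0 < e0 \<Longrightarrow> 1 < cmod (\<psi> y)" unfolding eventually_at by auto
 define e where "e = min e0 1"
 have e: "e > 0" "e \<le> 1" using e0 by (auto simp: e_def)
 have nz: "\<psi> z \<noteq> 0" if "z \<in> ball 0 e - {0}" for z
 proof -
  have "1 < cmod (\<psi> z)" using e0(2)[of z] that by (simp add: e_def)
  then show ?thesis by auto
 qed
 have sub: "ball 0 e - {0} \<subseteq> ball 0 1 - pole0"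
  unfolding p0 using e(2) by (intro Diff_mono subset_ball order_refl)
 define F where "F = (\<lambda>z. if z = 0 then 0 else 1 / \<psi> z)"
 have F1: "F holomorphic_on ball 0 e - {0}"
 proof (rule holomorphic_transform)
  show "(\<lambda>z. 1 / \<psi> z) holomorphic_on ball 0 e - {0}"
   by (intro holomorphic_intros holomorphic_on_subset[OF psi_hol sub]) (use nz in auto)
 qed (simp add: F_def)
 have "((\<lambda>z. inverse (\<psi> z)) \<longlongrightarrow> 0) (at 0)" by (rule filterlim_compose[OF tendsto_inverse_0 inf])
 then have "(F \<longlongrightarrow> 0) (at 0)"
  by (rule Lim_transform_eventually) (auto simp: F_def eventually_at_filter inverse_eq_divide)
 then have F0: "isCont F 0" by (simp add: isCont_def F_def)
 have Fc: "continuous_on (ball 0 e) F"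
 proof (rule continuous_at_imp_continuous_on, rule ballI)
  fix x :: complex assume "x \<in> ball 0 e"
  show "isCont F x"
  proof (cases "x = 0")
   case False
   have "open (ball 0 e - {0::complex})" by (intro open_Diff) auto
   then show ?thesis using holomorphic_on_imp_continuous_on[OF F1] \<open>x \<in> ball 0 e\<close> False
    by (auto simp: continuous_on_eq_continuous_at)
  qed (simp add: F0)
 qed
 have Fh: "F holomorphic_on ball 0 e" by (rule no_isolated_singularity[OF Fc F1 open_ball]) simp
 have Fi: "inj_on F (ball 0 e)"
 proof (rule inj_onI)
  fix x y assume xy: "x \<in> ball 0 e" "y \<in> ball 0 e" "F x = F y"
  show "x = y"
  proof (cases "x = 0 \<or> y = 0")
   case True
   then show ?thesis using xy nz[of x] nz[of y] by (auto simp: F_def split: if_splits)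
  next
   case False
   then have "\<psi> x = \<psi> y" using xy(3) by (simp add: F_def)
   moreover have "x \<in> ball 0 1 - pole0" "y \<in> ball 0 1 - pole0" using sub False xy by auto
   ultimately show ?thesis using inj_onD[OF psi_inj] by blast
  qed
 qed
 have F00: "F 0 = 0" by (simp add: F_def)
 have FF: "\<psi> z \<noteq> 0 \<and> F z = 1 / \<psi> z" if z: "z \<in> ball 0 e - {0}" for z
  using nz[OF z] z by (simp add: F_def)
 show ?thesis by (rule that[OF e Fh Fi F00 FF])
qed

text \<open>With F = 1 / \<psi> one has z G \<psi>' = - (\<psi> G) F' / (F / z), and F / z tends to
  F'(0) \<noteq> 0. So the differential G dw has no residue at infinity once w G(w) tends to
  0.\<close>

lemma residue_pole:
 assumes nb: "\<not> bounded S" and G: "((\<lambda>w. w * G w) \<longlongrightarrow> 0) at_infinity"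
 shows "((\<lambda>z. (z - 0) * (G (\<psi> z) * deriv \<psi> z)) \<longlongrightarrow> 0) (at 0)"
proof -
 have p0: "pole0 = {0}" using nb by (simp add: pole0_def)
 note inf = psi_at_infinity[OF nb]
 obtain F e where e: "0 < e" "e \<le> 1" and Fh: "F holomorphic_on ball 0 e" and Fi: "inj_on F (ball 0 e)" and F0: "F 0 = 0"
  and FF: "\<And>z. z \<in> ball 0 e - {0} \<Longrightarrow> \<psi> z \<noteq> 0 \<and> F z = 1 / \<psi> z"
  by (rule psi_reciprocal[OF nb], rule that, assumption+)
 have sub: "ball 0 e - {0} \<subseteq> ball 0 1 - pole0"
  unfolding p0 using e(2) by (intro Diff_mono subset_ball order_refl)
 have b0: "0 \<in> ball (0::complex) e" using e by simp
 have d0: "deriv F 0 \<noteq> 0" by (rule holomorphic_injective_imp_regular[OF Fh open_ball Fi b0])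
 have "(F has_field_derivative deriv F 0) (at 0)" by (rule holomorphic_derivI[OF Fh open_ball b0])
 then have l1: "((\<lambda>z. F z / z) \<longlongrightarrow> deriv F 0) (at 0)" by (simp add: has_field_derivative_iff F0)
 have "deriv F holomorphic_on ball 0 e" by (intro holomorphic_deriv Fh open_ball)
 then have "isCont (deriv F) 0" using b0 by (auto dest: holomorphic_on_imp_continuous_on simp: continuous_on_eq_continuous_at)
 then have l2: "(deriv F \<longlongrightarrow> deriv F 0) (at 0)" by (simp add: isCont_def)
 have l3: "((\<lambda>z. \<psi> z * G (\<psi> z)) \<longlongrightarrow> 0) (at 0)" by (rule filterlim_compose[OF G inf])
 have "((\<lambda>z. - (\<psi> z * G (\<psi> z)) * deriv F z / (F z / z)) \<longlongrightarrow> - 0 * deriv F 0 / deriv F 0) (at 0)"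
  by (intro tendsto_intros l1 l2 l3 d0)
 moreover have "\<forall>\<^sub>F z in at 0. - (\<psi> z * G (\<psi> z)) * deriv F z / (F z / z) = (z - 0) * (G (\<psi> z) * deriv \<psi> z)"
 proof -
  have "\<forall>\<^sub>F z in at 0. z \<in> ball 0 e - {0}" using b0 by (intro eventually_at_in_open) auto
  then show ?thesis
  proof eventually_elim
   case (elim z)
   have z: "z \<noteq> 0" "\<psi> z \<noteq> 0" "F z = 1 / \<psi> z" using elim FF by auto
   have "z \<in> ball 0 1 - pole0" using sub elim by blast
   then have "(\<psi> has_field_derivative deriv \<psi> z) (at z)" by (rule holomorphic_derivI[OF psi_hol psi_domain_open])
   then have "((\<lambda>z. 1 / \<psi> z) has_field_derivative - deriv \<psi> z / (\<psi> z)\<^sup>2) (at z)"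
    using z by (auto intro!: derivative_eq_intros simp: power2_eq_square)
   moreover have "\<forall>\<^sub>F x in nhds z. x \<in> ball 0 e - {0}" using elim by (intro eventually_nhds_in_open) auto
   then have "\<forall>\<^sub>F x in nhds z. 1 / \<psi> x = F x" by eventually_elim (simp add: FF)
   ultimately have "(F has_field_derivative - deriv \<psi> z / (\<psi> z)\<^sup>2) (at z)"
    by (rule DERIV_cong_ev[OF refl _ refl, THEN iffD1, rotated])
   then have "deriv F z = - deriv \<psi> z / (\<psi> z)\<^sup>2" by (rule DERIV_imp_deriv)
   then show ?case using z by (simp add: power2_eq_square)
  qed
 qed
 ultimately show ?thesis by (simp add: Lim_transform_eventually)
qed

section \<open>Winding numbers of the boundary loop and independence of the cycle\<close>

lemma C0_cont: "\<eta>1 \<le> \<eta> \<Longrightarrow> continuous_on {v. 0 \<le> Im v \<and> Im v < \<eta>1} C0"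
 by (rule continuous_on_subset[OF holomorphic_on_imp_continuous_on[OF C0_hol]]) (auto simp: strip_def)

lemma C0_closure: "0 \<le> Im v \<Longrightarrow> Im v < \<eta> \<Longrightarrow> C0 v \<in> closure S"
proof (cases "Im v = 0")
 case True
 then have "v = of_real (Re v)" by (simp add: complex_eq_iff)
 then show ?thesis using curve_real[of "Re v"] by (simp add: frontier_def)
next
 case False
 assume "0 \<le> Im v" "Im v < \<eta>"
 then show ?thesis using False curve_upper[of v] closure_subset[of S] by auto
qed

lemma kernel_cont: "w \<notin> frontier S \<Longrightarrow> continuous_on (frontier S) (\<lambda>z. 1 / (z - w))"
 by (intro continuous_intros) auto

text \<open>Subtracting two kernels makes the integrand O(1 / w^2) at infinity, so a pole of \<psi>
  contributes no residue. The preimage of \<open>w\<close> contributes 1, and \<open>b\<close> has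
  no preimage.\<close>

lemma loop_winding_difference:
 assumes w: "w \<in> S" and b: "b \<notin> closure S"
 shows "wint loop (\<lambda>z. 1 / (z - w)) - wint loop (\<lambda>z. 1 / (z - b)) = 2 * of_real pi * \<i>"
proof -
 obtain z0 where z0: "z0 \<in> ball 0 1 - pole0" "w = \<psi> z0" using w psi_image by blast
 define Z where "Z = insert z0 pole0"
 have Z: "finite Z" "Z \<subseteq> ball 0 1" "pole0 \<subseteq> Z" using z0 pole0_finite pole0_sub by (auto simp: Z_def)
 define G where "G = (\<lambda>a. 1 * (1 / (a - w)) + (-1) * (1 / (a - b)))"
 define r where "r = (\<lambda>\<zeta>. if \<zeta> = z0 then 1 else 0 :: complex)"
 have bS: "b \<notin> S" using b closure_subset by blast
 have bf: "b \<notin> frontier S" using b by (simp add: frontier_def)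
 have wf: "w \<notin> frontier S" using w frontier_disjoint by blast
 obtain \<eta>0 where eta0: "\<eta>0 > 0" "\<And>v. \<bar>Im v\<bar> < \<eta>0 \<Longrightarrow> unit_exp v \<notin> Z"
  using strip_avoids_finite[OF Z(1)] Z(2) by (metis dist_0_norm less_irrefl mem_ball subsetD)
 define \<eta>1 where "\<eta>1 = min \<eta>0 \<eta>"
 have ne: "C0 v \<noteq> w" if v: "0 \<le> Im v" "Im v < \<eta>1" for v
 proof (cases "Im v = 0")
  case True
  then have "v = of_real (Re v)" by (simp add: complex_eq_iff)
  then show ?thesis using curve_real[of "Re v"] wf by metis
 next
  case False
  have "unit_exp v \<in> ball 0 1 - pole0" using v False by (intro unit_exp_upper) auto
  moreover have "unit_exp v \<noteq> z0" using eta0(2)[of v] v by (auto simp: \<eta>1_def Z_def)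
  ultimately have "\<psi> (unit_exp v) \<noteq> \<psi> z0" using z0(1) inj_onD[OF psi_inj] by blast
  then show ?thesis using C0_psi[of v] v z0(2) by (simp add: \<eta>1_def)
 qed
 have neb: "C0 v \<noteq> b" if "0 \<le> Im v" "Im v < \<eta>1" for v
  using C0_closure[of v] that b by (auto simp: \<eta>1_def)
 have "wint loop G = 2 * of_real pi * \<i> * (\<Sum>\<zeta>\<in>Z. r \<zeta>)"
 proof (rule loop_residue[OF Z, where GS="\<lambda>v. G (C0 v)" and \<epsilon>=\<eta>1])
  show "G holomorphic_on \<psi> ` (ball 0 1 - Z)"
  proof -
   have "a \<noteq> w \<and> a \<noteq> b" if "a \<in> \<psi> ` (ball 0 1 - Z)" for a
   proof -
    obtain z where z: "z \<in> ball 0 1 - Z" "a = \<psi> z" using \<open>a \<in> \<psi> ` (ball 0 1 - Z)\<close> by blast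
    then have "z \<in> ball 0 1 - pole0" "z \<noteq> z0" by (auto simp: Z_def)
    then show ?thesis using inj_onD[OF psi_inj _ _ z0(1), of z] z0(2) z(2) psi_in_S[of z] bS by auto
   qed
   then show ?thesis unfolding G_def by (intro holomorphic_intros) auto
  qed
  show "continuous_on {v. 0 \<le> Im v \<and> Im v < \<eta>1} (\<lambda>v. G (C0 v))"
   unfolding G_def by (intro continuous_intros C0_cont) (use ne neb in \<open>auto simp: \<eta>1_def\<close>)
  show "continuous_on (frontier S) G" unfolding G_def by (intro continuous_intros) (use wf bf in auto)
  fix \<zeta> assume zeta: "\<zeta> \<in> Z"
  show "((\<lambda>z. (z - \<zeta>) * (G (\<psi> z) * deriv \<psi> z)) \<longlongrightarrow> r \<zeta>) (at \<zeta>)"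
  proof (cases "\<zeta> = z0")
   case True
   have d: "(\<psi> has_field_derivative deriv \<psi> z0) (at z0)" by (rule holomorphic_derivI[OF psi_hol psi_domain_open z0(1)])
   have l: "(deriv \<psi> \<longlongrightarrow> deriv \<psi> z0) (at z0)" "(\<psi> \<longlongrightarrow> \<psi> z0) (at z0)"
    using DERIV_isCont[OF d] deriv_psi_tendsto[OF z0(1)] by (auto simp: isCont_def)
   have "((\<lambda>z. (z - z0) * (1 / (\<psi> z - \<psi> z0) * deriv \<psi> z) - (z - z0) * (1 / (\<psi> z - b) * deriv \<psi> z))
     \<longlongrightarrow> 1 - (z0 - z0) * (1 / (\<psi> z0 - b) * deriv \<psi> z0)) (at z0)"
    by (intro tendsto_intros residue_simple z0(1) l) (use z0(2) w bS in auto)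
   then show ?thesis using True z0(2) by (simp add: G_def r_def algebra_simps)
  next
   case False
   then have p: "\<zeta> \<in> pole0" using zeta by (auto simp: Z_def)
   then have nb: "\<not> bounded S" and z: "\<zeta> = 0" by (auto simp: pole0_def split: if_splits)
   have "((\<lambda>a. a * G a) \<longlongrightarrow> 0) at_infinity"
   proof (rule Lim_transform_eventually)
    have i: "((\<lambda>a. inverse (a - q)) \<longlongrightarrow> 0) at_infinity" for q :: complex
    proof -
     have "filterlim (\<lambda>a. a - q) at_infinity at_infinity"
      using tendsto_add_filterlim_at_infinity'[OF filterlim_ident tendsto_const, of "- q"] by simp
     then show ?thesis by (rule filterlim_compose[OF tendsto_inverse_0])
    qed
    have "((\<lambda>a. w * inverse (a - w) - b * inverse (a - b)) \<longlongrightarrow> w * 0 - b * 0) at_infinity" by (intro tendsto_intros i)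
    then show "((\<lambda>a. w * inverse (a - w) - b * inverse (a - b)) \<longlongrightarrow> 0) at_infinity" by simp
    have "\<forall>\<^sub>F a in at_infinity. norm a \<ge> max (cmod w) (cmod b) + 1" by (rule eventually_at_infinityI) simp
    then show "\<forall>\<^sub>F a in at_infinity. w * inverse (a - w) - b * inverse (a - b) = a * G a"
    proof eventually_elim
     case (elim a)
     then have "a - w \<noteq> 0" "a - b \<noteq> 0" by auto
     then have wk: "w * inverse (a - w) = a * inverse (a - w) - 1" "b * inverse (a - b) = a * inverse (a - b) - 1"
      by (simp_all add: field_simps)
     show ?case unfolding wk by (simp add: G_def inverse_eq_divide algebra_simps)
    qed
   qed
   from residue_pole[OF nb this] show ?thesis using False z by (simp add: r_def)
  qed
 qed (use eta0 eta_pos in \<open>auto simp: \<eta>1_def c_def\<close>)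
 also have "(\<Sum>\<zeta>\<in>Z. r \<zeta>) = 1" unfolding r_def using Z(1) by (simp add: Z_def sum.delta)
 finally have "wint loop G = 2 * of_real pi * \<i>" by simp
 moreover have "wint loop G = 1 * wint loop (\<lambda>z. 1 / (z - w)) + (-1) * wint loop (\<lambda>z. 1 / (z - b))"
  unfolding G_def by (rule wint_lin[OF weight_loop kernel_cont[OF wf] kernel_cont[OF bf]])
 ultimately show ?thesis by simp
qed

lemma wint_kernel_at_infinity:
 assumes m: "weight m"
 shows "((\<lambda>w. wint m (\<lambda>z. 1 / (z - w))) \<longlongrightarrow> 0) at_infinity"
proof -
 obtain C where C: "\<And>g e. continuous_on (frontier S) g \<Longrightarrow> \<forall>z\<in>frontier S. cmod (g z) \<le> e \<Longrightarrow> cmod (wint m g) \<le> e * C"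
  using wint_bound[OF m] by blast
 obtain R where R: "\<And>z. z \<in> frontier S \<Longrightarrow> cmod z \<le> R" using frontier_bounded unfolding bounded_iff by blast
 show ?thesis
 proof (rule Lim_null_comparison)
  have "\<forall>\<^sub>F w in at_infinity. norm w \<ge> \<bar>R\<bar> + 1" for w :: complex by (rule eventually_at_infinityI) simp
  then show "\<forall>\<^sub>F w in at_infinity. cmod (wint m (\<lambda>z. 1 / (z - w))) \<le> inverse (cmod w - \<bar>R\<bar>) * C"
  proof eventually_elim
   case (elim w)
   show ?case
   proof (rule C)
    show "continuous_on (frontier S) (\<lambda>z. 1 / (z - w))" using R[of w] elim by (intro kernel_cont) auto
    show "\<forall>z\<in>frontier S. cmod (1 / (z - w)) \<le> inverse (cmod w - \<bar>R\<bar>)"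
    proof
     fix z assume "z \<in> frontier S"
     then have "cmod z \<le> \<bar>R\<bar>" using R[of z] by simp
     then have "cmod w - \<bar>R\<bar> \<le> cmod (z - w)" using norm_triangle_ineq3[of w z] by (simp add: norm_minus_commute)
     then show "cmod (1 / (z - w)) \<le> inverse (cmod w - \<bar>R\<bar>)"
      unfolding norm_divide norm_one inverse_eq_divide using elim by (intro divide_left_mono) (auto intro!: mult_pos_pos)
    qed
   qed
  qed
  have "filterlim (\<lambda>w::complex. - \<bar>R\<bar> + norm w) at_top at_infinity"
   by (rule filterlim_tendsto_add_at_top[OF tendsto_const filterlim_norm_at_top])
  then have "((\<lambda>w::complex. inverse (- \<bar>R\<bar> + norm w)) \<longlongrightarrow> 0) at_infinity"
   by (rule tendsto_inverse_0_at_top)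
  then show "((\<lambda>w. inverse (cmod w - \<bar>R\<bar>) * C) \<longlongrightarrow> 0) at_infinity"
   by (simp add: tendsto_mult_left_zero)
 qed
qed

text \<open>The kernel integral is constant on \<open>S\<close> and on the exterior, with a jump of
  2 pi i between them. It tends to 0 at infinity, so its value is 0 on whichever of the two sets
  reaches infinity.\<close>

lemma loop_winding:
 assumes w: "w \<notin> frontier S"
 shows "wint loop (\<lambda>z. 1 / (z - w)) =
  2 * of_real pi * \<i> * (if bounded S then (if w \<in> S then 1 else 0) else (if w \<in> S then 0 else -1))"
proof -
 define n where "n w = wint loop (\<lambda>z. 1 / (z - w))" for w
 have lim: "(n \<longlongrightarrow> 0) at_infinity" unfolding n_def[abs_def] by (rule wint_kernel_at_infinity[OF weight_loop])
 obtain b0 where b0: "b0 \<notin> closure S" using exterior_point by blast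
 obtain w0 where w0: "w0 \<in> S" using S_ne by blast
 have diff: "n w - n b = 2 * of_real pi * \<i>" if "w \<in> S" "b \<notin> closure S" for w b
  unfolding n_def by (rule loop_winding_difference[OF that])
 have ext: "w \<notin> closure S" if "w \<notin> S" using that w closure_eq by auto
 show ?thesis
 proof (cases "bounded S")
  case True
  have eq: "n b = n b0" if "b \<notin> closure S" for b using diff[OF w0 that] diff[OF w0 b0] by (simp add: diff_eq_eq)
  have "bounded (closure S)" by (rule bounded_closure[OF True])
  then obtain R where R: "\<And>z. z \<in> closure S \<Longrightarrow> cmod z \<le> R" unfolding bounded_iff by blast
  have "\<forall>\<^sub>F b in at_infinity. norm b \<ge> R + 1" for b :: complex by (rule eventually_at_infinityI) simp
  then have "\<forall>\<^sub>F b in at_infinity. n b = n b0"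
  proof eventually_elim
   case (elim b)
   have "b \<notin> closure S" using R[of b] elim by auto
   then show ?case by (rule eq)
  qed
  then have "((\<lambda>b. n b0) \<longlongrightarrow> 0) (at_infinity :: complex filter)" by (rule Lim_transform_eventually[OF lim])
  from tendsto_unique[OF trivial_limit_at_infinity this tendsto_const] have n0: "n b0 = 0" by simp
  show ?thesis
  proof (cases "w \<in> S")
   case True then show ?thesis using diff[OF True b0] n0 \<open>bounded S\<close> by (simp add: n_def)
  next
   case False then show ?thesis using eq[OF ext[OF False]] n0 \<open>bounded S\<close> by (simp add: n_def)
  qed
 next
  case False
  have eq: "n w = n w0" if "w \<in> S" for w using diff[OF that b0] diff[OF w0 b0] by (simp add: diff_eq_eq)
  have "\<exists>\<^sub>F w in at_infinity. w \<in> S"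
  proof (rule ccontr)
   assume "\<not> (\<exists>\<^sub>F w in at_infinity. w \<in> S)"
   then have "\<forall>\<^sub>F w in at_infinity. w \<notin> S" by (simp add: not_frequently)
   then obtain b where "\<forall>x. b \<le> cmod x \<longrightarrow> x \<notin> S" unfolding eventually_at_infinity by blast
   then have "\<forall>x\<in>S. cmod x \<le> b" using linear by blast
   then show False using False unfolding bounded_iff by blast
  qed
  then have fr: "\<exists>\<^sub>F w in at_infinity. n w = n w0" by (rule frequently_elim1) (rule eq)
  have n0: "n w0 = 0"
  proof (rule ccontr)
   assume "n w0 \<noteq> 0"
   then have "\<forall>\<^sub>F w in at_infinity. dist (n w) 0 < cmod (n w0)" by (intro tendstoD[OF lim]) simp
   then have "\<forall>\<^sub>F w in at_infinity. \<not> (n w = n w0)" by eventually_elim auto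
   then show False using fr by (simp add: frequently_def)
  qed
  show ?thesis
  proof (cases "w \<in> S")
   case True then show ?thesis using eq[OF True] n0 False by (simp add: n_def)
  next
   case nS: False
   have "n w0 - n w = 2 * of_real pi * \<i>" by (rule diff[OF w0 ext[OF nS]])
   then have "- n w = 2 * of_real pi * \<i>" using n0 by simp
   then have "n w = - (2 * of_real pi * \<i>)" by (rule minus_equation_iff[THEN iffD1, THEN sym])
   then show ?thesis using False nS by (simp add: n_def)
  qed
 qed
qed

lemma cycle_weight:
 assumes "\<forall>\<gamma>\<in>set \<Gamma>. valid_path \<gamma> \<and> path_image \<gamma> \<subseteq> frontier S"
 shows "\<exists>m. weight m \<and> (\<forall>g. continuous_on (frontier S) g \<longrightarrow> sum_list (map (\<lambda>\<gamma>. contour_integral \<gamma> g) \<Gamma>) = wint m g)"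
 using assms
proof (induction \<Gamma>)
 case Nil
 have "weight (\<lambda>s. 0)" unfolding weight_def by (auto intro!: exI[of _ 0])
 moreover have "wint (\<lambda>s. 0) g = 0" for g by (simp add: wint_def)
 ultimately show ?case by (intro exI[of _ "\<lambda>s. 0"]) auto
next
 case (Cons \<gamma> \<Gamma>)
 obtain m where m: "weight m" "\<And>g. continuous_on (frontier S) g \<Longrightarrow> sum_list (map (\<lambda>\<gamma>. contour_integral \<gamma> g) \<Gamma>) = wint m g"
  using Cons by auto
 obtain m' where m': "weight m'" "\<And>g. continuous_on (frontier S) g \<Longrightarrow> (g has_contour_integral wint m' g) \<gamma>"
  using contour_integral_representation[of \<gamma>] Cons.prems by auto
 have "sum_list (map (\<lambda>\<gamma>. contour_integral \<gamma> g) (\<gamma> # \<Gamma>)) = wint (\<lambda>s. m' s + m s) g"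
  if g: "continuous_on (frontier S) g" for g
  using m(2)[OF g] contour_integral_unique[OF m'(2)[OF g]] wint_add[OF m'(1) m(1) g] by simp
 then show ?case using weight_add[OF m'(1) m(1)] by blast
qed

text \<open>The weight of the cycle and that of the loop have equal kernel integrals off the
  frontier, so their difference annihilates every continuous function. This frees the quadrature
  identity from the choice of the cycle.\<close>

lemma cycle_eq_loop:
 assumes G: "pos_boundary_cycle S \<Gamma>" and g: "continuous_on (frontier S) g"
 shows "sum_list (map (\<lambda>\<gamma>. contour_integral \<gamma> g) \<Gamma>) = wint loop g"
proof -
 have v: "\<forall>\<gamma>\<in>set \<Gamma>. valid_path \<gamma> \<and> path_image \<gamma> \<subseteq> frontier S"
  using G unfolding pos_boundary_cycle_def by blast
 obtain m where m: "weight m" "\<And>g. continuous_on (frontier S) g \<Longrightarrow> sum_list (map (\<lambda>\<gamma>. contour_integral \<gamma> g) \<Gamma>) = wint m g"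
  using cycle_weight[OF v] by blast
 have wl: "weight (\<lambda>s. (-1) * loop s)" by (rule weight_scale[OF weight_loop])
 have diff: "wint (\<lambda>s. m s + (-1) * loop s) g = wint m g - wint loop g" if "continuous_on (frontier S) g" for g
  unfolding wint_add[OF m(1) wl that] wint_scale by simp
 have "wint (\<lambda>s. m s + (-1) * loop s) g = 0"
 proof (rule wint_eq_0[OF weight_add[OF m(1) wl] _ g])
  fix w assume w: "w \<notin> frontier S"
  have "contour_integral \<gamma> (\<lambda>z. 1 / (z - w)) = 2 * of_real pi * \<i> * winding_number \<gamma> w" if "\<gamma> \<in> set \<Gamma>" for \<gamma>
  proof -
   have "w \<notin> path_image \<gamma>" using v that w by blast
   then show ?thesis using winding_number_valid_path[of \<gamma> w] v that by simp
  qed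
  then have mapeq: "map (\<lambda>\<gamma>. contour_integral \<gamma> (\<lambda>z. 1 / (z - w))) \<Gamma> = map (\<lambda>\<gamma>. 2 * of_real pi * \<i> * winding_number \<gamma> w) \<Gamma>" by simp
  have "wint m (\<lambda>z. 1 / (z - w)) = 2 * of_real pi * \<i> * sum_list (map (\<lambda>\<gamma>. winding_number \<gamma> w) \<Gamma>)"
   unfolding m(2)[OF kernel_cont[OF w], symmetric] mapeq by (rule sum_list_const_mult)
  moreover have "sum_list (map (\<lambda>\<gamma>. winding_number \<gamma> w) \<Gamma>) = (if bounded S then (if w \<in> S then 1 else 0) else (if w \<in> S then 0 else -1))"
   using G w unfolding pos_boundary_cycle_def by blast
  ultimately show "wint (\<lambda>s. m s + (-1) * loop s) (\<lambda>z. 1 / (z - w)) = 0"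
   unfolding diff[OF kernel_cont[OF w]] loop_winding[OF w] by simp
 qed
 then show ?thesis using diff[OF g] m(2)[OF g] by simp
qed

end

section \<open>The area integral as a boundary integral of the logarithm\<close>

lemma filterlim_inverse_at_0: "filterlim inverse (at (0::complex)) at_infinity"
 by (simp add: filterlim_def at_to_infinity)

lemma mult_ln_norm_tendsto_0: "((\<lambda>a::complex. a * of_real (ln ((cmod a)\<^sup>2))) \<longlongrightarrow> 0) (at 0)"
proof (rule Lim_null_comparison)
 have "cmod (a * of_real (ln ((cmod a)\<^sup>2))) \<le> 4 * sqrt (cmod a) * (1 + cmod a)" for a :: complex
 proof (cases "a = 0")
  case False
  define y where "y = sqrt (cmod a)"
  have y: "y > 0" "cmod a = y\<^sup>2" using False by (auto simp: y_def)
  have "cmod (a * of_real (ln ((cmod a)\<^sup>2))) = 2 * y * (y * \<bar>ln (y\<^sup>2)\<bar>)"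
  proof -
   have l: "ln ((y\<^sup>2)\<^sup>2) = 2 * ln (y\<^sup>2)" using y(1) by (subst ln_realpow) auto
   show ?thesis unfolding norm_mult y(2) norm_of_real l abs_mult by (simp add: power2_eq_square)
  qed
  also have "\<dots> \<le> 2 * y * (2 * (1 + y\<^sup>2))" using y(1) by (intro mult_left_mono abs_mult_ln_square_le) auto
  finally show ?thesis by (simp add: y(2)[symmetric] y_def[symmetric] algebra_simps)
 qed simp
 then show "\<forall>\<^sub>F a::complex in at 0. cmod (a * of_real (ln ((cmod a)\<^sup>2))) \<le> 4 * sqrt (cmod a) * (1 + cmod a)" by simp
 have "((\<lambda>a::complex. 4 * sqrt (cmod a) * (1 + cmod a)) \<longlongrightarrow> 4 * sqrt (cmod 0) * (1 + cmod 0)) (at 0)"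
  by (intro tendsto_intros)
 then show "((\<lambda>a::complex. 4 * sqrt (cmod a) * (1 + cmod a)) \<longlongrightarrow> 0) (at 0)" by simp
qed

context rmap_curve
begin

lemma unbounded_contains_exterior:
 assumes nb: "\<not> bounded S" shows "\<exists>R>0. \<forall>w. cmod w \<ge> R \<longrightarrow> w \<in> S"
proof -
 obtain R where R: "\<And>z. z \<in> frontier S \<Longrightarrow> cmod z \<le> R" using frontier_bounded unfolding bounded_iff by blast
 define E where "E = - cball (0::complex) (\<bar>R\<bar> + 1)"
 have cE: "connected E" unfolding E_def by (rule connected_complement_bounded_convex) auto
 obtain x where x: "x \<in> S" "cmod x > \<bar>R\<bar> + 1" using nb unfolding bounded_iff by (metis not_le)
 have "E \<inter> frontier S = {}" using R by (force simp: E_def)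
 moreover have "x \<in> E" using x(2) by (simp add: E_def)
 then have "E \<inter> S \<noteq> {}" using x(1) by blast
 ultimately have "E - S = {}" using connected_Int_frontier[OF cE] by blast
 then have "E \<subseteq> S" by blast
 then have "\<forall>w. cmod w \<ge> \<bar>R\<bar> + 2 \<longrightarrow> w \<in> S" by (auto simp: E_def)
 then show ?thesis by (intro exI[of _ "\<bar>R\<bar> + 2"]) auto
qed

context
 fixes f :: "complex \<Rightarrow> complex"
 assumes fL: "f \<in> L1a_rho0 S"
begin

lemma f_hol: "f holomorphic_on S" and f_cont: "continuous_on (closure S) f"
 and f_inf: "\<not> bounded S \<Longrightarrow> analytic_at_infinity f"
 and f_int: "(\<lambda>w. f w / of_real ((cmod w)\<^sup>2)) absolutely_integrable_on S"
 using fL by (auto simp: L1a_rho0_def A_space_def)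

definition \<kappa> :: "complex \<Rightarrow> complex" where
 "\<kappa> w = indicator S w *\<^sub>R (f w / of_real ((cmod w)\<^sup>2))"

lemma kappa_integrable: "integrable lborel \<kappa>"
proof -
 have [measurable]: "(\<lambda>w. indicator S w *\<^sub>R f w) \<in> borel_measurable borel"
  by (rule borel_measurable_continuous_on_indicator[OF S_borel holomorphic_on_imp_continuous_on[OF f_hol]])
 have eq: "\<kappa> = (\<lambda>w. (indicator S w *\<^sub>R f w) / of_real ((cmod w)\<^sup>2))" by (simp add: \<kappa>_def fun_eq_iff scaleR_conv_of_real)
 have "\<kappa> \<in> borel_measurable borel" unfolding eq by measurable
 moreover have "integrable (completion lborel) \<kappa>" using f_int unfolding set_integrable_def \<kappa>_def[abs_def] .
 ultimately show ?thesis by (simp add: integrable_completion)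
qed

lemma f_bound_ball: "\<exists>M\<ge>0. \<forall>w\<in>closure S. cmod w \<le> R \<longrightarrow> cmod (f w) \<le> M"
proof -
 have "compact (closure S \<inter> cball 0 R)" by (intro closed_Int_compact) auto
 then have "compact (f ` (closure S \<inter> cball 0 R))"
  by (rule compact_continuous_image[OF continuous_on_subset[OF f_cont], rotated]) auto
 from compact_imp_bounded[OF this] obtain M where "\<forall>x\<in>f ` (closure S \<inter> cball 0 R). cmod x \<le> M" unfolding bounded_iff by blast
 then show ?thesis by (intro exI[of _ "\<bar>M\<bar>"]) (auto intro: order_trans[OF _ abs_ge_self])
qed

text \<open>The bound is uniform over an annulus that can be chosen to contain the frontier: points
  of the small disks stay at distance at least \<delta> / 2 from the singularity of the weight at
  0.\<close>

lemma kappa_bound: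
 assumes d: "\<delta> > 0"
 shows "\<exists>M. \<forall>a. \<delta> \<le> cmod a \<longrightarrow> cmod a \<le> R \<longrightarrow> (\<forall>w\<in>ball a (min 1 (\<delta> / 2)). cmod (\<kappa> w) \<le> M)"
proof -
 obtain M where M: "M \<ge> 0" "\<And>w. w \<in> closure S \<Longrightarrow> cmod w \<le> R + 1 \<Longrightarrow> cmod (f w) \<le> M" using f_bound_ball by blast
 have "cmod (\<kappa> w) \<le> M / (\<delta> / 2)\<^sup>2" if a: "\<delta> \<le> cmod a" "cmod a \<le> R" and w: "w \<in> ball a (min 1 (\<delta> / 2))" for a w
 proof (cases "w \<in> S")
  case True
  have n: "cmod (w - a) < 1" "cmod (w - a) < \<delta> / 2" using w by (auto simp: dist_norm norm_minus_commute)
  have 1: "cmod w \<le> R + 1" using norm_triangle_sub[of w a] n(1) a(2) by linarith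
  have 2: "\<delta> / 2 \<le> cmod w" using norm_triangle_sub[of a w] n(2) a(1) by (simp add: norm_minus_commute)
  have "cmod (f w) \<le> M" using M(2)[of w] True closure_subset[of S] 1 by blast
  moreover have "(\<delta> / 2)\<^sup>2 \<le> (cmod w)\<^sup>2" using 2 d by (intro power_mono) auto
  ultimately have "cmod (f w) / (cmod w)\<^sup>2 \<le> M / (\<delta> / 2)\<^sup>2" using d M(1) by (intro frac_le) auto
  then show ?thesis using True by (simp add: \<kappa>_def norm_divide norm_power)
 qed (use M(1) in \<open>simp add: \<kappa>_def\<close>)
 then show ?thesis by blast
qed

text \<open>Otherwise the weighted function would dominate a multiple of |w|^(-2) near 0, which is
  not integrable.\<close>

lemma f_at_0: assumes "0 \<in> S" shows "f 0 = 0"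
proof (rule ccontr)
 assume f0: "f 0 \<noteq> 0"
 define d where "d = cmod (f 0) / 2"
 have d: "d > 0" using f0 by (simp add: d_def)
 have "isCont f 0" using holomorphic_on_imp_continuous_on[OF f_hol] S_open assms by (simp add: continuous_on_eq_continuous_at)
 then obtain e1 where e1: "e1 > 0" "\<And>w. dist w 0 < e1 \<Longrightarrow> dist (f w) (f 0) < d"
  using d unfolding continuous_at_eps_delta dist_norm by blast
 obtain e2 where e2: "e2 > 0" "ball 0 e2 \<subseteq> S" using S_open assms open_contains_ball by blast
 define t where "t n = inverse (real (Suc n))" for n
 have t: "t n > 0" for n by (simp add: t_def)
 have lim: "t \<longlonglongrightarrow> 0" unfolding t_def by (rule LIMSEQ_inverse_real_of_nat)
 show False
 proof (rule inverse_square_not_integrable[OF kappa_integrable t _ d])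
  fix x :: real assume "x > 0"
  then have "\<forall>\<^sub>F n in sequentially. t n < x / 2" by (intro order_tendstoD(2)[OF lim]) simp
  then show "\<forall>\<^sub>F n in sequentially. \<not> (t n \<le> x \<and> x \<le> 2 * t n)" by eventually_elim auto
 next
  have "\<forall>\<^sub>F n in sequentially. t n < min e1 e2 / 4" using e1(1) e2(1) by (intro order_tendstoD(2)[OF lim]) simp
  then show "\<forall>\<^sub>F n in sequentially. \<forall>w\<in>cbox (Complex (t n) (t n)) (Complex (2 * t n) (2 * t n)). cmod (\<kappa> w) \<ge> d / (cmod w)\<^sup>2"
  proof eventually_elim
   case (elim n)
   show ?case
   proof
    fix w assume "w \<in> cbox (Complex (t n) (t n)) (Complex (2 * t n) (2 * t n))"
    then have "\<bar>Re w\<bar> \<le> 2 * t n" "\<bar>Im w\<bar> \<le> 2 * t n" using t[of n] by (auto simp: in_cbox_complex_iff)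
    then have "cmod w < min e1 e2" using cmod_le[of w] elim by linarith
    then have "w \<in> S" "dist (f w) (f 0) < d" using e1(2)[of w] e2(2) by auto
    then have "d \<le> cmod (f w)" using norm_triangle_sub[of "f 0" "f w"] by (simp add: d_def dist_norm norm_minus_commute)
    then show "cmod (\<kappa> w) \<ge> d / (cmod w)\<^sup>2" using \<open>w \<in> S\<close> by (simp add: \<kappa>_def norm_divide norm_power divide_right_mono)
   qed
  qed
 qed
qed

text \<open>Integrability excludes a nonzero value at infinity just as at the origin; analyticity
  there then improves vanishing to O(1 / w).\<close>

lemma f_decay: assumes nb: "\<not> bounded S" shows "\<exists>l. ((\<lambda>w. w * f w) \<longlongrightarrow> l) at_infinity"
proof -
 obtain l0 where l0: "(f \<longlongrightarrow> l0) at_infinity" "(\<lambda>z. if z = 0 then l0 else f (1 / z)) analytic_on {0}"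
  using f_inf[OF nb] unfolding analytic_at_infinity_def by blast
 obtain R where R: "R > 0" "\<And>w. cmod w \<ge> R \<Longrightarrow> w \<in> S" using unbounded_contains_exterior[OF nb] by blast
 have "l0 = 0"
 proof (rule ccontr)
  assume n0: "l0 \<noteq> 0"
  define d where "d = cmod l0 / 2"
  have d: "d > 0" using n0 by (simp add: d_def)
  have "\<forall>\<^sub>F w in at_infinity. dist (f w) l0 < d" by (rule tendstoD[OF l0(1) d])
  then obtain R1 where R1: "\<And>w. cmod w \<ge> R1 \<Longrightarrow> dist (f w) l0 < d" unfolding eventually_at_infinity by blast
  show False
  proof (rule inverse_square_not_integrable[OF kappa_integrable, of "\<lambda>n. real (Suc n)", OF _ _ d])
   fix x :: real
   have "\<forall>\<^sub>F n in sequentially. x < real n" by (rule eventually_sequentiallyI[of "nat \<lceil>x\<rceil> + 1"]) linarith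
   then show "\<forall>\<^sub>F n in sequentially. \<not> (real (Suc n) \<le> x \<and> x \<le> 2 * real (Suc n))" by eventually_elim auto
  next
   have "\<forall>\<^sub>F n in sequentially. max R R1 < real n" by (rule eventually_sequentiallyI[of "nat \<lceil>max R R1\<rceil> + 1"]) linarith
   then show "\<forall>\<^sub>F n in sequentially. \<forall>w\<in>cbox (Complex (real (Suc n)) (real (Suc n))) (Complex (2 * real (Suc n)) (2 * real (Suc n))). cmod (\<kappa> w) \<ge> d / (cmod w)\<^sup>2"
   proof eventually_elim
    case (elim n)
    show ?case
    proof
     fix w assume "w \<in> cbox (Complex (real (Suc n)) (real (Suc n))) (Complex (2 * real (Suc n)) (2 * real (Suc n)))"
     then have "real (Suc n) \<le> Re w" by (auto simp: in_cbox_complex_iff)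
     then have "max R R1 \<le> cmod w" using complex_Re_le_cmod[of w] elim by linarith
     then have "w \<in> S" "dist (f w) l0 < d" using R(2) R1 by auto
     then have "d \<le> cmod (f w)" using norm_triangle_sub[of l0 "f w"] by (simp add: d_def dist_norm norm_minus_commute)
     then show "cmod (\<kappa> w) \<ge> d / (cmod w)\<^sup>2" using \<open>w \<in> S\<close> by (simp add: \<kappa>_def norm_divide norm_power divide_right_mono)
    qed
   qed
  qed simp
 qed
 define g where "g = (\<lambda>z. if z = 0 then l0 else f (1 / z))"
 have "g field_differentiable (at 0)" using l0(2) unfolding g_def by (rule analytic_on_imp_differentiable_at) simp
 then obtain l where "(g has_field_derivative l) (at 0)" unfolding field_differentiable_def by blast
 then have "((\<lambda>z. g z / z) \<longlongrightarrow> l) (at 0)" using \<open>l0 = 0\<close> by (simp add: has_field_derivative_iff g_def)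
 then have "((\<lambda>w. g (inverse w) / inverse w) \<longlongrightarrow> l) at_infinity"
  by (rule filterlim_compose[OF _ filterlim_inverse_at_0])
 moreover have "\<forall>\<^sub>F w in at_infinity. norm w \<ge> 1" for w :: complex by (rule eventually_at_infinityI) simp
 then have "\<forall>\<^sub>F w in at_infinity. g (inverse w) / inverse w = w * f w"
  by eventually_elim (auto simp: g_def field_simps)
 ultimately show ?thesis by (blast intro: Lim_transform_eventually)
qed

lemma cauchy_kappa_isCont: "a \<noteq> 0 \<Longrightarrow> isCont (cauchy_transform \<kappa>) a"
proof -
 assume a: "a \<noteq> 0"
 have "0 < cmod a" using a by simp
 from kappa_bound[OF this, of "cmod a"]
 obtain M where "\<forall>x. cmod a \<le> cmod x \<longrightarrow> cmod x \<le> cmod a \<longrightarrow> (\<forall>w\<in>ball x (min 1 (cmod a / 2)). cmod (\<kappa> w) \<le> M)" by blast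
 then have M: "cmod (\<kappa> w) \<le> M" if "w \<in> ball a (min 1 (cmod a / 2))" for w using that by blast
 have "0 < min 1 (cmod a / 2)" using a by simp
 from cauchy_transform_isCont[OF kappa_integrable this M] show ?thesis .
qed

text \<open>\<open>E\<close> is the logarithmic integrand made holomorphic on \<open>S\<close>
  without 0 by the Cauchy transform of \<open>\<kappa>\<close>. After a correction at infinity its
  loop integral has no residues at all, so the logarithmic integral is read off from the two added
  terms.\<close>

lemma area_loop:
 "wint loop (\<lambda>w. f w * of_real (ln ((cmod w)\<^sup>2)) / w) = 2 * \<i> * (LINT w|lborel. \<kappa> w)"
proof -
 obtain b where b: "b \<notin> closure S" "b \<noteq> 0" using exterior_point by blast
 have bf: "b \<notin> frontier S" using b by (simp add: frontier_def)
 define \<mu> where "\<mu> = (LINT w|lborel. \<kappa> w) / of_real pi"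
 define E where "E a = f a / a * of_real (ln ((cmod a)\<^sup>2)) + cauchy_transform \<kappa> a / of_real pi" for a
 define G where "G a = E a + \<mu> / (a - b)" for a
 define Z where "Z = (\<psi> -` {0} \<inter> (ball 0 1 - pole0)) \<union> pole0"
 have Z: "finite Z" "Z \<subseteq> ball 0 1" "pole0 \<subseteq> Z"
  unfolding Z_def using pole0_finite pole0_sub finite_vimage_IntI[OF _ psi_inj, of "{0}"] by auto
 have norm2: "complex_of_real ((cmod w)\<^sup>2) = w * cnj w" for w by (rule complex_norm_square)
 have Eh: "E holomorphic_on S - {0}"
  unfolding E_def
 proof (rule log_primitive_holomorphic[OF _ _ _ kappa_integrable])
  show "open (S - {0})" using S_open by (simp add: open_Diff)
  show "(\<lambda>a. f a / a) holomorphic_on S - {0}" by (intro holomorphic_intros holomorphic_on_subset[OF f_hol]) auto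
  show "\<kappa> w = f w / w / cnj w" if "w \<in> S - {0}" for w using that unfolding \<kappa>_def norm2 by simp
 qed auto
 have bS: "b \<notin> S" using b closure_subset by blast
 have Gh: "G holomorphic_on S - {0}" unfolding G_def by (intro holomorphic_intros Eh) (use bS in auto)
 have closS: "frontier S \<subseteq> closure S" by (simp add: frontier_def)
 have kc: "continuous_on X (cauchy_transform \<kappa>)" if "0 \<notin> X" for X
  using that by (intro continuous_at_imp_continuous_on ballI cauchy_kappa_isCont) auto
 have Gc: "continuous_on (closure S - {0}) G"
  unfolding G_def E_def by (intro continuous_intros continuous_on_subset[OF f_cont] kc) (use b in auto)
 have C0in: "C0 v \<in> closure S - {0}" if "0 \<le> Im v" "Im v < \<eta>" for v
  using C0_closure[OF that] psi_nz[OF that] C0_psi[OF that] by simp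
 have Gfr: "continuous_on (frontier S) G" by (rule continuous_on_subset[OF Gc]) (use closS zero_frontier in auto)
 \<comment> \<open>The zero of \<open>f\<close> reduces the singularity of \<open>\<kappa>\<close>
   to O(1 / |w|), the growth that \<open>cauchy_transform_at_0\<close> admits.\<close>
 have at0: "((\<lambda>a. a * G a) \<longlongrightarrow> 0) (at 0)" if S0: "0 \<in> S"
 proof -
  have f0: "f 0 = 0" by (rule f_at_0[OF S0])
  have "(f has_field_derivative deriv f 0) (at 0)" by (rule holomorphic_derivI[OF f_hol S_open S0])
  then have l: "((\<lambda>a. f a / a) \<longlongrightarrow> deriv f 0) (at 0)" by (simp add: has_field_derivative_iff f0)
  then have "\<forall>\<^sub>F a in at 0. dist (f a / a) (deriv f 0) < 1" by (rule tendstoD) simp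
  then obtain R where R: "R > 0" "\<And>a. a \<noteq> 0 \<Longrightarrow> dist a 0 < R \<Longrightarrow> dist (f a / a) (deriv f 0) < 1" unfolding eventually_at by auto
  have "((\<lambda>a. a * cauchy_transform \<kappa> a) \<longlongrightarrow> 0) (at 0)"
  proof (rule cauchy_transform_at_0[OF kappa_integrable R(1)])
   fix w :: complex assume w: "w \<in> ball 0 R - {0}"
   have "dist (f w / w) (deriv f 0) < 1" using R(2)[of w] w by simp
   then have "cmod (f w / w) \<le> cmod (deriv f 0) + 1" using norm_triangle_sub[of "f w / w" "deriv f 0"] by (simp add: dist_norm)
   then have "cmod (f w / w) / cmod w \<le> (cmod (deriv f 0) + 1) / cmod w" by (rule divide_right_mono) simp
   moreover have "cmod (\<kappa> w) \<le> cmod (f w / w) / cmod w" by (simp add: \<kappa>_def norm_divide norm_mult norm_power power2_eq_square indicator_def)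
   ultimately show "cmod (\<kappa> w) \<le> (cmod (deriv f 0) + 1) / cmod w" by simp
  qed
  then have "((\<lambda>a. f a / a * (a * of_real (ln ((cmod a)\<^sup>2))) + a * cauchy_transform \<kappa> a / of_real pi + a * (\<mu> / (a - b))) \<longlongrightarrow> deriv f 0 * 0 + 0 / of_real pi + 0 * (\<mu> / (0 - b))) (at 0)"
   by (intro tendsto_intros l mult_ln_norm_tendsto_0) (use b(2) in auto)
  then show ?thesis by (simp add: G_def E_def algebra_simps)
 qed
 have at_inf: "((\<lambda>a. a * G a) \<longlongrightarrow> 0) at_infinity" if nb: "\<not> bounded S"
 proof -
  obtain l where l: "((\<lambda>w. w * f w) \<longlongrightarrow> l) at_infinity" using f_decay[OF nb] by blast
  have "\<forall>\<^sub>F w in at_infinity. dist (w * f w) l < 1" by (rule tendstoD[OF l]) simp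
  then obtain R1 where R1: "\<And>w. R1 \<le> cmod w \<Longrightarrow> dist (w * f w) l < 1" unfolding eventually_at_infinity by blast
  define R where "R = \<bar>R1\<bar> + 1"
  have "((\<lambda>a. a * cauchy_transform \<kappa> a) \<longlongrightarrow> - (LINT w|lborel. \<kappa> w)) at_infinity"
  proof (rule cauchy_transform_at_infinity[OF kappa_integrable, of R])
   show "R > 0" by (simp add: R_def)
   fix w :: complex assume w: "R \<le> cmod w"
   have w0: "cmod w > 0" using w unfolding R_def by linarith
   have "dist (w * f w) l < 1" using R1[of w] w by (simp add: R_def)
   then have "cmod (w * f w) \<le> cmod l + 1" using norm_triangle_sub[of "w * f w" l] by (simp add: dist_norm)
   then have "cmod (w * f w) / cmod w ^ 3 \<le> (cmod l + 1) / cmod w ^ 3" by (rule divide_right_mono) simp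
   moreover have "cmod (\<kappa> w) \<le> cmod (w * f w) / cmod w ^ 3"
    using w0 by (simp add: \<kappa>_def norm_divide norm_mult norm_power power2_eq_square power3_eq_cube indicator_def)
   ultimately show "cmod (\<kappa> w) \<le> (cmod l + 1) / cmod w ^ 3" by simp
  qed
  moreover have "((\<lambda>a. inverse a * of_real (ln ((cmod (inverse a))\<^sup>2)) :: complex) \<longlongrightarrow> 0) at_infinity"
   by (rule filterlim_compose[OF mult_ln_norm_tendsto_0 filterlim_inverse_at_0])
  moreover have "((\<lambda>a. inverse (a - b)) \<longlongrightarrow> 0) at_infinity"
  proof -
   have "filterlim (\<lambda>a. a - b) at_infinity at_infinity"
    using tendsto_add_filterlim_at_infinity'[OF filterlim_ident tendsto_const, of "- b"] by simp
   then show ?thesis by (rule filterlim_compose[OF tendsto_inverse_0])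
  qed
  ultimately have "((\<lambda>a. - (a * f a * (inverse a * of_real (ln ((cmod (inverse a))\<^sup>2)))) + a * cauchy_transform \<kappa> a / of_real pi + (\<mu> + \<mu> * b * inverse (a - b)))
    \<longlongrightarrow> - (l * 0) + - (LINT w|lborel. \<kappa> w) / of_real pi + (\<mu> + \<mu> * b * 0)) at_infinity"
   by (intro tendsto_intros l) auto
  then have lim: "((\<lambda>a. - (a * f a * (inverse a * of_real (ln ((cmod (inverse a))\<^sup>2)))) + a * cauchy_transform \<kappa> a / of_real pi + (\<mu> + \<mu> * b * inverse (a - b)))
    \<longlongrightarrow> 0) at_infinity" by (simp add: \<mu>_def)
  have "\<forall>\<^sub>F a in at_infinity. norm a \<ge> cmod b + 1" for a :: complex by (rule eventually_at_infinityI) simp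
  then have "\<forall>\<^sub>F a in at_infinity. - (a * f a * (inverse a * of_real (ln ((cmod (inverse a))\<^sup>2)))) + a * cauchy_transform \<kappa> a / of_real pi + (\<mu> + \<mu> * b * inverse (a - b)) = a * G a"
  proof eventually_elim
   case (elim a)
   have "cmod a > 0" "cmod a \<noteq> cmod b" using elim norm_ge_zero[of b] by linarith+
   then have a: "a \<noteq> 0" "a - b \<noteq> 0" by auto
   have "ln ((cmod (inverse a))\<^sup>2) = - ln ((cmod a)\<^sup>2)" using a by (simp add: norm_inverse power_inverse ln_inverse)
   then have 1: "- (a * f a * (inverse a * of_real (ln ((cmod (inverse a))\<^sup>2)))) = a * (f a / a * of_real (ln ((cmod a)\<^sup>2)))"
    using a(1) by simp
   have 2: "\<mu> + \<mu> * b * inverse (a - b) = a * (\<mu> / (a - b))" using a(2) by (simp add: field_simps)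
   show ?case unfolding 1 2 by (simp add: G_def E_def distrib_left)
  qed
  then show ?thesis by (rule Lim_transform_eventually[OF lim])
 qed
 have "wint loop G = 2 * of_real pi * \<i> * (\<Sum>\<zeta>\<in>Z. (\<lambda>\<zeta>. 0) \<zeta>)"
 proof (rule loop_residue[OF Z, where GS="\<lambda>v. G (C0 v)" and \<epsilon>=\<eta>])
  have "\<psi> ` (ball 0 1 - Z) \<subseteq> S - {0}" using psi_in_S by (auto simp: Z_def)
  then show "G holomorphic_on \<psi> ` (ball 0 1 - Z)" by (rule holomorphic_on_subset[OF Gh])
  show "continuous_on {v. 0 \<le> Im v \<and> Im v < \<eta>} (\<lambda>v. G (C0 v))"
   by (rule continuous_on_compose2[OF Gc C0_cont]) (use C0in in auto)
  fix \<zeta> assume zeta: "\<zeta> \<in> Z"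
  show "((\<lambda>z. (z - \<zeta>) * (G (\<psi> z) * deriv \<psi> z)) \<longlongrightarrow> 0) (at \<zeta>)"
  proof (cases "\<zeta> \<in> pole0")
   case True
   then have "\<not> bounded S" "\<zeta> = 0" by (auto simp: pole0_def split: if_splits)
   then show ?thesis using residue_pole[OF _ at_inf] by simp
  next
   case False
   then have z: "\<zeta> \<in> ball 0 1 - pole0" "\<psi> \<zeta> = 0" using zeta by (auto simp: Z_def)
   then have S0: "0 \<in> S" using psi_in_S[of \<zeta>] by auto
   have d: "(\<psi> has_field_derivative deriv \<psi> \<zeta>) (at \<zeta>)" by (rule holomorphic_derivI[OF psi_hol psi_domain_open z(1)])
   have p0: "(\<psi> \<longlongrightarrow> 0) (at \<zeta>)" using DERIV_isCont[OF d] z(2) by (simp add: isCont_def)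
   have ev: "\<forall>\<^sub>F x in at \<zeta>. x \<in> ball 0 1 - pole0 - {\<zeta>}" by (rule eventually_at_in_open[OF psi_domain_open z(1)])
   then have nz: "\<forall>\<^sub>F x in at \<zeta>. \<psi> x \<noteq> 0"
   proof eventually_elim
    case (elim x)
    then have "\<psi> x \<noteq> \<psi> \<zeta>" using inj_onD[OF psi_inj, of x \<zeta>] z(1) by blast
    then show ?case by (simp only: z(2)) simp
   qed
   have "filterlim \<psi> (at 0) (at \<zeta>)" using p0 nz by (simp add: filterlim_at)
   then have "((\<lambda>x. \<psi> x * G (\<psi> x)) \<longlongrightarrow> 0) (at \<zeta>)" by (rule filterlim_compose[OF at0[OF S0]])
   from tendsto_mult[OF residue_simple[OF z(1)] this]
   have "((\<lambda>x. (x - \<zeta>) * (1 / (\<psi> x - \<psi> \<zeta>) * deriv \<psi> x) * (\<psi> x * G (\<psi> x))) \<longlongrightarrow> 0) (at \<zeta>)" by simp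
   moreover have "\<forall>\<^sub>F x in at \<zeta>. (x - \<zeta>) * (1 / (\<psi> x - \<psi> \<zeta>) * deriv \<psi> x) * (\<psi> x * G (\<psi> x)) = (x - \<zeta>) * (G (\<psi> x) * deriv \<psi> x)"
    using nz by eventually_elim (simp add: z(2))
   ultimately show ?thesis by (rule Lim_transform_eventually)
  qed
 qed (use eta_pos Gfr in \<open>auto simp: c_def\<close>)
 then have G0: "wint loop G = 0" by simp
 have kfr: "continuous_on (frontier S) (cauchy_transform \<kappa>)" by (rule kc) (rule zero_frontier)
 have "wint loop (\<lambda>w. f w * of_real (ln ((cmod w)\<^sup>2)) / w)
   = wint loop (\<lambda>z. 1 * G z + (-1) * (\<mu> * (1 / (z - b)) + (1 / of_real pi) * cauchy_transform \<kappa> z))"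
  by (rule wint_cong) (simp add: G_def E_def)
 also have "\<dots> = - (\<mu> * wint loop (\<lambda>z. 1 / (z - b)) + (1 / of_real pi) * wint loop (cauchy_transform \<kappa>))"
  using wint_lin[OF weight_loop Gfr, of "\<lambda>z. \<mu> * (1 / (z - b)) + (1 / of_real pi) * cauchy_transform \<kappa> z" 1 "-1"]
   wint_lin[OF weight_loop kernel_cont[OF bf] kfr, of \<mu> "1 / of_real pi"] G0
   continuous_on_add[OF continuous_on_mult_left[OF kernel_cont[OF bf], of \<mu>] continuous_on_mult_left[OF kfr, of "1 / of_real pi"]]
  by simp
 finally have F: "wint loop (\<lambda>w. f w * of_real (ln ((cmod w)\<^sup>2)) / w)
   = - (\<mu> * wint loop (\<lambda>z. 1 / (z - b)) + (1 / of_real pi) * wint loop (cauchy_transform \<kappa>))" .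
 obtain R where R: "\<And>z. z \<in> frontier S \<Longrightarrow> cmod z \<le> R" using frontier_bounded unfolding bounded_iff by blast
 obtain \<delta> where del: "\<delta> > 0" "\<And>z. z \<in> frontier S \<Longrightarrow> \<delta> \<le> cmod z"
 proof -
  have "open (- frontier S)" by (simp add: open_Compl)
  moreover have "0 \<in> - frontier S" using zero_frontier by simp
  ultimately obtain d where d: "d > 0" "ball 0 d \<subseteq> - frontier S" using open_contains_ball by blast
  show ?thesis
  proof (rule that[OF d(1)])
   fix z assume "z \<in> frontier S"
   then have "z \<notin> ball 0 d" using d(2) by blast
   then show "d \<le> cmod z" by simp
  qed
 qed
 obtain M where M: "\<And>a w. \<delta> \<le> cmod a \<Longrightarrow> cmod a \<le> R \<Longrightarrow> w \<in> ball a (min 1 (\<delta> / 2)) \<Longrightarrow> cmod (\<kappa> w) \<le> M"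
  using kappa_bound[OF del(1), of R] by blast
 have "wint loop (cauchy_transform \<kappa>) = - (LINT w|lborel. \<kappa> w * wint loop (\<lambda>z. 1 / (z - w)))"
  by (rule wint_cauchy_transform[OF weight_loop kappa_integrable, of "min 1 (\<delta> / 2)" M])
   (use del(1) M del(2)[OF c_frontier] R[OF c_frontier] in auto)
 also have "(LINT w|lborel. \<kappa> w * wint loop (\<lambda>z. 1 / (z - w))) = (LINT w|lborel. \<kappa> w * (2 * of_real pi * \<i> * (if bounded S then 1 else 0)))"
 proof (intro Bochner_Integration.integral_cong refl)
  fix w show "\<kappa> w * wint loop (\<lambda>z. 1 / (z - w)) = \<kappa> w * (2 * of_real pi * \<i> * (if bounded S then 1 else 0))"
  proof (cases "w \<in> S")
   case True
   then have "w \<notin> frontier S" using frontier_disjoint by blast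
   from loop_winding[OF this] show ?thesis using True by simp
  qed (simp add: \<kappa>_def)
 qed
 also have "\<dots> = (LINT w|lborel. \<kappa> w) * (2 * of_real pi * \<i> * (if bounded S then 1 else 0))" by (rule integral_mult_left_zero)
 finally have k: "wint loop (cauchy_transform \<kappa>) = - ((LINT w|lborel. \<kappa> w) * (2 * of_real pi * \<i> * (if bounded S then 1 else 0)))" .
 \<comment> \<open>In the bounded case only the Cauchy transform contributes, in the unbounded case
   only the kernel at \<open>b\<close>, whose winding number is then -1; the totals agree.\<close>
 show ?thesis unfolding F k loop_winding[OF bf] using bS by (simp add: \<mu>_def)
qed

end

end

section \<open>The quadrature function\<close>

lemma coprime_reduction:
 fixes p0 q0 :: "complex poly"
 assumes "q0 \<noteq> 0" and "b \<Longrightarrow> p0 = 0 \<or> degree p0 < degree q0"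
 shows "\<exists>p q. q \<noteq> 0 \<and> coprime p q \<and> q dvd q0 \<and> p * q0 = p0 * q \<and> (b \<longrightarrow> p = 0 \<or> degree p < degree q)"
 using assms
proof (induction "degree q0" arbitrary: p0 q0 rule: less_induct)
 case less
 show ?case
 proof (cases "coprime p0 q0")
  case True then show ?thesis using less.prems by (intro exI[of _ p0] exI[of _ q0]) auto
 next
  case False
  then obtain d where d: "d dvd p0" "d dvd q0" "\<not> is_unit d" unfolding coprime_def by blast
  obtain p1 q1 where pq: "p0 = d * p1" "q0 = d * q1" using d(1,2) by (auto elim!: dvdE)
  have d0: "d \<noteq> 0" and q1: "q1 \<noteq> 0" using less.prems(1) pq by auto
  have dd: "degree d > 0" using d(3) d0 is_unit_iff_degree by blast
  have dq: "degree q0 = degree d + degree q1" unfolding pq using d0 q1 by (rule degree_mult_eq)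
  have "b \<Longrightarrow> p1 = 0 \<or> degree p1 < degree q1"
  proof -
   assume b: b
   show "p1 = 0 \<or> degree p1 < degree q1"
   proof (cases "p1 = 0")
    case False
    have "degree p0 = degree d + degree p1" unfolding pq using d0 False by (rule degree_mult_eq)
    then show ?thesis using less.prems(2)[OF b] dq False d0 pq by auto
   qed simp
  qed
  from less.hyps[OF _ q1 this] dd dq obtain p q where r: "q \<noteq> 0" "coprime p q" "q dvd q1" "p * q1 = p1 * q" "b \<longrightarrow> p = 0 \<or> degree p < degree q"
   by auto
  have "p * q0 = p0 * q" using r(4) unfolding pq by (simp add: mult_ac)
  moreover have "q dvd q0" unfolding pq using r(3) by (rule dvd_mult)
  ultimately show ?thesis using r by blast
 qed
qed

lemma poly_quotient_at_infinity:
 fixes p q :: "complex poly"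
 assumes "p = 0 \<or> degree p < degree q"
 shows "((\<lambda>w. poly p w / poly q w) \<longlongrightarrow> 0) at_infinity"
 using assms poly_divide_tendsto_0_at_infinity[of p q] by auto

text \<open>In the coordinate z = 1 / w the function z^N k(1/z) has a removable singularity;
  division with remainder by z^N separates the terms that become a polynomial in
  \<open>w\<close>.\<close>

lemma principal_part_at_infinity:
 fixes k :: "complex \<Rightarrow> complex"
 assumes R: "R > 0" and k: "k holomorphic_on {w. cmod w > R}" and B: "\<And>w. cmod w > R \<Longrightarrow> cmod (k w) \<le> M * cmod w ^ N"
 shows "\<exists>P. ((\<lambda>w. k w - poly P w) \<longlongrightarrow> 0) at_infinity"
proof -
 define U where "U = ball (0::complex) (1 / R)"
 have big: "cmod (inverse z) > R" if "z \<in> U - {0}" for z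
 proof -
  have "0 < cmod z" "cmod z < 1 / R" using that by (auto simp: U_def)
  then show ?thesis unfolding norm_inverse using R by (simp add: field_simps)
 qed
 have h: "(\<lambda>z. z ^ N * k (inverse z)) holomorphic_on U - {0}"
 proof (intro holomorphic_intros)
  show "(\<lambda>z. k (inverse z)) holomorphic_on U - {0}"
   by (rule holomorphic_on_compose_gen[OF _ k, unfolded comp_def]) (use big in \<open>auto intro!: holomorphic_intros\<close>)
 qed
 have bd: "cmod (z ^ N * k (inverse z)) \<le> M" if z: "z \<in> U - {0}" for z
 proof -
  have "cmod (z ^ N * k (inverse z)) \<le> cmod z ^ N * (M * cmod (inverse z) ^ N)"
   unfolding norm_mult norm_power using B[OF big[OF z]] by (intro mult_left_mono) auto
  also have "\<dots> = M" using z by (simp add: norm_inverse power_inverse)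
  finally show ?thesis .
 qed
 have U: "open U" "{0} \<subseteq> U" using R by (auto simp: U_def)
 obtain G where G: "G holomorphic_on U" "\<And>z. z \<in> U - {0} \<Longrightarrow> G z = z ^ N * k (inverse z)"
  using holomorphic_extend_finite[of "{0}" U, OF _ U h bd] by auto
 have "\<exists>P g. g holomorphic_on U \<and> (\<forall>w\<in>U. G w = poly P w + poly (monom 1 N) w * g w) \<and> (P = 0 \<or> degree P < degree (monom (1::complex) N))"
  by (rule hermite_division[OF G(1) U(1)]) (use U(2) in \<open>auto simp: poly_monom split: if_splits\<close>)
 then obtain P g where P0: "g holomorphic_on U" "\<forall>w\<in>U. G w = poly P w + poly (monom 1 N) w * g w"
  "P = 0 \<or> degree P < degree (monom (1::complex) N)" by blast
 have P: "g holomorphic_on U" "\<And>w. w \<in> U \<Longrightarrow> G w = poly P w + w ^ N * g w" "degree P \<le> N"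
  using P0 by (auto simp: poly_monom degree_monom_eq)
 \<comment> \<open>Reversing the coefficients expresses w^N P(1/w) as a polynomial; the constant
   \<open>g 0\<close> is moved into it so that the difference tends to 0.\<close>
 define Q where "Q = (\<Sum>i\<le>N. monom (coeff P i) (N - i)) + [:g 0:]"
 have "isCont g 0" using holomorphic_on_imp_continuous_on[OF P(1)] U by (simp add: continuous_on_eq_continuous_at)
 then have "((\<lambda>z. g z - g 0) \<longlongrightarrow> 0) (at 0)" using LIM_zero by (auto simp: isCont_def)
 then have "((\<lambda>w. g (inverse w) - g 0) \<longlongrightarrow> 0) at_infinity" by (rule filterlim_compose[OF _ filterlim_inverse_at_0])
 moreover have "\<forall>\<^sub>F w in at_infinity. norm w \<ge> R + 1" for w :: complex by (rule eventually_at_infinityI) simp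
 then have "\<forall>\<^sub>F w in at_infinity. g (inverse w) - g 0 = k w - poly Q w"
 proof eventually_elim
  case (elim w)
  have w0: "w \<noteq> 0" using elim R by auto
  have "inverse (cmod w) < 1 / R"
  proof -
   have "R < cmod w" "0 < cmod w" using elim w0 by auto
   then show ?thesis using R by (simp add: field_simps)
  qed
  then have zU: "inverse w \<in> U - {0}" using w0 by (simp add: U_def norm_inverse del: inverse_eq_divide)
  have "inverse w ^ N * k w = poly P (inverse w) + inverse w ^ N * g (inverse w)"
   using G(2)[OF zU] P(2)[of "inverse w"] zU by simp
  then have eq: "w ^ N * (inverse w ^ N * k w) = w ^ N * poly P (inverse w) + w ^ N * (inverse w ^ N * g (inverse w))"
   by (simp only: distrib_left)
  have one: "w ^ N * inverse w ^ N = 1" using w0 by (simp add: power_inverse)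
  have canc: "w ^ N * (inverse w ^ N * x) = x" for x unfolding mult.assoc[symmetric] one by simp
  have kw: "k w = w ^ N * poly P (inverse w) + g (inverse w)" using eq unfolding canc .
  have "poly P (inverse w) = (\<Sum>i\<le>N. coeff P i * inverse w ^ i)"
  proof -
   have "(\<Sum>i\<le>N. coeff P i * inverse w ^ i) = (\<Sum>i\<le>degree P. coeff P i * inverse w ^ i)"
    by (rule sum.mono_neutral_right) (use P(3) in \<open>auto simp: coeff_eq_0\<close>)
   then show ?thesis by (simp add: poly_altdef)
  qed
  then have "w ^ N * poly P (inverse w) = (\<Sum>i\<le>N. coeff P i * w ^ (N - i))"
   using w0 by (simp add: sum_distrib_left power_diff power_inverse divide_inverse mult_ac)
  then show ?case unfolding kw by (simp add: Q_def poly_sum poly_monom)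
 qed
 ultimately have "((\<lambda>w. k w - poly Q w) \<longlongrightarrow> 0) at_infinity" by (rule Lim_transform_eventually)
 then show ?thesis by blast
qed

lemma poly_lower_bound_near_0:
 fixes p :: "complex poly"
 assumes "p \<noteq> 0"
 shows "\<exists>c>0. \<exists>e>0. \<exists>N. \<forall>z. cmod z < e \<longrightarrow> c * cmod z ^ N \<le> cmod (poly p z)"
proof -
 obtain q where q: "p = [:- 0, 1:] ^ order 0 p * q" "\<not> [:- 0, 1:] dvd q" using order_decomp[OF assms] by blast
 have q0: "poly q 0 \<noteq> 0" using q(2) by (simp add: poly_eq_0_iff_dvd)
 define c where "c = cmod (poly q 0) / 2"
 have c: "c > 0" using q0 by (simp add: c_def)
 have "isCont (poly q) 0" by (rule poly_isCont)
 then obtain e where e: "e > 0" "\<And>z. dist z 0 < e \<Longrightarrow> dist (poly q z) (poly q 0) < c"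
  using c unfolding continuous_at_eps_delta dist_norm by blast
 have "c * cmod z ^ order 0 p \<le> cmod (poly p z)" if "cmod z < e" for z
 proof -
  have "dist (poly q z) (poly q 0) < c" using e(2)[of z] that by simp
  then have "c \<le> cmod (poly q z)" using norm_triangle_sub[of "poly q 0" "poly q z"] by (simp add: c_def dist_norm norm_minus_commute)
  moreover have "poly p z = z ^ order 0 p * poly q z" by (subst q(1)) simp
  ultimately show ?thesis using mult_right_mono[of c "cmod (poly q z)" "cmod z ^ order 0 p"]
   by (simp add: norm_mult norm_power mult.commute)
 qed
 then show ?thesis using c e(1) by blast
qed

context rmap_curve
begin

lemma B_ne: "B \<noteq> 0"
 using B_nz[of 0] eta_pos by auto

lemma psi_inverse_near_pole:
 assumes nb: "\<not> bounded S" and e: "e > 0"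
 shows "\<exists>R>0. \<forall>z\<in>ball 0 1 - pole0. cmod (\<psi> z) > R \<longrightarrow> cmod z < e"
proof -
 have "compact (cball 0 1 - ball 0 e :: complex set)" by (intro compact_diff compact_cball open_ball)
 then have "compact (\<psi> ` (cball 0 1 - ball 0 e))"
  by (rule compact_continuous_image[OF continuous_on_subset[OF psi_cont], rotated]) (use e nb in \<open>auto simp: pole0_def\<close>)
 from compact_imp_bounded[OF this] obtain R where R: "\<forall>x\<in>\<psi> ` (cball 0 1 - ball 0 e). cmod x \<le> R" unfolding bounded_iff by blast
 show ?thesis
 proof (rule exI[of _ "\<bar>R\<bar> + 1"], intro conjI ballI impI)
  fix z assume z: "z \<in> ball 0 1 - pole0" "\<bar>R\<bar> + 1 < cmod (\<psi> z)"
  show "cmod z < e"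
  proof (rule ccontr)
   assume "\<not> cmod z < e"
   then have "cmod (\<psi> z) \<le> R" using R z(1) by auto
   then show False using z(2) by linarith
  qed
 qed simp
qed

text \<open>With \<theta> inverse to \<psi>, the function ln |w|^2 / w continues from the boundary
  into \<open>S\<close> as A(\<theta>) / (B(\<theta>) w). Removing its principal parts leaves a
  function holomorphic in \<open>S\<close> that vanishes at infinity in the unbounded case; times
  \<open>f\<close> it has loop integral 0, thanks to the decay of \<open>f\<close>.\<close>

lemma quadrature_function:
 "\<exists>p q. quad_fun_ok S p q \<and> (\<forall>f\<in>L1a_rho0 S.
   wint loop (\<lambda>w. f w * (poly p w / poly q w)) = wint loop (\<lambda>w. f w * of_real (ln ((cmod w)\<^sup>2)) / w))"
proof -
 obtain \<theta> where th: "\<theta> holomorphic_on \<psi> ` (ball 0 1 - pole0)" "\<And>z. z \<in> ball 0 1 - pole0 \<Longrightarrow> \<theta> (\<psi> z) = z"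
  by (rule holomorphic_has_inverse[OF psi_hol psi_domain_open psi_inj]) (rule that, assumption+)
 have thS: "\<theta> w \<in> ball 0 1 - pole0 \<and> \<psi> (\<theta> w) = w" if "w \<in> S" for w
 proof -
  have "w \<in> \<psi> ` (ball 0 1 - pole0)" unfolding psi_image by (rule that)
  then obtain z where z: "z \<in> ball 0 1 - pole0" "w = \<psi> z" by blast
  have tw: "\<theta> w = z" unfolding z(2) by (rule th(2)[OF z(1)])
  show ?thesis unfolding tw using z(1) z(2)[symmetric] by (rule conjI)
 qed
 have thh: "\<theta> holomorphic_on S" using th(1) psi_image by simp
 have ph: "(\<lambda>w. poly P (\<theta> w)) holomorphic_on S" for P by (intro holomorphic_intros thh)
 \<comment> \<open>The denominator of the continued integrand. Its zeros are the candidates for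
   finite poles and become the roots of the polynomial \<open>q0\<close>.\<close>
 define X where "X w = poly B (\<theta> w) * w" for w
 have Xh: "X holomorphic_on S" unfolding X_def by (intro holomorphic_intros ph)
 have "{w\<in>S. X w = 0} \<subseteq> insert 0 (\<psi> ` {z. poly B z = 0})"
 proof
  fix w assume w: "w \<in> {w\<in>S. X w = 0}"
  then have "poly B (\<theta> w) = 0 \<or> w = 0" by (auto simp: X_def)
  moreover have "w = \<psi> (\<theta> w)" using thS[of w] w by simp
  ultimately show "w \<in> insert 0 (\<psi> ` {z. poly B z = 0})" by (auto intro: image_eqI[of _ \<psi> "\<theta> w"])
 qed
 then have Xfin: "finite {w\<in>S. X w = 0}"
  by (rule finite_subset) (intro finite.insertI finite_imageI poly_roots_finite B_ne)
 have "infinite S"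
 proof -
  obtain x where "x \<in> S" using S_ne by blast
  then have "x islimpt S" using S_open by (intro interior_limit_point) (simp add: interior_open)
  then show ?thesis using islimpt_finite[of S x] by auto
 qed
 have "\<exists>w\<in>S. X w \<noteq> 0"
 proof (rule ccontr)
  assume "\<not> (\<exists>w\<in>S. X w \<noteq> 0)"
  then have "{w\<in>S. X w = 0} = S" by blast
  then show False using Xfin \<open>infinite S\<close> by simp
 qed
 from factor_out_zeros[OF Xh S_open S_conn Xfin this]
 obtain q0 X0 where q0: "q0 \<noteq> 0" "\<And>z. poly q0 z = 0 \<longleftrightarrow> z \<in> S \<and> X z = 0" "X0 holomorphic_on S"
  "\<And>z. z \<in> S \<Longrightarrow> X0 z \<noteq> 0 \<and> X z = poly q0 z * X0 z" by blast
 have Eh: "(\<lambda>w. poly A (\<theta> w) / X0 w) holomorphic_on S" using q0(4) by (intro holomorphic_intros ph q0(3)) auto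
 have "\<exists>P g. g holomorphic_on S \<and> (\<forall>w\<in>S. poly A (\<theta> w) / X0 w = poly P w + poly q0 w * g w) \<and> (P = 0 \<or> degree P < degree q0)"
  by (rule hermite_division[OF Eh S_open q0(1)]) (use q0(2) in blast)
 then obtain P g where P: "g holomorphic_on S" "\<And>w. w \<in> S \<Longrightarrow> poly A (\<theta> w) / X0 w = poly P w + poly q0 w * g w"
  "P = 0 \<or> degree P < degree q0" by blast
 have key: "poly A (\<theta> w) / (poly B (\<theta> w) * w) = poly P w / poly q0 w + g w" if w: "w \<in> S" "poly q0 w \<noteq> 0" for w
 proof -
  have "poly A (\<theta> w) / (poly B (\<theta> w) * w) = (poly A (\<theta> w) / X0 w) / poly q0 w"
   using q0(4)[OF w(1)] w(2) by (simp add: X_def[symmetric])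
  also have "\<dots> = poly P w / poly q0 w + g w" unfolding P(2)[OF w(1)] using w(2) by (simp add: add_divide_distrib)
  finally show ?thesis .
 qed
 \<comment> \<open>In the unbounded case \<theta> tends to 0 at infinity, where \<open>B\<close> may
   vanish; the resulting pole at infinity contributes the polynomial part \<open>T\<close>.\<close>
 have "\<exists>T. (bounded S \<longrightarrow> T = 0) \<and> (\<not> bounded S \<longrightarrow> ((\<lambda>w. g w - poly T w) \<longlongrightarrow> 0) at_infinity)"
 proof (cases "bounded S")
  case False
  obtain cB e1 N where cB: "cB > 0" "e1 > 0" "\<And>z. cmod z < e1 \<Longrightarrow> cB * cmod z ^ N \<le> cmod (poly B z)"
   using poly_lower_bound_near_0[OF B_ne] by blast
  have "isCont (poly A) 0" by (rule poly_isCont)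
  then obtain e2 where e2: "e2 > 0" "\<And>z. dist z 0 < e2 \<Longrightarrow> dist (poly A z) (poly A 0) < 1"
   unfolding continuous_at_eps_delta dist_norm by (meson zero_less_one)
  obtain F e where e: "0 < e" "e \<le> 1" and F: "F holomorphic_on ball 0 e" "F 0 = 0"
   and FF: "\<And>z. z \<in> ball 0 e - {0} \<Longrightarrow> \<psi> z \<noteq> 0 \<and> F z = 1 / \<psi> z"
   by (rule psi_reciprocal[OF False]) (rule that, assumption+)
  have "(F has_field_derivative deriv F 0) (at 0)" by (rule holomorphic_derivI[OF F(1) open_ball]) (use e in simp)
  then have "((\<lambda>z. F z / z) \<longlongrightarrow> deriv F 0) (at 0)" by (simp add: has_field_derivative_iff F(2))
  then have "\<forall>\<^sub>F z in at 0. dist (F z / z) (deriv F 0) < 1" by (rule tendstoD) simp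
  then obtain e3 where e3: "e3 > 0" "\<And>z. z \<noteq> 0 \<Longrightarrow> dist z 0 < e3 \<Longrightarrow> dist (F z / z) (deriv F 0) < 1" unfolding eventually_at by auto
  define D where "D = cmod (deriv F 0) + 1"
  have D: "D > 0" by (simp add: D_def add_nonneg_pos)
  define \<epsilon> where "\<epsilon> = min (min e1 e2) (min e e3)"
  have eps: "\<epsilon> > 0" using cB e2 e e3 by (simp add: \<epsilon>_def)
  obtain R1 where R1: "R1 > 0" "\<And>z. z \<in> ball 0 1 - pole0 \<Longrightarrow> cmod (\<psi> z) > R1 \<Longrightarrow> cmod z < \<epsilon>"
   using psi_inverse_near_pole[OF False eps] by blast
  obtain R2 where R2: "R2 > 0" "\<And>w. cmod w \<ge> R2 \<Longrightarrow> w \<in> S" using unbounded_contains_exterior[OF False] by blast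
  define MA where "MA = cmod (poly A 0) + 1"
  define R where "R = max (max R1 R2) 1"
  define k where "k w = poly A (\<theta> w) / (poly B (\<theta> w) * w)" for w
  have th0: "cmod (\<theta> w) < \<epsilon> \<and> \<theta> w \<noteq> 0 \<and> w \<in> S \<and> w \<noteq> 0 \<and> cmod w \<ge> 1" if w: "cmod w > R" for w
  proof -
   have "w \<in> S" using R2(2) w by (simp add: R_def)
   moreover have "cmod (\<theta> w) < \<epsilon>" using R1(2)[of "\<theta> w"] thS[OF \<open>w \<in> S\<close>] w by (auto simp: R_def)
   ultimately show ?thesis using thS[of w] False w by (auto simp: pole0_def R_def)
  qed
  have Bn: "poly B (\<theta> w) \<noteq> 0" if w: "cmod w > R" for w
  proof -
   have "cB * cmod (\<theta> w) ^ N > 0" using th0[OF w] cB(1) by simp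
   moreover have "cB * cmod (\<theta> w) ^ N \<le> cmod (poly B (\<theta> w))" using th0[OF w] by (intro cB(3)) (simp add: \<epsilon>_def)
   ultimately show ?thesis by auto
  qed
  have kh: "k holomorphic_on {w. cmod w > R}"
   unfolding k_def using th0 Bn by (intro holomorphic_intros holomorphic_on_subset[OF ph]) auto
  have kb: "cmod (k w) \<le> (MA / cB * D ^ N) * cmod w ^ N" if w: "cmod w > R" for w
  proof -
   note t = th0[OF w]
   have a: "cmod (poly A (\<theta> w)) \<le> MA"
    using e2(2)[of "\<theta> w"] t norm_triangle_sub[of "poly A (\<theta> w)" "poly A 0"] by (simp add: MA_def \<epsilon>_def dist_norm)
   have bb: "cB * cmod (\<theta> w) ^ N \<le> cmod (poly B (\<theta> w))" using t by (intro cB(3)) (simp add: \<epsilon>_def)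
   \<comment> \<open>A lower bound for \<theta>: from |F z| <= D |z| follows |\<theta> w| >= 1 / (D
     |w|). Since \<open>B\<close> is bounded below by a power near 0, this gives polynomial growth
     of \<open>k\<close>.\<close>
   have "F (\<theta> w) = 1 / w" using FF[of "\<theta> w"] t thS[of w] by (simp add: \<epsilon>_def)
   moreover have "cmod (F (\<theta> w) / \<theta> w) \<le> D"
    using e3(2)[of "\<theta> w"] t norm_triangle_sub[of "F (\<theta> w) / \<theta> w" "deriv F 0"] by (simp add: D_def \<epsilon>_def dist_norm)
   ultimately have "1 / (cmod w * cmod (\<theta> w)) \<le> D" by (simp add: norm_divide norm_mult)
   then have "1 \<le> D * cmod w * cmod (\<theta> w)" using t by (simp add: field_simps)
   then have "1 \<le> (D * cmod w * cmod (\<theta> w)) ^ N" by (rule one_le_power)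
   then have "cB \<le> cB * (D * cmod w * cmod (\<theta> w)) ^ N" using cB(1) by simp
   also have "\<dots> = (D * cmod w) ^ N * (cB * cmod (\<theta> w) ^ N)" by (simp add: power_mult_distrib mult_ac)
   also have "\<dots> \<le> (D * cmod w) ^ N * (cmod (poly B (\<theta> w)) * cmod w)"
   proof (intro mult_left_mono)
    have "cmod (poly B (\<theta> w)) * 1 \<le> cmod (poly B (\<theta> w)) * cmod w" using t by (intro mult_left_mono) auto
    then show "cB * cmod (\<theta> w) ^ N \<le> cmod (poly B (\<theta> w)) * cmod w" using bb by simp
   qed (use D in auto)
   finally have c: "cB \<le> (D * cmod w) ^ N * (cmod (poly B (\<theta> w)) * cmod w)" .
   have pos: "cmod (poly B (\<theta> w)) * cmod w > 0" using Bn[OF w] t by simp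
   have "cmod (k w) \<le> MA / (cmod (poly B (\<theta> w)) * cmod w)"
    unfolding k_def norm_divide norm_mult using a by (intro divide_right_mono) auto
   also have "\<dots> = (MA / cB) * (cB / (cmod (poly B (\<theta> w)) * cmod w))" using cB(1) by simp
   also have "\<dots> \<le> (MA / cB) * (D * cmod w) ^ N"
    using c pos cB(1) by (intro mult_left_mono) (auto simp: pos_divide_le_eq MA_def)
   finally show ?thesis by (simp add: power_mult_distrib mult_ac)
  qed
  have "R > 0" using R1(1) by (simp add: R_def)
  from principal_part_at_infinity[OF this kh kb] obtain T where T: "((\<lambda>w. k w - poly T w) \<longlongrightarrow> 0) at_infinity" by blast
  have "((\<lambda>w. (k w - poly T w) - poly P w / poly q0 w) \<longlongrightarrow> 0 - 0) at_infinity"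
   by (intro tendsto_diff T poly_quotient_at_infinity P(3))
  then have l: "((\<lambda>w. (k w - poly T w) - poly P w / poly q0 w) \<longlongrightarrow> 0) at_infinity" by simp
  have "\<forall>\<^sub>F w in at_infinity. norm w \<ge> R + 1" for w :: complex by (rule eventually_at_infinityI) simp
  then have "\<forall>\<^sub>F w in at_infinity. (k w - poly T w) - poly P w / poly q0 w = g w - poly T w"
  proof eventually_elim
   case (elim w)
   then have w: "cmod w > R" by simp
   have "X w \<noteq> 0" using Bn[OF w] th0[OF w] by (simp add: X_def)
   then have "poly q0 w \<noteq> 0" using q0(2) by blast
   then show ?case using key[of w] th0[OF w] by (simp add: k_def)
  qed
  then have "((\<lambda>w. g w - poly T w) \<longlongrightarrow> 0) at_infinity" by (rule Lim_transform_eventually[OF l])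
  then show ?thesis using False by blast
 qed auto
 then obtain T where T: "bounded S \<Longrightarrow> T = 0" "\<not> bounded S \<Longrightarrow> ((\<lambda>w. g w - poly T w) \<longlongrightarrow> 0) at_infinity" by blast
 \<comment> \<open>The quadrature function is the sum of the finite principal parts P / q0 and the
   polynomial part \<open>T\<close>; the remainder of the continued integrand is
   \<open>g - T\<close>.\<close>
 define p0 where "p0 = P + q0 * T"
 have "\<exists>p q. q \<noteq> 0 \<and> coprime p q \<and> q dvd q0 \<and> p * q0 = p0 * q \<and> (bounded S \<longrightarrow> p = 0 \<or> degree p < degree q)"
  by (rule coprime_reduction[OF q0(1)]) (use P(3) T(1) in \<open>simp add: p0_def\<close>)
 then obtain p q where pq: "q \<noteq> 0" "coprime p q" "q dvd q0" "p * q0 = p0 * q" "bounded S \<longrightarrow> p = 0 \<or> degree p < degree q" by blast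
 have qroot: "poly q z = 0 \<Longrightarrow> poly q0 z = 0" for z using pq(3) by (auto elim: dvdE)
 have qS: "poly q z = 0 \<Longrightarrow> z \<in> S" for z using qroot q0(2) by blast
 have h_eq: "poly p w / poly q w = poly P w / poly q0 w + poly T w" if w: "poly q0 w \<noteq> 0" for w
 proof -
  have qw: "poly q w \<noteq> 0" using qroot w by blast
  have "poly p w * poly q0 w = poly p0 w * poly q w" using arg_cong[OF pq(4), of "\<lambda>r. poly r w"] by simp
  then have "poly p w / poly q w = poly p0 w / poly q0 w" using w qw by (simp add: frac_eq_eq)
  also have "\<dots> = poly P w / poly q0 w + poly T w" using w by (simp add: p0_def add_divide_distrib)
  finally show ?thesis .
 qed
 have ok: "quad_fun_ok S p q" unfolding quad_fun_ok_def using pq qS by blast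
 define ZZ where "ZZ = \<psi> -` {w. poly q0 w = 0} \<inter> (ball 0 1 - pole0)"
 have ZZ: "finite ZZ" unfolding ZZ_def using finite_vimage_IntI[OF poly_roots_finite[OF q0(1)] psi_inj] by simp
 have ZZ1: "cmod z \<noteq> 1" if "z \<in> ZZ" for z using that by (auto simp: ZZ_def)
 obtain \<eta>0 where eta0: "\<eta>0 > 0" "\<And>v. \<bar>Im v\<bar> < \<eta>0 \<Longrightarrow> unit_exp v \<notin> ZZ" using strip_avoids_finite[OF ZZ ZZ1] by blast
 define \<eta>1 where "\<eta>1 = min \<eta>0 \<eta>"
 have e1: "0 < \<eta>1" "\<eta>1 \<le> \<eta>" using eta0(1) eta_pos by (auto simp: \<eta>1_def)
 have fr_q0: "poly q0 w \<noteq> 0" if "w \<in> frontier S" for w using q0(2) frontier_disjoint[OF that] by blast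
 have C0q0: "poly q0 (C0 v) \<noteq> 0" if v: "0 \<le> Im v" "Im v < \<eta>1" for v
 proof (cases "Im v = 0")
  case True
  then have "v = of_real (Re v)" by (simp add: complex_eq_iff)
  then show ?thesis using curve_real[of "Re v"] fr_q0 by metis
 next
  case False
  have "unit_exp v \<in> ball 0 1 - pole0" using v False by (intro unit_exp_upper) auto
  moreover have "unit_exp v \<notin> ZZ" using eta0(2)[of v] v by (auto simp: \<eta>1_def)
  ultimately show ?thesis using C0_psi[of v] v by (auto simp: ZZ_def \<eta>1_def)
 qed
 have "wint loop (\<lambda>w. f w * (poly p w / poly q w)) = wint loop (\<lambda>w. f w * of_real (ln ((cmod w)\<^sup>2)) / w)"
  if fL: "f \<in> L1a_rho0 S" for f
 proof -
  define G where "G w = f w * (g w - poly T w)" for w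
  define GS where "GS v = f (C0 v) * (poly A (unit_exp v) / poly B (unit_exp v) / C0 v - poly p (C0 v) / poly q (C0 v))" for v
  define gK where "gK w = f w * (of_real (ln ((cmod w)\<^sup>2)) / w - poly p w / poly q w)" for w
  have fh: "f holomorphic_on S" and fc: "continuous_on (closure S) f" using f_hol[OF fL] f_cont[OF fL] .
  have frS: "frontier S \<subseteq> closure S" by (simp add: frontier_def)
  have fcK: "continuous_on (frontier S) f" by (rule continuous_on_subset[OF fc frS])
  have nz: "w \<noteq> 0" "poly q w \<noteq> 0" if "w \<in> frontier S" for w using that zero_frontier qS frontier_disjoint by auto
  have c1: "continuous_on (frontier S) (\<lambda>w. f w * of_real (ln ((cmod w)\<^sup>2)) / w)"
   using nz by (intro continuous_intros fcK) auto
  have c2: "continuous_on (frontier S) (\<lambda>w. f w * (poly p w / poly q w))"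
   using nz by (intro continuous_intros fcK) auto
  have gKc: "continuous_on (frontier S) gK" unfolding gK_def using nz by (intro continuous_intros fcK) auto
  have "wint loop gK = 2 * of_real pi * \<i> * (\<Sum>\<zeta>\<in>pole0. (\<lambda>\<zeta>. 0) \<zeta>)"
  proof (rule loop_residue[OF pole0_finite pole0_sub order_refl, where G=G and GS=GS and \<epsilon>=\<eta>1])
   show "G holomorphic_on \<psi> ` (ball 0 1 - pole0)"
    unfolding psi_image G_def by (intro holomorphic_intros fh P(1))
   show "((\<lambda>z. (z - \<zeta>) * (G (\<psi> z) * deriv \<psi> z)) \<longlongrightarrow> 0) (at \<zeta>)" if "\<zeta> \<in> pole0" for \<zeta>
   proof -
    have nb: "\<not> bounded S" and z0: "\<zeta> = 0" using that by (auto simp: pole0_def split: if_splits)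
    obtain l where l: "((\<lambda>w. w * f w) \<longlongrightarrow> l) at_infinity" using f_decay[OF fL nb] by blast
    from tendsto_mult[OF l T(2)[OF nb]] have "((\<lambda>w. w * G w) \<longlongrightarrow> 0) at_infinity" by (simp add: G_def mult.assoc)
    from residue_pole[OF nb this] show ?thesis by (simp add: z0)
   qed
   have ne: "C0 v \<noteq> 0 \<and> poly B (unit_exp v) \<noteq> 0 \<and> poly q (C0 v) \<noteq> 0 \<and> C0 v \<in> closure S" if "0 \<le> Im v" "Im v < \<eta>1" for v
    using that psi_nz[of v] C0_psi[of v] B_nz[of v] qroot C0q0[of v] C0_closure[of v] e1(2) by auto
   have ue: "continuous_on A unit_exp" for A unfolding unit_exp_def[abs_def] by (intro continuous_intros)
   have fC: "continuous_on {v. 0 \<le> Im v \<and> Im v < \<eta>1} (\<lambda>v. f (C0 v))"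
    by (rule continuous_on_compose2[OF fc C0_cont[OF e1(2)]]) (use ne in auto)
   show "continuous_on {v. 0 \<le> Im v \<and> Im v < \<eta>1} GS"
    unfolding GS_def by (intro continuous_intros fC C0_cont[OF e1(2)] ue) (use ne in auto)
   show "GS v = G (C0 v)" if v: "0 < Im v" "Im v < \<eta>1" for v
   proof -
    have u: "unit_exp v \<in> ball 0 1 - pole0" by (rule unit_exp_upper[OF v(1)])
    have C: "C0 v = \<psi> (unit_exp v)" using C0_psi[of v] v e1(2) by simp
    have inS: "C0 v \<in> S" using curve_upper[of v] v e1(2) by simp
    have t: "\<theta> (C0 v) = unit_exp v" unfolding C by (rule th(2)[OF u])
    have qn: "poly q0 (C0 v) \<noteq> 0" using C0q0[of v] v by simp
    have "poly A (unit_exp v) / poly B (unit_exp v) / C0 v = poly P (C0 v) / poly q0 (C0 v) + g (C0 v)"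
     using key[OF inS qn] by (simp add: t)
    then show ?thesis by (simp add: GS_def G_def h_eq[OF qn])
   qed
   show "GS (of_real s) = gK (c s)" for s
   proof -
    have n1: "cmod (unit_exp (of_real s)) = 1" by (simp add: norm_unit_exp)
    have C: "c s = \<psi> (unit_exp (of_real s))" unfolding c_def using C0_psi[of "of_real s"] eta_pos by simp
    have "of_real (ln ((cmod (c s))\<^sup>2)) = poly A (unit_exp (of_real s)) / poly B (unit_exp (of_real s))"
     using u_rational[OF n1] by (simp add: u_def C)
    then show ?thesis by (simp add: GS_def gK_def c_def)
   qed
  qed (use e1 gKc in auto)
  then have "wint loop gK = 0" by simp
  moreover have "wint loop gK = wint loop (\<lambda>w. 1 * (f w * of_real (ln ((cmod w)\<^sup>2)) / w) + (-1) * (f w * (poly p w / poly q w)))"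
   by (rule wint_cong) (simp add: gK_def algebra_simps)
  ultimately show ?thesis using wint_lin[OF weight_loop c1 c2, of 1 "-1"] by simp
 qed
 then show ?thesis using ok by blast
qed

theorem rational_imp_QD0:
 assumes "piecewise_C1_boundary S" shows "QD0 S"
proof -
 obtain p q where pq: "quad_fun_ok S p q" "\<And>f. f \<in> L1a_rho0 S \<Longrightarrow>
   wint loop (\<lambda>w. f w * (poly p w / poly q w)) = wint loop (\<lambda>w. f w * of_real (ln ((cmod w)\<^sup>2)) / w)"
  using quadrature_function by blast
 have "area_int0 S f = bdry_int \<Gamma> (\<lambda>w. f w * (poly p w / poly q w))"
  if G: "pos_boundary_cycle S \<Gamma>" and fL: "f \<in> L1a_rho0 S" for \<Gamma> f
 proof -
  have "frontier S \<subseteq> closure S" by (simp add: frontier_def)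
  then have fc: "continuous_on (frontier S) f" by (rule continuous_on_subset[OF f_cont[OF fL]])
  have "poly q w \<noteq> 0" if "w \<in> frontier S" for w
   using pq(1) frontier_disjoint[OF that] unfolding quad_fun_ok_def by blast
  then have c: "continuous_on (frontier S) (\<lambda>w. f w * (poly p w / poly q w))"
   by (intro continuous_intros fc) auto
  have "area_int0 S f = (LINT w|lborel. \<kappa> f w) / of_real pi"
   by (rule area_int0_eq[OF kappa_integrable[OF fL] S_borel]) (rule \<kappa>_def[OF fL])
  \<comment> \<open>The loop integral is 2 i times the integral of \<open>\<kappa>\<close>; division
    by 2 pi i yields the area measure normalized by 1 / pi.\<close>
  also have "\<dots> = wint loop (\<lambda>w. f w * (poly p w / poly q w)) / (2 * of_real pi * \<i>)"
   unfolding pq(2)[OF fL] area_loop[OF fL] by simp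
  also have "\<dots> = bdry_int \<Gamma> (\<lambda>w. f w * (poly p w / poly q w))"
   unfolding bdry_int_def cycle_eq_loop[OF G c] ..
  finally show ?thesis .
 qed
 then have "QD0_with S p q"
  unfolding QD0_with_def using sd zero_frontier int_closure pq(1) assms by (auto simp: piecewise_C1_boundary_def)
 then show ?thesis by (auto simp: QD0_def)
qed

end

theorem theorem4p1:
 fixes S :: "complex set" and \<phi> :: "complex \<Rightarrow> complex"
 assumes "sphere_domain S"
  and "sphere_simply_connected S"
  and "piecewise_C1_boundary S"
  and "0 \<notin> frontier S"
  and "interior (closure S) = S"
  and "riemann_map S \<phi>"
 shows "QD0 S \<longleftrightarrow>
  (\<exists>p q :: complex poly. q \<noteq> 0 \<and> (\<forall>z\<in>riemann_disk S. poly q z \<noteq> 0) \<and>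
    (\<forall>z\<in>riemann_disk S. phi_out S \<phi> z = exp (poly p z / poly q z)))"
proof -
 interpret rmap S \<phi> by unfold_locales (use assms in auto)
 have "QD0 S" if r: "rational_on_circle u"
 proof -
  obtain A B where AB: "\<And>xi. cmod xi = 1 \<Longrightarrow> poly B xi \<noteq> 0" "\<And>xi. cmod xi = 1 \<Longrightarrow> complex_of_real (u xi) = poly A xi / poly B xi"
   using r unfolding rational_on_circle_def by blast
  obtain C0 \<eta> where "rmap_curve S \<phi> C0 \<eta> A B" using rational_curve[OF AB] by blast
  then show ?thesis by (rule rmap_curve.rational_imp_QD0) (rule assms(3))
 qed
 then have "QD0 S \<longleftrightarrow> rational_on_circle u" using QD0_imp_rational by blast
 also have "\<dots> \<longleftrightarrow> (\<exists>p q :: complex poly. q \<noteq> 0 \<and> (\<forall>z\<in>riemann_disk S. poly q z \<noteq> 0) \<and>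
    (\<forall>z\<in>riemann_disk S. phi_out S \<phi> z = exp (poly p z / poly q z)))"
  by (rule phi_out_rational_iff[symmetric])
 finally show ?thesis .
qed

end
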